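(* Let $0<q<1$, let $n(q)$ be a geometric random variable with parameter $1-q$ and let $X_1,X_2,\ldots$ be independent and identically distributed real random variables, independent of $n(q)$. Let $S_j=\sum_{i=1}^jX_i$ for $j\ge1$. Let $x_1,x_2,\ldots$ be an enumeration of the set of real numbers $x$ for which $\mathbb{P}(S_k=kx)$ is positive for some $k>0$, and for $j\ge1$ let $$\mu_j(q)=\sum_{k=1}^\infty k^{-1}q^k\mathbb{P}(S_k=kx_j).$$ Let $S_\rho^{[0,n(q)]}$, its concave majorant $\bar C_\rho^{[0,n(q)]}$, and the nested compositions $\Xi^H_{[0,n(q)]}\preceq\Xi^K_{[0,n(q)]}\preceq\Xi^F_{[0,n(q)]}$ of $n(q)$ be as defined in the context. Then independently for each $j\ge1$: - There is a face of $\bar C_\rho^{[0,n(q)]}$ with slope $x_j$ with probability $1-e^{-\mu_j(q)}$. - Conditionally given there is a face of slope $x_j$, the number of blocks of $\Xi^K_{[0,n(q)]}$ with associated slope $x_j$ has the Poisson distribution with parameter $\mu_j(q)$, conditionally on the value being at least one. - Conditionally given there are $k_{q,j}$ blocks of $\Xi^K_{[0,n(q)]}$ with associated slope $x_j$, the number of excursion blocks in each of the $k_{q,j}$ segment blocks has the log-series distribution with parameter $1-e^{-\mu_j(q)}$, independently for each segment. - The length of each excursion of slope $x_j$ is independent of all other excursions and has distribution with probability generating function $$G_{L^H_{q,j}}(z)=(1-e^{-\mu_j(zq)})/(1-e^{-\mu_j(q)}).$$ Any face block with associated slope $x$ such that $x\neq x_j$ for any $j\ge1$ will be comprised of exactly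 one segment block, which will also be comprised of exactly one excursion block. The lengths and increments of faces with slope $x$ such that $x\ne x_j$ for any $j\ge1$ form a Poisson point process on $\{1,2,\ldots\}\times\mathbb{R}$ with intensity $i^{-1}q^i\,\mathbb{P}(S_i\in ds)$ for $i\ge1$, $s\in\mathbb{R}$, but restricted to the region $$\{(i,s)\in\{1,2,\ldots\}\times\mathbb{R}:\ s\ne ix_j\text{ for any }j\ge1\}.$$ Three nested compositions with the joint law of $\Xi^H_{[0,n(q)]}$, $\Xi^K_{[0,n(q)]}$ and $\Xi^F_{[0,n(q)]}$ are created by uniformly randomly ordering the excursions within each segment, uniformly randomly ordering the segments within each face, arranging the faces in order of decreasing slope, and then looking at the induced compositions of excursion blocks, segment blocks and face blocks.
   Context: Geometric with parameter $1-q$ means $\mathbb{P}(n(q)\ge n)=q^n$ for $n=0,1,2,\ldots$. The log-series distribution with parameter $p\in(0,1)$ is $\mathbb{P}(E=i)=p^i/(-i\log(1-p))$, $i=1,2,\ldots$; for $p=1-e^{-\mu_j(q)}$ this is $(1-e^{-\mu_j(q)})^i/(i\mu_j(q))$. Construction of $S_\rho^{[0,n(q)]}$. Conditionally given $n(q)=n$, independently of the $X_i$ let $(n_1,\ldots,n_k)$ be the cycle lengths, in non-increasing order, of a uniform random permutation of $[n]=\{1,\dots,n\}$. Split $X_1,\ldots,X_n$ into $k$ consecutive blocks of lengths $n_1,\ldots,n_k$. Consider all choices of an ordering $\tau$ (a permutation of $[k]$, block $\tau(i)$ being placed in position $i$) and of a cyclic shift of the increments in each block (one of $n_i$ shifts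 for block $i$) such that, after the rearrangement, the arithmetic means of the successive blocks are non-increasing and, in each block, the average of the first $m$ increments is at most the mean of the block for every $m$ up to the block length. Choose one of these admissible choices uniformly at random. $S_\rho^{[0,n]}$ is the walk started from $0$ with the rearranged increments, with values $S_j^\rho$, and $\bar C_\rho^{[0,n]}$ is its concave majorant, i.e. the least concave function on $[0,n]$ which is $\ge S_j^\rho$ at each integer $0\le j\le n$. Compositions. A composition of $n$ is a finite sequence of positive integers with sum $n$; its blocks are the successive intervals, e.g. the blocks of $(3,4,1)$ are $[0,3],[3,7],[7,8]$. $\Xi\preceq\Xi'$ means that $\Xi$ refines $\Xi'$. $\Xi^K_{[0,n]}=(n_{\tau(1)},\ldots,n_{\tau(k)})$ is the composition given by the lengths of the segments (the blocks of the partition used in the construction) in their order after rearrangement. $\Xi^H_{[0,n]}$ is the composition given by the lengths of the excursions of $S_\rho^{[0,n]}$, an excursion being the piece of the walk between two successive integer times at which it meets $\bar C_\rho^{[0,n]}$. $\Xi^F_{[0,n]}$ is the composition given by the lengths of the faces (maximal linear pieces) of $\bar C_\rho^{[0,n]}$. Excursion, segment and face blocks are the blocks of $\Xi^H,\Xi^K,\Xi^F$ respectively. The slope associated with a block (or excursion, segment, face) $[a,b]$ is $(S_b^\rho-S_a^\rho)/(b-a)$, and the increment of a face occupying $[a,b]$ is $S_b^\rho-S_a^\rho$. $\Xi^{\cdot}_{[0,n(q)]}$ is $\Xi^{\cdot}_{[0,n]}$ on $\{n(q)=n\}$. *)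

theory Defs
  imports
    "HOL-Probability.Probability"
    "HOL-Combinatorics.Orbits"
    "HOL-Combinatorics.Multiset_Permutations"
begin

(* Indices of increments, of blocks and of permuted points start at 0: "X i" is the (i+1)-st
   increment, and permutations of {1,...,n} become permutations of {..<n}. *)


section \<open>Compositions\<close>

definition is_composition :: "nat \<Rightarrow> nat list \<Rightarrow> bool" where
  "is_composition n c \<longleftrightarrow> 0 \<notin> set c \<and> sum_list c = n"

definition comp_refines :: "nat list \<Rightarrow> nat list \<Rightarrow> bool" where
  "comp_refines c d \<longleftrightarrow> (\<exists>cs. concat cs = c \<and> map sum_list cs = d)"

primrec blocks_from :: "nat \<Rightarrow> nat list \<Rightarrow> (nat \<times> nat) list" where
  "blocks_from a [] = []"
| "blocks_from a (l # ls) = (a, a + l) # blocks_from (a + l) ls"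

(* The block [a,b] is represented by the pair (a, b). *)
definition blocks :: "nat list \<Rightarrow> (nat \<times> nat) list" where
  "blocks c = blocks_from 0 c"

definition block_length :: "nat \<times> nat \<Rightarrow> nat" where
  "block_length I = snd I - fst I"

definition blocks_within :: "nat list \<Rightarrow> nat \<times> nat \<Rightarrow> (nat \<times> nat) list" where
  "blocks_within c I = filter (\<lambda>I'. fst I \<le> fst I' \<and> snd I' \<le> snd I) (blocks c)"

definition gaps :: "nat set \<Rightarrow> nat list" where
  "gaps T = (let ts = sorted_list_of_set T in map2 (\<lambda>a b. b - a) ts (tl ts))"


section \<open>Concave majorants\<close>

definition concave_majorant :: "nat \<Rightarrow> (nat \<Rightarrow> real) \<Rightarrow> real \<Rightarrow> real" where
  "concave_majorant n s t =
     (INF g \<in> {g. concave_on {0..real n} g \<and> (\<forall>j\<le>n. s j \<le> g (real j))}. g t)"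

(* The pointwise infimum is itself concave, hence it is the least concave majorant. *)
lemma concave_majorant_bdd:
  assumes "t \<in> {0..real n}"
  shows "bdd_below ((\<lambda>g. g t) ` {g. concave_on {0..real n} g \<and> (\<forall>j\<le>n. s j \<le> g (real j))})"
proof (rule bdd_belowI2)
  fix g assume "g \<in> {g. concave_on {0..real n} g \<and> (\<forall>j\<le>n. s j \<le> g (real j))}"
  then have g: "concave_on {0..real n} g" "s 0 \<le> g (real 0)" "s n \<le> g (real n)"
    by blast+
  define m where "m = min (s 0) (s n)"
  show "m \<le> g t"
  proof (cases "n = 0")
    case True
    then show ?thesis using g assms by (auto simp: m_def)
  next
    case False
    define u where "u = t / real n"
    have u: "0 \<le> u" "u \<le> 1" and t: "t = (1 - u) * 0 + u * real n"
      using assms False by (auto simp: u_def field_simps)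
    have "m = (1 - u) * m + u * m"
      by (simp add: algebra_simps)
    also have "\<dots> \<le> (1 - u) * g 0 + u * g (real n)"
      using g u by (intro add_mono mult_left_mono) (auto simp: m_def)
    also have "\<dots> \<le> g ((1 - u) * 0 + u * real n)"
      using concave_onD[OF g(1) u, of 0 "real n"] by simp
    also have "(1 - u) * 0 + u * real n = t" by (rule t[symmetric])
    finally show ?thesis .
  qed
qed

lemma concave_majorant_le:
  assumes "concave_on {0..real n} g" "\<And>j. j \<le> n \<Longrightarrow> s j \<le> g (real j)" "t \<in> {0..real n}"
  shows "concave_majorant n s t \<le> g t"
  unfolding concave_majorant_def
  using concave_majorant_bdd[OF assms(3)] assms(1,2) by (intro cINF_lower) auto

lemma concave_majorant_nonempty:
  "{g. concave_on {0..real n} g \<and> (\<forall>j\<le>n. s j \<le> g (real j))} \<noteq> {}"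
proof -
  have "(\<lambda>_. Max (s ` {..n})) \<in> {g. concave_on {0..real n} g \<and> (\<forall>j\<le>n. s j \<le> g (real j))}"
    by (auto simp: concave_on_iff simp flip: distrib_right)
  then show ?thesis by blast
qed

lemma concave_majorant_ge:
  assumes "j \<le> n"
  shows "s j \<le> concave_majorant n s (real j)"
  unfolding concave_majorant_def
  using assms concave_majorant_nonempty by (intro cINF_greatest) auto

lemma concave_majorant_concave: "concave_on {0..real n} (concave_majorant n s)"
proof -
  have "(1 - u) * concave_majorant n s a + u * concave_majorant n s b
      \<le> concave_majorant n s ((1 - u) * a + u * b)"
    if "0 \<le> u" "u \<le> 1" "a \<in> {0..real n}" "b \<in> {0..real n}" for u a b
  proof -
    have "(1 - u) * concave_majorant n s a + u * concave_majorant n s b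
        \<le> g ((1 - u) * a + u * b)"
      if g: "concave_on {0..real n} g" "\<forall>j\<le>n. s j \<le> g (real j)" for g
    proof -
      have "(1 - u) * concave_majorant n s a + u * concave_majorant n s b
          \<le> (1 - u) * g a + u * g b"
        using \<open>0 \<le> u\<close> \<open>u \<le> 1\<close> \<open>a \<in> _\<close> \<open>b \<in> _\<close> g
        by (intro add_mono mult_left_mono concave_majorant_le) auto
      also have "\<dots> \<le> g ((1 - u) * a + u * b)"
        using concave_onD[OF g(1) \<open>0 \<le> u\<close> \<open>u \<le> 1\<close> \<open>a \<in> _\<close> \<open>b \<in> _\<close>] by simp
      finally show ?thesis .
    qed
    then show ?thesis
      unfolding concave_majorant_def[of n s "(1 - u) * a + u * b"]
      using concave_majorant_nonempty by (intro cINF_greatest) auto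
  qed
  then show ?thesis
    unfolding concave_on_def by (intro convex_onI) (auto simp: algebra_simps)
qed

definition affine_on :: "real set \<Rightarrow> (real \<Rightarrow> real) \<Rightarrow> bool" where
  "affine_on I f \<longleftrightarrow> (\<exists>m c. \<forall>t\<in>I. f t = m * t + c)"

definition is_face :: "nat \<Rightarrow> (real \<Rightarrow> real) \<Rightarrow> real \<Rightarrow> real \<Rightarrow> bool" where
  "is_face n C a b \<longleftrightarrow>
     0 \<le> a \<and> a < b \<and> b \<le> real n \<and> affine_on {a..b} C \<and>
     (\<forall>a' b'. 0 \<le> a' \<and> a' \<le> a \<and> b \<le> b' \<and> b' \<le> real n \<and> affine_on {a'..b'} C
        \<longrightarrow> a' = a \<and> b' = b)"


section \<open>Walks given by a list of increments\<close>

definition walk :: "real list \<Rightarrow> nat \<Rightarrow> real" where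
  "walk ys j = sum_list (take j ys)"

definition majorant :: "real list \<Rightarrow> real \<Rightarrow> real" where
  "majorant ys = concave_majorant (length ys) (walk ys)"

definition slope :: "real list \<Rightarrow> nat \<times> nat \<Rightarrow> real" where
  "slope ys I = (walk ys (snd I) - walk ys (fst I)) / real (block_length I)"

definition excursion_comp :: "real list \<Rightarrow> nat list" where
  "excursion_comp ys = gaps {j. j \<le> length ys \<and> walk ys j = majorant ys (real j)}"

(* Kinks of the majorant occur at integer times only, so all end points of faces are found. *)
definition face_comp :: "real list \<Rightarrow> nat list" where
  "face_comp ys = gaps {j. \<exists>t. is_face (length ys) (majorant ys) (real j) t \<or>
                              is_face (length ys) (majorant ys) t (real j)}"

definition has_face :: "real list \<Rightarrow> real \<Rightarrow> bool" where
  "has_face ys y \<longleftrightarrow> (\<exists>I\<in>set (blocks (face_comp ys)). slope ys I = y)"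


section \<open>The rearranged walk\<close>

definition cycle_lengths :: "nat \<Rightarrow> (nat \<Rightarrow> nat) \<Rightarrow> nat list" where
  "cycle_lengths n p = rev (sorted_list_of_multiset (image_mset card (mset_set (orbit p ` {..<n}))))"

primrec split_blocks :: "nat list \<Rightarrow> 'a list \<Rightarrow> 'a list list" where
  "split_blocks [] xs = []"
| "split_blocks (n # ns) xs = take n xs # split_blocks ns (drop n xs)"

definition mean :: "real list \<Rightarrow> real" where
  "mean b = sum_list b / real (length b)"

(* A choice (\<tau>, \<sigma>) places block \<tau> i, cyclically shifted by \<sigma> (\<tau> i), in position i. *)
definition rearrange ::
    "nat list \<Rightarrow> 'a list \<Rightarrow> (nat \<Rightarrow> nat) \<times> (nat \<Rightarrow> nat) \<Rightarrow> 'a list list" where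
  "rearrange ns xs c =
     (case c of (\<tau>, \<sigma>) \<Rightarrow>
        map (\<lambda>i. rotate (\<sigma> (\<tau> i)) (split_blocks ns xs ! \<tau> i)) [0..<length ns])"

definition choices :: "nat list \<Rightarrow> ((nat \<Rightarrow> nat) \<times> (nat \<Rightarrow> nat)) set" where
  "choices ns = {\<tau>. \<tau> permutes {..<length ns}} \<times> (\<Pi>\<^sub>E i\<in>{..<length ns}. {..<ns ! i})"

definition admissible :: "nat list \<Rightarrow> real list \<Rightarrow> ((nat \<Rightarrow> nat) \<times> (nat \<Rightarrow> nat)) set" where
  "admissible ns xs =
     {c \<in> choices ns.
        sorted_wrt (\<ge>) (map mean (rearrange ns xs c)) \<and>
        (\<forall>b\<in>set (rearrange ns xs c). \<forall>m\<in>{1..length b}. mean (take m b) \<le> mean b)}"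

(* perm is the uniform random permutation whose cycle lengths give the blocks; choice is the
   uniformly chosen admissible rearrangement. *)
locale rearranged_walk = prob_space M
  for M :: "'w measure" +
  fixes q :: real and N :: "'w \<Rightarrow> nat" and X :: "nat \<Rightarrow> 'w \<Rightarrow> real"
    and perm :: "'w \<Rightarrow> nat \<Rightarrow> nat" and choice :: "'w \<Rightarrow> (nat \<Rightarrow> nat) \<times> (nat \<Rightarrow> nat)"
  assumes q: "0 < q" "q < 1"
    and N_measurable: "N \<in> M \<rightarrow>\<^sub>M count_space UNIV"
    and N_geometric: "\<And>n. \<P>(\<omega> in M. N \<omega> \<ge> n) = q ^ n"
    and X_indep: "indep_vars (\<lambda>_. borel) X UNIV"
    and X_identical: "\<And>i. distr M borel (X i) = distr M borel (X 0)"
    and N_X_indep: "\<And>n A. A \<in> sets (PiM UNIV (\<lambda>_. borel)) \<Longrightarrow>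
          \<P>(\<omega> in M. N \<omega> = n \<and> (\<lambda>i. X i \<omega>) \<in> A) =
          \<P>(\<omega> in M. N \<omega> = n) * \<P>(\<omega> in M. (\<lambda>i. X i \<omega>) \<in> A)"
    and perm_measurable: "perm \<in> M \<rightarrow>\<^sub>M count_space UNIV"
    and perm_permutes: "\<And>\<omega>. \<omega> \<in> space M \<Longrightarrow> perm \<omega> permutes {..<N \<omega>}"
    and perm_uniform: "\<And>n p A. A \<in> sets (PiM UNIV (\<lambda>_. borel)) \<Longrightarrow>
          \<P>(\<omega> in M. N \<omega> = n \<and> (\<lambda>i. X i \<omega>) \<in> A \<and> perm \<omega> = p) =
          \<P>(\<omega> in M. N \<omega> = n \<and> (\<lambda>i. X i \<omega>) \<in> A) * pmf (pmf_of_set {p. p permutes {..<n}}) p"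
    and choice_measurable: "choice \<in> M \<rightarrow>\<^sub>M count_space UNIV"
    and choice_admissible: "\<And>\<omega>. \<omega> \<in> space M \<Longrightarrow>
          choice \<omega> \<in> admissible (cycle_lengths (N \<omega>) (perm \<omega>)) (map (\<lambda>i. X i \<omega>) [0..<N \<omega>])"
    and choice_uniform: "\<And>n p c A. A \<in> sets (PiM UNIV (\<lambda>_. borel)) \<Longrightarrow>
          \<P>(\<omega> in M. N \<omega> = n \<and> perm \<omega> = p \<and> (\<lambda>i. X i \<omega>) \<in> A \<and> choice \<omega> = c) =
          (\<integral>\<omega>. indicator {\<omega>. N \<omega> = n \<and> perm \<omega> = p \<and> (\<lambda>i. X i \<omega>) \<in> A} \<omega> *
               pmf (pmf_of_set (admissible (cycle_lengths n p) (map (\<lambda>i. X i \<omega>) [0..<n]))) c \<partial>M)"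

definition segments ::
    "('w \<Rightarrow> nat) \<Rightarrow> (nat \<Rightarrow> 'w \<Rightarrow> real) \<Rightarrow> ('w \<Rightarrow> nat \<Rightarrow> nat) \<Rightarrow>
     ('w \<Rightarrow> (nat \<Rightarrow> nat) \<times> (nat \<Rightarrow> nat)) \<Rightarrow> 'w \<Rightarrow> real list list" where
  "segments N X perm choice \<omega> =
     rearrange (cycle_lengths (N \<omega>) (perm \<omega>)) (map (\<lambda>i. X i \<omega>) [0..<N \<omega>]) (choice \<omega>)"

(* In what follows bs is the list of segments (lists of increments) of the rearranged walk. *)

definition \<Xi>H :: "real list list \<Rightarrow> nat list" where
  "\<Xi>H bs = excursion_comp (concat bs)"

definition \<Xi>K :: "real list list \<Rightarrow> nat list" where
  "\<Xi>K bs = map length bs"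

definition \<Xi>F :: "real list list \<Rightarrow> nat list" where
  "\<Xi>F bs = face_comp (concat bs)"

(* Lengths of the excursions within each segment of slope y, segment by segment, in order of time. *)
definition excursion_lengths :: "real list list \<Rightarrow> real \<Rightarrow> nat list list" where
  "excursion_lengths bs y =
     map (\<lambda>I. map block_length (blocks_within (\<Xi>H bs) I))
         (filter (\<lambda>I. slope (concat bs) I = y) (blocks (\<Xi>K bs)))"

definition face_points :: "real set \<Rightarrow> real list list \<Rightarrow> (nat \<times> real) multiset" where
  "face_points A bs =
     image_mset (\<lambda>I. (block_length I, walk (concat bs) (snd I) - walk (concat bs) (fst I)))
       (filter_mset (\<lambda>I. slope (concat bs) I \<notin> A) (mset (blocks (\<Xi>F bs))))"


section \<open>Distributions\<close>

definition partial_sum :: "(nat \<Rightarrow> 'w \<Rightarrow> real) \<Rightarrow> nat \<Rightarrow> 'w \<Rightarrow> real" where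
  "partial_sum X k \<omega> = (\<Sum>i<k. X i \<omega>)"

definition atom_slopes :: "'w measure \<Rightarrow> (nat \<Rightarrow> 'w \<Rightarrow> real) \<Rightarrow> real set" where
  "atom_slopes M X = {y. \<exists>k>0. \<P>(\<omega> in M. partial_sum X k \<omega> = real k * y) > 0}"

definition slope_rate :: "'w measure \<Rightarrow> (nat \<Rightarrow> 'w \<Rightarrow> real) \<Rightarrow> real \<Rightarrow> real \<Rightarrow> real" where
  "slope_rate M X y r =
     (\<Sum>k. r ^ Suc k / real (Suc k) *
        \<P>(\<omega> in M. partial_sum X (Suc k) \<omega> = real (Suc k) * y))"

definition log_series_mass :: "real \<Rightarrow> nat \<Rightarrow> real" where
  "log_series_mass p i = (if i = 0 then 0 else p ^ i / (- real i * ln (1 - p)))"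

(* A finite point process is a random multiset.  The Poisson mass function is written out because
   poisson_pmf is only specified for positive rates. *)
definition poisson_point_process :: "'w measure \<Rightarrow> 'p measure \<Rightarrow> ('w \<Rightarrow> 'p multiset) \<Rightarrow> bool" where
  "poisson_point_process M \<Lambda> Z \<longleftrightarrow>
     finite_measure \<Lambda> \<and>
     (\<forall>B\<in>sets \<Lambda>.
        (\<lambda>\<omega>. size (filter_mset (\<lambda>z. z \<in> B) (Z \<omega>))) \<in> M \<rightarrow>\<^sub>M count_space UNIV \<and>
        (\<forall>k. \<P>(\<omega> in M. size (filter_mset (\<lambda>z. z \<in> B) (Z \<omega>)) = k) =
           measure \<Lambda> B ^ k / fact k * exp (- measure \<Lambda> B))) \<and>
     (\<forall>(B :: nat \<Rightarrow> 'p set) m. B ` {..<m} \<subseteq> sets \<Lambda> \<and> disjoint_family_on B {..<m} \<longrightarrow>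
        prob_space.indep_vars M (\<lambda>_. count_space UNIV)
          (\<lambda>i \<omega>. size (filter_mset (\<lambda>z. z \<in> B i) (Z \<omega>))) {..<m})"

definition process_events :: "'w measure \<Rightarrow> 'p measure \<Rightarrow> ('w \<Rightarrow> 'p multiset) \<Rightarrow> 'w set set" where
  "process_events M P Z =
     sigma_sets (space M)
       {{\<omega>\<in>space M. size (filter_mset (\<lambda>z. z \<in> B) (Z \<omega>)) = m} | B m. B \<in> sets P}"

(* The intensity i^-1 q^i P(S_i \<in> ds) on {1,2,...} x R, restricted to the points (i, s) with
   s \<noteq> i y for all y in A.  It is built as an image measure; see emeasure_face_intensity. *)
definition face_intensity ::
    "'w measure \<Rightarrow> (nat \<Rightarrow> 'w \<Rightarrow> real) \<Rightarrow> real \<Rightarrow> real set \<Rightarrow> (nat \<times> real) measure" where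
  "face_intensity M X q A =
     density
       (distr (density (count_space {1..} \<Otimes>\<^sub>M M) (\<lambda>(i, \<omega>). ennreal (q ^ i / real i)))
          (count_space UNIV \<Otimes>\<^sub>M borel) (\<lambda>(i, \<omega>). (i, partial_sum X i \<omega>)))
       (indicator {(i, s). \<forall>y\<in>A. s \<noteq> real i * y})"

lemma emeasure_face_intensity:
  assumes "prob_space M" and X: "\<And>i. X i \<in> borel_measurable M" and "countable A"
    and B: "B \<in> sets (count_space UNIV \<Otimes>\<^sub>M borel)"
  shows "emeasure (face_intensity M X q A) B =
     (\<Sum>k. ennreal (q ^ Suc k / real (Suc k)) *
        emeasure (distr M borel (partial_sum X (Suc k)))
          {s. (Suc k, s) \<in> B \<and> (\<forall>y\<in>A. s \<noteq> real (Suc k) * y)})"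
proof -
  interpret prob_space M by fact
  let ?P = "count_space {1::nat..} \<Otimes>\<^sub>M M" and ?Q = "count_space (UNIV :: nat set) \<Otimes>\<^sub>M (borel :: real measure)"
  let ?R = "{(i::nat, s::real). \<forall>y\<in>A. s \<noteq> real i * y}"
  let ?S = "\<lambda>k. {s. (k, s) \<in> B \<and> (\<forall>y\<in>A. s \<noteq> real k * y)}"
  have S[measurable]: "partial_sum X k \<in> borel_measurable M" for k
    unfolding partial_sum_def using X by measurable
  have g[measurable]: "(\<lambda>(i, \<omega>). (i, partial_sum X i \<omega>)) \<in> ?P \<rightarrow>\<^sub>M ?Q"
    by (rule measurable_pair_measure_countable1) (auto intro!: measurable_Pair)
  have f[measurable]: "(\<lambda>(i, \<omega>). ennreal (q ^ i / real i)) \<in> borel_measurable ?P"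
    by (rule measurable_pair_measure_countable1) auto
  have "?R = space ?Q - (\<Union>y\<in>A. {z \<in> space ?Q. snd z = real (fst z) * y})"
    by (auto simp: space_pair_measure)
  also have "\<dots> \<in> sets ?Q"
  proof (intro sets.Diff sets.top sets.countable_UN' image_subsetI)
    show "{z \<in> space ?Q. snd z = real (fst z) * y} \<in> sets ?Q" for y
      by measurable
  qed fact
  finally have R[measurable]: "?R \<in> sets ?Q" .
  have RB: "?R \<inter> B \<in> sets ?Q" using R B by (rule sets.Int)
  let ?G = "(\<lambda>(i, \<omega>). (i, partial_sum X i \<omega>)) -` (?R \<inter> B) \<inter> space ?P"
  have G[measurable]: "?G \<in> sets ?P" using RB by (rule measurable_sets[OF g])
  have Sk: "?S k \<in> sets borel" for k
  proof -
    have "?S k = Pair k -` (?R \<inter> B)" by auto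
    then show ?thesis using sets_Pair1[OF RB, of k] by simp
  qed
  have "emeasure (face_intensity M X q A) B = 
      emeasure (distr (density ?P (\<lambda>(i, \<omega>). ennreal (q ^ i / real i))) ?Q
          (\<lambda>(i, \<omega>). (i, partial_sum X i \<omega>))) (?R \<inter> B)"
    unfolding face_intensity_def by (rule emeasure_restricted) (simp_all only: sets_distr R B)
  also have "\<dots> = emeasure (density ?P (\<lambda>(i, \<omega>). ennreal (q ^ i / real i))) ?G"
    using emeasure_distr[of "\<lambda>(i, \<omega>). (i, partial_sum X i \<omega>)"
        "density ?P (\<lambda>(i, \<omega>). ennreal (q ^ i / real i))" ?Q "?R \<inter> B"] g RB
    by (simp only: measurable_density_eq1 space_density)
  also have "\<dots> = (\<integral>\<^sup>+z. (case z of (i, \<omega>) \<Rightarrow> ennreal (q ^ i / real i)) * indicator ?G z \<partial>?P)"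
    by (rule emeasure_density[OF f G])
  also have "\<dots> = (\<integral>\<^sup>+i. \<integral>\<^sup>+\<omega>. ennreal (q ^ i / real i) * indicator ?G (i, \<omega>) \<partial>M \<partial>count_space {1..})"
    using nn_integral_fst[OF borel_measurable_times_ennreal[OF f borel_measurable_indicator[OF G]]]
    by (simp only: prod.case)
  also have "\<dots> = (\<integral>\<^sup>+i. ennreal (q ^ i / real i) * emeasure (distr M borel (partial_sum X i)) (?S i)
                   \<partial>count_space {1..})"
  proof (rule nn_integral_cong)
    fix i assume i: "i \<in> space (count_space {1::nat..})"
    have "(\<integral>\<^sup>+\<omega>. ennreal (q ^ i / real i) * indicator ?G (i, \<omega>) \<partial>M) =
          (\<integral>\<^sup>+\<omega>. ennreal (q ^ i / real i) * indicator (partial_sum X i -` ?S i \<inter> space M) \<omega> \<partial>M)"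
      using i by (intro nn_integral_cong) (auto simp: indicator_def space_pair_measure)
    also have "\<dots> = ennreal (q ^ i / real i) * emeasure M (partial_sum X i -` ?S i \<inter> space M)"
      using measurable_sets[OF S Sk] by (rule nn_integral_cmult_indicator)
    finally show "(\<integral>\<^sup>+\<omega>. ennreal (q ^ i / real i) * indicator ?G (i, \<omega>) \<partial>M) =
        ennreal (q ^ i / real i) * emeasure (distr M borel (partial_sum X i)) (?S i)"
      using Sk by (simp add: emeasure_distr)
  qed
  also have "\<dots> = (\<integral>\<^sup>+k. ennreal (q ^ Suc k / real (Suc k)) *
       emeasure (distr M borel (partial_sum X (Suc k))) (?S (Suc k)) \<partial>count_space UNIV)"
    by (rule nn_integral_bij_count_space[symmetric])
       (rule bij_betw_byWitness[where f' = "\<lambda>n. n - 1"]; auto)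
  finally show ?thesis by (simp only: nn_integral_count_space_nat)
qed


section \<open>Random ordering of excursions, segments and faces\<close>

primrec draw_each :: "('a \<Rightarrow> 'b pmf) \<Rightarrow> 'a list \<Rightarrow> 'b list pmf" where
  "draw_each f [] = return_pmf []"
| "draw_each f (x # xs) =
     bind_pmf (f x) (\<lambda>y. bind_pmf (draw_each f xs) (\<lambda>ys. return_pmf (y # ys)))"

definition order_randomly :: "'a multiset \<Rightarrow> 'a list pmf" where
  "order_randomly A = pmf_of_set (permutations_of_multiset A)"

(* A face is described by the multiset of its segments, a segment by the multiset of the lengths
   of its excursions. *)
definition order_face :: "nat multiset multiset \<Rightarrow> nat list list pmf" where
  "order_face A = bind_pmf (order_randomly A) (draw_each order_randomly)"

definition by_decreasing_slope :: "(real \<times> 'a) set \<Rightarrow> 'a list" where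
  "by_decreasing_slope D = map snd (rev (sorted_key_list_of_set fst D))"

definition created_compositions ::
    "(real \<times> nat multiset multiset) set \<Rightarrow> (nat list \<times> nat list \<times> nat list) pmf" where
  "created_compositions D =
     map_pmf (\<lambda>fs. (concat (concat fs), map sum_list (concat fs), map (sum_list \<circ> concat) fs))
       (draw_each order_face (by_decreasing_slope D))"

definition unordered_faces :: "real list list \<Rightarrow> (real \<times> nat multiset multiset) set" where
  "unordered_faces bs =
     (\<lambda>I. (slope (concat bs) I,
           image_mset (\<lambda>I'. image_mset block_length (mset (blocks_within (\<Xi>H bs) I')))
             (mset (blocks_within (\<Xi>K bs) I))))
       ` set (blocks (\<Xi>F bs))"

end

theory Submission
  imports Defs
begin

text \<open>
  The theorem has a deterministic and a probabilistic half.

  The rearranged walk is the concatenation of segments whose means are non-increasing and each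
  of which stays below the line to its end point (predicate good). For such a list the concave
  majorant is the polygon through the ends of the segments (majorant_segment). Hence faces are
  maximal runs of segments of equal mean, excursions are the pieces of a segment between its
  contacts with its own chord, and all three compositions are functions of the list of segments
  (compositions_face_shape, face_blocks).

  For the law of the segments, summing a function of the cycle type over the permutations of $n$
  points amounts to summing it over the lists $(n_1,\dots,n_k)$ of positive integers with sum
  $n$, with the weight $n!/(k!\,\prod_i n_i)$ (sum_cycle_type). A block \<open>b\<close> of iid
  increments is rotated to a good one; since rotations preserve the law of the increments, the
  rotated block of length \<open>m\<close> has density \<open>m * block_weight b\<close>, where
  \<open>block_weight b\<close> is the reciprocal of the number of good rotations if
  \<open>b\<close> is good and 0 otherwise. The factors $n_i$ cancel, and on the event that the
  walk has length $n$ the list of segments has density $(1-q)\,q^n \prod_i w(b_i)$ with \<open>w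
  = block_weight\<close>, restricted to sorted lists and divided by the number of ways to sort
  (law_sorted). For events that do not see in which order segments of different means come this
  is $(1-q)\,q^n \prod_i w(b_i) / k!$ (law_insensitive), which says that the segments are a
  Poisson number of independent blocks, the intensity being $q^n$ times the law of
  \<open>n\<close> iid increments times \<open>block_weight\<close> (law_marks, rate_sums).
  Slopes are marks of the segments, so different slopes are independent (marks_independent,
  slopes_independent).

  Fix an atom \<open>y\<close>. A good block of mean \<open>y\<close> with \<open>m\<close>
  excursions has exactly \<open>m\<close> good rotations (nrot_good) and is a concatenation of
  \<open>m\<close> irreducible excursions, so its intensity is $\frac1m \prod_i a(l_i)$, where
  the $l_i$ are the lengths of the excursions and $a(l)$ is $q^l$ times the probability that $l$
  increments form an irreducible excursion (seg_law_mass). This is the law of a log-series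
  number of independent excursions (product_list_law), and comparison of total masses gives
  $\sum_l a(l) = 1 - e^{-\mu}$.

  For slopes that are not atoms, two disjoint groups of increments almost surely have different
  means (AE_mean_coincidence), so faces, segments and excursions coincide, and averaging over
  the $i$ rotations turns the intensity into $i^{-1} q^i P(S_i \in ds)$ (rate_face_intensity).

  Finally, permuting excursions of equal length inside one face permutes iid increments, and so
  does reordering the segments of a face. Neither changes the slopes or the multiset of the
  numbers of excursions of the segments, hence not the density of law_sorted. So the excursion
  lengths, given what is left after forgetting the order of the segments inside the faces and of
  the excursions inside the segments, are uniformly ordered (prob_face_shape_forget), which is
  the last assertion (law_compositions).
\<close>

section \<open>Compositions and their partial sums\<close>

definition partial_sums :: "nat list \<Rightarrow> nat set" where
  "partial_sums c = (\<lambda>i. sum_list (take i c)) ` {..length c}"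

lemma partial_sums_Nil [simp]: "partial_sums [] = {0}"
  by (simp add: partial_sums_def)

lemma partial_sums_Cons: "partial_sums (l # ls) = insert 0 ((+) l ` partial_sums ls)"
proof -
  have "{..length (l # ls)} = insert 0 (Suc ` {..length ls})"
    by (simp add: atMost_Suc_eq_insert_0)
  then show ?thesis
    unfolding partial_sums_def by (simp add: image_image)
qed

lemma zero_in_partial_sums: "0 \<in> partial_sums c"
  by (cases c) (auto simp: partial_sums_Cons)

text \<open>
  A composition is recovered from its set of partial sums; excursion and face compositions are
  defined through such sets.
\<close>

lemma gaps_partial_sums:
  assumes "0 \<notin> set c"
  shows "gaps (partial_sums c) = c"
proof -
  let ?s = "\<lambda>i. sum_list (take i c)"
  let ?ts = "map ?s [0..<Suc (length c)]"
  have step: "?s (Suc i) = ?s i + c ! i" if "i < length c" for i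
    using that by (simp add: take_Suc_conv_app_nth)
  have mono: "?s i < ?s j" if "i < j" "j \<le> length c" for i j
    using that
  proof (induction j)
    case (Suc j)
    then have "c ! j \<noteq> 0" using assms by (metis Suc_le_eq nth_mem)
    moreover have "?s i \<le> ?s j" using Suc by (cases "i = j") auto
    ultimately show ?case using step[of j] Suc.prems by simp
  qed simp
  have "sorted_list_of_set (partial_sums c) = ?ts"
  proof -
    have "sorted_wrt (<) ?ts"
      by (auto simp: sorted_wrt_iff_nth_less simp del: upt_Suc intro!: mono)
    moreover have "set ?ts = partial_sums c"
      unfolding partial_sums_def by (auto simp del: upt_Suc simp: atMost_atLeast0 atLeastLessThanSuc_atLeastAtMost)
    ultimately show ?thesis
      by (metis sorted_list_of_set.idem_if_sorted_distinct strict_sorted_iff)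
  qed
  then have "gaps (partial_sums c) = map2 (\<lambda>a b. b - a) ?ts (tl ?ts)"
    by (simp add: gaps_def Let_def)
  also have "\<dots> = c"
    by (rule nth_equalityI) (auto simp del: upt_Suc simp: nth_tl step)
  finally show ?thesis .
qed

primrec nested_blocks :: "nat \<Rightarrow> nat list list \<Rightarrow> (nat \<times> nat) list list" where
  "nested_blocks a [] = []"
| "nested_blocks a (c # cs) = blocks_from a c # nested_blocks (a + sum_list c) cs"

lemma blocks_from_append: "blocks_from a (c @ d) = blocks_from a c @ blocks_from (a + sum_list c) d"
  by (induction c arbitrary: a) (auto simp: add.assoc)

lemma concat_nested_blocks: "concat (nested_blocks a cs) = blocks_from a (concat cs)"
  by (induction cs arbitrary: a) (auto simp: blocks_from_append)

lemma length_blocks_from [simp]: "length (blocks_from a c) = length c"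
  by (induction c arbitrary: a) auto

lemma blocks_from_bounds:
  assumes "I \<in> set (blocks_from a c)" "0 \<notin> set c"
  shows "a \<le> fst I" "fst I < snd I" "snd I \<le> a + sum_list c"
  using assms by (induction c arbitrary: a) (fastforce simp: add.assoc)+

lemma map_block_length_blocks_from [simp]: "map block_length (blocks_from a c) = c"
  by (induction c arbitrary: a) (auto simp: block_length_def)

lemma filter_nested_blocks:
  assumes "0 \<notin> set (concat cs)" "[] \<notin> set cs"
  shows "map (\<lambda>I. filter (\<lambda>I'. fst I \<le> fst I' \<and> snd I' \<le> snd I) (blocks_from a (concat cs)))
             (blocks_from a (map sum_list cs)) = nested_blocks a cs"
  using assms
proof (induction cs arbitrary: a)
  case (Cons c cs)
  let ?P = "\<lambda>I I'. fst I \<le> fst I' \<and> snd I' \<le> snd (I :: nat \<times> nat)"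
  have c: "0 \<notin> set c" and cs: "0 \<notin> set (concat cs)" "[] \<notin> set cs" using Cons.prems by auto
  have pos: "0 \<notin> set (map sum_list cs)"
  proof
    assume "0 \<in> set (map sum_list cs)"
    then obtain c' where c': "c' \<in> set cs" "sum_list c' = 0" by auto
    then have "hd c' \<in> set c'" using cs(2) by (intro hd_in_set) auto
    then show False using c' cs(1) by auto
  qed
  have "filter (?P (a, a + sum_list c)) (blocks_from a c) = blocks_from a c"
    using blocks_from_bounds[OF _ c] by (auto intro!: filter_True)
  moreover have "filter (?P (a, a + sum_list c)) (blocks_from (a + sum_list c) (concat cs)) = []"
    using blocks_from_bounds[OF _ cs(1)] by (auto intro!: filter_False) (metis dual_order.trans leD le_trans)
  moreover have "filter (?P I) (blocks_from a c) = []"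
    if "I \<in> set (blocks_from (a + sum_list c) (map sum_list cs))" for I
    using blocks_from_bounds[OF _ c] blocks_from_bounds[OF that pos]
    by (auto intro!: filter_False) (metis dual_order.trans leD le_trans snd_conv)
  ultimately show ?case
    using Cons.IH[OF cs, of "a + sum_list c"] by (simp add: blocks_from_append cong: map_cong)
qed simp

text \<open>
  When one composition refines another, selecting the blocks that lie within a given coarse
  block by comparing end points agrees with cutting the refinement into consecutive sublists.
\<close>

lemma blocks_within_nested:
  assumes "0 \<notin> set (concat cs)" "[] \<notin> set cs"
  shows "map (blocks_within (concat cs)) (blocks (map sum_list cs)) = nested_blocks 0 cs"
  using filter_nested_blocks[OF assms, of 0] by (simp add: blocks_within_def[abs_def] blocks_def)

lemma length_nested_blocks [simp]: "length (nested_blocks a cs) = length cs"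
  by (induction cs arbitrary: a) auto

lemma list_all2_nested_blocks_shape:
  "list_all2 (\<lambda>u v. length u = length v) (nested_blocks a cs) cs"
  by (induction cs arbitrary: a) auto

lemma list_all2_concat_split:
  assumes "list_all2 R (concat xss) (concat yss)" "list_all2 (\<lambda>u v. length u = length v) xss yss"
  shows "list_all2 (list_all2 R) xss yss"
  using assms(2,1)
  by (induction xss yss rule: list_all2_induct) (auto simp: list_all2_append)

lemma map_filter_list_all2:
  assumes "list_all2 (\<lambda>a b. (P a \<longleftrightarrow> Q b) \<and> f a = g b) as bs"
  shows "map f (filter P as) = map g (filter Q bs)"
  using assms by (induction rule: list_all2_induct) auto

section \<open>Blocks that stay below their mean\<close>

text \<open>The admissibility condition on one block of a rearrangement.\<close>

definition good :: "real list \<Rightarrow> bool" where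
  "good b \<longleftrightarrow> (\<forall>m\<in>{1..length b}. mean (take m b) \<le> mean b)"

text \<open>
  An excursion strictly below the line of slope \<open>y\<close>: the walk touches the line only
  at the two ends.
\<close>

definition irr :: "real \<Rightarrow> real list \<Rightarrow> bool" where
  "irr y e \<longleftrightarrow> e \<noteq> [] \<and> sum_list e = y * real (length e) \<and>
     (\<forall>m. 0 < m \<and> m < length e \<longrightarrow> sum_list (take m e) < y * real m)"

definition contacts :: "real list \<Rightarrow> nat set" where
  "contacts b = {m. m \<le> length b \<and> walk b m = mean b * real m}"

definition excs :: "real list \<Rightarrow> nat list" where
  "excs b = gaps (contacts b)"

lemma walk_0 [simp]: "walk b 0 = 0"
  by (simp add: walk_def)

lemma walk_append:
  "walk (xs @ ys) m = (if m \<le> length xs then walk xs m else sum_list xs + walk ys (m - length xs))"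
  by (simp add: walk_def)

lemma walk_length: "walk b (length b) = sum_list b"
  by (simp add: walk_def)

lemma sum_list_mean: "sum_list b = mean b * real (length b)"
  by (cases b) (auto simp: mean_def)

lemma good_iff: "good b \<longleftrightarrow> (\<forall>m\<le>length b. walk b m \<le> mean b * real m)"
proof -
  have "mean (take m b) \<le> mean b \<longleftrightarrow> walk b m \<le> mean b * real m" if "m \<in> {1..length b}" for m
    using that by (auto simp: mean_def[of "take m b"] walk_def divide_le_eq min_def)
  then have "good b \<longleftrightarrow> (\<forall>m\<in>{1..length b}. walk b m \<le> mean b * real m)"
    by (simp add: good_def)
  also have "\<dots> \<longleftrightarrow> (\<forall>m\<le>length b. walk b m \<le> mean b * real m)"
    by (metis One_nat_def Suc_leI atLeastAtMost_iff less_eq_nat.simps(1) mult_zero_right neq0_conv of_nat_0 order_refl walk_0)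
  finally show ?thesis .
qed

text \<open>
  A concatenation of strict excursions below a line touches that line exactly at the junctions.
\<close>

lemma irr_excursions:
  assumes "\<forall>e\<in>set es. irr y e"
  shows "{m. m \<le> length (concat es) \<and> walk (concat es) m = y * real m} = partial_sums (map length es)"
    and "m \<le> length (concat es) \<Longrightarrow> walk (concat es) m \<le> y * real m"
    and "sum_list (concat es) = y * real (length (concat es))"
  using assms
proof (induction es arbitrary: m)
  case (Cons e es)
  {
    case 3
    then show ?case using Cons(3) by (auto simp: irr_def algebra_simps)
  next
    case 2
    then have e: "sum_list e = y * real (length e)" "walk e m < y * real m" if "0 < m" "m < length e"
      using that by (auto simp: irr_def walk_def)
    show ?case
    proof (cases "m \<le> length e")
      case True
      then show ?thesis using 2 by (cases "m = 0"; cases "m = length e") (auto simp: irr_def walk_def min_def)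
    next
      case False
      then have "walk (concat es) (m - length e) \<le> y * real (m - length e)"
        using 2 by (intro Cons(2)) auto
      then show ?thesis using False 2 by (auto simp: walk_append irr_def of_nat_diff algebra_simps)
    qed
  next
    case 1
    then have e: "e \<noteq> []" "sum_list e = y * real (length e)" "\<And>m. 0 < m \<Longrightarrow> m < length e \<Longrightarrow> walk e m < y * real m"
      by (auto simp: irr_def walk_def)
    have IH: "{m. m \<le> length (concat es) \<and> walk (concat es) m = y * real m} = partial_sums (map length es)"
      using 1 by (intro Cons(1)) auto
    have "m \<le> length (concat (e # es)) \<and> walk (concat (e # es)) m = y * real m \<longleftrightarrow>
          m = 0 \<or> (\<exists>k. m = length e + k \<and> k \<le> length (concat es) \<and> walk (concat es) k = y * real k)" for m
    proof (cases "m < length e")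
      case True
      then show ?thesis using e by (auto simp: walk_append) (metis less_irrefl neq0_conv)
    next
      case False
      then obtain k where k: "m = length e + k" by (metis le_add_diff_inverse not_less)
      show ?thesis using k e by (auto simp: walk_append walk_length algebra_simps)
    qed
    then show ?case
      unfolding list.map partial_sums_Cons IH[symmetric] by auto
  }
qed (auto simp: walk_def)

lemma irr_excursions_contacts:
  assumes "\<forall>e\<in>set es. irr y e" "es \<noteq> []"
  shows "mean (concat es) = y" "good (concat es)" "excs (concat es) = map length es"
proof -
  have ne: "length (concat es) \<noteq> 0" using assms by (cases es) (auto simp: irr_def)
  then show m: "mean (concat es) = y"
    using irr_excursions(3)[OF assms(1)] by (simp add: mean_def)
  show "good (concat es)" using irr_excursions(2)[OF assms(1)] by (simp add: good_iff m)
  have "0 \<notin> set (map length es)" using assms(1) by (auto simp: irr_def)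
  then show "excs (concat es) = map length es"
    by (simp add: excs_def contacts_def m irr_excursions(1)[OF assms(1)] gaps_partial_sums)
qed

text \<open>
  Cut at the first return to the line of slope \<open>y\<close>; what is left again stays below
  the line and ends on it.
\<close>

lemma good_decompose_aux:
  assumes "\<forall>m\<le>length b. walk b m \<le> y * real m" "sum_list b = y * real (length b)"
  shows "\<exists>es. concat es = b \<and> (\<forall>e\<in>set es. irr y e)"
  using assms
proof (induction b rule: length_induct)
  case (1 b)
  show ?case
  proof (cases "b = []")
    case False
    let ?Q = "\<lambda>m. 0 < m \<and> m \<le> length b \<and> walk b m = y * real m"
    have "?Q (length b)" using False 1(3) by (auto simp: walk_length)
    then have m: "?Q (LEAST m. ?Q m)" by (rule LeastI)
    define m where "m = (LEAST m. ?Q m)"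
    have least: "\<not> ?Q k" if "k < m" for k using that not_less_Least unfolding m_def by blast
    have "irr y (take m b)"
    proof -
      have "walk b k < y * real k" if "0 < k" "k < m" for k
        using least[OF that(2)] that m 1(2) unfolding m_def[symmetric]
        by (metis less_imp_le order_trans order_le_less)
      then show ?thesis using m False unfolding m_def[symmetric] irr_def
        by (auto simp: walk_def min_def)
    qed
    moreover have "\<exists>es. concat es = drop m b \<and> (\<forall>e\<in>set es. irr y e)"
    proof -
      have w: "walk b (m + k) = y * real m + walk (drop m b) k" for k
      proof -
        have "walk (take m b @ drop m b) (m + k) = walk b m + walk (drop m b) k"
          using m unfolding m_def[symmetric] by (simp only: walk_def take_add sum_list_append append_take_drop_id)
        then show ?thesis using m unfolding m_def[symmetric] by simp
      qed
      have "length (drop m b) < length b" using m unfolding m_def[symmetric] by auto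
      moreover have "walk (drop m b) k \<le> y * real k" if "k \<le> length (drop m b)" for k
      proof -
        have "walk b (m + k) \<le> y * real (m + k)" using 1(2)[rule_format, of "m + k"] that m unfolding m_def[symmetric] by auto
        then show ?thesis using w[of k] by (simp add: algebra_simps)
      qed
      moreover have "sum_list (drop m b) = y * real (length (drop m b))"
        using w[of "length b - m"] m 1(3) unfolding m_def[symmetric]
        by (simp add: walk_def of_nat_diff algebra_simps)
      ultimately show ?thesis using 1(1) by blast
    qed
    ultimately show ?thesis
      by (metis append_take_drop_id concat.simps(2) set_ConsD)
  qed (auto intro: exI[of _ "[]"])
qed

lemma good_decompose:
  assumes "good b" "b \<noteq> []"
  obtains es where "concat es = b" "\<forall>e\<in>set es. irr (mean b) e" "es \<noteq> []" "excs b = map length es"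
proof -
  obtain es where es: "concat es = b" "\<forall>e\<in>set es. irr (mean b) e"
    using good_decompose_aux[of b "mean b"] assms(1) by (auto simp: good_iff sum_list_mean)
  moreover have "es \<noteq> []" using es(1) assms(2) by auto
  ultimately show ?thesis using irr_excursions_contacts(3)[of es "mean b"] that by auto
qed

lemma concat_split_blocks:
  "sum_list l = length b \<Longrightarrow> concat (split_blocks l b) = b"
proof (induction l arbitrary: b)
  case (Cons a l)
  then have "concat (split_blocks l (drop a b)) = drop a b" by (intro Cons.IH) auto
  then show ?case by simp
qed simp

lemma length_split_blocks [simp]: "length (split_blocks l b) = length l"
  by (induction l arbitrary: b) auto

lemma map_length_split_blocks:
  "sum_list l \<le> length b \<Longrightarrow> map length (split_blocks l b) = l"
  by (induction l arbitrary: b) auto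

lemma split_blocks_concat: "split_blocks (map length bs) (concat bs) = bs"
  by (induction bs) auto

lemma split_blocks_concat': "map length bs = l \<Longrightarrow> split_blocks l (concat bs) = bs"
  using split_blocks_concat by blast

text \<open>
  Being good with prescribed mean and prescribed excursion lengths is a product condition on the
  pieces of the block. This is what makes the excursions of one slope independent.
\<close>

lemma good_excs_iff:
  assumes "b \<noteq> []" "sum_list l = length b"
  shows "good b \<and> mean b = y \<and> excs b = l \<longleftrightarrow> (\<forall>e\<in>set (split_blocks l b). irr y e)"
proof
  assume *: "good b \<and> mean b = y \<and> excs b = l"
  then obtain es where "concat es = b" "\<forall>e\<in>set es. irr y e" "excs b = map length es"
    using good_decompose[of b] assms by metis
  then show "\<forall>e\<in>set (split_blocks l b). irr y e" using split_blocks_concat[of es] * by auto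
next
  assume *: "\<forall>e\<in>set (split_blocks l b). irr y e"
  have "l \<noteq> []" using assms by auto
  then have ne: "split_blocks l b \<noteq> []" by (cases l) auto
  show "good b \<and> mean b = y \<and> excs b = l"
    using irr_excursions_contacts[OF * ne] concat_split_blocks[OF assms(2)]
      map_length_split_blocks[of l b] assms(2) by simp
qed

lemma excs_props:
  assumes "good b" "b \<noteq> []"
  shows "sum_list (excs b) = length b" "0 \<notin> set (excs b)" "excs b \<noteq> []"
    "contacts b = partial_sums (excs b)"
proof -
  obtain es where es: "concat es = b" "\<forall>e\<in>set es. irr (mean b) e" "es \<noteq> []" "excs b = map length es"
    using good_decompose[OF assms] .
  show "sum_list (excs b) = length b" using es by (metis length_concat)
  show "0 \<notin> set (excs b)" using es by (auto simp: irr_def)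
  show "excs b \<noteq> []" using es by auto
  show "contacts b = partial_sums (excs b)"
    using irr_excursions(1)[OF es(2)] es by (simp add: contacts_def)
qed

section \<open>Rotations of a block\<close>

definition nrot :: "real list \<Rightarrow> nat" where
  "nrot b = card {s. s < length b \<and> good (rotate s b)}"

lemma sum_list_rotate [simp]: "sum_list (rotate s b) = (sum_list b :: real)"
  unfolding rotate_drop_take by (metis add.commute append_take_drop_id sum_list_append)

lemma mean_rotate [simp]: "mean (rotate s b) = mean b"
  by (simp add: mean_def)

lemma walk_rotate:
  assumes "s < length b" "i \<le> length b"
  shows "walk (rotate s b) i = (if i \<le> length b - s then walk b (s + i) - walk b s
            else walk b (i - (length b - s)) + sum_list b - walk b s)"
proof -
  have r: "rotate s b = drop s b @ take s b" using assms by (simp add: rotate_drop_take)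
  have d: "sum_list b = walk b s + sum_list (drop s b)"
    by (metis append_take_drop_id sum_list_append walk_def)
  have "walk (drop s b) j = walk b (s + j) - walk b s" if "j \<le> length b - s" for j
  proof -
    have "take (s + j) b = take s b @ take j (drop s b)" by (simp add: take_add)
    then show ?thesis by (simp add: walk_def)
  qed
  then show ?thesis using assms unfolding r walk_append
    by (auto simp: d) (auto simp: walk_def min_def)
qed

text \<open>
  The cycle lemma: a rotation is good exactly when it starts at a place where the walk, with its
  drift removed, is maximal.
\<close>

lemma good_rotate_iff:
  assumes "s < length b"
  shows "good (rotate s b) \<longleftrightarrow> (\<forall>m\<le>length b. walk b m - mean b * real m \<le> walk b s - mean b * real s)"
proof
  assume g: "good (rotate s b)"
  show "\<forall>m\<le>length b. walk b m - mean b * real m \<le> walk b s - mean b * real s"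
  proof (intro allI impI)
    fix m assume m: "m \<le> length b"
    show "walk b m - mean b * real m \<le> walk b s - mean b * real s"
    proof (cases "m < s")
      case True
      have "length b - s + m \<le> length b" using True assms by simp
      then have "walk (rotate s b) (length b - s + m) \<le> mean b * real (length b - s + m)"
        using g by (metis good_iff length_rotate mean_rotate)
      moreover have "walk (rotate s b) (length b - s + m) = walk b m + sum_list b - walk b s"
      proof (cases "m = 0")
        case True
        then show ?thesis using walk_rotate[OF assms, of "length b - s"] assms by (simp add: walk_length)
      next
        case False
        then show ?thesis by (subst walk_rotate[OF assms]) (use assms True False in auto)
      qed
      ultimately show ?thesis using assms by (simp add: of_nat_diff algebra_simps sum_list_mean[of b])
    next
      case False
      have "walk (rotate s b) (m - s) \<le> mean b * real (m - s)"
        using g m by (auto simp: good_iff)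
      moreover have "m - s \<le> length b - s" "s + (m - s) = m" using False m by auto
      ultimately show ?thesis using False assms m by (simp add: walk_rotate of_nat_diff algebra_simps)
    qed
  qed
next
  assume *: "\<forall>m\<le>length b. walk b m - mean b * real m \<le> walk b s - mean b * real s"
  have "walk (rotate s b) m \<le> mean b * real m" if "m \<le> length b" for m
  proof (cases "m \<le> length b - s")
    case True
    then show ?thesis using *[rule_format, of "s + m"] assms that by (auto simp: walk_rotate algebra_simps)
  next
    case False
    then show ?thesis using *[rule_format, of "m - (length b - s)"] assms that
      by (auto simp: walk_rotate algebra_simps of_nat_diff sum_list_mean[of b])
  qed
  then show "good (rotate s b)" by (simp add: good_iff)
qed

lemma good_rotation_exists:
  assumes "b \<noteq> []"
  shows "\<exists>s<length b. good (rotate s b)"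
proof -
  let ?D = "\<lambda>m. walk b m - mean b * real m"
  have fin: "finite (?D ` {..<length b})" "?D ` {..<length b} \<noteq> {}" using assms by auto
  have "Max (?D ` {..<length b}) \<in> ?D ` {..<length b}" by (rule Max_in[OF fin])
  then obtain s where s: "s < length b" "?D s = Max (?D ` {..<length b})" by auto
  have lt: "?D m \<le> ?D s" if "m < length b" for m
    using Max_ge[OF fin(1)] that s(2) by auto
  have D0: "?D (length b) = ?D 0" by (simp add: walk_length sum_list_mean[of b])
  have "?D m \<le> ?D s" if "m \<le> length b" for m
  proof (cases "m = length b")
    case True
    have "?D 0 \<le> ?D s" using assms by (intro lt) auto
    then show ?thesis by (simp only: True D0)
  qed (use lt that in auto)
  then show ?thesis using s(1) good_rotate_iff by blast
qed

lemma nrot_pos: "b \<noteq> [] \<Longrightarrow> nrot b > 0"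
  using good_rotation_exists[of b] by (auto simp: nrot_def card_gt_0_iff)

lemma nrot_rotate: "nrot (rotate t b) = nrot b"
proof (cases "b = []")
  case False
  let ?n = "length b"
  let ?A = "\<lambda>c. {s. s < ?n \<and> good (rotate s c)}"
  have n: "?n > 0" using False by simp
  have "bij_betw (\<lambda>s. (s + t) mod ?n) (?A (rotate t b)) (?A b)"
  proof (rule bij_betw_byWitness[where f' = "\<lambda>s. (s + (?n - t mod ?n)) mod ?n"])
    have a: "((s + t) mod ?n + (?n - t mod ?n)) mod ?n = s" if "s < ?n" for s
    proof -
      have "((s + t) mod ?n + (?n - t mod ?n)) mod ?n = (s + t + (?n - t mod ?n)) mod ?n"
        by (simp add: mod_add_left_eq)
      also have "s + t + (?n - t mod ?n) = s + ?n * (t div ?n) + ?n"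
        using mult_div_mod_eq[of ?n t] mod_less_divisor[OF n, of t] by linarith
      finally show ?thesis using that by simp
    qed
    have b: "((s + (?n - t mod ?n)) mod ?n + t) mod ?n = s" if "s < ?n" for s
    proof -
      have "((s + (?n - t mod ?n)) mod ?n + t) mod ?n = (s + t + (?n - t mod ?n)) mod ?n"
        by (simp add: mod_add_left_eq mod_add_right_eq algebra_simps)
      also have "s + t + (?n - t mod ?n) = s + ?n * (t div ?n) + ?n"
        using mult_div_mod_eq[of ?n t] mod_less_divisor[OF n, of t] by linarith
      finally show ?thesis using that by simp
    qed
    show "\<forall>s\<in>?A (rotate t b). ((s + t) mod ?n + (?n - t mod ?n)) mod ?n = s" using a by auto
    show "\<forall>s\<in>?A b. ((s + (?n - t mod ?n)) mod ?n + t) mod ?n = s" using b by auto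
    show "(\<lambda>s. (s + t) mod ?n) ` ?A (rotate t b) \<subseteq> ?A b"
      using n by (auto simp: rotate_rotate simp flip: rotate_conv_mod)
    show "(\<lambda>s. (s + (?n - t mod ?n)) mod ?n) ` ?A b \<subseteq> ?A (rotate t b)"
    proof safe
      fix s assume s: "s < ?n" "good (rotate s b)"
      have "rotate ((s + (?n - t mod ?n)) mod ?n) (rotate t b) = rotate (((s + (?n - t mod ?n)) mod ?n + t) mod ?n) b"
        by (simp add: rotate_rotate flip: rotate_conv_mod)
      then show "good (rotate ((s + (?n - t mod ?n)) mod ?n) (rotate t b))"
        using b[OF s(1)] s by simp
    qed (use n in auto)
  qed
  then show ?thesis using bij_betw_same_card by (fastforce simp: nrot_def)
qed simp

text \<open>
  Contacts of a good block with its chord are the maxima of the walk with its drift removed, and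
  these are the starting points of the good rotations.
\<close>

lemma nrot_good:
  assumes "good b" "b \<noteq> []"
  shows "nrot b = length (excs b)"
proof -
  let ?n = "length b"
  have c: "contacts b = insert ?n {s. s < ?n \<and> good (rotate s b)}"
  proof -
    have "good (rotate s b) \<longleftrightarrow> walk b s = mean b * real s" if "s < ?n" for s
      using good_rotate_iff[OF that] assms(1) that unfolding good_iff
      by (auto intro: antisym) (metis diff_ge_0_iff_ge le0 mult_zero_right of_nat_0 diff_zero walk_0 dual_order.antisym less_or_eq_imp_le)
    then show ?thesis unfolding contacts_def
      by (auto simp: walk_length sum_list_mean[of b])
  qed
  have "card (contacts b) = Suc (nrot b)"
    unfolding c nrot_def by (subst card_insert_disjoint) auto
  moreover have "length (excs b) = card (contacts b) - 1"
    by (auto simp: excs_def gaps_def Let_def)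
  ultimately show ?thesis by simp
qed

section \<open>The concave majorant of a sorted list of good blocks\<close>

text \<open>What the construction guarantees about the list of segments.\<close>

definition valid :: "real list list \<Rightarrow> bool" where
  "valid bs \<longleftrightarrow> (\<forall>b\<in>set bs. b \<noteq> [] \<and> good b) \<and> sorted_wrt (\<ge>) (map mean bs)"

lemma walk_le_line:
  assumes "\<forall>b\<in>set bs. good b \<and> mean b \<le> y" "j \<le> length (concat bs)"
  shows "walk (concat bs) j \<le> y * real j"
  using assms
proof (induction bs arbitrary: j)
  case (Cons b bs)
  have b: "walk b k \<le> y * real k" if "k \<le> length b" for k
  proof -
    have "walk b k \<le> mean b * real k" using Cons.prems that by (auto simp: good_iff)
    also have "\<dots> \<le> y * real k" using Cons.prems by (intro mult_right_mono) auto
    finally show ?thesis .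
  qed
  show ?case
  proof (cases "j \<le> length b")
    case True
    then show ?thesis using b by (simp add: walk_append)
  next
    case False
    then have "walk (concat bs) (j - length b) \<le> y * real (j - length b)"
      using Cons.prems by (intro Cons.IH) auto
    then show ?thesis using False b[of "length b"]
      by (simp add: walk_append walk_length of_nat_diff algebra_simps)
  qed
qed (simp add: walk_def)

lemma walk_ge_line:
  assumes "\<forall>b\<in>set bs. good b \<and> y \<le> mean b" "j \<le> length (concat bs)"
  shows "walk (concat bs) j + y * real (length (concat bs) - j) \<le> sum_list (concat bs)"
  using assms
proof (induction bs arbitrary: j)
  case (Cons b bs)
  have b: "walk b k + y * real (length b - k) \<le> sum_list b" if "k \<le> length b" for k
  proof -
    have "walk b k \<le> mean b * real k" using Cons.prems that by (auto simp: good_iff)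
    moreover have "y * real (length b - k) \<le> mean b * real (length b - k)"
      using Cons.prems by (intro mult_right_mono) auto
    ultimately show ?thesis using that by (simp add: sum_list_mean[of b] of_nat_diff algebra_simps)
  qed
  have IH: "walk (concat bs) k + y * real (length (concat bs) - k) \<le> sum_list (concat bs)"
    if "k \<le> length (concat bs)" for k
    using Cons.prems that by (intro Cons.IH) auto
  show ?case
  proof (cases "j \<le> length b")
    case True
    then show ?thesis using b[OF True] IH[of 0] by (simp add: walk_append of_nat_diff algebra_simps)
  next
    case False
    then show ?thesis using IH[of "j - length b"] Cons.prems
      by (simp add: walk_append of_nat_diff algebra_simps)
  qed
qed (simp add: walk_def)

lemma validD:
  assumes "valid (pre @ b # post)"
  shows "valid pre" "valid post" "b \<noteq> []" "good b"
    "\<forall>c\<in>set pre. c \<noteq> [] \<and> good c \<and> mean b \<le> mean c"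
    "\<forall>c\<in>set post. c \<noteq> [] \<and> good c \<and> mean c \<le> mean b"
  using assms by (auto simp: valid_def sorted_wrt_append)

text \<open>
  Segments before \<open>b\<close> have larger means and segments after it smaller ones, so the
  whole walk stays below the line that carries the segment \<open>b\<close>.
\<close>

lemma walk_le_segment_line:
  assumes "valid (pre @ b # post)" "j \<le> length (concat (pre @ b # post))"
  shows "walk (concat (pre @ b # post)) j
    \<le> sum_list (concat pre) + mean b * (real j - real (length (concat pre)))"
proof (cases "j \<le> length (concat pre)")
  case True
  then show ?thesis
    using walk_ge_line[of pre "mean b" j] validD(5)[OF assms(1)]
    by (auto simp: walk_append of_nat_diff algebra_simps)
next
  case False
  then have "walk (concat (b # post)) (j - length (concat pre)) \<le> mean b * real (j - length (concat pre))"
    using validD[OF assms(1)] assms(2) by (intro walk_le_line) auto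
  then show ?thesis using False
    by (simp add: walk_append[of "concat pre" "concat (b # post)", simplified] of_nat_diff)
qed

lemma concave_on_affine:
  assumes "convex A"
  shows "concave_on A (\<lambda>t. m * t + k :: real)"
  unfolding concave_on_iff
proof (intro conjI ballI allI impI)
  fix x y u v :: real assume "u + v = 1"
  have "u * (m * x + k) + v * (m * y + k) = m * (u * x + v * y) + (u + v) * k" by (simp add: algebra_simps)
  then show "u * (m * x + k) + v * (m * y + k) \<le> m * (u *\<^sub>R x + v *\<^sub>R y) + k"
    using \<open>u + v = 1\<close> by simp
qed (rule assms)

lemma concave_on_ge_line:
  assumes C: "concave_on {0..n} C" and uv: "0 \<le> u" "u < v" "v \<le> n" "t \<in> {u..v}"
    and "m * u + k \<le> C u" "m * v + k \<le> C v"
  shows "m * t + k \<le> (C t :: real)"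
proof -
  define s where "s = (t - u) / (v - u)"
  have "s * (v - u) = t - u" using uv by (simp add: s_def)
  then have "t = (1 - s) * u + s * v" by (simp add: algebra_simps)
  moreover have "0 \<le> s" "s \<le> 1" using uv by (auto simp: s_def)
  ultimately have s: "0 \<le> s" "s \<le> 1" "t = (1 - s) * u + s * v" "(1 - s) \<ge> 0" by auto
  have "m * t + k = (1 - s) * (m * u + k) + s * (m * v + k)"
    unfolding s(3) by (simp add: algebra_simps)
  also have "\<dots> \<le> (1 - s) * C u + s * C v"
    using assms s by (intro add_mono mult_left_mono) auto
  also have "\<dots> \<le> C ((1 - s) * u + s * v)"
    using concave_onD[OF C s(1,2), of u v] uv by simp
  finally show ?thesis using s(3) by simp
qed

text \<open>
  The line through a segment is a concave function above the walk, so the majorant is at most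
  the chord; it is at least the chord because any concave function above the walk lies above its
  chords.
\<close>

lemma majorant_segment:
  assumes "valid (pre @ b # post)"
    and t: "t \<in> {real (length (concat pre))..real (length (concat (pre @ [b])))}"
  shows "majorant (concat (pre @ b # post)) t
    = sum_list (concat pre) + mean b * (t - real (length (concat pre)))"
proof (rule antisym)
  let ?ys = "concat (pre @ b # post)" and ?a = "length (concat pre)"
  let ?n = "length ?ys"
  let ?C = "concave_majorant ?n (walk ?ys)"
  let ?l = "\<lambda>t. mean b * t + (sum_list (concat pre) - mean b * real ?a)"
  have "concave_on {0..real ?n} ?l"
    by (rule concave_on_affine) simp
  moreover have "walk ?ys j \<le> ?l (real j)" if "j \<le> ?n" for j
    using walk_le_segment_line[OF assms(1) that] by (simp add: algebra_simps)
  moreover have "t \<in> {0..real ?n}" using t by auto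
  ultimately have "?C t \<le> ?l t" by (rule concave_majorant_le)
  then show "majorant ?ys t \<le> sum_list (concat pre) + mean b * (t - real ?a)"
    by (simp add: majorant_def algebra_simps)
  have "b \<noteq> []" using validD[OF assms(1)] by simp
  have "?l t \<le> ?C t"
  proof (rule concave_on_ge_line[OF concave_majorant_concave[of ?n "walk ?ys"] _ _ _ t])
    have w: "walk ?ys ?a = sum_list (concat pre)" by (simp add: walk_append walk_length)
    show "?l (real ?a) \<le> ?C (real ?a)"
      using concave_majorant_ge[of ?a ?n "walk ?ys"] w by simp
    have w: "walk ?ys (length (concat (pre @ [b]))) = sum_list (concat pre) + mean b * real (length b)"
      using \<open>b \<noteq> []\<close> by (simp add: walk_append walk_length sum_list_mean[of b])
    show "?l (real (length (concat (pre @ [b])))) \<le> ?C (real (length (concat (pre @ [b]))))"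
      using concave_majorant_ge[of "length (concat (pre @ [b]))" ?n "walk ?ys"] w by (simp add: algebra_simps)
  qed (use \<open>b \<noteq> []\<close> in auto)
  then show "sum_list (concat pre) + mean b * (t - real ?a) \<le> majorant ?ys t"
    by (simp add: majorant_def algebra_simps)
qed

lemma majorant_end:
  assumes "valid bs"
  shows "majorant (concat bs) (real (length (concat bs))) = sum_list (concat bs)"
proof (cases bs rule: rev_cases)
  case Nil
  have "concave_on {0..real 0} (\<lambda>_. 0 :: real)" by (simp add: concave_on_iff)
  then have "concave_majorant 0 (walk []) (real 0) \<le> 0"
    by (rule concave_majorant_le) (auto simp: walk_def)
  moreover have "walk [] 0 \<le> concave_majorant 0 (walk []) (real 0)"
    by (rule concave_majorant_ge) simp
  ultimately show ?thesis using Nil by (simp add: majorant_def walk_def)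
next
  case (snoc pre b)
  then show ?thesis
    using majorant_segment[of pre b "[]" "real (length (concat (pre @ [b])))"] assms
    by (simp add: sum_list_mean[of b])
qed

text \<open>
  On each segment the majorant is the chord, so the walk meets it where the segment meets its
  own chord. The prefix \<open>pre\<close> allows an induction over the segments.
\<close>

lemma contacts_append_walk:
  assumes "valid (pre @ bs)"
  shows "{j. j \<le> length (concat bs) \<and>
      walk (concat (pre @ bs)) (length (concat pre) + j) = majorant (concat (pre @ bs)) (real (length (concat pre) + j))}
    = partial_sums (concat (map excs bs))"
  using assms
proof (induction bs arbitrary: pre)
  case Nil
  then show ?case using majorant_end[OF Nil] by (auto simp: walk_length)
next
  case (Cons b bs)
  let ?ys = "concat (pre @ b # bs)" and ?a = "length (concat pre)"
  have b: "b \<noteq> []" "good b" using validD[OF Cons.prems] by auto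
  have IH: "{j. j \<le> length (concat bs) \<and>
      walk ?ys (?a + length b + j) = majorant ?ys (real (?a + length b + j))} = partial_sums (concat (map excs bs))"
    using Cons.IH[of "pre @ [b]"] Cons.prems by (simp add: add.assoc)
  have hd: "walk ?ys (?a + j) = majorant ?ys (real (?a + j)) \<longleftrightarrow> j \<in> contacts b" if "j \<le> length b" for j
    using that majorant_segment[OF Cons.prems, of "real (?a + j)"]
    by (auto simp: contacts_def walk_append walk_length)
  have "{j. j \<le> length (concat (b # bs)) \<and> walk ?ys (?a + j) = majorant ?ys (real (?a + j))}
     = contacts b \<union> (+) (length b) ` partial_sums (concat (map excs bs))" (is "?L = ?R")
  proof (intro set_eqI)
    fix j
    show "j \<in> ?L \<longleftrightarrow> j \<in> ?R"
    proof (cases "j < length b")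
      case True
      then show ?thesis using hd[of j] by auto
    next
      case False
      then obtain k where k: "j = length b + k" by (metis le_add_diff_inverse not_less)
      have "j \<in> ?L \<longleftrightarrow> k \<in> partial_sums (concat (map excs bs))"
        unfolding IH[symmetric] k by (simp add: add.assoc)
      moreover have "j \<in> contacts b \<Longrightarrow> k = 0" using k by (auto simp: contacts_def)
      ultimately show ?thesis using zero_in_partial_sums k by auto
    qed
  qed
  also have "\<dots> = partial_sums (excs b @ concat (map excs bs))"
  proof -
    have "partial_sums (c @ d) = partial_sums c \<union> (+) (sum_list c) ` partial_sums d" for c d
    proof (induction c)
      case Nil
      then show ?case using zero_in_partial_sums by auto
    next
      case (Cons a c)
      then show ?case by (auto simp: partial_sums_Cons image_Un image_image add.assoc)
    qed
    then show ?thesis using excs_props[OF b(2,1)] by simp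
  qed
  finally show ?case by simp
qed

lemma excursion_comp_valid:
  assumes "valid bs"
  shows "excursion_comp (concat bs) = concat (map excs bs)"
proof -
  have "0 \<notin> set (concat (map excs bs))"
    using assms excs_props(2) by (auto simp: valid_def)
  then show ?thesis
    unfolding excursion_comp_def using contacts_append_walk[of "[]" bs] assms
    by (simp add: gaps_partial_sums)
qed

section \<open>Faces\<close>

lemma locate_block:
  assumes "0 \<le> u" "u < real (length (concat bs))"
  shows "\<exists>pre b post. bs = pre @ b # post \<and> real (length (concat pre)) \<le> u \<and>
           u < real (length (concat (pre @ [b])))"
  using assms
proof (induction bs rule: rev_induct)
  case (snoc b bs)
  show ?case
  proof (cases "u < real (length (concat bs))")
    case True
    then obtain pre c post where "bs = pre @ c # post" "real (length (concat pre)) \<le> u" "u < real (length (concat (pre @ [c])))"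
      using snoc by blast
    then show ?thesis by (intro exI[of _ pre] exI[of _ c] exI[of _ "post @ [b]"]) auto
  next
    case False
    then show ?thesis using snoc.prems by (intro exI[of _ bs] exI[of _ b] exI[of _ "[]"]) auto
  qed
qed simp

text \<open>
  Where the slope drops strictly the majorant is not affine, so no face extends across such a
  point.
\<close>

lemma not_affine_at_kink:
  assumes v: "valid (pre @ b # c # post)" and "mean c < mean b"
    and uv: "0 \<le> u" "u < real (length (concat (pre @ [b])))" "real (length (concat (pre @ [b]))) < v"
    and aff: "affine_on {u..v} (majorant (concat (pre @ b # c # post)))"
  shows False
proof -
  let ?C = "majorant (concat (pre @ b # c # post))"
  let ?s = "real (length (concat (pre @ [b])))" and ?a = "real (length (concat pre))"
  let ?e = "real (length (concat (pre @ [b, c])))"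
  obtain m k where mk: "\<And>t. t \<in> {u..v} \<Longrightarrow> ?C t = m * t + k"
    using aff by (auto simp: affine_on_def)
  have ne: "b \<noteq> []" "c \<noteq> []" using validD(3)[OF v] validD(3)[of "pre @ [b]" c post] v by auto
  define u' where "u' = max u ?a"
  define v' where "v' = min v ?e"
  have u': "u' \<in> {u..v}" "u' \<in> {?a..?s}" "u' < ?s" "?s \<in> {u..v}" using uv ne by (auto simp: u'_def)
  have v': "v' \<in> {u..v}" "v' \<in> {?s..?e}" "?s < v'" using uv ne by (auto simp: v'_def)
  have 1: "?C t = sum_list (concat pre) + mean b * (t - ?a)" if "t \<in> {?a..?s}" for t
    using majorant_segment[OF v that] .
  have 2: "?C t = sum_list (concat (pre @ [b])) + mean c * (t - ?s)" if "t \<in> {?s..?e}" for t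
    using majorant_segment[of "pre @ [b]" c post t] v that by simp
  have "m * (?s - u') = mean b * (?s - u')"
    using mk[of u'] mk[of ?s] u' 1[of u'] 1[of ?s] by (simp add: algebra_simps)
  moreover have "m * (v' - ?s) = mean c * (v' - ?s)"
    using mk[of v'] mk[of ?s] u' v' 2[of v'] 2[of ?s] by (simp add: algebra_simps)
  ultimately show False using u' v' assms(2) by auto
qed

text \<open>Lists in which every block is a whole face.\<close>

definition strict_valid :: "real list list \<Rightarrow> bool" where
  "strict_valid bs \<longleftrightarrow> (\<forall>b\<in>set bs. b \<noteq> [] \<and> good b) \<and> sorted_wrt (>) (map mean bs)"

lemma strict_valid_valid: "strict_valid bs \<Longrightarrow> valid bs"
  by (auto simp: strict_valid_def valid_def sorted_wrt_map elim: sorted_wrt_mono_rel[rotated])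

lemma not_affine_across:
  assumes "strict_valid (pre @ b # post)" "post \<noteq> []" 
    "0 \<le> u" "u < real (length (concat (pre @ [b])))" "real (length (concat (pre @ [b]))) < v"
  shows "\<not> affine_on {u..v} (majorant (concat (pre @ b # post)))"
proof -
  obtain c post' where p: "post = c # post'" using assms(2) by (cases post) auto
  have "valid (pre @ b # c # post')" using strict_valid_valid assms(1) p by blast
  moreover have "mean c < mean b" using assms(1) p by (auto simp: strict_valid_def sorted_wrt_append)
  ultimately show ?thesis using not_affine_at_kink assms(3-) p by blast
qed

lemma is_face_segment:
  assumes "strict_valid (pre @ b # post)"
  shows "is_face (length (concat (pre @ b # post))) (majorant (concat (pre @ b # post)))
     (real (length (concat pre))) (real (length (concat (pre @ [b]))))"
  unfolding is_face_def
proof (intro conjI allI impI; (elim conjE)?)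
  let ?C = "majorant (concat (pre @ b # post))"
  let ?s = "real (length (concat (pre @ [b])))" and ?a = "real (length (concat pre))"
  have v: "valid (pre @ b # post)" using assms by (rule strict_valid_valid)
  have ne: "b \<noteq> []" using validD[OF v] by auto
  show "0 \<le> ?a" "?a < ?s" "?s \<le> real (length (concat (pre @ b # post)))" using ne by auto
  show "affine_on {?a..?s} ?C"
    unfolding affine_on_def
    using majorant_segment[OF v]
    by (intro exI[of _ "mean b"] exI[of _ "sum_list (concat pre) - mean b * ?a"]) (auto simp: algebra_simps)
  fix a' b' assume *: "0 \<le> a'" "a' \<le> ?a" "?s \<le> b'" "b' \<le> real (length (concat (pre @ b # post)))"
    "affine_on {a'..b'} ?C"
  show "a' = ?a"
  proof (rule ccontr)
    assume "a' \<noteq> ?a"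
    then have lt: "a' < ?a" using * by simp
    then have "pre \<noteq> []" using * by auto
    have "?a < ?s" using ne by auto
    then have lt2: "?a < b'" using *(3) by linarith
    from \<open>pre \<noteq> []\<close> obtain p d where p: "pre = p @ [d]" by (cases pre rule: rev_cases) auto
    have "\<not> affine_on {a'..b'} (majorant (concat (p @ d # b # post)))"
      using assms lt lt2 * by (intro not_affine_across) (auto simp: p)
    then show False using * p by simp
  qed
  show "b' = ?s"
  proof (rule ccontr)
    assume "b' \<noteq> ?s"
    then have lt: "?s < b'" using * by simp
    then have "post \<noteq> []" using * by auto
    have "?a < ?s" using ne by auto
    then have l3: "a' < ?s" using *(2) by linarith
    from \<open>post \<noteq> []\<close> have "\<not> affine_on {a'..b'} ?C"
      using assms lt l3 * by (intro not_affine_across) auto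
    then show False using * by simp
  qed
qed

lemma is_face_is_segment:
  assumes sv: "strict_valid bs"
    and f: "is_face (length (concat bs)) (majorant (concat bs)) u v"
  shows "\<exists>pre b post. bs = pre @ b # post \<and> u = real (length (concat pre)) \<and> v = real (length (concat (pre @ [b])))"
proof -
  let ?C = "majorant (concat bs)"
  have uv: "0 \<le> u" "u < v" "v \<le> real (length (concat bs))" "affine_on {u..v} ?C"
    and mx: "\<And>a' b'. 0 \<le> a' \<Longrightarrow> a' \<le> u \<Longrightarrow> v \<le> b' \<Longrightarrow> b' \<le> real (length (concat bs)) \<Longrightarrow> affine_on {a'..b'} ?C \<Longrightarrow> a' = u \<and> b' = v"
    using f by (auto simp: is_face_def)
  obtain pre b post where bs: "bs = pre @ b # post" "real (length (concat pre)) \<le> u" "u < real (length (concat (pre @ [b])))"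
    using locate_block[of u bs] uv by auto
  have "v \<le> real (length (concat (pre @ [b])))"
  proof (rule ccontr)
    assume "\<not> ?thesis"
    then have lt: "real (length (concat (pre @ [b]))) < v" by simp
    then have "post \<noteq> []" using uv bs by auto
    then show False using not_affine_across[of pre b post u v] sv lt uv bs by auto
  qed
  moreover have "is_face (length (concat bs)) ?C (real (length (concat pre))) (real (length (concat (pre @ [b]))))"
    using is_face_segment sv bs by simp
  ultimately show ?thesis
    using mx[of "real (length (concat pre))" "real (length (concat (pre @ [b])))"] bs
    by (intro exI[of _ pre] exI[of _ b] exI[of _ post]) (auto simp: is_face_def)
qed

lemma partial_sums_conv:
  "partial_sums (map length bs) = {length (concat pre) | pre post. bs = pre @ post}"
proof (induction bs)
  case (Cons b bs)
  have "{length (concat pre) | pre post. b # bs = pre @ post} =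
     insert 0 ((+) (length b) ` {length (concat pre) | pre post. bs = pre @ post})" (is "?L = ?R")
  proof (intro equalityI subsetI)
    fix x assume "x \<in> ?L"
    then obtain pre post where p: "b # bs = pre @ post" "x = length (concat pre)" by auto
    show "x \<in> ?R"
    proof (cases pre)
      case (Cons c pre')
      then have "bs = pre' @ post" "x = length b + length (concat pre')" using p by auto
      then show ?thesis by blast
    qed (use p in simp)
  next
    fix x assume "x \<in> ?R"
    then consider "x = 0" | pre post where "bs = pre @ post" "x = length (concat (b # pre))" by auto
    then show "x \<in> ?L"
    proof cases
      case 1
      have "b # bs = [] @ (b # bs)" "x = length (concat [])" using 1 by auto
      then show ?thesis by blast
    next
      case 2
      then have "b # bs = (b # pre) @ post" by simp
      then show ?thesis using 2(2) by blast
    qed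
  qed
  then show ?case using Cons by (simp add: partial_sums_Cons)
qed simp

text \<open>
  The faces of the majorant are the maximal linear pieces, which are the single blocks when the
  slopes decrease strictly.
\<close>

lemma face_comp_strict_valid:
  assumes "strict_valid bs"
  shows "face_comp (concat bs) = map length bs"
proof (cases "bs = []")
  case True
  then have "{j. \<exists>t. is_face (length (concat bs)) (majorant (concat bs)) (real j) t \<or>
      is_face (length (concat bs)) (majorant (concat bs)) t (real j)} = {}"
    by (auto simp: is_face_def)
  then show ?thesis using True by (simp add: face_comp_def gaps_def Let_def)
next
  case False
  let ?F = "is_face (length (concat bs)) (majorant (concat bs))"
  have "{j. \<exists>t. ?F (real j) t \<or> ?F t (real j)} = partial_sums (map length bs)"
    unfolding partial_sums_conv
  proof (intro equalityI subsetI)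
    fix j assume "j \<in> {j. \<exists>t. ?F (real j) t \<or> ?F t (real j)}"
    then obtain t where "?F (real j) t \<or> ?F t (real j)" by blast
    then obtain pre b post where "bs = pre @ b # post" "j = length (concat pre) \<or> j = length (concat (pre @ [b]))"
      using is_face_is_segment[OF assms] by (metis of_nat_eq_iff)
    moreover have "pre @ b # post = (pre @ [b]) @ post" by simp
    ultimately show "j \<in> {length (concat pre) |pre post. bs = pre @ post}" by blast
  next
    fix j assume "j \<in> {length (concat pre) |pre post. bs = pre @ post}"
    then obtain pre post where j: "j = length (concat pre)" and bs: "bs = pre @ post" by blast
    have "\<exists>t. ?F (real (length (concat pre))) t \<or> ?F t (real (length (concat pre)))"
    proof (cases post)
      case (Cons b post')
      then show ?thesis using is_face_segment[of pre b post'] assms bs by auto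
    next
      case Nil
      then obtain p b where "pre = p @ [b]" using False bs by (cases pre rule: rev_cases) auto
      then show ?thesis using is_face_segment[of p b "[]"] assms bs Nil by auto
    qed
    then show "j \<in> {j. \<exists>t. ?F (real j) t \<or> ?F t (real j)}" unfolding j by blast
  qed
  moreover have "0 \<notin> set (map length bs)" using assms by (auto simp: strict_valid_def)
  ultimately show ?thesis by (simp add: face_comp_def gaps_partial_sums)
qed

text \<open>Faces merge the consecutive segments of equal mean.\<close>

function groups :: "real list list \<Rightarrow> real list list list" where
  "groups [] = []"
| "groups (b # bs) = (b # takeWhile (\<lambda>c. mean c = mean b) bs) # groups (dropWhile (\<lambda>c. mean c = mean b) bs)"
  by pat_completeness auto
termination
  by (relation "Wellfounded.measure length") (auto simp: less_Suc_eq_le length_dropWhile_le)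

lemma concat_groups [simp]: "concat (groups bs) = bs"
  by (induction bs rule: groups.induct) auto

lemma groups_props:
  assumes "sorted_wrt (\<ge>) (map mean bs)"
  shows "[] \<notin> set (groups bs)" "\<And>g. g \<in> set (groups bs) \<Longrightarrow> \<forall>b\<in>set g. mean b = mean (hd g)"
    "sorted_wrt (>) (map (\<lambda>g. mean (hd g)) (groups bs))"
proof -
  have "[] \<notin> set (groups bs) \<and> (\<forall>g\<in>set (groups bs). \<forall>b\<in>set g. mean b = mean (hd g)) \<and>
     sorted_wrt (>) (map (\<lambda>g. mean (hd g)) (groups bs)) \<and> (\<forall>g\<in>set (groups bs). hd g \<in> set bs)"
    using assms
  proof (induction bs rule: groups.induct)
    case (2 b bs)
    let ?d = "dropWhile (\<lambda>c. mean c = mean b) bs"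
    have s: "sorted_wrt (\<ge>) (map mean ?d)"
      using 2(2) sorted_wrt_drop[where xs = "map mean bs"] by (simp add: dropWhile_eq_drop drop_map)
    have lt: "mean c < mean b" if "c \<in> set ?d" for c
    proof (cases ?d)
      case (Cons e es)
      then have "mean e \<noteq> mean b" using hd_dropWhile[of "\<lambda>c. mean c = mean b" bs] by auto
      moreover have "e \<in> set bs" using Cons by (metis list.set_intros(1) set_dropWhileD)
      ultimately have "mean e < mean b" using 2(2) by (auto simp: order_le_less)
      moreover have "mean c \<le> mean e" using s that Cons by auto
      ultimately show ?thesis by simp
    next
      case Nil
      then show ?thesis using that by (metis empty_iff list.set(1))
    qed
    have IH: "[] \<notin> set (groups ?d)" "\<forall>g\<in>set (groups ?d). \<forall>b\<in>set g. mean b = mean (hd g)"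
      "sorted_wrt (>) (map (\<lambda>g. mean (hd g)) (groups ?d))" "\<forall>g\<in>set (groups ?d). hd g \<in> set ?d"
      using 2(1)[OF s] by blast+
    have tw: "mean c = mean b" "c \<in> set bs" if "c \<in> set (takeWhile (\<lambda>c. mean c = mean b) bs)" for c
      using set_takeWhileD[OF that] by simp_all
    show ?case
      unfolding groups.simps
    proof (intro conjI ballI)
      fix g c assume "g \<in> set ((b # takeWhile (\<lambda>c. mean c = mean b) bs) # groups ?d)" "c \<in> set g"
      then consider "g = b # takeWhile (\<lambda>c. mean c = mean b) bs" "c \<in> set g" | "g \<in> set (groups ?d)" "c \<in> set g"
        by (metis set_ConsD)
      then show "mean c = mean (hd g)"
      proof cases
        case 1
        then have "c = b \<or> c \<in> set (takeWhile (\<lambda>c. mean c = mean b) bs)" by (metis set_ConsD)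
        then show ?thesis using tw(1) 1(1) by (metis list.sel(1))
      next
        case 2
        then show ?thesis using IH(2) by blast
      qed
    next
      fix g assume "g \<in> set ((b # takeWhile (\<lambda>c. mean c = mean b) bs) # groups ?d)"
      then show "hd g \<in> set (b # bs)" using IH(4) set_dropWhileD by fastforce
    qed (use IH(1,3,4) lt in auto)
  qed simp
  then show "[] \<notin> set (groups bs)" "\<And>g. g \<in> set (groups bs) \<Longrightarrow> \<forall>b\<in>set g. mean b = mean (hd g)"
    "sorted_wrt (>) (map (\<lambda>g. mean (hd g)) (groups bs))" by blast+
qed

text \<open>
  Good blocks of one common mean form a good block, so merging segments into faces leads back to
  the strict case.
\<close>

lemma good_concat:
  assumes "\<forall>b\<in>set g. b \<noteq> [] \<and> good b \<and> mean b = y" "g \<noteq> []"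
  shows "concat g \<noteq> []" "mean (concat g) = y" "good (concat g)"
proof -
  have "\<exists>es. concat es = concat g \<and> (\<forall>e\<in>set es. irr y e)"
    using assms(1)
  proof (induction g)
    case (Cons b g)
    then obtain es where "concat es = concat g" "\<forall>e\<in>set es. irr y e" by auto
    moreover obtain es' where "concat es' = b" "\<forall>e\<in>set es'. irr y e"
      using good_decompose[of b] Cons.prems by (metis list.set_intros(1))
    ultimately show ?case by (intro exI[of _ "es' @ es"]) auto
  qed (auto intro: exI[of _ "[]"])
  then obtain es where es: "concat es = concat g" "\<forall>e\<in>set es. irr y e" by blast
  show ne: "concat g \<noteq> []" using assms by (cases g) auto
  then have "es \<noteq> []" using es by auto
  then show "mean (concat g) = y" "good (concat g)" using irr_excursions_contacts[OF es(2)] es(1) by auto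
qed

lemma valid_groups:
  assumes "valid bs"
  shows "strict_valid (map concat (groups bs))"
    "\<And>g. g \<in> set (groups bs) \<Longrightarrow> mean (concat g) = mean (hd g)"
proof -
  have s: "sorted_wrt (\<ge>) (map mean bs)" using assms by (simp add: valid_def)
  have g: "concat g \<noteq> []" "mean (concat g) = mean (hd g)" "good (concat g)" if "g \<in> set (groups bs)" for g
  proof -
    have sub: "set g \<subseteq> set bs" using that concat_groups[of bs] by (metis UN_upper set_concat)
    have 1: "\<forall>b\<in>set g. b \<noteq> [] \<and> good b \<and> mean b = mean (hd g)"
      using groups_props(2)[OF s that] sub assms unfolding valid_def by blast
    have 2: "g \<noteq> []" using groups_props(1)[OF s] that by metis
    show "concat g \<noteq> []" "mean (concat g) = mean (hd g)" "good (concat g)"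
      using good_concat[OF 1 2] .
  qed
  then show "\<And>g. g \<in> set (groups bs) \<Longrightarrow> mean (concat g) = mean (hd g)" by blast
  have m: "map mean (map concat (groups bs)) = map (\<lambda>g. mean (hd g)) (groups bs)"
    using g by auto
  have "\<forall>b\<in>set (map concat (groups bs)). b \<noteq> [] \<and> good b"
    using g(1,3) by (metis (no_types, lifting) imageE list.set_map)
  then show "strict_valid (map concat (groups bs))"
    using groups_props(3)[OF s] unfolding strict_valid_def m by blast
qed

lemma concat_map_concat_groups [simp]: "concat (map concat (groups bs)) = concat bs"
proof -
  have "concat (map concat gs) = concat (concat gs)" for gs :: "real list list list" by (induction gs) auto
  then show ?thesis by simp
qed

lemma face_comp_valid:
  assumes "valid bs"
  shows "face_comp (concat bs) = map (\<lambda>g. length (concat g)) (groups bs)"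
  using face_comp_strict_valid[OF valid_groups(1)[OF assms]] by (simp add: comp_def)

section \<open>Reading off blocks, excursions and faces\<close>

lemma list_all2_blocks:
  assumes "\<And>pre b post. bs = pre @ b # post \<Longrightarrow> R (length (concat pre), length (concat pre) + length b) b"
  shows "list_all2 R (blocks (map length bs)) bs"
proof -
  have "list_all2 R (blocks_from (length (concat p)) (map length c)) c" if "bs = p @ c" for p c
    using that
  proof (induction c arbitrary: p)
    case (Cons b c)
    then show ?case using assms[of p b c] Cons.IH[of "p @ [b]"] by simp
  qed simp
  from this[of "[]" bs] show ?thesis by (simp add: blocks_def)
qed

lemma slope_block:
  assumes "\<And>b. b \<in> set bs \<Longrightarrow> b \<noteq> []"
  shows "list_all2 (\<lambda>I b. slope (concat bs) I = mean b \<and> block_length I = length b \<and>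
     walk (concat bs) (snd I) - walk (concat bs) (fst I) = sum_list b) (blocks (map length bs)) bs"
proof (rule list_all2_blocks)
  fix pre b post assume bs: "bs = pre @ b # post"
  have 1: "walk (concat bs) (length (concat pre)) = sum_list (concat pre)"
    unfolding bs by (simp add: walk_append walk_length)
  have "concat bs = concat (pre @ [b]) @ concat post" unfolding bs by simp
  then have 2: "walk (concat bs) (length (concat pre) + length b) = sum_list (concat pre) + sum_list b"
    by (metis (no_types, lifting) concat.simps concat_append length_append order_refl sum_list_append walk_append walk_length append_Nil2)
  show "slope (concat bs) (length (concat pre), length (concat pre) + length b) = mean b \<and>
     block_length (length (concat pre), length (concat pre) + length b) = length b \<and>
     walk (concat bs) (snd (length (concat pre), length (concat pre) + length b)) -
       walk (concat bs) (fst (length (concat pre), length (concat pre) + length b)) = sum_list b"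
    using 1 2 by (simp add: slope_def block_length_def mean_def)
qed

lemma segment_blocks:
  assumes "valid bs"
  shows "list_all2 (\<lambda>I b. slope (concat bs) I = mean b \<and>
      map block_length (blocks_within (\<Xi>H bs) I) = excs b) (blocks (\<Xi>K bs)) bs"
proof -
  have v: "\<And>b. b \<in> set bs \<Longrightarrow> b \<noteq> [] \<and> good b" using assms by (auto simp: valid_def)
  have K: "\<Xi>K bs = map sum_list (map excs bs)"
    using v excs_props(1) by (auto simp: \<Xi>K_def)
  have H: "\<Xi>H bs = concat (map excs bs)" by (simp add: \<Xi>H_def excursion_comp_valid[OF assms])
  have w: "map (blocks_within (\<Xi>H bs)) (blocks (\<Xi>K bs)) = nested_blocks 0 (map excs bs)"
    unfolding H K
  proof (rule blocks_within_nested)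
    show "0 \<notin> set (concat (map excs bs))" using v excs_props(2) by auto
    show "[] \<notin> set (map excs bs)"
    proof
      assume "[] \<in> set (map excs bs)"
      then obtain b where "b \<in> set bs" "excs b = []" by auto
      then show False using v[of b] excs_props(3)[of b] by simp
    qed
  qed
  have "map (map block_length) (nested_blocks a cs) = cs" for a cs
    by (induction cs arbitrary: a) auto
  then have "map (\<lambda>I. map block_length (blocks_within (\<Xi>H bs) I)) (blocks (\<Xi>K bs)) = map excs bs"
    unfolding w[symmetric, unfolded map_map] by (metis (no_types, lifting) map_map w comp_apply map_eq_conv)
  then have "list_all2 (\<lambda>I b. map block_length (blocks_within (\<Xi>H bs) I) = excs b) (blocks (\<Xi>K bs)) bs"
    by (simp add: list_eq_iff_nth_eq list_all2_conv_all_nth)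
  moreover have "list_all2 (\<lambda>I b. slope (concat bs) I = mean b) (blocks (\<Xi>K bs)) bs"
    unfolding \<Xi>K_def using slope_block[of bs] v by (auto elim: list_all2_mono)
  ultimately show ?thesis by (auto simp: list_all2_conv_all_nth)
qed

lemma excursion_lengths_valid:
  assumes "valid bs"
  shows "excursion_lengths bs y = map excs (filter (\<lambda>b. mean b = y) bs)"
  unfolding excursion_lengths_def
  by (rule map_filter_list_all2) (auto intro: list_all2_mono[OF segment_blocks[OF assms]])

text \<open>Reads the data of a face off the group of segments that form it.\<close>

lemma face_blocks:
  assumes "valid bs"
  shows "list_all2 (\<lambda>I g. slope (concat bs) I = mean (hd g) \<and> block_length I = length (concat g) \<and>
     walk (concat bs) (snd I) - walk (concat bs) (fst I) = sum_list (concat g) \<and>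
     map (\<lambda>I'. map block_length (blocks_within (\<Xi>H bs) I')) (blocks_within (\<Xi>K bs) I) = map excs g)
     (blocks (\<Xi>F bs)) (groups bs)"
proof -
  let ?G = "map concat (groups bs)"
  have sv: "strict_valid ?G" using valid_groups[OF assms] by simp
  have v: "\<And>b. b \<in> set bs \<Longrightarrow> b \<noteq> [] \<and> good b" using assms by (auto simp: valid_def)
  have s: "sorted_wrt (\<ge>) (map mean bs)" using assms by (simp add: valid_def)
  have F: "\<Xi>F bs = map length ?G" by (simp add: \<Xi>F_def face_comp_valid[OF assms] comp_def)
  have "list_all2 (\<lambda>I b. slope (concat bs) I = mean b \<and> block_length I = length b \<and>
     walk (concat bs) (snd I) - walk (concat bs) (fst I) = sum_list b) (blocks (\<Xi>F bs)) ?G"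
  proof -
    have "\<And>b. b \<in> set ?G \<Longrightarrow> b \<noteq> []" using sv unfolding strict_valid_def by blast
    from slope_block[of ?G, OF this] show ?thesis unfolding concat_map_concat_groups F .
  qed
  then have 1: "list_all2 (\<lambda>I g. slope (concat bs) I = mean (concat g) \<and> block_length I = length (concat g) \<and>
     walk (concat bs) (snd I) - walk (concat bs) (fst I) = sum_list (concat g)) (blocks (\<Xi>F bs)) (groups bs)"
    by (simp add: list_all2_map2)
  let ?cs = "map (map length) (groups bs)"
  have cK: "concat ?cs = \<Xi>K bs" unfolding \<Xi>K_def by (simp flip: map_concat)
  have F': "\<Xi>F bs = map sum_list ?cs" unfolding F by (simp add: length_concat)
  have w: "map (blocks_within (\<Xi>K bs)) (blocks (\<Xi>F bs)) = nested_blocks 0 ?cs"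
    unfolding F' cK[symmetric] 
    using v groups_props(1)[OF s] by (intro blocks_within_nested) (auto simp: cK \<Xi>K_def)
  have "list_all2 (\<lambda>I b. map block_length (blocks_within (\<Xi>H bs) I) = excs b) (concat (nested_blocks 0 ?cs)) (concat (groups bs))"
    unfolding concat_nested_blocks cK using segment_blocks[OF assms]
    by (auto simp: blocks_def elim: list_all2_mono)
  moreover have "list_all2 (\<lambda>u v. length u = length v) (nested_blocks 0 ?cs) (groups bs)"
    using list_all2_nested_blocks_shape[of 0 ?cs] by (simp add: list_all2_map2)
  ultimately have "list_all2 (list_all2 (\<lambda>I b. map block_length (blocks_within (\<Xi>H bs) I) = excs b)) (nested_blocks 0 ?cs) (groups bs)"
    by (rule list_all2_concat_split)
  then have 2: "list_all2 (\<lambda>I g. list_all2 (\<lambda>I b. map block_length (blocks_within (\<Xi>H bs) I) = excs b) (blocks_within (\<Xi>K bs) I) g)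
     (blocks (\<Xi>F bs)) (groups bs)"
    unfolding w[symmetric] by (simp add: list_all2_map1)
  have 3: "list_all2 (\<lambda>I b. map block_length (blocks_within (\<Xi>H bs) I) = excs b) u g \<Longrightarrow>
      map (\<lambda>I'. map block_length (blocks_within (\<Xi>H bs) I')) u = map excs g" for u g
    by (induction rule: list_all2_induct) auto
  show ?thesis using 1 2 3 valid_groups(2)[OF assms]
    by (simp add: list_all2_conv_all_nth)
qed

lemma has_face_valid:
  assumes "valid bs"
  shows "has_face (concat bs) y \<longleftrightarrow> (\<exists>b\<in>set bs. mean b = y)"
proof -
  have s: "sorted_wrt (\<ge>) (map mean bs)" using assms by (simp add: valid_def)
  have "map (slope (concat bs)) (blocks (\<Xi>F bs)) = map (\<lambda>g. mean (hd g)) (groups bs)"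
    using face_blocks[OF assms] by (auto simp: list_all2_conv_all_nth intro!: nth_equalityI)
  then have "slope (concat bs) ` set (blocks (\<Xi>F bs)) = (\<lambda>g. mean (hd g)) ` set (groups bs)"
    by (metis list.set_map)
  then have "has_face (concat bs) y \<longleftrightarrow> (\<exists>g\<in>set (groups bs). mean (hd g) = y)"
    unfolding has_face_def \<Xi>F_def[symmetric] by (auto simp: image_iff) (metis imageE imageI)+
  also have "\<dots> \<longleftrightarrow> (\<exists>b\<in>set bs. mean b = y)"
  proof -
    have "set bs = (\<Union>g\<in>set (groups bs). set g)" using concat_groups[of bs] by (metis set_concat)
    then show ?thesis using groups_props(1,2)[OF s] by (auto) (metis hd_in_set)+
  qed
  finally show ?thesis .
qed

lemma face_points_valid:
  assumes "valid bs"
  shows "face_points A bs = mset (map (\<lambda>g. (length (concat g), sum_list (concat g)))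
    (filter (\<lambda>g. mean (hd g) \<notin> A) (groups bs)))"
  unfolding face_points_def mset_filter[symmetric] mset_map[symmetric]
  by (rule arg_cong[where f = mset], rule map_filter_list_all2)
     (auto intro: list_all2_mono[OF face_blocks[OF assms]])

text \<open>
  All three compositions at once: the excursion lengths, segment by segment and face by face.
\<close>

definition face_shape :: "real list list \<Rightarrow> nat list list list" where
  "face_shape bs = map (map excs) (groups bs)"

lemma compositions_face_shape:
  assumes "valid bs"
  shows "\<Xi>H bs = concat (concat (face_shape bs))" "\<Xi>K bs = map sum_list (concat (face_shape bs))"
    "\<Xi>F bs = map (sum_list \<circ> concat) (face_shape bs)"
proof -
  have v: "\<And>b. b \<in> set bs \<Longrightarrow> b \<noteq> [] \<and> good b" using assms by (auto simp: valid_def)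
  have c: "concat (face_shape bs) = map excs bs" by (simp add: face_shape_def flip: map_concat)
  show "\<Xi>H bs = concat (concat (face_shape bs))" by (simp add: c \<Xi>H_def excursion_comp_valid[OF assms])
  show "\<Xi>K bs = map sum_list (concat (face_shape bs))" using v excs_props(1) by (auto simp: \<Xi>K_def c)
  have "length (concat g) = sum_list (concat (map excs g))" if "g \<in> set (groups bs)" for g
  proof -
    have "set g \<subseteq> set bs" using that concat_groups[of bs] by (metis UN_upper set_concat)
    then have "\<forall>b\<in>set g. sum_list (excs b) = length b" using v excs_props(1) by auto
    then show ?thesis by (induction g) auto
  qed
  then show "\<Xi>F bs = map (sum_list \<circ> concat) (face_shape bs)"
    by (auto simp: \<Xi>F_def face_comp_valid[OF assms] face_shape_def)
qed

lemma compositions_valid: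
  assumes "valid bs" "length (concat bs) = n"
  shows "is_composition n (\<Xi>H bs)" "is_composition n (\<Xi>K bs)" "is_composition n (\<Xi>F bs)"
    "comp_refines (\<Xi>H bs) (\<Xi>K bs)" "comp_refines (\<Xi>K bs) (\<Xi>F bs)"
proof -
  note cf = compositions_face_shape[OF assms(1)]
  have v: "\<And>b. b \<in> set bs \<Longrightarrow> b \<noteq> [] \<and> good b" using assms by (auto simp: valid_def)
  have s: "sum_list (\<Xi>K bs) = n" using assms(2) by (simp add: \<Xi>K_def length_concat)
  have sc: "sum_list (concat xss) = sum_list (map sum_list xss)" for xss :: "nat list list"
    by (induction xss) auto
  show "is_composition n (\<Xi>K bs)" using v s by (auto simp: is_composition_def \<Xi>K_def)
  have "0 \<notin> set (\<Xi>H bs)"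
    using v excs_props(2) by (auto simp: \<Xi>H_def excursion_comp_valid[OF assms(1)])
  then show "is_composition n (\<Xi>H bs)" using s by (simp add: is_composition_def cf sc)
  show "is_composition n (\<Xi>F bs)"
  proof -
    have "strict_valid (map concat (groups bs))" using valid_groups[OF assms(1)] by simp
    then have "0 \<notin> set (\<Xi>F bs)"
      by (auto simp: \<Xi>F_def face_comp_valid[OF assms(1)] strict_valid_def)
    moreover have "sum_list (\<Xi>F bs) = n"
      using s unfolding cf by (simp add: sc map_concat comp_def)
    ultimately show ?thesis by (simp add: is_composition_def)
  qed
  show "comp_refines (\<Xi>H bs) (\<Xi>K bs)" unfolding comp_refines_def cf by blast
  show "comp_refines (\<Xi>K bs) (\<Xi>F bs)" unfolding comp_refines_def cf
    by (rule exI[of _ "map (map sum_list) (face_shape bs)"]) (auto simp: map_concat sc comp_def)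
qed

section \<open>The cycle type of a uniform permutation\<close>

definition cycle_type :: "nat \<Rightarrow> (nat \<Rightarrow> nat) \<Rightarrow> nat multiset" where
  "cycle_type n p = image_mset card (mset_set (orbit p ` {..<n}))"

definition comps :: "nat \<Rightarrow> nat list set" where
  "comps n = {ns. 0 \<notin> set ns \<and> sum_list ns = n}"

text \<open>
  Cauchy's weight: the chance that the cycle lengths of a uniform permutation, listed in
  uniformly random order, are \<open>ns\<close>.
\<close>

definition comp_weight :: "nat list \<Rightarrow> real" where
  "comp_weight ns = 1 / (fact (length ns) * real (prod_list ns))"

lemma length_le_sum_list: "0 \<notin> set ns \<Longrightarrow> length ns \<le> sum_list (ns :: nat list)"
  by (induction ns) auto

lemma finite_comps [simp]: "finite (comps n)"
proof (rule finite_subset)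
  show "comps n \<subseteq> {ns. set ns \<subseteq> {..n} \<and> length ns \<le> n}"
    unfolding comps_def using length_le_sum_list member_le_sum_list by fastforce
qed (simp add: finite_lists_length_le)

lemma comps_0 [simp]: "comps 0 = {[]}"
  by (auto simp: comps_def) (metis length_greater_0_conv list.set_intros(1) neq_Nil_conv)

context
  fixes q :: "nat \<Rightarrow> nat" and n :: nat
  assumes q: "q permutes {..<n}"
begin

lemma permutation_q: "permutation q"
  using q permutation_permutes by blast

lemma orbit_q_eq: "y \<in> orbit q x \<Longrightarrow> orbit q y = orbit q x"
  using permutation_self_in_orbit[OF permutation_q] by (metis orbit_cyclic_eq3 cyclic_on_orbit' permutation_q)

lemma orbit_q_subset: "x < n \<Longrightarrow> orbit q x \<subseteq> {..<n}"
  using permutes_orbit_subset[OF q] by auto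

lemma orbit_q_member_iff: "y \<in> orbit q x \<longleftrightarrow> orbit q y = orbit q x"
  using orbit_q_eq permutation_self_in_orbit[OF permutation_q] by metis

text \<open>
  A permutation of \<open>Suc n\<close> points arises from one of \<open>n\<close> points by
  inserting the new point after \<open>b\<close> in the cycle of \<open>b\<close>, which leaves
  the other cycles alone.
\<close>

lemma orbit_insert:
  assumes b: "b < n"
  defines "p \<equiv> Transposition.transpose n b \<circ> q"
  shows "orbit p b = insert n (orbit q b)"
    and "x < n \<Longrightarrow> x \<notin> orbit q b \<Longrightarrow> orbit p x = orbit q x"
proof -
  have qn: "q n = n" using q by (simp add: permutes_not_in)
  have pn: "p n = b" by (simp add: p_def qn)
  have "p permutes {..<Suc n}"
    unfolding p_def using q b
    by (intro permutes_compose permutes_swap_id) (auto intro: permutes_subset)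
  then have perm_p: "permutation p" using permutation_permutes by blast
  have self: "b \<in> orbit p b" "b \<in> orbit q b"
    by (auto intro: permutation_self_in_orbit perm_p permutation_q)
  have p_cases: "p s = (if q s = b then n else q s)" if "s < n" for s
  proof -
    have "q s < n" using q that by (metis lessThan_iff permutes_in_image)
    then show ?thesis by (auto simp: p_def Transposition.transpose_def)
  qed
  show "orbit p b = insert n (orbit q b)"
  proof (intro equalityI subsetI)
    fix s assume "s \<in> orbit p b"
    then show "s \<in> insert n (orbit q b)"
    proof (induction rule: orbit.induct)
      case base
      then show ?case using p_cases[OF b] by (auto intro: orbit.base)
    next
      case (step y)
      then show ?case
      proof (cases "y = n")
        case True
        then show ?thesis using pn self by simp
      next
        case False
        then have "y \<in> orbit q b" using step by simp
        moreover have "y < n" using calculation orbit_q_subset[OF b] by auto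
        ultimately show ?thesis using p_cases by (auto intro: orbit.step)
      qed
    qed
  next
    have sub: "s \<in> orbit p b" if "s \<in> orbit q b" for s
      using that
    proof (induction rule: orbit.induct)
      case base
      then show ?case using p_cases[OF b] self orbit.base[of p b] by (auto split: if_splits)
    next
      case (step y)
      have "y < n" using step.hyps orbit_q_subset[OF b] by auto
      then show ?case using p_cases[of y] self orbit.step[OF step.IH] by (auto split: if_splits)
    qed
    fix s assume s: "s \<in> insert n (orbit q b)"
    have "n \<in> orbit p b"
    proof -
      obtain c where c: "q c = b" using q by (metis permutes_def)
      have "b \<in> orbit q c" using orbit.base[of q c] c by simp
      then have "c \<in> orbit q b" using orbit_q_member_iff[of b c] orbit_q_member_iff[of c b] by simp
      then have "c \<in> orbit p b" "c < n" using sub orbit_q_subset[OF b] by auto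
      then show ?thesis using p_cases[of c] c orbit.step[of c p b] by simp
    qed
    then show "s \<in> orbit p b" using s sub[of s] by auto
  qed
  show "orbit p x = orbit q x" if x: "x < n" "x \<notin> orbit q b"
  proof (rule orbit_cong)
    show "x \<in> orbit q x" by (rule permutation_self_in_orbit[OF permutation_q])
    fix s assume s: "s \<in> orbit q x"
    have "q s \<noteq> b"
    proof
      assume "q s = b"
      then have "b \<in> orbit q x" using orbit.step[OF s] by simp
      then show False using x orbit_q_member_iff by metis
    qed
    moreover have "s < n" using s orbit_q_subset[OF x(1)] by auto
    ultimately show "p s = q s" using p_cases by simp
  qed
qed

lemma cycle_type_insert:
  assumes b: "b < n"
  shows "cycle_type (Suc n) (Transposition.transpose n b \<circ> q) =
     add_mset (Suc (card (orbit q b))) (cycle_type n q - {#card (orbit q b)#})"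
proof -
  let ?p = "Transposition.transpose n b \<circ> q" and ?O = "orbit q b" and ?A = "orbit q ` {..<n}"
  have "?p permutes {..<Suc n}"
    using q b by (intro permutes_compose permutes_swap_id) (auto intro: permutes_subset)
  then have perm_p: "permutation ?p" using permutation_permutes by blast
  have T: "orbit ?p x = insert n ?O" if "x \<in> insert n ?O" for x
    using that orbit_insert(1)[OF b]
    by (metis cyclic_on_orbit' orbit_cyclic_eq3 perm_p)
  have n: "n \<notin> ?O" using orbit_q_subset[OF b] by auto
  have im: "orbit ?p ` {..<Suc n} = insert (insert n ?O) (?A - {?O})"
  proof (intro equalityI subsetI)
    fix y assume "y \<in> orbit ?p ` {..<Suc n}"
    then obtain x where x: "x < Suc n" "y = orbit ?p x" by auto
    show "y \<in> insert (insert n ?O) (?A - {?O})"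
    proof (cases "x \<in> insert n ?O")
      case True then show ?thesis using T x by auto
    next
      case False
      then have "x < n" using x by auto
      then show ?thesis using False x orbit_insert(2)[OF b] orbit_q_member_iff by auto
    qed
  next
    fix y assume "y \<in> insert (insert n ?O) (?A - {?O})"
    then consider "y = insert n ?O" | x where "x < n" "y = orbit q x" "orbit q x \<noteq> ?O" by auto
    then show "y \<in> orbit ?p ` {..<Suc n}"
    proof cases
      case 1 then show ?thesis using T[of n] by auto
    next
      case 2
      then have "x \<notin> ?O" using orbit_q_member_iff by auto
      then show ?thesis using 2 orbit_insert(2)[OF b] by (intro image_eqI[of _ _ x]) auto
    qed
  qed
  have "insert n ?O \<notin> ?A - {?O}" using orbit_q_subset by (metis DiffD1 imageE insertI1 lessThan_iff less_irrefl subsetD)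
  then have "mset_set (orbit ?p ` {..<Suc n}) = add_mset (insert n ?O) (mset_set (?A - {?O}))"
    unfolding im by simp
  also have "mset_set (?A - {?O}) = mset_set ?A - {#?O#}"
    using b by (subst mset_set_Diff) auto
  finally have "cycle_type (Suc n) ?p = add_mset (card (insert n ?O)) (image_mset card (mset_set ?A - {#?O#}))"
    by (simp only: cycle_type_def image_mset_add_mset)
  also have "card (insert n ?O) = Suc (card ?O)"
    using n orbit_q_subset[OF b] by (simp add: finite_subset)
  also have "image_mset card (mset_set ?A - {#?O#}) = image_mset card (mset_set ?A) - {#card ?O#}"
    using b by (subst image_mset_Diff) auto
  finally show ?thesis unfolding cycle_type_def by simp
qed

lemma cycle_type_fixed: "cycle_type (Suc n) q = add_mset 1 (cycle_type n q)"
proof -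
  have "q n = n" using q by (simp add: permutes_not_in)
  then have "orbit q n = {n}" by (simp add: orbit_eq_singleton_iff)
  then have "orbit q ` {..<Suc n} = insert {n} (orbit q ` {..<n})" by (simp add: lessThan_Suc)
  moreover have "{n} \<notin> orbit q ` {..<n}" using orbit_q_subset by fastforce
  ultimately show ?thesis by (simp add: cycle_type_def)
qed

text \<open>
  A cycle of length \<open>c\<close> has \<open>c\<close> points in which the new point can be
  inserted.
\<close>

lemma sum_over_cycles:
  "(\<Sum>b<n. g (card (orbit q b))) = (\<Sum>c\<in>#cycle_type n q. real c * g c)"
proof -
  let ?A = "orbit q ` {..<n}"
  have "(\<Sum>b<n. g (card (orbit q b))) = (\<Sum>O'\<in>?A. \<Sum>b\<in>{b\<in>{..<n}. orbit q b = O'}. g (card (orbit q b)))"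
    by (rule sum.image_gen) simp
  also have "\<dots> = (\<Sum>O'\<in>?A. real (card O') * g (card O'))"
  proof (rule sum.cong[OF refl])
    fix O' assume "O' \<in> ?A"
    then obtain x where x: "x < n" "O' = orbit q x" by auto
    have "{b\<in>{..<n}. orbit q b = O'} = O'"
      using x orbit_q_subset[OF x(1)] orbit_q_member_iff by auto
    moreover have "(\<Sum>b\<in>{b\<in>{..<n}. orbit q b = O'}. g (card (orbit q b))) = (\<Sum>b\<in>{b\<in>{..<n}. orbit q b = O'}. g (card O'))"
      by (rule sum.cong) auto
    ultimately show "(\<Sum>b\<in>{b\<in>{..<n}. orbit q b = O'}. g (card (orbit q b))) = real (card O') * g (card O')"
      by simp
  qed
  also have "\<dots> = (\<Sum>c\<in>#cycle_type n q. real c * g c)"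
    by (simp add: cycle_type_def sum_unfold_sum_mset image_mset.compositionality comp_def)
  finally show ?thesis .
qed

end

lemma sum_mset_mset_nth: "(\<Sum>c\<in>#mset ns. f c) = (\<Sum>j<length ns. f (ns ! j))"
proof -
  have "(\<Sum>c\<in>#mset ns. f c) = sum_list (map f ns)" by (metis mset_map sum_mset_sum_list)
  also have "\<dots> = (\<Sum>j<length ns. f (ns ! j))" by (simp add: sum_list_sum_nth atLeast0LessThan)
  finally show ?thesis .
qed

text \<open>
  Both sides sum over a composition of \<open>Suc n\<close> with a marked part, weighted by the
  size of the part. Removing the marked part if it is 1, and decreasing it by one otherwise,
  yields a composition of \<open>n\<close>; this is the recursion of the cycle type under
  insertion of a point.
\<close>

lemma comps_recursion:
  fixes h :: "nat multiset \<Rightarrow> real"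
  shows "(\<Sum>ns\<in>comps n. comp_weight ns *
     (h (add_mset 1 (mset ns)) + (\<Sum>c\<in>#mset ns. real c * h (add_mset (Suc c) (mset ns - {#c#})))))
    = real (Suc n) * (\<Sum>ns\<in>comps (Suc n). comp_weight ns * h (mset ns))"
proof -
  define P where "P m = Sigma (comps m) (\<lambda>ns. {..<length ns})" for m
  have fin: "finite (P m)" for m unfolding P_def by (intro finite_SigmaI) auto
  define t where "t = (\<lambda>(ns, j). real (ns ! j) * comp_weight ns * h (mset ns))"
  have "real (Suc n) * (\<Sum>ns\<in>comps (Suc n). comp_weight ns * h (mset ns)) = (\<Sum>z\<in>P (Suc n). t z)"
  proof -
    have "real (Suc n) * (comp_weight ns * h (mset ns)) = (\<Sum>j<length ns. t (ns, j))" if "ns \<in> comps (Suc n)" for ns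
    proof -
      have "real (Suc n) = (\<Sum>j<length ns. real (ns ! j))"
        using that by (simp add: comps_def sum_list_sum_nth atLeast0LessThan flip: of_nat_sum)
      then show ?thesis by (simp add: t_def sum_distrib_right mult.assoc del: of_nat_Suc)
    qed
    then have "real (Suc n) * (\<Sum>ns\<in>comps (Suc n). comp_weight ns * h (mset ns)) =
        (\<Sum>ns\<in>comps (Suc n). \<Sum>j<length ns. t (ns, j))"
      by (simp only: sum_distrib_left cong: sum.cong)
    also have "\<dots> = (\<Sum>z\<in>P (Suc n). t z)"
      unfolding P_def by (subst sum.Sigma) auto
    finally show ?thesis .
  qed
  also have "\<dots> = (\<Sum>z\<in>{z\<in>P (Suc n). fst z ! snd z = 1}. t z) + (\<Sum>z\<in>{z\<in>P (Suc n). fst z ! snd z \<noteq> 1}. t z)"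
    using fin by (subst sum.union_disjoint[symmetric]) (auto intro!: sum.cong)
  also have "(\<Sum>z\<in>{z\<in>P (Suc n). fst z ! snd z \<noteq> 1}. t z) =
      (\<Sum>z\<in>P n. comp_weight (fst z) * (real (fst z ! snd z) * h (add_mset (Suc (fst z ! snd z)) (mset (fst z) - {#fst z ! snd z#}))))"
  proof (rule sum.reindex_bij_witness[where i = "\<lambda>(ns, j). (ns[j := Suc (ns ! j)], j)" and j = "\<lambda>(ns, j). (ns[j := ns ! j - 1], j)"])
    fix z assume z: "z \<in> {z\<in>P (Suc n). fst z ! snd z \<noteq> 1}"
    obtain ns j where zj: "z = (ns, j)" by (cases z)
    have a: "0 \<notin> set ns" "sum_list ns = Suc n" "j < length ns" "ns ! j \<noteq> 1" using z zj by (auto simp: P_def comps_def)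
    have nz: "ns ! j \<noteq> 0" using a by (metis nth_mem)
    have le: "ns ! j \<le> sum_list ns" using a(3) by (simp add: elem_le_sum_list)
    show "(\<lambda>(ns, j). (ns[j := Suc (ns ! j)], j)) ((\<lambda>(ns, j). (ns[j := ns ! j - 1], j)) z) = z"
      using a nz zj by simp
    show "(\<lambda>(ns, j). (ns[j := ns ! j - 1], j)) z \<in> P n"
      using a nz zj le set_update_subset_insert[of ns j "ns ! j - 1"]
      by (auto simp: P_def comps_def sum_list_update)
    let ?ms = "ns[j := ns ! j - 1]"
    have "real (prod_list ns) * real (?ms ! j) = real (prod_list ?ms) * real (ns ! j)"
    proof -
      have e: "xs = take j xs @ xs ! j # drop (Suc j) xs" if "j < length xs" for xs :: "nat list"
        using that by (simp add: id_take_nth_drop)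
      have "prod_list ns = prod_list (take j ns) * (ns ! j * prod_list (drop (Suc j) ns))"
        using arg_cong[OF e[OF a(3)], of prod_list] by simp
      moreover have "prod_list ?ms = prod_list (take j ns) * ((ns ! j - 1) * prod_list (drop (Suc j) ns))"
        using arg_cong[OF e[of ?ms], of prod_list] a(3) by simp
      ultimately show ?thesis using a by (simp add: algebra_simps flip: of_nat_mult)
    qed
    moreover have "prod_list ns \<noteq> 0" "prod_list ?ms \<noteq> 0"
      using a nz set_update_subset_insert[of ns j "ns ! j - 1"] by (auto simp: prod_list_zero_iff)
    ultimately have w: "comp_weight ?ms * real (?ms ! j) = real (ns ! j) * comp_weight ns"
      by (simp add: comp_weight_def field_simps)
    have "mset ns = add_mset (Suc (?ms ! j)) (mset ?ms - {#?ms ! j#})"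
    proof -
      have "ns = ?ms[j := Suc (?ms ! j)]" using a nz by simp
      then show ?thesis using mset_update[of j ?ms "Suc (?ms ! j)"] a(3) by (metis length_list_update)
    qed
    then have "h (add_mset (Suc (?ms ! j)) (mset ?ms - {#?ms ! j#})) = h (mset ns)" by simp
    then show "comp_weight (fst ((\<lambda>(ns, j). (ns[j := ns ! j - 1], j)) z)) *
        (real (fst ((\<lambda>(ns, j). (ns[j := ns ! j - 1], j)) z) ! snd ((\<lambda>(ns, j). (ns[j := ns ! j - 1], j)) z)) *
          h (add_mset (Suc (fst ((\<lambda>(ns, j). (ns[j := ns ! j - 1], j)) z) ! snd ((\<lambda>(ns, j). (ns[j := ns ! j - 1], j)) z)))
           (mset (fst ((\<lambda>(ns, j). (ns[j := ns ! j - 1], j)) z)) -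
            {#fst ((\<lambda>(ns, j). (ns[j := ns ! j - 1], j)) z) ! snd ((\<lambda>(ns, j). (ns[j := ns ! j - 1], j)) z)#}))) = t z"
      using w by (simp only: zj split fst_conv snd_conv t_def mult.assoc[symmetric])
  next
    fix z assume z: "z \<in> P n"
    obtain ns j where zj: "z = (ns, j)" by (cases z)
    have a: "0 \<notin> set ns" "sum_list ns = n" "j < length ns" using z zj by (auto simp: P_def comps_def)
    have nz: "ns ! j \<noteq> 0" using a by (metis nth_mem)
    show "(\<lambda>(ns, j). (ns[j := ns ! j - 1], j)) ((\<lambda>(ns, j). (ns[j := Suc (ns ! j)], j)) z) = z"
      using a zj by simp
    show "(\<lambda>(ns, j). (ns[j := Suc (ns ! j)], j)) z \<in> {z\<in>P (Suc n). fst z ! snd z \<noteq> 1}"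
      using a nz zj set_update_subset_insert[of ns j "Suc (ns ! j)"] elem_le_sum_list[OF a(3)]
      by (auto simp: P_def comps_def sum_list_update)
  qed
  also have "\<dots> = (\<Sum>ns\<in>comps n. comp_weight ns * (\<Sum>c\<in>#mset ns. real c * h (add_mset (Suc c) (mset ns - {#c#}))))"
  proof -
    have "(\<Sum>z\<in>P n. G (fst z) (snd z)) = (\<Sum>ns\<in>comps n. \<Sum>j<length ns. G ns j)" for G :: "nat list \<Rightarrow> nat \<Rightarrow> real"
      by (simp add: P_def sum.Sigma split_def)
    then show ?thesis by (simp only: sum_distrib_left sum_mset_mset_nth)
  qed
  also have "(\<Sum>z\<in>{z\<in>P (Suc n). fst z ! snd z = 1}. t z) =
      (\<Sum>z\<in>Sigma (comps n) (\<lambda>ns. {..length ns}). comp_weight (fst z) / real (Suc (length (fst z))) * h (add_mset 1 (mset (fst z))))"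
  proof (rule sum.reindex_bij_witness[where i = "\<lambda>(ns, j). (take j ns @ 1 # drop j ns, j)" and j = "\<lambda>(ns, j). (take j ns @ drop (Suc j) ns, j)"])
    fix z assume z: "z \<in> {z\<in>P (Suc n). fst z ! snd z = 1}"
    obtain ns j where zj: "z = (ns, j)" by (cases z)
    have a: "0 \<notin> set ns" "sum_list ns = Suc n" "j < length ns" "ns ! j = 1" using z zj by (auto simp: P_def comps_def)
    have e: "ns = take j ns @ 1 # drop (Suc j) ns" using a by (metis id_take_nth_drop)
    show "(\<lambda>(ns, j). (take j ns @ 1 # drop j ns, j)) ((\<lambda>(ns, j). (take j ns @ drop (Suc j) ns, j)) z) = z"
    proof -
      have "take j (take j ns @ drop (Suc j) ns) = take j ns" "drop j (take j ns @ drop (Suc j) ns) = drop (Suc j) ns"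
        using a by (simp_all add: min_def)
      then show ?thesis unfolding zj split using e by metis
    qed
    have "sum_list ns = sum_list (take j ns) + (1 + sum_list (drop (Suc j) ns))"
      using arg_cong[OF e, of sum_list] by simp
    then show "(\<lambda>(ns, j). (take j ns @ drop (Suc j) ns, j)) z \<in> Sigma (comps n) (\<lambda>ns. {..length ns})"
      using a zj by (auto simp: comps_def dest: in_set_takeD in_set_dropD)
    define r where "r = take j ns @ drop (Suc j) ns"
    have p: "prod_list ns = prod_list r" using arg_cong[OF e, of prod_list] by (simp add: r_def)
    have l: "length ns = Suc (length r)" using a by (simp add: r_def)
    have "comp_weight ns = comp_weight r / real (Suc (length r))"
      unfolding comp_weight_def p l fact_Suc by (simp add: divide_divide_eq_left mult_ac del: of_nat_Suc)
    then have "comp_weight ns = comp_weight (take j ns @ drop (Suc j) ns) / real (Suc (length (take j ns @ drop (Suc j) ns)))"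
      unfolding r_def .
    moreover have "mset ns = add_mset 1 (mset (take j ns @ drop (Suc j) ns))"
      using arg_cong[OF e, of mset] by simp
    ultimately show "comp_weight (fst ((\<lambda>(ns, j). (take j ns @ drop (Suc j) ns, j)) z)) /
         real (Suc (length (fst ((\<lambda>(ns, j). (take j ns @ drop (Suc j) ns, j)) z)))) *
         h (add_mset 1 (mset (fst ((\<lambda>(ns, j). (take j ns @ drop (Suc j) ns, j)) z)))) = t z"
      using a(4) by (simp only: zj split fst_conv snd_conv t_def of_nat_1 mult_1)
  next
    fix z assume z: "z \<in> Sigma (comps n) (\<lambda>ns. {..length ns})"
    obtain ns j where zj: "z = (ns, j)" by (cases z)
    have a: "0 \<notin> set ns" "sum_list ns = n" "j \<le> length ns" using z zj by (auto simp: comps_def)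
    show "(\<lambda>(ns, j). (take j ns @ drop (Suc j) ns, j)) ((\<lambda>(ns, j). (take j ns @ 1 # drop j ns, j)) z) = z"
      using a zj by (simp add: min_def)
    have "sum_list (take j ns) + sum_list (drop j ns) = n"
      using a(2) by (metis append_take_drop_id sum_list_append)
    then show "(\<lambda>(ns, j). (take j ns @ 1 # drop j ns, j)) z \<in> {z\<in>P (Suc n). fst z ! snd z = 1}"
      using a zj by (auto simp: P_def comps_def nth_append min_def dest: in_set_takeD in_set_dropD)
  qed
  also have "\<dots> = (\<Sum>ns\<in>comps n. comp_weight ns * h (add_mset 1 (mset ns)))"
  proof -
    have "(\<Sum>z\<in>Sigma (comps n) (\<lambda>ns. {..length ns}). G (fst z)) = (\<Sum>ns\<in>comps n. \<Sum>j\<le>length ns. G ns)" for G :: "nat list \<Rightarrow> real"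
      by (simp add: sum.Sigma split_def del: sum_constant)
    note this[of "\<lambda>ns. comp_weight ns / real (Suc (length ns)) * h (add_mset 1 (mset ns))"]
    then show ?thesis by simp
  qed
  finally show ?thesis by (simp add: distrib_left sum.distrib)
qed

text \<open>Cauchy's formula for the cycle type of a uniform permutation.\<close>

theorem sum_cycle_type:
  fixes h :: "nat multiset \<Rightarrow> real"
  shows "(\<Sum>p | p permutes {..<n}. h (cycle_type n p)) = fact n * (\<Sum>ns\<in>comps n. comp_weight ns * h (mset ns))"
proof (induction n arbitrary: h)
  case 0
  have "{p. p permutes {}} = {id :: nat \<Rightarrow> nat}" by auto
  then show ?case by (simp add: comp_weight_def cycle_type_def)
next
  case (Suc n)
  let ?H = "\<lambda>l. h (add_mset 1 l) + (\<Sum>c\<in>#l. real c * h (add_mset (Suc c) (l - {#c#})))"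
  have "(\<Sum>p | p permutes {..<Suc n}. h (cycle_type (Suc n) p)) =
     (\<Sum>b\<in>insert n {..<n}. \<Sum>q | q permutes {..<n}. h (cycle_type (Suc n) (Transposition.transpose n b \<circ> q)))"
    unfolding lessThan_Suc by (rule sum_over_permutations_insert) auto
  also have "\<dots> = (\<Sum>q | q permutes {..<n}. \<Sum>b\<in>insert n {..<n}. h (cycle_type (Suc n) (Transposition.transpose n b \<circ> q)))"
    by (rule sum.swap)
  also have "\<dots> = (\<Sum>q | q permutes {..<n}. ?H (cycle_type n q))"
  proof (rule sum.cong[OF refl])
    fix q assume "q \<in> {q. q permutes {..<n}}"
    then have q: "q permutes {..<n}" by simp
    have "(\<Sum>b<n. h (cycle_type (Suc n) (Transposition.transpose n b \<circ> q))) =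
      (\<Sum>b<n. (\<lambda>c. h (add_mset (Suc c) (cycle_type n q - {#c#}))) (card (orbit q b)))"
      using cycle_type_insert[OF q] by (intro sum.cong) auto
    also have "\<dots> = (\<Sum>c\<in>#cycle_type n q. real c * h (add_mset (Suc c) (cycle_type n q - {#c#})))"
      by (rule sum_over_cycles[OF q])
    finally show "(\<Sum>b\<in>insert n {..<n}. h (cycle_type (Suc n) (Transposition.transpose n b \<circ> q))) = ?H (cycle_type n q)"
      using cycle_type_fixed[OF q] by simp
  qed
  also have "\<dots> = fact n * (\<Sum>ns\<in>comps n. comp_weight ns * ?H (mset ns))"
    by (rule Suc.IH)
  also have "\<dots> = fact (Suc n) * (\<Sum>ns\<in>comps (Suc n). comp_weight ns * h (mset ns))"
    unfolding comps_recursion by simp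
  finally show ?case .
qed

lemma cycle_lengths_props:
  assumes "p permutes {..<n}"
  shows "mset (cycle_lengths n p) = cycle_type n p" "cycle_lengths n p \<in> comps n"
proof -
  show m: "mset (cycle_lengths n p) = cycle_type n p"
    by (simp add: cycle_lengths_def cycle_type_def)
  have "0 \<notin># cycle_type n p"
  proof
    assume "0 \<in># cycle_type n p"
    then obtain x where x: "x < n" "card (orbit p x) = 0" by (auto simp: cycle_type_def)
    then have "finite (orbit p x)" using orbit_q_subset[OF assms x(1)] finite_subset by blast
    then show False using x orbit_nonempty[of p x] by simp
  qed
  moreover have "sum_mset (cycle_type n p) = n"
  proof -
    have "real (sum_mset (cycle_type n p)) = (\<Sum>c\<in>#cycle_type n p. real c * 1)"
      by (simp add: of_nat_sum_mset)
    also have "\<dots> = (\<Sum>b<n. 1)" by (rule sum_over_cycles[OF assms, symmetric])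
    finally show ?thesis by (simp only: sum_constant card_lessThan mult_1_right of_nat_eq_iff)
  qed
  ultimately show "cycle_lengths n p \<in> comps n"
    using m by (metis (mono_tags, lifting) comps_def mem_Collect_eq set_mset_mset sum_mset_sum_list)
qed

section \<open>Measurable spaces of lists\<close>

abbreviation seqM :: "nat \<Rightarrow> (nat \<Rightarrow> real) measure" where
  "seqM n \<equiv> Pi\<^sub>M {..<n} (\<lambda>_. borel)"

text \<open>
  The lists carry the final sigma-algebra with respect to the maps that list finitely many
  coordinates. A function on lists is then measurable if it is so on lists of each fixed length.
\<close>

definition listM :: "real list measure" where
  "listM = sigma UNIV {A. \<forall>n. (\<lambda>x. map x [0..<n]) -` A \<inter> space (seqM n) \<in> sets (seqM n)}"

lemma space_listM [simp]: "space listM = UNIV"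
  by (simp add: listM_def)

lemma sigma_algebra_final:
  fixes f :: "'i \<Rightarrow> 'a \<Rightarrow> 'b"
  shows "sigma_algebra UNIV {A. \<forall>i. f i -` A \<inter> space (N i) \<in> sets (N i)}"
proof -
  have c: "f i -` (UNIV - A) \<inter> space (N i) = space (N i) - (f i -` A \<inter> space (N i))" for i A by auto
  have u: "f i -` (\<Union>k. A k) \<inter> space (N i) = (\<Union>k. f i -` A k \<inter> space (N i))" for i and A :: "nat \<Rightarrow> _" by auto
  show ?thesis
    unfolding sigma_algebra_iff2
  proof (intro conjI ballI allI impI; (elim conjE)?)
    fix A :: "nat \<Rightarrow> 'b set" assume "range A \<subseteq> {A. \<forall>i. f i -` A \<inter> space (N i) \<in> sets (N i)}"
    then have "f i -` A k \<inter> space (N i) \<in> sets (N i)" for i k by blast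
    then have "(\<Union>k. f i -` A k \<inter> space (N i)) \<in> sets (N i)" for i by (intro sets.countable_UN) auto
    then show "(\<Union>k. A k) \<in> {A. \<forall>i. f i -` A \<inter> space (N i) \<in> sets (N i)}" by (simp only: u mem_Collect_eq) blast
  qed (auto simp: c)
qed

lemma sets_listM: "A \<in> sets listM \<longleftrightarrow> (\<forall>n. (\<lambda>x. map x [0..<n]) -` A \<inter> space (seqM n) \<in> sets (seqM n))"
proof -
  have "sigma_sets UNIV {A. \<forall>n. (\<lambda>x. map x [0..<n]) -` A \<inter> space (seqM n) \<in> sets (seqM n)} =
      {A. \<forall>n. (\<lambda>x. map x [0..<n]) -` A \<inter> space (seqM n) \<in> sets (seqM n)}"
    by (rule sigma_algebra.sigma_sets_eq[OF sigma_algebra_final[of "\<lambda>n x. map x [0..<n]" seqM]])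
  then show ?thesis by (simp add: listM_def)
qed

lemma measurable_list_of_seq: "(\<lambda>x. map x [0..<n]) \<in> seqM n \<rightarrow>\<^sub>M listM"
  by (rule measurableI) (auto simp: sets_listM)

lemma measurable_from_listM:
  assumes "\<And>n. (\<lambda>x. f (map x [0..<n])) \<in> seqM n \<rightarrow>\<^sub>M N"
  shows "f \<in> listM \<rightarrow>\<^sub>M N"
proof (rule measurableI)
  fix b assume "b \<in> space listM"
  define x where "x = (\<lambda>i\<in>{..<length b}. b ! i)"
  have "x \<in> space (seqM (length b))" by (auto simp: x_def space_PiM)
  then have "f (map x [0..<length b]) \<in> space N" using measurable_space[OF assms] by blast
  moreover have "map x [0..<length b] = b" by (rule nth_equalityI) (auto simp: x_def)
  ultimately show "f b \<in> space N" by simp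
next
  fix A assume A: "A \<in> sets N"
  have "(\<lambda>x. map x [0..<n]) -` (f -` A \<inter> space listM) \<inter> space (seqM n) = (\<lambda>x. f (map x [0..<n])) -` A \<inter> space (seqM n)" for n
    by auto
  then show "f -` A \<inter> space listM \<in> sets listM"
    unfolding sets_listM using measurable_sets[OF assms A] by simp
qed

lemma measurable_to_listM:
  assumes "\<And>i. i \<in> set is \<Longrightarrow> X i \<in> borel_measurable M"
  shows "(\<lambda>\<omega>. map (\<lambda>i. X i \<omega>) is) \<in> M \<rightarrow>\<^sub>M listM"
proof -
  have "(\<lambda>\<omega>. \<lambda>k\<in>{..<length is}. X (is ! k) \<omega>) \<in> M \<rightarrow>\<^sub>M seqM (length is)"
    by (intro measurable_restrict assms) auto
  then have "(\<lambda>\<omega>. map (\<lambda>k\<in>{..<length is}. X (is ! k) \<omega>) [0..<length is]) \<in> M \<rightarrow>\<^sub>M listM"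
    using measurable_compose[OF _ measurable_list_of_seq] by blast
  moreover have "map (\<lambda>k\<in>{..<length is}. X (is ! k) \<omega>) [0..<length is] = map (\<lambda>i. X i \<omega>) is" for \<omega>
    by (rule nth_equalityI) auto
  ultimately show ?thesis by simp
qed

lemma measurable_listM_rearrange:
  assumes "\<And>(x :: nat \<Rightarrow> real) n. f (map x [0..<n]) = map x (g n)" "\<And>n. set (g n) \<subseteq> {..<n}"
  shows "f \<in> listM \<rightarrow>\<^sub>M listM"
proof (rule measurable_from_listM)
  fix n
  have "(\<lambda>x. map (\<lambda>i. x i) (g n)) \<in> seqM n \<rightarrow>\<^sub>M listM"
    using assms(2)[of n] by (intro measurable_to_listM measurable_component_singleton) auto
  then show "(\<lambda>x. f (map x [0..<n])) \<in> seqM n \<rightarrow>\<^sub>M listM" by (simp add: assms(1))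
qed

lemma measurable_take_listM [measurable]: "take m \<in> listM \<rightarrow>\<^sub>M listM"
  by (rule measurable_listM_rearrange[where g = "\<lambda>n. take m [0..<n]"]) (auto simp: take_map dest: in_set_takeD)

lemma measurable_drop_listM [measurable]: "drop m \<in> listM \<rightarrow>\<^sub>M listM"
  by (rule measurable_listM_rearrange[where g = "\<lambda>n. drop m [0..<n]"]) (auto simp: drop_map dest: in_set_dropD)

lemma measurable_rotate_listM [measurable]: "rotate m \<in> listM \<rightarrow>\<^sub>M listM"
  by (rule measurable_listM_rearrange[where g = "\<lambda>n. rotate m [0..<n]"]) (auto simp: rotate_map)

lemma measurable_length_listM [measurable]: "length \<in> listM \<rightarrow>\<^sub>M count_space UNIV"
  by (rule measurable_from_listM) simp

lemma measurable_sum_list_listM [measurable]: "sum_list \<in> borel_measurable listM"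
proof (rule measurable_from_listM)
  fix n
  have "(\<lambda>x. \<Sum>i<n. x i) \<in> borel_measurable (seqM n)"
    by (intro borel_measurable_sum measurable_component_singleton)
  then show "(\<lambda>x. sum_list (map x [0..<n])) \<in> borel_measurable (seqM n)"
    by (simp add: interv_sum_list_conv_sum_set_nat atLeast0LessThan)
qed

lemma measurable_mean_listM [measurable]: "mean \<in> borel_measurable listM"
  unfolding mean_def[abs_def] by measurable

lemma measurable_walk_listM [measurable]: "(\<lambda>b. walk b m) \<in> borel_measurable listM"
  unfolding walk_def by measurable

lemma measurable_good_listM [measurable]: "Measurable.pred listM good"
  unfolding good_iff[abs_def] by measurable

lemma measurable_irr_listM [measurable]: "Measurable.pred listM (irr y)"
proof -
  have "irr y = (\<lambda>e. length e \<noteq> 0 \<and> sum_list e = y * real (length e) \<and>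
     (\<forall>m. 0 < m \<and> m < length e \<longrightarrow> sum_list (take m e) < y * real m))"
    by (auto simp: irr_def fun_eq_iff)
  also have "Measurable.pred listM \<dots>" by measurable
  finally show ?thesis .
qed

lemma measurable_finite_set_fun:
  fixes P :: "nat \<Rightarrow> 'a \<Rightarrow> bool"
  assumes [measurable]: "\<And>m. Measurable.pred M (P m)" and fin: "\<And>x. x \<in> space M \<Longrightarrow> finite {m. P m x}"
  shows "(\<lambda>x. F {m. P m x}) \<in> M \<rightarrow>\<^sub>M count_space UNIV"
proof -
  let ?l = "\<lambda>x. sorted_list_of_set {m. P m x}"
  have "?l \<in> M \<rightarrow>\<^sub>M count_space UNIV"
  proof (subst measurable_count_space_eq2_countable, intro conjI ballI)
    show "?l \<in> space M \<rightarrow> UNIV" by auto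
    fix l :: "nat list"
    have "?l -` {l} \<inter> space M = {x\<in>space M. (sorted l \<and> distinct l) \<and> (\<forall>m. m \<in> set l \<longleftrightarrow> P m x)}"
    proof (intro set_eqI)
      fix x
      have "sorted_list_of_set {m. P m x} = l \<longleftrightarrow> sorted l \<and> distinct l \<and> set l = {m. P m x}" if "x \<in> space M"
        using fin[OF that] by (metis sorted_list_of_set.distinct_sorted_key_list_of_set sorted_list_of_set.idem_if_sorted_distinct sorted_list_of_set.set_sorted_key_list_of_set sorted_list_of_set.sorted_sorted_key_list_of_set)
      then show "x \<in> ?l -` {l} \<inter> space M \<longleftrightarrow> x \<in> {x\<in>space M. (sorted l \<and> distinct l) \<and> (\<forall>m. m \<in> set l \<longleftrightarrow> P m x)}"
        by auto
    qed
    also have "\<dots> \<in> sets M" by measurable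
    finally show "?l -` {l} \<inter> space M \<in> sets M" .
  qed
  then have "(\<lambda>x. (F \<circ> set) (?l x)) \<in> M \<rightarrow>\<^sub>M count_space UNIV"
    by (rule measurable_compose) simp
  moreover have "(F \<circ> set) (?l x) = F {m. P m x}" if "x \<in> space M" for x
    using fin[OF that] by simp
  ultimately show ?thesis by (simp cong: measurable_cong)
qed

lemma measurable_excs_listM [measurable]: "excs \<in> listM \<rightarrow>\<^sub>M count_space UNIV"
proof -
  have "(\<lambda>b. gaps {m. m \<le> length b \<and> walk b m = mean b * real m}) \<in> listM \<rightarrow>\<^sub>M count_space UNIV"
    by (rule measurable_finite_set_fun) auto
  then show ?thesis by (simp add: excs_def[abs_def] contacts_def)
qed

lemma measurable_nrot_listM [measurable]: "nrot \<in> listM \<rightarrow>\<^sub>M count_space UNIV"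
proof -
  have "(\<lambda>b. card {s. s < length b \<and> good (rotate s b)}) \<in> listM \<rightarrow>\<^sub>M count_space UNIV"
    by (rule measurable_finite_set_fun) auto
  then show ?thesis by (simp add: nrot_def[abs_def])
qed

text \<open>
  Lists of blocks are described by the block lengths, which are discrete, together with the
  concatenated list; this suggests the final sigma-algebra with respect to the splittings.
\<close>

definition segM :: "real list list measure" where
  "segM = sigma UNIV {A. \<forall>ns. (\<lambda>xs. split_blocks ns xs) -` A \<inter> space listM \<in> sets listM}"

lemma space_segM [simp]: "space segM = UNIV"
  by (simp add: segM_def)

lemma sets_segM: "A \<in> sets segM \<longleftrightarrow> (\<forall>ns. (\<lambda>xs. split_blocks ns xs) -` A \<in> sets listM)"
proof -
  have "sigma_sets UNIV {A. \<forall>ns. (\<lambda>xs. split_blocks ns xs) -` A \<inter> space listM \<in> sets listM} =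
      {A. \<forall>ns. (\<lambda>xs. split_blocks ns xs) -` A \<inter> space listM \<in> sets listM}"
    by (rule sigma_algebra.sigma_sets_eq[OF sigma_algebra_final[of "\<lambda>ns xs. split_blocks ns xs" "\<lambda>_. listM"]])
  then show ?thesis by (simp add: segM_def)
qed

lemma measurable_split_blocks [measurable]: "split_blocks ns \<in> listM \<rightarrow>\<^sub>M segM"
  by (rule measurableI) (auto simp: sets_segM)

lemma measurable_from_segM:
  assumes "\<And>ns. (\<lambda>xs. f (split_blocks ns xs)) \<in> listM \<rightarrow>\<^sub>M N"
  shows "f \<in> segM \<rightarrow>\<^sub>M N"
proof (rule measurableI)
  fix bs
  show "f bs \<in> space N"
    using measurable_space[OF assms, of "concat bs" "map length bs"] by (simp add: split_blocks_concat)
next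
  fix A assume A: "A \<in> sets N"
  have "(\<lambda>xs. split_blocks ns xs) -` (f -` A \<inter> space segM) = (\<lambda>xs. f (split_blocks ns xs)) -` A \<inter> space listM" for ns
    by auto
  then show "f -` A \<inter> space segM \<in> sets segM"
    unfolding sets_segM using measurable_sets[OF assms A] by simp
qed

lemma measurable_to_segM:
  assumes "\<And>i. i \<in> set (concat iss) \<Longrightarrow> X i \<in> borel_measurable M"
  shows "(\<lambda>\<omega>. map (map (\<lambda>i. X i \<omega>)) iss) \<in> M \<rightarrow>\<^sub>M segM"
proof -
  have "(\<lambda>\<omega>. split_blocks (map length iss) (map (\<lambda>i. X i \<omega>) (concat iss))) \<in> M \<rightarrow>\<^sub>M segM"
    by (rule measurable_compose[OF measurable_to_listM[OF assms] measurable_split_blocks])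
  moreover have "split_blocks (map length iss) (map (\<lambda>i. X i \<omega>) (concat iss)) = map (map (\<lambda>i. X i \<omega>)) iss" for \<omega>
    unfolding map_concat by (rule split_blocks_concat') (simp add: comp_def)
  ultimately show ?thesis by simp
qed

lemma measurable_countable2:
  fixes f :: "'a \<Rightarrow> 'b :: countable" and g :: "'a \<Rightarrow> 'c :: countable"
  assumes [measurable]: "f \<in> M \<rightarrow>\<^sub>M count_space UNIV" "g \<in> M \<rightarrow>\<^sub>M count_space UNIV"
  shows "(\<lambda>x. h (f x) (g x)) \<in> M \<rightarrow>\<^sub>M count_space UNIV"
proof -
  have "(\<lambda>x. h i (g x)) \<in> M \<rightarrow>\<^sub>M count_space UNIV" for i
    by (rule measurable_compose[OF assms(2)]) simp
  then show ?thesis by (rule measurable_compose_countable) (rule assms)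
qed

lemma measurable_map_segM:
  fixes F :: "real list \<Rightarrow> 'c :: countable"
  assumes [measurable]: "F \<in> listM \<rightarrow>\<^sub>M count_space UNIV"
  shows "map F \<in> segM \<rightarrow>\<^sub>M count_space UNIV"
proof (rule measurable_from_segM)
  fix ns
  show "(\<lambda>xs. map F (split_blocks ns xs)) \<in> listM \<rightarrow>\<^sub>M count_space UNIV"
  proof (induction ns)
    case (Cons n ns)
    have "(\<lambda>xs. F (take n xs) # map F (split_blocks ns (drop n xs))) \<in> listM \<rightarrow>\<^sub>M count_space UNIV"
      by (rule measurable_countable2) (use Cons in measurable)
    then show ?case by simp
  qed simp
qed

lemma nth_split_blocks:
  "i < length ns \<Longrightarrow> split_blocks ns xs ! i = take (ns ! i) (drop (sum_list (take i ns)) xs)"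
proof (induction ns arbitrary: i xs)
  case (Cons n ns)
  then show ?case by (cases i) (auto simp: add.commute)
qed simp

lemma measurable_nth_split_blocks:
  assumes "i < length ns"
  shows "(\<lambda>xs. split_blocks ns xs ! i) \<in> listM \<rightarrow>\<^sub>M listM"
  unfolding nth_split_blocks[OF assms] by measurable

lemma measurable_length_segM [measurable]: "length \<in> segM \<rightarrow>\<^sub>M count_space UNIV"
  by (rule measurable_from_segM) simp

lemma measurable_concat_segM [measurable]: "concat \<in> segM \<rightarrow>\<^sub>M listM"
proof (rule measurable_from_segM)
  fix ns
  have "concat (split_blocks ns xs) = take (sum_list ns) xs" for xs :: "real list"
    by (induction ns arbitrary: xs) (auto simp: take_add)
  then show "(\<lambda>xs. concat (split_blocks ns xs)) \<in> listM \<rightarrow>\<^sub>M listM" by simp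
qed

text \<open>
  Sorting and grouping blocks depends on their means only through comparisons. The table of
  comparisons is discrete, which makes everything that it determines measurable.
\<close>

definition mean_pattern :: "real list list \<Rightarrow> bool list list" where
  "mean_pattern bs = map (\<lambda>i. map (\<lambda>j. mean (bs ! i) \<le> mean (bs ! j)) [0..<length bs]) [0..<length bs]"

lemma measurable_map_const:
  fixes f :: "'i \<Rightarrow> 'a \<Rightarrow> 'c :: countable"
  assumes "\<And>i. i \<in> set is \<Longrightarrow> f i \<in> M \<rightarrow>\<^sub>M count_space UNIV"
  shows "(\<lambda>x. map (\<lambda>i. f i x) is) \<in> M \<rightarrow>\<^sub>M count_space UNIV"
  using assms
proof (induction "is")
  case (Cons i js)
  then have "(\<lambda>x. f i x # map (\<lambda>i. f i x) js) \<in> M \<rightarrow>\<^sub>M count_space UNIV"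
    using measurable_countable2[of "f i" M "\<lambda>x. map (\<lambda>i. f i x) js" "(#)"] by auto
  then show ?case by simp
qed simp

lemma measurable_mean_pattern: "mean_pattern \<in> segM \<rightarrow>\<^sub>M count_space UNIV"
proof (rule measurable_from_segM)
  fix ns
  note [measurable] = measurable_nth_split_blocks
  have "(\<lambda>xs. map (\<lambda>i. map (\<lambda>j. mean (split_blocks ns xs ! i) \<le> mean (split_blocks ns xs ! j)) [0..<length ns]) [0..<length ns])
     \<in> listM \<rightarrow>\<^sub>M count_space UNIV"
    by (rule measurable_map_const, rule measurable_map_const) auto
  then show "(\<lambda>xs. mean_pattern (split_blocks ns xs)) \<in> listM \<rightarrow>\<^sub>M count_space UNIV"
    by (simp add: mean_pattern_def)
qed

lemma measurable_determined:
  fixes D :: "'a \<Rightarrow> 'd"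
  assumes D: "D \<in> M \<rightarrow>\<^sub>M count_space UNIV" and f: "\<And>x y. D x = D y \<Longrightarrow> f x = f y"
  shows "f \<in> M \<rightarrow>\<^sub>M count_space UNIV"
proof -
  have "f = (\<lambda>x. f (SOME y. D y = D x))" using f by (metis (mono_tags, lifting) someI_ex)
  moreover have "(\<lambda>x. (\<lambda>d. f (SOME y. D y = d)) (D x)) \<in> M \<rightarrow>\<^sub>M count_space UNIV"
    by (rule measurable_compose[OF D]) simp
  ultimately show ?thesis by simp
qed

lemma mean_pattern_eqD:
  assumes "mean_pattern bs = mean_pattern cs"
  shows "length bs = length cs"
    and "i < length bs \<Longrightarrow> j < length bs \<Longrightarrow> mean (bs ! i) \<le> mean (bs ! j) \<longleftrightarrow> mean (cs ! i) \<le> mean (cs ! j)"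
proof -
  show l: "length bs = length cs" using arg_cong[OF assms, of length] by (simp add: mean_pattern_def)
  assume "i < length bs" "j < length bs"
  then show "mean (bs ! i) \<le> mean (bs ! j) \<longleftrightarrow> mean (cs ! i) \<le> mean (cs ! j)"
    using arg_cong[OF assms, of "\<lambda>m. m ! i ! j"] l by (simp add: mean_pattern_def)
qed

lemma list_all2_takeWhile_dropWhile:
  assumes "list_all2 (\<lambda>b c. P b \<longleftrightarrow> Q c) bs cs"
  shows "length (takeWhile P bs) = length (takeWhile Q cs)"
  using assms by (induction rule: list_all2_induct) auto

lemma groups_lengths_cong:
  assumes "length bs = length cs"
    "\<And>i j. i < length bs \<Longrightarrow> j < length bs \<Longrightarrow> mean (bs ! i) = mean (bs ! j) \<longleftrightarrow> mean (cs ! i) = mean (cs ! j)"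
  shows "map length (groups bs) = map length (groups cs)"
  using assms
proof (induction bs arbitrary: cs rule: groups.induct)
  case (2 b bs)
  then obtain c cs' where cs: "cs = c # cs'" by (cases cs) auto
  let ?P = "\<lambda>d. mean d = mean b" and ?Q = "\<lambda>d. mean d = mean c"
  have len: "length bs = length cs'" using 2 cs by simp
  have eq: "mean (bs ! i) = mean b \<longleftrightarrow> mean (cs' ! i) = mean c" if "i < length bs" for i
    using 2(3)[of "Suc i" 0] that cs by simp
  have t: "length (takeWhile ?P bs) = length (takeWhile ?Q cs')"
    using eq len by (intro list_all2_takeWhile_dropWhile) (auto simp: list_all2_conv_all_nth)
  have d: "dropWhile ?P bs = drop (length (takeWhile ?P bs)) bs" "dropWhile ?Q cs' = drop (length (takeWhile ?P bs)) cs'"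
    by (simp_all add: dropWhile_eq_drop t)
  have "map length (groups (dropWhile ?P bs)) = map length (groups (dropWhile ?Q cs'))"
  proof (rule 2(1))
    show "length (dropWhile ?P bs) = length (dropWhile ?Q cs')" unfolding d using len by simp
    fix i j assume "i < length (dropWhile ?P bs)" "j < length (dropWhile ?P bs)"
    then show "mean (dropWhile ?P bs ! i) = mean (dropWhile ?P bs ! j) \<longleftrightarrow>
        mean (dropWhile ?Q cs' ! i) = mean (dropWhile ?Q cs' ! j)"
      unfolding d using len cs
        2(3)[of "Suc (length (takeWhile ?P bs) + i)" "Suc (length (takeWhile ?P bs) + j)"] by simp
  qed
  then show ?case using cs t by simp
qed simp

lemma groups_split: "groups bs = split_blocks (map length (groups bs)) bs"
  using split_blocks_concat[of "groups bs"] by simp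

lemma split_blocks_map: "split_blocks ns (map f xs) = map (map f) (split_blocks ns xs)"
  by (induction ns arbitrary: xs) (auto simp: take_map drop_map)

lemma measurable_face_shape [measurable]: "face_shape \<in> segM \<rightarrow>\<^sub>M count_space UNIV"
proof (rule measurable_determined)
  show "(\<lambda>bs. (map excs bs, mean_pattern bs)) \<in> segM \<rightarrow>\<^sub>M count_space UNIV"
    by (rule measurable_countable2[OF measurable_map_segM measurable_mean_pattern]) simp
  fix bs cs assume eq: "(map excs bs, mean_pattern bs) = (map excs cs, mean_pattern cs)"
  then have "mean_pattern bs = mean_pattern cs" by simp
  note p = mean_pattern_eqD[OF this]
  have g: "map length (groups bs) = map length (groups cs)"
    using p by (intro groups_lengths_cong) (auto intro: antisym simp: order_eq_iff)
  have "face_shape bs = split_blocks (map length (groups bs)) (map excs bs)" for bs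
    unfolding face_shape_def split_blocks_map by (subst groups_split) simp
  then show "face_shape bs = face_shape cs" using eq g by simp
qed

lemma measurable_valid [measurable]: "Measurable.pred segM valid"
proof -
  have 1: "(\<lambda>bs. (map (\<lambda>b. length b \<noteq> 0 \<and> good b) bs, mean_pattern bs)) \<in> segM \<rightarrow>\<^sub>M count_space UNIV"
    by (rule measurable_countable2[OF measurable_map_segM measurable_mean_pattern]) measurable
  show ?thesis
  proof (rule measurable_determined[OF 1])
    fix bs cs :: "real list list"
    assume eq: "(map (\<lambda>b. length b \<noteq> 0 \<and> good b) bs, mean_pattern bs) = (map (\<lambda>b. length b \<noteq> 0 \<and> good b) cs, mean_pattern cs)"
    then have "mean_pattern bs = mean_pattern cs" by simp
    note p = mean_pattern_eqD[OF this]
    have v: "valid bs \<longleftrightarrow> list_all id (map (\<lambda>b. length b \<noteq> 0 \<and> good b) bs) \<and>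
       (\<forall>i<length bs. \<forall>j<length bs. i < j \<longrightarrow> mean (bs ! j) \<le> mean (bs ! i))" for bs
      by (auto simp: valid_def list_all_iff sorted_wrt_iff_nth_less)
    show "valid bs = valid cs" unfolding v using eq p by auto
  qed
qed

section \<open>Independent and identically distributed increments\<close>

locale iid_sequence = prob_space M
  for M :: "'w measure" +
  fixes X :: "nat \<Rightarrow> 'w \<Rightarrow> real"
  assumes X_indep: "indep_vars (\<lambda>_. borel) X UNIV"
    and X_identical: "\<And>i. distr M borel (X i) = distr M borel (X 0)"
begin

lemma X_measurable [measurable]: "X i \<in> borel_measurable M"
  using X_indep by (auto simp: indep_vars_def)

definition Xs :: "'w \<Rightarrow> nat list \<Rightarrow> real list" where
  "Xs \<omega> is = map (\<lambda>i. X i \<omega>) is"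

text \<open>
  The expectation of a functional of the first \<open>n\<close> increments. By exchangeability
  any other \<open>n\<close> distinct increments would do.
\<close>

definition EE :: "nat \<Rightarrow> (real list \<Rightarrow> real) \<Rightarrow> real" where
  "EE n G = (\<integral>\<omega>. G (Xs \<omega> [0..<n]) \<partial>M)"

lemma measurable_Xs [measurable]: "(\<lambda>\<omega>. Xs \<omega> is) \<in> M \<rightarrow>\<^sub>M listM"
  unfolding Xs_def by (rule measurable_to_listM) simp

lemma length_Xs [simp]: "length (Xs \<omega> is) = length is"
  by (simp add: Xs_def)

abbreviation D :: "real measure" where "D \<equiv> distr M borel (X 0)"

lemma distr_Xs:
  assumes "distinct is"
  shows "distr M listM (\<lambda>\<omega>. Xs \<omega> is) = distr (Pi\<^sub>M {..<length is} (\<lambda>_. D)) listM (\<lambda>x. map x [0..<length is])"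
proof -
  have D: "prob_space D" by (rule prob_space_distr) simp
  let ?n = "length is"
  have P: "distr M (Pi\<^sub>M UNIV (\<lambda>_. borel)) (\<lambda>\<omega>. \<lambda>i\<in>UNIV. X i \<omega>) = Pi\<^sub>M UNIV (\<lambda>_. D)"
  proof -
    have i: "(\<lambda>i. distr M borel (X i)) = (\<lambda>_. D)" using X_identical by blast
    show ?thesis
      using X_indep indep_vars_iff_distr_eq_PiM'[where I = UNIV and M' = "\<lambda>_. borel" and X = X] unfolding i by auto
  qed
  have "distr (Pi\<^sub>M UNIV (\<lambda>_. D)) (Pi\<^sub>M {..<?n} (\<lambda>_. D)) (\<lambda>x. \<lambda>k\<in>{..<?n}. x (is ! k)) = Pi\<^sub>M {..<?n} (\<lambda>_. D)"
    using assms D by (intro distr_PiM_reindex) (auto simp: inj_on_def nth_eq_iff_index_eq)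
  moreover have "distr (Pi\<^sub>M UNIV (\<lambda>_. D)) (Pi\<^sub>M {..<?n} (\<lambda>_. D)) (\<lambda>x. \<lambda>k\<in>{..<?n}. x (is ! k)) =
      distr M (Pi\<^sub>M {..<?n} (\<lambda>_. D)) (\<lambda>\<omega>. \<lambda>k\<in>{..<?n}. X (is ! k) \<omega>)"
    unfolding P[symmetric]
  proof -
    have m1: "(\<lambda>\<omega>. \<lambda>i\<in>UNIV. X i \<omega>) \<in> M \<rightarrow>\<^sub>M Pi\<^sub>M UNIV (\<lambda>_. borel)"
      by (rule measurable_restrict) (rule X_measurable)
    have c: "(\<lambda>x. x (is ! k)) \<in> Pi\<^sub>M UNIV (\<lambda>_. borel) \<rightarrow>\<^sub>M D" for k
      unfolding measurable_distr_eq2 by (rule measurable_component_singleton) simp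
    have m2: "(\<lambda>x. \<lambda>k\<in>{..<?n}. x (is ! k)) \<in> Pi\<^sub>M UNIV (\<lambda>_. borel) \<rightarrow>\<^sub>M Pi\<^sub>M {..<?n} (\<lambda>_. D)"
      by (rule measurable_restrict) (rule c)
    have "(\<lambda>x. \<lambda>k\<in>{..<?n}. x (is ! k)) \<circ> (\<lambda>\<omega>. \<lambda>i\<in>UNIV. X i \<omega>) = (\<lambda>\<omega>. \<lambda>k\<in>{..<?n}. X (is ! k) \<omega>)"
      by (rule ext) (simp add: comp_def restrict_def)
    then show "distr (distr M (Pi\<^sub>M UNIV (\<lambda>_. borel)) (\<lambda>\<omega>. \<lambda>i\<in>UNIV. X i \<omega>)) (Pi\<^sub>M {..<?n} (\<lambda>_. D)) (\<lambda>x. \<lambda>k\<in>{..<?n}. x (is ! k)) =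
        distr M (Pi\<^sub>M {..<?n} (\<lambda>_. D)) (\<lambda>\<omega>. \<lambda>k\<in>{..<?n}. X (is ! k) \<omega>)"
      using distr_distr[OF m2 m1] by (simp only:)
  qed
  ultimately have e: "distr M (Pi\<^sub>M {..<?n} (\<lambda>_. D)) (\<lambda>\<omega>. \<lambda>k\<in>{..<?n}. X (is ! k) \<omega>) = Pi\<^sub>M {..<?n} (\<lambda>_. D)" by simp
  have s: "sets (Pi\<^sub>M {..<?n} (\<lambda>_. D)) = sets (seqM ?n)" by (intro sets_PiM_cong) auto
  have "distr (distr M (Pi\<^sub>M {..<?n} (\<lambda>_. D)) (\<lambda>\<omega>. \<lambda>k\<in>{..<?n}. X (is ! k) \<omega>)) listM (\<lambda>x. map x [0..<?n]) =
     distr M listM ((\<lambda>x. map x [0..<?n]) \<circ> (\<lambda>\<omega>. \<lambda>k\<in>{..<?n}. X (is ! k) \<omega>))"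
  proof (rule distr_distr)
    show "(\<lambda>x. map x [0..<?n]) \<in> Pi\<^sub>M {..<?n} (\<lambda>_. D) \<rightarrow>\<^sub>M listM"
      using measurable_list_of_seq[of ?n] s by (simp cong: measurable_cong_sets)
    show "(\<lambda>\<omega>. \<lambda>k\<in>{..<?n}. X (is ! k) \<omega>) \<in> M \<rightarrow>\<^sub>M Pi\<^sub>M {..<?n} (\<lambda>_. D)"
      by (rule measurable_restrict) simp
  qed
  also have "(\<lambda>x. map x [0..<?n]) \<circ> (\<lambda>\<omega>. \<lambda>k\<in>{..<?n}. X (is ! k) \<omega>) = (\<lambda>\<omega>. Xs \<omega> is)"
    by (auto simp: fun_eq_iff Xs_def intro!: nth_equalityI)
  finally show ?thesis unfolding e by simp
qed

lemma exchangeable: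
  assumes "distinct is" "length is = n" and [measurable]: "G \<in> borel_measurable listM"
  shows "(\<integral>\<omega>. G (Xs \<omega> is) \<partial>M) = EE n G"
proof -
  have "distr M listM (\<lambda>\<omega>. Xs \<omega> is) = distr M listM (\<lambda>\<omega>. Xs \<omega> [0..<n])"
    using distr_Xs[OF assms(1)] distr_Xs[of "[0..<n]"] assms(2) by simp
  then have "(\<integral>x. G x \<partial>distr M listM (\<lambda>\<omega>. Xs \<omega> is)) = (\<integral>x. G x \<partial>distr M listM (\<lambda>\<omega>. Xs \<omega> [0..<n]))" by simp
  then show ?thesis by (subst (asm) (1 2) integral_distr) (auto simp: EE_def)
qed

lemma integrable_Xs:
  assumes [measurable]: "G \<in> borel_measurable listM" and "\<And>b. length b = length is \<Longrightarrow> \<bar>G b\<bar> \<le> (c :: real)"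
  shows "integrable M (\<lambda>\<omega>. G (Xs \<omega> is))"
  by (rule integrable_const_bound[of _ c]) (use assms(2) in auto)

lemma EE_rearrange:
  assumes r: "\<And>(f :: nat \<Rightarrow> real) xs. length xs = n \<Longrightarrow> r (map f xs) = map f (r' xs)"
    and perm: "mset (r' [0..<n]) = mset [0..<n]"
    and [measurable]: "G \<in> borel_measurable listM"
  shows "EE n (\<lambda>xs. G (r xs)) = EE n G"
proof -
  have "EE n (\<lambda>xs. G (r xs)) = (\<integral>\<omega>. G (Xs \<omega> (r' [0..<n])) \<partial>M)"
    unfolding EE_def Xs_def by (simp add: r)
  also have "\<dots> = EE n G"
  proof (rule exchangeable)
    show "distinct (r' [0..<n])" using perm by (metis distinct_upt mset_eq_imp_distinct_iff)
    show "length (r' [0..<n]) = n" using perm by (metis length_upt minus_nat.diff_0 size_mset)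
  qed simp
  finally show ?thesis .
qed

lemma EE_append:
  assumes [measurable]: "F \<in> borel_measurable listM" "G \<in> borel_measurable listM"
    and F: "\<And>b. length b = a \<Longrightarrow> \<bar>F b\<bar> \<le> c" and G: "\<And>b. length b = d \<Longrightarrow> \<bar>G b\<bar> \<le> c'"
  shows "EE (a + d) (\<lambda>xs. F (take a xs) * G (drop a xs)) = EE a F * EE d G"
proof -
  have ind: "indep_var (Pi\<^sub>M {0..<a} (\<lambda>_. borel)) (\<lambda>\<omega>. \<lambda>i\<in>{0..<a}. X i \<omega>) (Pi\<^sub>M {a..<a + d} (\<lambda>_. borel)) (\<lambda>\<omega>. \<lambda>i\<in>{a..<a + d}. X i \<omega>)"
    by (rule indep_var_restrict[OF X_indep]) auto
  have m: "(\<lambda>x. H (map (\<lambda>i. x i) is)) \<in> borel_measurable (Pi\<^sub>M I (\<lambda>_. borel))"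
    if "set is \<subseteq> I" "H \<in> borel_measurable listM" for H :: "real list \<Rightarrow> real" and I :: "nat set" and "is"
  proof -
    have "(\<lambda>x. map (\<lambda>i. x i) is) \<in> Pi\<^sub>M I (\<lambda>_. borel) \<rightarrow>\<^sub>M listM"
      using that(1) by (intro measurable_to_listM measurable_component_singleton) auto
    from measurable_compose[OF this that(2)] show ?thesis .
  qed
  have e: "Xs \<omega> is = map (\<lambda>i. (\<lambda>i\<in>set is. X i \<omega>) i) is" for \<omega> "is"
    by (simp add: Xs_def)
  have "indep_var borel ((\<lambda>x. F (map (\<lambda>i. x i) [0..<a])) \<circ> (\<lambda>\<omega>. \<lambda>i\<in>{0..<a}. X i \<omega>))
      borel ((\<lambda>x. G (map (\<lambda>i. x i) [a..<a + d])) \<circ> (\<lambda>\<omega>. \<lambda>i\<in>{a..<a + d}. X i \<omega>))"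
    by (rule indep_var_compose[OF ind]) (auto intro!: m)
  then have iv: "indep_var borel (\<lambda>\<omega>. F (Xs \<omega> [0..<a])) borel (\<lambda>\<omega>. G (Xs \<omega> [a..<a + d]))"
    unfolding e by (simp add: comp_def)
  have "EE (a + d) (\<lambda>xs. F (take a xs) * G (drop a xs)) = (\<integral>\<omega>. F (Xs \<omega> [0..<a]) * G (Xs \<omega> [a..<a + d]) \<partial>M)"
    unfolding EE_def Xs_def by (simp add: take_map drop_map)
  also have "\<dots> = (\<integral>\<omega>. F (Xs \<omega> [0..<a]) \<partial>M) * (\<integral>\<omega>. G (Xs \<omega> [a..<a + d]) \<partial>M)"
    using F G by (intro indep_var_lebesgue_integral[OF iv] integrable_Xs) auto
  also have "(\<integral>\<omega>. G (Xs \<omega> [a..<a + d]) \<partial>M) = EE d G"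
    by (rule exchangeable) auto
  finally show ?thesis by (simp add: EE_def)
qed

end

section \<open>Orderings that sort the means\<close>

text \<open>The orderings of the blocks that the construction admits.\<close>

definition sorting :: "real list list \<Rightarrow> (nat \<Rightarrow> nat) set" where
  "sorting B = {\<tau>. \<tau> permutes {..<length B} \<and> sorted_wrt (\<ge>) (map mean (permute_list \<tau> B))}"

definition sort_average :: "(real list list \<Rightarrow> real) \<Rightarrow> real list list \<Rightarrow> real" where
  "sort_average \<Phi> B = (\<Sum>\<tau>\<in>sorting B. \<Phi> (permute_list \<tau> B)) / real (card (sorting B))"

text \<open>
  The stable sort is one particular admissible order; it serves as a canonical representative.
\<close>

abbreviation sort_means :: "real list list \<Rightarrow> real list list" where
  "sort_means \<equiv> sort_key (\<lambda>b. - mean b)"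

lemma finite_sorting [simp]: "finite (sorting B)"
  unfolding sorting_def by (rule finite_subset[OF _ finite_permutations[of "{..<length B}"]]) auto

lemma sort_key_map: "sort_key f (map g xs) = map g (sort_key (f \<circ> g) xs)"
proof (induction xs)
  case (Cons a xs)
  have "insort_key f (g a) (map g ys) = map g (insort_key (f \<circ> g) a ys)" for ys
    by (induction ys) auto
  then show ?case using Cons by (simp add: comp_def)
qed simp

lemma sort_key_cong: "(\<And>x. x \<in> set xs \<Longrightarrow> f x = g x) \<Longrightarrow> sort_key f xs = sort_key g xs"
proof (induction xs)
  case (Cons a xs)
  have "insort_key f a ys = insort_key g a ys" if "set ys \<subseteq> set xs" for ys
    using that Cons.prems by (induction ys) auto
  then show ?case using Cons by simp
qed simp

lemma sort_means_permutation:
  "\<exists>\<pi>. \<pi> permutes {..<length ks} \<and> (\<forall>bs. map mean bs = ks \<longrightarrow> permute_list \<pi> bs = sort_means bs)"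
proof -
  let ?k = "length ks"
  let ?il = "sort_key (\<lambda>i. - (ks ! i)) [0..<?k]"
  define \<pi> where "\<pi> = (\<lambda>i. if i < ?k then ?il ! i else i)"
  have il: "distinct ?il" "set ?il = {..<?k}" "length ?il = ?k" by auto
  have "bij_betw (\<lambda>i. ?il ! i) {..<?k} {..<?k}"
    using bij_betw_nth[OF il(1), of "{..<?k}" "{..<?k}"] il by simp
  then have "bij_betw \<pi> {..<?k} {..<?k}"
    by (rule bij_betw_cong[THEN iffD1, rotated]) (simp add: \<pi>_def)
  then have "\<pi> permutes {..<?k}" by (rule bij_imp_permutes) (simp add: \<pi>_def)
  moreover have "permute_list \<pi> bs = sort_means bs" if "map mean bs = ks" for bs
  proof -
    have k: "length bs = ?k" using that by auto
    have "permute_list \<pi> bs = map (\<lambda>i. bs ! (?il ! i)) [0..<?k]"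
      unfolding permute_list_def k by (rule map_cong) (auto simp: \<pi>_def)
    also have "\<dots> = map ((!) bs) (map ((!) ?il) [0..<length ?il])" using il by simp
    also have "\<dots> = map ((!) bs) ?il" by (simp only: map_nth)
    also have "?il = sort_key ((\<lambda>b. - mean b) \<circ> (!) bs) [0..<?k]"
      using that k by (intro sort_key_cong) auto
    also have "map ((!) bs) \<dots> = sort_means (map ((!) bs) [0..<length bs])"
      unfolding sort_key_map k ..
    finally show ?thesis by (simp only: map_nth)
  qed
  ultimately show ?thesis by blast
qed

lemma sorted_sort_means: "sorted_wrt (\<ge>) (map mean (sort_means bs))"
proof -
  have "sorted (map (\<lambda>b. - mean b) (sort_means bs))" by simp
  then show ?thesis by (simp add: sorted_wrt_map)
qed

lemma permute_list_permute_list: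
  "\<sigma> permutes {..<length B} \<Longrightarrow> permute_list \<sigma> (permute_list \<tau> B) = permute_list (\<tau> \<circ> \<sigma>) B"
  by (simp add: permute_list_compose)

lemma map_permute_list: "\<tau> permutes {..<length B} \<Longrightarrow> map f (permute_list \<tau> B) = permute_list \<tau> (map f B)"
  by (simp add: permute_list_map)

lemma sorting_nonempty: "sorting B \<noteq> {}"
proof -
  obtain \<pi> where "\<pi> permutes {..<length B}" "permute_list \<pi> B = sort_means B"
    using sort_means_permutation[of "map mean B"] by auto
  then have "\<pi> \<in> sorting B" using sorted_sort_means[of B] by (simp add: sorting_def)
  then show ?thesis by blast
qed

lemma card_sorting_pos: "card (sorting B) > 0"
  using sorting_nonempty by (simp add: card_gt_0_iff)

lemma sorting_cong: "map mean B = map mean C \<Longrightarrow> sorting B = sorting C"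
proof -
  assume eq: "map mean B = map mean C"
  then have "length B = length C" using map_eq_imp_length_eq by blast
  then show ?thesis unfolding sorting_def by (auto simp: map_permute_list eq)
qed

lemma bij_betw_compose_permutes:
  assumes "\<pi> permutes S"
  shows "bij_betw (\<lambda>\<tau>. \<pi> \<circ> \<tau>) {\<tau>. \<tau> permutes S} {\<tau>. \<tau> permutes S}"
proof (rule bij_betw_byWitness[where f' = "\<lambda>\<tau>. inv \<pi> \<circ> \<tau>"])
  show "\<forall>\<tau>\<in>{\<tau>. \<tau> permutes S}. inv \<pi> \<circ> (\<pi> \<circ> \<tau>) = \<tau>"
    using assms by (auto simp: fun_eq_iff permutes_inverses)
  show "\<forall>\<tau>\<in>{\<tau>. \<tau> permutes S}. \<pi> \<circ> (inv \<pi> \<circ> \<tau>) = \<tau>"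
    using assms by (auto simp: fun_eq_iff permutes_inverses)
qed (use assms permutes_inv in \<open>auto intro: permutes_compose\<close>)

lemma bij_betw_sorting_permute:
  assumes "\<pi> permutes {..<length B}"
  shows "bij_betw (\<lambda>\<tau>. \<pi> \<circ> \<tau>) (sorting (permute_list \<pi> B)) (sorting B)"
proof -
  have "\<tau> \<in> sorting (permute_list \<pi> B) \<longleftrightarrow> \<tau> permutes {..<length B} \<and> \<pi> \<circ> \<tau> \<in> sorting B"
    for \<tau>
    using assms permutes_compose[of \<tau> "{..<length B}" \<pi>]
    by (auto simp: sorting_def permute_list_permute_list)
  then have s: "sorting (permute_list \<pi> B) = {\<tau>\<in>{\<tau>. \<tau> permutes {..<length B}}. \<pi> \<circ> \<tau> \<in> sorting B}" by auto
  have b: "bij_betw (\<lambda>\<tau>. \<pi> \<circ> \<tau>) {\<tau>. \<tau> permutes {..<length B}} {\<tau>. \<tau> permutes {..<length B}}"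
    by (rule bij_betw_compose_permutes[OF assms])
  have sub: "sorting B \<subseteq> {\<tau>. \<tau> permutes {..<length B}}" by (auto simp: sorting_def)
  have "(\<lambda>\<tau>. \<pi> \<circ> \<tau>) ` sorting (permute_list \<pi> B) = sorting B"
  proof (intro equalityI subsetI)
    fix t assume "t \<in> sorting B"
    then have "t \<in> (\<lambda>\<tau>. \<pi> \<circ> \<tau>) ` {\<tau>. \<tau> permutes {..<length B}}" using b sub by (auto simp: bij_betw_def)
    then show "t \<in> (\<lambda>\<tau>. \<pi> \<circ> \<tau>) ` sorting (permute_list \<pi> B)" using \<open>t \<in> sorting B\<close> s by auto
  qed (auto simp: s)
  moreover have "inj_on (\<lambda>\<tau>. \<pi> \<circ> \<tau>) (sorting (permute_list \<pi> B))"
    using b s by (auto simp: bij_betw_def intro: inj_on_subset)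
  ultimately show ?thesis by (simp add: bij_betw_def)
qed

lemma sort_average_permute:
  assumes "\<pi> permutes {..<length B}"
  shows "sort_average \<Phi> (permute_list \<pi> B) = sort_average \<Phi> B"
proof -
  note b = bij_betw_sorting_permute[OF assms]
  have "(\<Sum>\<tau>\<in>sorting (permute_list \<pi> B). \<Phi> (permute_list \<tau> (permute_list \<pi> B))) =
     (\<Sum>\<tau>\<in>sorting (permute_list \<pi> B). \<Phi> (permute_list (\<pi> \<circ> \<tau>) B))"
    by (rule sum.cong) (auto simp: sorting_def permute_list_permute_list)
  also have "\<dots> = (\<Sum>\<tau>\<in>sorting B. \<Phi> (permute_list \<tau> B))"
    by (rule sum.reindex_bij_betw[OF b, of "\<lambda>\<tau>. \<Phi> (permute_list \<tau> B)"])
  finally show ?thesis using bij_betw_same_card[OF b] by (simp add: sort_average_def)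
qed

text \<open>
  Sort a uniformly random order of the blocks. Orders that agree up to permuting blocks of equal
  mean form a coset of the stabiliser \<open>H\<close> of the list of means, and sorting maps
  each coset bijectively onto the set of all admissible orders. So for functionals that are
  unchanged by sorting, the uniform admissible order may be replaced by a uniform order.
\<close>

lemma sort_average_insensitive:
  assumes ins: "\<And>bs. \<Phi> (sort_means bs) = \<Phi> bs"
  shows "sort_average \<Phi> B = (\<Sum>\<tau> | \<tau> permutes {..<length B}. \<Phi> (permute_list \<tau> B)) / fact (length B)"
proof -
  let ?k = "length B"
  let ?S = "{\<tau>. \<tau> permutes {..<?k}}"
  let ?ks = "map mean B"
  \<comment> \<open>The stabiliser of the list of means.\<close>
  define H where "H = {\<rho>. \<rho> permutes {..<?k} \<and> permute_list \<rho> ?ks = ?ks}"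
  have HS: "H \<subseteq> ?S" by (auto simp: H_def)
  have key: "\<exists>f. bij_betw f H (sorting B) \<and> (\<forall>\<rho>\<in>H. \<Phi> (permute_list (\<rho> \<circ> \<tau>) B) = \<Phi> (permute_list (f \<rho>) B))"
    if t: "\<tau> permutes {..<?k}" for \<tau>
  proof -
    have means: "map mean (permute_list (\<rho> \<circ> \<tau>) B) = permute_list \<tau> ?ks" if "\<rho> \<in> H" for \<rho>
    proof -
      have r: "\<rho> permutes {..<?k}" "permute_list \<rho> ?ks = ?ks" using that by (auto simp: H_def)
      have "map mean (permute_list (\<rho> \<circ> \<tau>) B) = permute_list (\<rho> \<circ> \<tau>) ?ks"
        using r t permutes_compose[OF t r(1)] by (simp add: map_permute_list)
      also have "\<dots> = permute_list \<tau> (permute_list \<rho> ?ks)" using t by (simp add: permute_list_compose)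
      finally show ?thesis using r by simp
    qed
    obtain \<pi> where p: "\<pi> permutes {..<?k}" "\<And>bs. map mean bs = permute_list \<tau> ?ks \<Longrightarrow> permute_list \<pi> bs = sort_means bs"
      using sort_means_permutation[of "permute_list \<tau> ?ks"] by auto
    define g where "g = \<tau> \<circ> \<pi>"
    have g: "g permutes {..<?k}" unfolding g_def using t p by (intro permutes_compose)
    have sg: "permute_list (\<rho> \<circ> g) B = sort_means (permute_list (\<rho> \<circ> \<tau>) B)" if "\<rho> \<in> H" for \<rho>
    proof -
      have "permute_list \<pi> (permute_list (\<rho> \<circ> \<tau>) B) = permute_list (\<rho> \<circ> \<tau> \<circ> \<pi>) B"
        using p by (simp add: permute_list_permute_list)
      then show ?thesis using p(2)[OF means[OF that]] by (simp add: g_def comp_assoc)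
    qed
    have idH: "id \<in> H" by (simp add: H_def permutes_id)
    have srt: "sorted_wrt (\<ge>) (permute_list g ?ks)"
      using sorted_sort_means sg[OF idH] g by (metis comp_id id_comp map_permute_list)
    have "bij_betw (\<lambda>\<rho>. \<rho> \<circ> g) H (sorting B)"
    proof (rule bij_betw_byWitness[where f' = "\<lambda>\<sigma>. \<sigma> \<circ> inv g"])
      show "\<forall>\<rho>\<in>H. \<rho> \<circ> g \<circ> inv g = \<rho>" using g by (auto simp: fun_eq_iff permutes_inverses)
      show "\<forall>\<sigma>\<in>sorting B. \<sigma> \<circ> inv g \<circ> g = \<sigma>" using g by (auto simp: fun_eq_iff permutes_inverses)
      show "(\<lambda>\<rho>. \<rho> \<circ> g) ` H \<subseteq> sorting B"
      proof clarify
        fix \<rho> assume r: "\<rho> \<in> H"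
        have "\<rho> \<circ> g permutes {..<?k}" using r g by (auto simp: H_def intro: permutes_compose)
        then show "\<rho> \<circ> g \<in> sorting B" using sg[OF r] sorted_sort_means by (simp add: sorting_def)
      qed
      show "(\<lambda>\<sigma>. \<sigma> \<circ> inv g) ` sorting B \<subseteq> H"
      proof clarify
        fix \<sigma> assume "\<sigma> \<in> sorting B"
        then have s: "\<sigma> permutes {..<?k}" "sorted_wrt (\<ge>) (permute_list \<sigma> ?ks)"
          by (auto simp: sorting_def map_permute_list)
        have "mset (permute_list \<sigma> ?ks) = mset (permute_list g ?ks)" using s g by (simp add: mset_permute_list)
        then have "permute_list \<sigma> ?ks = permute_list g ?ks"
        proof -
          have "sorted (rev (permute_list \<sigma> ?ks))" "sorted (rev (permute_list g ?ks))"
            using s(2) srt by (simp_all add: sorted_wrt_rev)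
          then have "rev (permute_list \<sigma> ?ks) = rev (permute_list g ?ks)"
            using \<open>mset (permute_list \<sigma> ?ks) = _\<close> by (metis mset_rev properties_for_sort)
          then show ?thesis by simp
        qed
        then have "permute_list (inv g) (permute_list \<sigma> ?ks) = permute_list (inv g) (permute_list g ?ks)" by simp
        then have "permute_list (\<sigma> \<circ> inv g) ?ks = permute_list (g \<circ> inv g) ?ks"
          using permutes_inv[OF g] by (simp add: permute_list_compose)
        also have "g \<circ> inv g = id" using g by (auto simp: fun_eq_iff permutes_inverses)
        finally have "permute_list (\<sigma> \<circ> inv g) ?ks = ?ks" by (simp only: permute_list_id)
        then show "\<sigma> \<circ> inv g \<in> H"
          unfolding H_def mem_Collect_eq using permutes_compose[OF permutes_inv[OF g] s(1)] by blast
      qed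
    qed
    then show ?thesis using sg ins by (intro exI[of _ "\<lambda>\<rho>. \<rho> \<circ> g"]) auto
  qed
  have cardH: "card H = card (sorting B)"
    using key[OF permutes_id] bij_betw_same_card by blast
  have row: "(\<Sum>\<rho>\<in>H. \<Phi> (permute_list (\<rho> \<circ> \<tau>) B)) = (\<Sum>\<sigma>\<in>sorting B. \<Phi> (permute_list \<sigma> B))"
    if t: "\<tau> permutes {..<?k}" for \<tau>
  proof -
    obtain f where f: "bij_betw f H (sorting B)" "\<And>\<rho>. \<rho> \<in> H \<Longrightarrow> \<Phi> (permute_list (\<rho> \<circ> \<tau>) B) = \<Phi> (permute_list (f \<rho>) B)"
      using key[OF t] by blast
    have "(\<Sum>\<rho>\<in>H. \<Phi> (permute_list (\<rho> \<circ> \<tau>) B)) = (\<Sum>\<rho>\<in>H. \<Phi> (permute_list (f \<rho>) B))" using f(2) by (rule sum.cong[OF refl])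
    also have "\<dots> = (\<Sum>\<sigma>\<in>sorting B. \<Phi> (permute_list \<sigma> B))"
      by (rule sum.reindex_bij_betw[OF f(1), of "\<lambda>\<sigma>. \<Phi> (permute_list \<sigma> B)"])
    finally show ?thesis .
  qed
  have col: "(\<Sum>\<tau>\<in>?S. \<Phi> (permute_list (\<rho> \<circ> \<tau>) B)) = (\<Sum>\<tau>\<in>?S. \<Phi> (permute_list \<tau> B))" if "\<rho> \<in> H" for \<rho>
    using that HS by (intro sum.reindex_bij_betw[OF bij_betw_compose_permutes, of \<rho> "{..<?k}" "\<lambda>\<tau>. \<Phi> (permute_list \<tau> B)"]) auto
  have "real (card H) * (\<Sum>\<tau>\<in>?S. \<Phi> (permute_list \<tau> B)) = (\<Sum>\<rho>\<in>H. \<Sum>\<tau>\<in>?S. \<Phi> (permute_list (\<rho> \<circ> \<tau>) B))"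
    using col by simp
  also have "\<dots> = (\<Sum>\<tau>\<in>?S. \<Sum>\<rho>\<in>H. \<Phi> (permute_list (\<rho> \<circ> \<tau>) B))" by (rule sum.swap)
  also have "\<dots> = (\<Sum>\<tau>\<in>?S. \<Sum>\<sigma>\<in>sorting B. \<Phi> (permute_list \<sigma> B))" using row by simp
  also have "\<dots> = fact ?k * (\<Sum>\<sigma>\<in>sorting B. \<Phi> (permute_list \<sigma> B))"
    by (simp add: card_permutations)
  finally have eq: "real (card (sorting B)) * (\<Sum>\<tau>\<in>?S. \<Phi> (permute_list \<tau> B)) = fact ?k * (\<Sum>\<sigma>\<in>sorting B. \<Phi> (permute_list \<sigma> B))"
    unfolding cardH .
  have c: "real (card (sorting B)) \<noteq> 0" using card_sorting_pos[of B] by linarith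
  show ?thesis
    unfolding sort_average_def frac_eq_eq[OF c fact_nonzero] using eq by (metis mult.commute)
qed

section \<open>The average over admissible choices\<close>

text \<open>
  The probability that a good block is the result of a uniformly chosen good rotation of any of
  its rotations.
\<close>

definition block_weight :: "real list \<Rightarrow> real" where
  "block_weight b = (if good b then 1 / real (nrot b) else 0)"

definition weight :: "real list list \<Rightarrow> real" where
  "weight bs = (\<Prod>b\<leftarrow>bs. block_weight b)"

definition rotate_blocks :: "(nat \<Rightarrow> nat) \<Rightarrow> 'a list list \<Rightarrow> 'a list list" where
  "rotate_blocks \<sigma> B = map (\<lambda>i. rotate (\<sigma> i) (B ! i)) [0..<length B]"

lemma rearrange_conv:
  "\<tau> permutes {..<length ns} \<Longrightarrow> rearrange ns xs (\<tau>, \<sigma>) = permute_list \<tau> (rotate_blocks \<sigma> (split_blocks ns xs))"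
  unfolding rearrange_def permute_list_def rotate_blocks_def
  by (auto simp: permutes_in_image intro!: map_cong) (metis lessThan_iff permutes_in_image add.left_neutral nth_map_upt diff_zero)

lemma map_mean_rotate_blocks: "map mean (rotate_blocks \<sigma> B) = map mean B"
  by (rule nth_equalityI) (auto simp: rotate_blocks_def)

lemma length_rotate_blocks [simp]: "length (rotate_blocks \<sigma> B) = length B"
  by (simp add: rotate_blocks_def)

lemma sorting_rotate_blocks [simp]: "sorting (rotate_blocks \<sigma> B) = sorting B"
  by (rule sorting_cong) (rule map_mean_rotate_blocks)

text \<open>
  An admissible choice consists of independent choices of an ordering and of one good rotation
  for each block.
\<close>

lemma admissible_eq:
  "admissible ns xs = sorting (split_blocks ns xs) \<times>
     (\<Pi>\<^sub>E i\<in>{..<length ns}. {s. s < ns ! i \<and> good (rotate s (split_blocks ns xs ! i))})"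
proof -
  let ?B = "split_blocks ns xs"
  have "(\<tau>, \<sigma>) \<in> admissible ns xs \<longleftrightarrow> \<tau> \<in> sorting ?B \<and>
     \<sigma> \<in> (\<Pi>\<^sub>E i\<in>{..<length ns}. {s. s < ns ! i \<and> good (rotate s (?B ! i))})" for \<tau> \<sigma>
  proof (cases "\<tau> permutes {..<length ns}")
    case True
    have r: "rearrange ns xs (\<tau>, \<sigma>) = permute_list \<tau> (rotate_blocks \<sigma> ?B)" by (rule rearrange_conv[OF True])
    have "map mean (permute_list \<tau> (rotate_blocks \<sigma> ?B)) = map mean (permute_list \<tau> ?B)"
      using True by (simp add: map_permute_list map_mean_rotate_blocks)
    moreover have "set (permute_list \<tau> (rotate_blocks \<sigma> ?B)) = (\<lambda>i. rotate (\<sigma> i) (?B ! i)) ` {..<length ns}"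
      using True by (simp add: set_permute_list) (auto simp: rotate_blocks_def)
    ultimately show ?thesis using True
      unfolding admissible_def choices_def mem_Collect_eq r good_def[symmetric] sorting_def
      by (auto simp: PiE_iff extensional_def)
  next
    case False
    then show ?thesis by (auto simp: admissible_def choices_def sorting_def)
  qed
  then show ?thesis by (auto simp: set_eq_iff)
qed

lemma weight_rotate_blocks:
  "weight (rotate_blocks \<sigma> B) = (\<Prod>i<length B. if good (rotate (\<sigma> i) (B ! i)) then 1 / real (nrot (B ! i)) else 0)"
proof -
  have "weight (rotate_blocks \<sigma> B) = prod_list (map (\<lambda>i. block_weight (rotate (\<sigma> i) (B ! i))) [0..<length B])"
    by (simp add: weight_def rotate_blocks_def comp_def)
  also have "\<dots> = (\<Prod>i\<in>set [0..<length B]. block_weight (rotate (\<sigma> i) (B ! i)))"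
    by (rule prod.distinct_set_conv_list[symmetric]) simp
  finally show ?thesis unfolding block_weight_def nrot_rotate by (simp add: atLeast0LessThan)
qed

text \<open>
  The number of admissible choices is the number of sorting orders times the product of the
  numbers of good rotations; the latter is absorbed into the weights.
\<close>

lemma admissible_average:
  assumes ns: "0 \<notin> set ns" "sum_list ns = length xs"
  shows "(\<Sum>c\<in>admissible ns xs. \<Phi> (rearrange ns xs c)) / real (card (admissible ns xs)) =
    (\<Sum>\<sigma>\<in>(\<Pi>\<^sub>E i\<in>{..<length ns}. {..<ns ! i}).
        weight (rotate_blocks \<sigma> (split_blocks ns xs)) * sort_average \<Phi> (rotate_blocks \<sigma> (split_blocks ns xs)))"
proof -
  let ?B = "split_blocks ns xs"
  let ?k = "length ns"
  let ?G = "\<lambda>i. {s. s < ns ! i \<and> good (rotate s (?B ! i))}"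
  let ?P = "\<Pi>\<^sub>E i\<in>{..<?k}. ?G i" and ?Q = "\<Pi>\<^sub>E i\<in>{..<?k}. {..<ns ! i}"
  have len: "length (?B ! i) = ns ! i" if "i < ?k" for i
    using map_length_split_blocks[of ns xs] ns(2) that by (metis length_split_blocks nth_map order_refl)
  have cardG: "card (?G i) = nrot (?B ! i)" if "i < ?k" for i
    using len[OF that] by (simp add: nrot_def)
  have cardP: "card ?P = (\<Prod>i<?k. nrot (?B ! i))"
    using cardG by (simp add: card_PiE)
  have finQ: "finite ?Q" by (intro finite_PiE) auto
  have PQ: "?P \<subseteq> ?Q" by (intro PiE_mono) auto
  have w: "weight (rotate_blocks \<sigma> ?B) = (if \<sigma> \<in> ?P then 1 / real (card ?P) else 0)" if sQ: "\<sigma> \<in> ?Q" for \<sigma>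
  proof (cases "\<sigma> \<in> ?P")
    case True
    then have "weight (rotate_blocks \<sigma> ?B) = (\<Prod>i<?k. 1 / real (nrot (?B ! i)))"
      unfolding weight_rotate_blocks by (intro prod.cong) (auto simp: PiE_iff)
    then show ?thesis using True by (simp add: cardP prod_dividef)
  next
    case False
    then obtain i where "i < ?k" "\<not> good (rotate (\<sigma> i) (?B ! i))" using sQ by (auto simp: PiE_iff)
    then show ?thesis using False unfolding weight_rotate_blocks by (auto intro!: prod_zero)
  qed
  have "(\<Sum>c\<in>admissible ns xs. \<Phi> (rearrange ns xs c)) = (\<Sum>\<tau>\<in>sorting ?B. \<Sum>\<sigma>\<in>?P. \<Phi> (rearrange ns xs (\<tau>, \<sigma>)))"
    unfolding admissible_eq by (simp add: sum.cartesian_product)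
  also have "\<dots> = (\<Sum>\<sigma>\<in>?P. \<Sum>\<tau>\<in>sorting ?B. \<Phi> (rearrange ns xs (\<tau>, \<sigma>)))" by (rule sum.swap)
  also have "\<dots> = (\<Sum>\<sigma>\<in>?P. \<Sum>\<tau>\<in>sorting ?B. \<Phi> (permute_list \<tau> (rotate_blocks \<sigma> ?B)))"
    by (intro sum.cong refl) (auto simp: sorting_def rearrange_conv)
  also have "\<dots> = (\<Sum>\<sigma>\<in>?P. real (card (sorting ?B)) * sort_average \<Phi> (rotate_blocks \<sigma> ?B))"
    by (simp add: sort_average_def sorting_nonempty)
  finally have "(\<Sum>c\<in>admissible ns xs. \<Phi> (rearrange ns xs c)) / real (card (admissible ns xs)) =
     (\<Sum>\<sigma>\<in>?P. 1 / real (card ?P) * sort_average \<Phi> (rotate_blocks \<sigma> ?B))"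
    unfolding admissible_eq card_cartesian_product
    by (simp add: sum_distrib_left[symmetric] sum_divide_distrib[symmetric] sorting_nonempty)
  also have "\<dots> = (\<Sum>\<sigma>\<in>?P. weight (rotate_blocks \<sigma> ?B) * sort_average \<Phi> (rotate_blocks \<sigma> ?B))"
    using PQ w by (intro sum.cong) auto
  also have "\<dots> = (\<Sum>\<sigma>\<in>?Q. weight (rotate_blocks \<sigma> ?B) * sort_average \<Phi> (rotate_blocks \<sigma> ?B))"
    using PQ finQ w by (intro sum.mono_neutral_left) auto
  finally show ?thesis .
qed

lemma finite_choices: "finite (choices ns)"
  unfolding choices_def by (intro finite_cartesian_product finite_permutations finite_PiE) auto

lemma admissible_subset_choices: "admissible ns xs \<subseteq> choices ns"
  by (auto simp: admissible_def)

lemma admissible_valid: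
  assumes "c \<in> admissible ns xs" "0 \<notin> set ns" "sum_list ns = length xs"
  shows "valid (rearrange ns xs c)" "length (concat (rearrange ns xs c)) = length xs"
proof -
  obtain \<tau> \<sigma> where c: "c = (\<tau>, \<sigma>)" by (cases c)
  have t: "\<tau> permutes {..<length ns}" using assms(1) c by (auto simp: admissible_def choices_def)
  let ?B = "split_blocks ns xs"
  have r: "rearrange ns xs c = permute_list \<tau> (rotate_blocks \<sigma> ?B)" unfolding c by (rule rearrange_conv[OF t])
  have len: "map length (rotate_blocks \<sigma> ?B) = ns"
  proof (rule nth_equalityI)
    fix i assume "i < length (map length (rotate_blocks \<sigma> ?B))"
    then show "map length (rotate_blocks \<sigma> ?B) ! i = ns ! i"
      using map_length_split_blocks[of ns xs] assms(3)
      by (simp add: rotate_blocks_def) (metis length_split_blocks nth_map order_refl)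
  qed simp
  have "set (map length (rearrange ns xs c)) = set ns"
    unfolding r using t len by (simp add: map_permute_list)
  then have ne: "\<forall>b\<in>set (rearrange ns xs c). b \<noteq> []" using assms(2) by (metis imageI list.set_map list.size(3))
  then show "valid (rearrange ns xs c)"
    using assms(1) unfolding valid_def admissible_def good_def by blast
  have "length (concat (rearrange ns xs c)) = sum_list (map length (rearrange ns xs c))" by (simp add: length_concat)
  also have "\<dots> = sum_list ns"
    unfolding r using t len by (simp add: map_permute_list) (metis length_map length_rotate_blocks length_split_blocks mset_permute_list sum_mset_sum_list)
  finally show "length (concat (rearrange ns xs c)) = length xs" using assms by simp
qed

section \<open>Measurability of sorting, weights and admissible choices\<close>

lemma measurable_listM_segM:
  assumes "\<And>(x :: nat \<Rightarrow> real) n. f (map x [0..<n]) = map (map x) (g n)" "\<And>n. set (concat (g n)) \<subseteq> {..<n}"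
  shows "f \<in> listM \<rightarrow>\<^sub>M segM"
proof (rule measurable_from_listM)
  fix n
  have "(\<lambda>x. map (map (\<lambda>i. x i)) (g n)) \<in> seqM n \<rightarrow>\<^sub>M segM"
    using assms(2)[of n] by (intro measurable_to_segM measurable_component_singleton) auto
  then show "(\<lambda>x. f (map x [0..<n])) \<in> seqM n \<rightarrow>\<^sub>M segM" by (simp add: assms(1))
qed

lemma set_concat_split_blocks: "set (concat (split_blocks ns xs)) \<subseteq> set xs"
proof (induction ns arbitrary: xs)
  case (Cons n ns)
  then show ?case
    unfolding split_blocks.simps concat.simps set_append
    using set_take_subset[of n xs] set_drop_subset[of n xs] by (meson Un_least order_trans)
qed simp

lemma permute_split_blocks_map:
  assumes "\<tau> permutes {..<length ns}"
  shows "permute_list \<tau> (split_blocks ns (map f xs)) = map (map f) (permute_list \<tau> (split_blocks ns xs))"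
  using assms by (simp add: split_blocks_map map_permute_list)

lemma rotate_split_blocks_map:
  "rotate_blocks \<sigma> (split_blocks ns (map f xs)) = map (map f) (rotate_blocks \<sigma> (split_blocks ns xs))"
  by (simp add: split_blocks_map rotate_blocks_def rotate_map)

lemma mset_rotate_list: "mset (rotate n xs) = mset xs"
  unfolding rotate_drop_take by (metis append_take_drop_id mset_append union_commute)

lemma mset_concat_permute_list:
  assumes "\<tau> permutes {..<length B}"
  shows "mset (concat (permute_list \<tau> B)) = mset (concat B)"
proof -
  have "mset (concat C) = sum_mset (image_mset mset (mset C))" for C :: "'a list list"
    by (metis mset_concat mset_map sum_mset_sum_list)
  then show ?thesis using assms by (simp add: mset_permute_list)
qed

lemma mset_concat_rotate_blocks: "mset (concat (rotate_blocks \<sigma> B)) = mset (concat B)"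
proof -
  have "map mset (rotate_blocks \<sigma> B) = map mset B"
    by (rule nth_equalityI) (auto simp: rotate_blocks_def mset_rotate_list)
  then show ?thesis by (simp add: mset_concat)
qed

lemma set_concat_eqI: "mset (concat A) = mset (concat B) \<Longrightarrow> set (concat A) = set (concat B)"
  by (metis set_mset_mset)

lemma measurable_permute_split_blocks:
  assumes "\<tau> permutes {..<length ns}"
  shows "(\<lambda>xs. permute_list \<tau> (split_blocks ns xs)) \<in> listM \<rightarrow>\<^sub>M segM"
proof (rule measurable_listM_segM[where g = "\<lambda>n. permute_list \<tau> (split_blocks ns [0..<n])"])
  fix n
  have "set (concat (permute_list \<tau> (split_blocks ns [0..<n]))) = set (concat (split_blocks ns [0..<n]))"
    using assms by (intro set_concat_eqI mset_concat_permute_list) simp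
  then show "set (concat (permute_list \<tau> (split_blocks ns [0..<n]))) \<subseteq> {..<n}"
    using set_concat_split_blocks[of ns "[0..<n]"] by auto
qed (rule permute_split_blocks_map[OF assms])

lemma measurable_rotate_split_blocks:
  "(\<lambda>xs. rotate_blocks \<sigma> (split_blocks ns xs)) \<in> listM \<rightarrow>\<^sub>M segM"
proof (rule measurable_listM_segM[where g = "\<lambda>n. rotate_blocks \<sigma> (split_blocks ns [0..<n])"])
  fix n
  have "set (concat (rotate_blocks \<sigma> (split_blocks ns [0..<n]))) = set (concat (split_blocks ns [0..<n]))"
    by (intro set_concat_eqI mset_concat_rotate_blocks)
  then show "set (concat (rotate_blocks \<sigma> (split_blocks ns [0..<n]))) \<subseteq> {..<n}"
    using set_concat_split_blocks[of ns "[0..<n]"] by auto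
qed (rule rotate_split_blocks_map)

lemma sorting_mean_pattern:
  assumes "mean_pattern bs = mean_pattern cs"
  shows "sorting bs = sorting cs"
proof -
  note p = mean_pattern_eqD[OF assms]
  have "sorted_wrt (\<ge>) (map mean (permute_list \<tau> bs)) \<longleftrightarrow>
      (\<forall>i<length bs. \<forall>j<length bs. i < j \<longrightarrow> mean (bs ! \<tau> j) \<le> mean (bs ! \<tau> i))"
    if "\<tau> permutes {..<length bs}" for \<tau> and bs :: "real list list"
    using that unfolding sorted_wrt_iff_nth_less by (auto simp: permute_list_nth)
  moreover have "\<tau> i < length bs" if "\<tau> permutes {..<length bs}" "i < length bs" for \<tau> i
    using that by (metis lessThan_iff permutes_in_image)
  ultimately show "sorting bs = sorting cs"
    unfolding sorting_def using p by (intro Collect_cong conj_cong) auto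
qed

lemma measurable_sorting: "sorting \<in> segM \<rightarrow>\<^sub>M count_space UNIV"
  by (rule measurable_determined[OF measurable_mean_pattern]) (rule sorting_mean_pattern)

lemma measurable_fun_sorting: "(\<lambda>xs. F (sorting xs) :: real) \<in> borel_measurable segM"
  by (rule measurable_compose[OF measurable_sorting]) simp

lemma measurable_block_weight [measurable]: "block_weight \<in> borel_measurable listM"
proof -
  have "(\<lambda>b. real (nrot b)) \<in> borel_measurable listM" by measurable
  then show ?thesis unfolding block_weight_def[abs_def] by measurable
qed

lemma measurable_weight [measurable]: "weight \<in> borel_measurable segM"
proof (rule measurable_from_segM)
  fix ns
  show "(\<lambda>xs. weight (split_blocks ns xs)) \<in> borel_measurable listM"
  proof (induction ns)
    case (Cons n ns)
    then have [measurable]: "(\<lambda>xs. weight (split_blocks ns xs)) \<in> borel_measurable listM" .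
    have "(\<lambda>xs. block_weight (take n xs) * weight (split_blocks ns (drop n xs))) \<in> borel_measurable listM"
      by measurable
    then show ?case by (simp add: weight_def)
  qed (simp add: weight_def)
qed

lemma sort_average_alt:
  "sort_average \<Phi> B = (\<Sum>\<tau> | \<tau> permutes {..<length B}. of_bool (\<tau> \<in> sorting B) * \<Phi> (permute_list \<tau> B)) / real (card (sorting B))"
proof -
  have "(\<Sum>\<tau> | \<tau> permutes {..<length B}. of_bool (\<tau> \<in> sorting B) * \<Phi> (permute_list \<tau> B)) = (\<Sum>\<tau>\<in>sorting B. \<Phi> (permute_list \<tau> B))"
    by (rule sum.mono_neutral_cong_right) (auto simp: sorting_def intro: finite_permutations)
  then show ?thesis by (simp add: sort_average_def)
qed

lemma measurable_sort_average [measurable]: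
  assumes [measurable]: "\<Phi> \<in> borel_measurable segM"
  shows "sort_average \<Phi> \<in> borel_measurable segM"
proof (rule measurable_from_segM)
  fix ns
  have 1: "(\<lambda>xs. F (sorting (split_blocks ns xs)) :: real) \<in> borel_measurable listM" for F
    using measurable_compose[OF measurable_split_blocks measurable_fun_sorting] .
  have [measurable]: "(\<lambda>xs. of_bool (\<tau> \<in> sorting (split_blocks ns xs)) :: real) \<in> borel_measurable listM" for \<tau>
    using 1[of "\<lambda>S. of_bool (\<tau> \<in> S)"] .
  have [measurable]: "(\<lambda>xs. real (card (sorting (split_blocks ns xs)))) \<in> borel_measurable listM"
    using 1[of "\<lambda>S. real (card S)"] .
  have 2: "(\<lambda>xs. \<Phi> (permute_list \<tau> (split_blocks ns xs))) \<in> borel_measurable listM" if "\<tau> permutes {..<length ns}" for \<tau>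
    using measurable_compose[OF measurable_permute_split_blocks[OF that] assms] .
  have "(\<lambda>xs. (\<Sum>\<tau> | \<tau> permutes {..<length ns}. of_bool (\<tau> \<in> sorting (split_blocks ns xs)) * \<Phi> (permute_list \<tau> (split_blocks ns xs)))
        / real (card (sorting (split_blocks ns xs)))) \<in> borel_measurable listM"
    using 2 by (intro borel_measurable_divide borel_measurable_sum borel_measurable_times) auto
  then show "(\<lambda>xs. sort_average \<Phi> (split_blocks ns xs)) \<in> borel_measurable listM"
    by (simp add: sort_average_alt)
qed

lemma measurable_admissible: "admissible ns \<in> listM \<rightarrow>\<^sub>M count_space UNIV"
proof (rule measurable_determined)
  let ?g = "\<lambda>xs. map (\<lambda>i. map (\<lambda>s. good (rotate s (split_blocks ns xs ! i))) [0..<ns ! i]) [0..<length ns]"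
  have 1: "?g \<in> listM \<rightarrow>\<^sub>M count_space UNIV"
  proof (rule measurable_map_const, rule measurable_map_const)
    fix i s assume i: "i \<in> set [0..<length ns]"
    have [measurable]: "(\<lambda>xs. split_blocks ns xs ! i) \<in> listM \<rightarrow>\<^sub>M listM"
      using i by (intro measurable_nth_split_blocks) auto
    show "Measurable.pred listM (\<lambda>x. good (rotate s (split_blocks ns x ! i)))" by measurable
  qed
  show "(\<lambda>xs. (mean_pattern (split_blocks ns xs), ?g xs)) \<in> listM \<rightarrow>\<^sub>M count_space UNIV"
    by (rule measurable_countable2[OF measurable_compose[OF measurable_split_blocks measurable_mean_pattern] 1])
  fix xs ys :: "real list"
  assume eq: "(mean_pattern (split_blocks ns xs), ?g xs) = (mean_pattern (split_blocks ns ys), ?g ys)"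
  then have p: "mean_pattern (split_blocks ns xs) = mean_pattern (split_blocks ns ys)" and g: "?g xs = ?g ys" by auto
  have "good (rotate s (split_blocks ns xs ! i)) = good (rotate s (split_blocks ns ys ! i))" if "i < length ns" "s < ns ! i" for i s
    using arg_cong[OF g, of "\<lambda>m. m ! i ! s"] that by simp
  moreover have "sorting (split_blocks ns xs) = sorting (split_blocks ns ys)"
    by (rule sorting_mean_pattern[OF p])
  ultimately show "admissible ns xs = admissible ns ys"
    unfolding admissible_eq by (intro arg_cong2[where f = "\<lambda>a b. a \<times> b"] PiE_cong) auto
qed

section \<open>Rearrangement of iid increments\<close>

context iid_sequence
begin

lemma EE_cong: "(\<And>xs. length xs = n \<Longrightarrow> F xs = G xs) \<Longrightarrow> EE n F = EE n G"
  unfolding EE_def by (intro Bochner_Integration.integral_cong) auto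

lemma EE_mult: "EE n (\<lambda>xs. c * F xs) = c * EE n F"
  unfolding EE_def by simp

lemma EE_sum:
  assumes "\<And>i. i \<in> I \<Longrightarrow> F i \<in> borel_measurable listM" "\<And>i b. i \<in> I \<Longrightarrow> length b = n \<Longrightarrow> \<bar>F i b\<bar> \<le> (c :: real)"
  shows "EE n (\<lambda>xs. \<Sum>i\<in>I. F i xs) = (\<Sum>i\<in>I. EE n (F i))"
  unfolding EE_def using assms by (intro Bochner_Integration.integral_sum integrable_Xs) auto

lemma EE_block_rearrange:
  fixes op_real :: "real list \<Rightarrow> real list list" and op_nat :: "nat list \<Rightarrow> nat list list"
  assumes nat: "\<And>f xs. length xs = n \<Longrightarrow> op_real (map f xs) = map (map f) (op_nat xs)"
    and perm: "mset (concat (op_nat [0..<n])) = mset [0..<n]"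
    and len: "map length (op_nat [0..<n]) = ms"
    and G: "G \<in> borel_measurable segM"
  shows "EE n (\<lambda>xs. G (op_real xs)) = EE n (\<lambda>xs. G (split_blocks ms xs))"
proof -
  let ?is = "concat (op_nat [0..<n])"
  have "op_real (Xs \<omega> [0..<n]) = split_blocks ms (Xs \<omega> ?is)" for \<omega>
  proof -
    have "op_real (Xs \<omega> [0..<n]) = map (map (\<lambda>i. X i \<omega>)) (op_nat [0..<n])" unfolding Xs_def by (rule nat) simp
    also have "\<dots> = split_blocks ms (concat (map (map (\<lambda>i. X i \<omega>)) (op_nat [0..<n])))"
      by (rule split_blocks_concat'[symmetric]) (simp add: comp_def flip: len)
    finally show ?thesis by (simp add: Xs_def map_concat)
  qed
  then have "EE n (\<lambda>xs. G (op_real xs)) = (\<integral>\<omega>. G (split_blocks ms (Xs \<omega> ?is)) \<partial>M)" by (simp add: EE_def)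
  also have "\<dots> = EE n (\<lambda>xs. G (split_blocks ms xs))"
  proof (rule exchangeable)
    show "distinct ?is" using perm by (metis distinct_upt mset_eq_imp_distinct_iff)
    show "length ?is = n" using perm by (metis length_upt minus_nat.diff_0 size_mset)
    show "(\<lambda>xs. G (split_blocks ms xs)) \<in> borel_measurable listM"
      by (rule measurable_compose[OF measurable_split_blocks G])
  qed
  finally show ?thesis .
qed

lemma EE_permute_blocks:
  assumes ns: "sum_list ns = n" and t: "\<tau> permutes {..<length ns}" and G: "G \<in> borel_measurable segM"
  shows "EE n (\<lambda>xs. G (permute_list \<tau> (split_blocks ns xs))) = EE n (\<lambda>xs. G (split_blocks (permute_list \<tau> ns) xs))"
proof (rule EE_block_rearrange[where op_nat = "\<lambda>xs. permute_list \<tau> (split_blocks ns xs)", OF _ _ _ G])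
  show "mset (concat (permute_list \<tau> (split_blocks ns [0..<n]))) = mset [0..<n]"
    using t ns by (subst mset_concat_permute_list) (auto simp: concat_split_blocks)
  show "map length (permute_list \<tau> (split_blocks ns [0..<n])) = permute_list \<tau> ns"
    using t ns by (simp add: map_permute_list map_length_split_blocks)
qed (rule permute_split_blocks_map[OF t])

lemma EE_rotate_blocks:
  assumes ns: "sum_list ns = n" and G: "G \<in> borel_measurable segM"
  shows "EE n (\<lambda>xs. G (rotate_blocks \<sigma> (split_blocks ns xs))) = EE n (\<lambda>xs. G (split_blocks ns xs))"
proof (rule EE_block_rearrange[where op_nat = "\<lambda>xs. rotate_blocks \<sigma> (split_blocks ns xs)", OF _ _ _ G])
  show "mset (concat (rotate_blocks \<sigma> (split_blocks ns [0..<n]))) = mset [0..<n]"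
    using ns by (subst mset_concat_rotate_blocks) (auto simp: concat_split_blocks)
  show "map length (rotate_blocks \<sigma> (split_blocks ns [0..<n])) = ns"
  proof -
    have "map length (rotate_blocks \<sigma> B) = map length B" for B :: "nat list list"
      by (rule nth_equalityI) (auto simp: rotate_blocks_def)
    then show ?thesis using ns by (simp add: map_length_split_blocks)
  qed
qed (rule rotate_split_blocks_map)

end

lemma block_weight_bounds: "0 \<le> block_weight b" "block_weight b \<le> 1"
proof -
  show "0 \<le> block_weight b" by (simp add: block_weight_def)
  show "block_weight b \<le> 1" by (cases "nrot b") (auto simp: block_weight_def)
qed

lemma weight_bounds: "0 \<le> weight B" "weight B \<le> 1"
proof -
  have "0 \<le> weight B \<and> weight B \<le> 1"
    by (induction B) (auto simp: weight_def block_weight_bounds intro: mult_le_one)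
  then show "0 \<le> weight B" "weight B \<le> 1" by auto
qed

lemma weight_permute_list: "\<tau> permutes {..<length B} \<Longrightarrow> weight (permute_list \<tau> B) = weight B"
  unfolding weight_def prod_mset_prod_list[symmetric] by (simp add: mset_permute_list)

lemma sort_average_bounds:
  assumes "\<And>bs. 0 \<le> \<Phi> bs" "\<And>bs. \<Phi> bs \<le> 1"
  shows "0 \<le> sort_average \<Phi> B" "sort_average \<Phi> B \<le> 1"
proof -
  show "0 \<le> sort_average \<Phi> B" using assms by (auto simp: sort_average_def intro!: divide_nonneg_nonneg sum_nonneg)
  have "(\<Sum>\<tau>\<in>sorting B. \<Phi> (permute_list \<tau> B)) \<le> (\<Sum>\<tau>\<in>sorting B. 1)" using assms by (intro sum_mono) auto
  then show "sort_average \<Phi> B \<le> 1" using card_sorting_pos[of B] by (simp add: sort_average_def divide_le_eq)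
qed

text \<open>
  Reordering is a bijection of the compositions with a given number of parts, so symmetrising
  the summand has no effect.
\<close>

lemma sum_permute_comps:
  fixes f :: "nat list \<Rightarrow> real"
  shows "(\<Sum>ns\<in>comps n. (\<Sum>\<tau> | \<tau> permutes {..<length ns}. f (permute_list \<tau> ns)) / fact (length ns)) = (\<Sum>ns\<in>comps n. f ns)"
proof -
  let ?C = "\<lambda>k. {ns\<in>comps n. length ns = k}"
  have inner: "(\<Sum>ns\<in>?C k. f (permute_list \<tau> ns)) = (\<Sum>ns\<in>?C k. f ns)" if t: "\<tau> permutes {..<k}" for k \<tau>
  proof (rule sum.reindex_bij_witness[where i = "permute_list (inv \<tau>)" and j = "permute_list \<tau>"])
    have m: "permute_list \<rho> ns \<in> ?C k" if "ns \<in> ?C k" "\<rho> permutes {..<k}" for \<rho> ns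
    proof -
      have "mset (permute_list \<rho> ns) = mset ns" using that by (simp add: mset_permute_list)
      then have "set (permute_list \<rho> ns) = set ns" "sum_list (permute_list \<rho> ns) = sum_list ns"
        by (metis set_mset_mset, metis sum_mset_sum_list)
      then show ?thesis using that by (simp add: comps_def)
    qed
    fix ns assume ns: "ns \<in> ?C k"
    show "permute_list \<tau> ns \<in> ?C k" "permute_list (inv \<tau>) ns \<in> ?C k"
      using m[OF ns] t permutes_inv[OF t] by auto
    have "permute_list (inv \<tau>) (permute_list \<tau> ns) = permute_list (\<tau> \<circ> inv \<tau>) ns"
      using ns permutes_inv[OF t] by (simp add: permute_list_compose)
    also have "\<tau> \<circ> inv \<tau> = id" using t by (auto simp: fun_eq_iff permutes_inverses)
    finally show "permute_list (inv \<tau>) (permute_list \<tau> ns) = ns" by simp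
    have "permute_list \<tau> (permute_list (inv \<tau>) ns) = permute_list (inv \<tau> \<circ> \<tau>) ns"
      using ns t by (simp add: permute_list_compose)
    also have "inv \<tau> \<circ> \<tau> = id" using t by (auto simp: fun_eq_iff permutes_inverses)
    finally show "permute_list \<tau> (permute_list (inv \<tau>) ns) = ns" by simp
  qed simp
  have "(\<Sum>ns\<in>?C k. (\<Sum>\<tau> | \<tau> permutes {..<length ns}. f (permute_list \<tau> ns)) / fact (length ns)) = (\<Sum>ns\<in>?C k. f ns)" for k
  proof -
    have "(\<Sum>ns\<in>?C k. (\<Sum>\<tau> | \<tau> permutes {..<length ns}. f (permute_list \<tau> ns)) / fact (length ns)) =
       (\<Sum>ns\<in>?C k. \<Sum>\<tau> | \<tau> permutes {..<k}. f (permute_list \<tau> ns)) / fact k"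
    proof -
      have "(\<Sum>ns\<in>?C k. (\<Sum>\<tau> | \<tau> permutes {..<length ns}. f (permute_list \<tau> ns)) / fact (length ns)) =
        (\<Sum>ns\<in>?C k. (\<Sum>\<tau> | \<tau> permutes {..<k}. f (permute_list \<tau> ns)) / fact k)" by (rule sum.cong) auto
      then show ?thesis by (simp only: sum_divide_distrib[symmetric])
    qed
    also have "\<dots> = (\<Sum>\<tau> | \<tau> permutes {..<k}. \<Sum>ns\<in>?C k. f (permute_list \<tau> ns)) / fact k"
      by (subst sum.swap) simp
    also have "\<dots> = (\<Sum>\<tau> | \<tau> permutes {..<k}. \<Sum>ns\<in>?C k. f ns) / fact k"
      using inner by simp
    also have "\<dots> = (\<Sum>ns\<in>?C k. f ns)" by (simp add: card_permutations)
    finally show ?thesis .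
  qed
  then have "(\<Sum>k\<in>length ` comps n. \<Sum>ns\<in>?C k. (\<Sum>\<tau> | \<tau> permutes {..<length ns}. f (permute_list \<tau> ns)) / fact (length ns)) =
     (\<Sum>k\<in>length ` comps n. \<Sum>ns\<in>?C k. f ns)" by simp
  then show ?thesis by (simp only: sum.image_gen[OF finite_comps, symmetric])
qed

sublocale rearranged_walk \<subseteq> iid_sequence M X
  by unfold_locales (rule X_indep, rule X_identical)

context rearranged_walk
begin

definition R :: "'w \<Rightarrow> real list list" where
  "R = segments N X perm choice"

lemma R_eq: "R \<omega> = rearrange (cycle_lengths (N \<omega>) (perm \<omega>)) (Xs \<omega> [0..<N \<omega>]) (choice \<omega>)"
  by (simp add: R_def segments_def Xs_def)

lemma R_valid: "\<omega> \<in> space M \<Longrightarrow> valid (R \<omega>)" "\<omega> \<in> space M \<Longrightarrow> length (concat (R \<omega>)) = N \<omega>"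
  using admissible_valid[OF choice_admissible] cycle_lengths_props(2)[OF perm_permutes]
  by (auto simp: R_eq Xs_def comps_def)

lemma pred_N [measurable]: "Measurable.pred M (\<lambda>\<omega>. N \<omega> = n)"
  using N_measurable by measurable

lemma pred_perm [measurable]: "Measurable.pred M (\<lambda>\<omega>. perm \<omega> = p)"
  using perm_measurable by measurable

lemma pred_choice [measurable]: "Measurable.pred M (\<lambda>\<omega>. choice \<omega> = c)"
  using choice_measurable by measurable

lemma prob_N: "\<P>(\<omega> in M. N \<omega> = n) = (1 - q) * q ^ n"
proof -
  have s: "{\<omega>\<in>space M. N \<omega> \<ge> m} \<in> events" for m using N_measurable by measurable
  have "{\<omega>\<in>space M. N \<omega> = n} = {\<omega>\<in>space M. N \<omega> \<ge> n} - {\<omega>\<in>space M. N \<omega> \<ge> Suc n}" by auto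
  then have "\<P>(\<omega> in M. N \<omega> = n) = q ^ n - q ^ Suc n"
    using s by (simp only:) (subst finite_measure_Diff; auto simp: N_geometric[simplified])
  then show ?thesis by (simp add: algebra_simps)
qed

lemma measurable_seq [measurable]: "(\<lambda>\<omega> i. X i \<omega>) \<in> M \<rightarrow>\<^sub>M Pi\<^sub>M UNIV (\<lambda>_. borel)"
  by (rule measurable_PiM_single') auto

lemma prob_N_perm:
  assumes "p permutes {..<n}" and A: "A \<in> sets (Pi\<^sub>M UNIV (\<lambda>_. borel))"
  shows "\<P>(\<omega> in M. N \<omega> = n \<and> (\<lambda>i. X i \<omega>) \<in> A \<and> perm \<omega> = p) =
    (1 - q) * q ^ n / fact n * \<P>(\<omega> in M. (\<lambda>i. X i \<omega>) \<in> A)"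
proof -
  have "pmf (pmf_of_set {p. p permutes {..<n}}) p = 1 / fact n"
    using assms(1) finite_permutations[of "{..<n}"] card_permutations[of "{..<n}" n] by (subst pmf_of_set) auto
  then show ?thesis unfolding perm_uniform[OF A] N_X_indep[OF A] prob_N by simp
qed

lemma expectation_sum_indicator:
  assumes "\<And>v. S v \<in> events"
  shows "(\<integral>\<omega>. (\<Sum>v\<in>V. c v * indicator (S v) \<omega>) \<partial>M) = (\<Sum>v\<in>V. c v * prob (S v))"
proof -
  have "integrable M (\<lambda>\<omega>. c v * indicator (S v) \<omega> :: real)" for v
    using assms[of v] by (intro integrable_mult_right integrable_real_indicator) (auto simp: emeasure_eq_measure)
  then have "(\<integral>\<omega>. (\<Sum>v\<in>V. c v * indicator (S v) \<omega>) \<partial>M) = (\<Sum>v\<in>V. \<integral>\<omega>. c v * indicator (S v) \<omega> \<partial>M)"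
    by (intro Bochner_Integration.integral_sum)
  also have "\<dots> = (\<Sum>v\<in>V. c v * prob (S v \<inter> space M))" by simp
  finally show ?thesis using sets.sets_into_space[OF assms] by (simp add: Int_absorb2)
qed

lemma expectation_N_perm:
  assumes p: "p permutes {..<n}" and H: "H \<in> borel_measurable (Pi\<^sub>M UNIV (\<lambda>_. borel))" and fin: "finite (range H)"
  shows "(\<integral>\<omega>. indicator {\<omega>. N \<omega> = n \<and> perm \<omega> = p} \<omega> * H (\<lambda>i. X i \<omega>) \<partial>M) =
     (1 - q) * q ^ n / fact n * (\<integral>\<omega>. H (\<lambda>i. X i \<omega>) \<partial>M)"
proof -
  let ?A = "\<lambda>v. H -` {v}"
  have A: "?A v \<in> sets (Pi\<^sub>M UNIV (\<lambda>_. borel))" for v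
    using measurable_sets[OF H, of "{v}"] by (simp add: space_PiM)
  have H_sum: "H x = (\<Sum>v\<in>range H. v * indicator (?A v) x)" for x
  proof -
    have "(\<Sum>v\<in>range H. v * indicator (?A v) x) = (\<Sum>v\<in>{H x}. v * indicator (?A v) x)"
      by (rule sum.mono_neutral_right) (use fin in \<open>auto simp: indicator_def\<close>)
    then show ?thesis by simp
  qed
  let ?F = "\<lambda>v. {\<omega>\<in>space M. N \<omega> = n \<and> (\<lambda>i. X i \<omega>) \<in> ?A v \<and> perm \<omega> = p}"
  let ?G = "\<lambda>v. {\<omega>\<in>space M. (\<lambda>i. X i \<omega>) \<in> ?A v}"
  have G: "?G v \<in> events" for v using A[of v] by measurable
  have F: "?F v \<in> events" for v using A[of v] by measurable
  have "(\<integral>\<omega>. indicator {\<omega>. N \<omega> = n \<and> perm \<omega> = p} \<omega> * H (\<lambda>i. X i \<omega>) \<partial>M) = (\<integral>\<omega>. (\<Sum>v\<in>range H. v * indicator (?F v) \<omega>) \<partial>M)"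
  proof (rule Bochner_Integration.integral_cong[OF refl])
    fix \<omega> assume "\<omega> \<in> space M"
    then show "indicator {\<omega>. N \<omega> = n \<and> perm \<omega> = p} \<omega> * H (\<lambda>i. X i \<omega>) = (\<Sum>v\<in>range H. v * indicator (?F v) \<omega>)"
      by (subst H_sum) (auto simp: sum_distrib_left indicator_def intro!: sum.cong)
  qed
  also have "\<dots> = (\<Sum>v\<in>range H. v * prob (?F v))"
    by (rule expectation_sum_indicator[OF F])
  also have "\<dots> = (\<Sum>v\<in>range H. v * ((1 - q) * q ^ n / fact n * prob (?G v)))"
    using prob_N_perm[OF p A] by simp
  also have "\<dots> = (1 - q) * q ^ n / fact n * (\<Sum>v\<in>range H. v * prob (?G v))"
    by (simp add: sum_distrib_left algebra_simps)
  also have "(\<Sum>v\<in>range H. v * prob (?G v)) = (\<integral>\<omega>. (\<Sum>v\<in>range H. v * indicator (?G v) \<omega>) \<partial>M)"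
    by (rule expectation_sum_indicator[OF G, symmetric])
  also have "\<dots> = (\<integral>\<omega>. H (\<lambda>i. X i \<omega>) \<partial>M)"
  proof (rule Bochner_Integration.integral_cong[OF refl])
    fix \<omega> assume "\<omega> \<in> space M"
    then show "(\<Sum>v\<in>range H. v * indicator (?G v) \<omega>) = H (\<lambda>i. X i \<omega>)"
      by (subst H_sum) (auto simp: indicator_def intro!: sum.cong)
  qed
  finally show ?thesis .
qed

lemma measurable_seq_list: "(\<lambda>x. map x [0..<n]) \<in> Pi\<^sub>M UNIV (\<lambda>_. borel) \<rightarrow>\<^sub>M listM"
  using measurable_to_listM[of "[0..<n]" "\<lambda>i x. x i" "Pi\<^sub>M UNIV (\<lambda>_. borel)"] by simp

lemma measurable_rearrange: "c \<in> choices ns \<Longrightarrow> (\<lambda>xs. rearrange ns xs c) \<in> listM \<rightarrow>\<^sub>M segM"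
proof -
  assume "c \<in> choices ns"
  then obtain \<tau> \<sigma> where c: "c = (\<tau>, \<sigma>)" "\<tau> permutes {..<length ns}" by (cases c) (auto simp: choices_def)
  have r: "rearrange ns xs c = permute_list \<tau> (rotate_blocks \<sigma> (split_blocks ns xs))" for xs :: "real list"
    unfolding c by (rule rearrange_conv[OF c(2)])
  show ?thesis unfolding r
  proof (rule measurable_listM_segM[where g = "\<lambda>n. permute_list \<tau> (rotate_blocks \<sigma> (split_blocks ns [0..<n]))"])
    fix n
    show "permute_list \<tau> (rotate_blocks \<sigma> (split_blocks ns (map x [0..<n]))) =
       map (map x) (permute_list \<tau> (rotate_blocks \<sigma> (split_blocks ns [0..<n])))" for x :: "nat \<Rightarrow> real"
      unfolding rotate_split_blocks_map using c(2) by (simp add: map_permute_list)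
    have "mset (concat (permute_list \<tau> (rotate_blocks \<sigma> (split_blocks ns [0..<n])))) = mset (concat (split_blocks ns [0..<n]))"
      using c(2) by (simp only: mset_concat_permute_list length_rotate_blocks length_split_blocks mset_concat_rotate_blocks)
    then show "set (concat (permute_list \<tau> (rotate_blocks \<sigma> (split_blocks ns [0..<n])))) \<subseteq> {..<n}"
      using set_concat_eqI set_concat_split_blocks[of ns "[0..<n]"] by (metis atLeast0LessThan atLeast_upt set_upt)
  qed
qed

text \<open>
  Each of the \<open>prod_list ns\<close> choices of rotations maps the iid increments to iid
  increments, so it contributes the same expectation.
\<close>

lemma law_given_permutation:
  assumes p: "p permutes {..<n}" and E: "E \<in> sets segM"
  defines "ns \<equiv> cycle_lengths n p"
  shows "\<P>(\<omega> in M. N \<omega> = n \<and> perm \<omega> = p \<and> R \<omega> \<in> E) =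
    (1 - q) * q ^ n / fact n * (real (prod_list ns) *
      EE n (\<lambda>xs. weight (split_blocks ns xs) * sort_average (indicator E) (split_blocks ns xs)))"
proof -
  have ns: "0 \<notin> set ns" "sum_list ns = n" using cycle_lengths_props(2)[OF p] by (auto simp: ns_def comps_def)
  let ?A = "\<lambda>c. {x. rearrange ns (map x [0..<n]) c \<in> E}"
  let ?H = "\<lambda>c x. indicator (?A c) x * pmf (pmf_of_set (admissible ns (map x [0..<n]))) c"
  let ?h = "\<lambda>c xs. indicator E (rearrange ns xs c) * pmf (pmf_of_set (admissible ns xs)) c"
  let ?Ev = "\<lambda>c. {\<omega>\<in>space M. N \<omega> = n \<and> perm \<omega> = p \<and> (\<lambda>i. X i \<omega>) \<in> ?A c \<and> choice \<omega> = c}"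
  have A: "?A c \<in> sets (Pi\<^sub>M UNIV (\<lambda>_. borel))" if "c \<in> choices ns" for c
  proof -
    have "(\<lambda>x. rearrange ns (map x [0..<n]) c) \<in> Pi\<^sub>M UNIV (\<lambda>_. borel) \<rightarrow>\<^sub>M segM"
      by (rule measurable_compose[OF measurable_seq_list measurable_rearrange[OF that]])
    from measurable_sets[OF this E] show ?thesis by (simp add: space_PiM vimage_def)
  qed
  have h: "?h c \<in> borel_measurable listM" if "c \<in> choices ns" for c
  proof -
    have "(\<lambda>xs. indicator E (rearrange ns xs c) :: real) \<in> borel_measurable listM"
      by (rule measurable_compose[OF measurable_rearrange[OF that]]) (use E in simp)
    moreover have "(\<lambda>xs. pmf (pmf_of_set (admissible ns xs)) c) \<in> borel_measurable listM"
      by (rule measurable_compose[OF measurable_admissible]) simp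
    ultimately show ?thesis by (rule borel_measurable_times)
  qed
  have H: "?H c \<in> borel_measurable (Pi\<^sub>M UNIV (\<lambda>_. borel))" if "c \<in> choices ns" for c
    using measurable_compose[OF measurable_seq_list[of n] h[OF that]] by (simp add: indicator_def)
  have finH: "finite (range (?H c))" for c
  proof (rule finite_subset)
    show "range (?H c) \<subseteq> insert 0 ((\<lambda>S. pmf (pmf_of_set S) c) ` Pow (choices ns))"
      using admissible_subset_choices by (auto simp: indicator_def)
  qed (simp add: finite_choices)
  have Ev: "?Ev c \<in> events" if "c \<in> choices ns" for c
  proof -
    have [measurable]: "Measurable.pred (Pi\<^sub>M UNIV (\<lambda>_. borel)) (\<lambda>x. x \<in> ?A c)"
      using A[OF that] by (simp add: pred_def space_PiM)
    show ?thesis by measurable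
  qed
  have "{\<omega>\<in>space M. N \<omega> = n \<and> perm \<omega> = p \<and> R \<omega> \<in> E} = (\<Union>c\<in>choices ns. ?Ev c)"
  proof (intro equalityI subsetI)
    fix \<omega> assume w: "\<omega> \<in> {\<omega>\<in>space M. N \<omega> = n \<and> perm \<omega> = p \<and> R \<omega> \<in> E}"
    then have "choice \<omega> \<in> choices ns"
      using choice_admissible[of \<omega>] admissible_subset_choices by (auto simp: ns_def)
    then show "\<omega> \<in> (\<Union>c\<in>choices ns. ?Ev c)" using w by (auto simp: R_eq Xs_def ns_def)
  qed (auto simp: R_eq Xs_def ns_def)
  moreover have "prob (\<Union>c\<in>choices ns. ?Ev c) = (\<Sum>c\<in>choices ns. prob (?Ev c))"
    using Ev finite_choices by (intro finite_measure_finite_Union) (auto simp: disjoint_family_on_def)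
  ultimately have "\<P>(\<omega> in M. N \<omega> = n \<and> perm \<omega> = p \<and> R \<omega> \<in> E) = (\<Sum>c\<in>choices ns. prob (?Ev c))" by simp
  also have "\<dots> = (\<Sum>c\<in>choices ns. (1 - q) * q ^ n / fact n * EE n (?h c))"
  proof (rule sum.cong[OF refl])
    fix c assume c: "c \<in> choices ns"
    have "prob (?Ev c) = (\<integral>\<omega>. indicator {\<omega>. N \<omega> = n \<and> perm \<omega> = p \<and> (\<lambda>i. X i \<omega>) \<in> ?A c} \<omega> *
               pmf (pmf_of_set (admissible ns (map (\<lambda>i. X i \<omega>) [0..<n]))) c \<partial>M)"
      unfolding ns_def by (rule choice_uniform) (use A[OF c] in \<open>simp add: ns_def\<close>)
    also have "\<dots> = (\<integral>\<omega>. indicator {\<omega>. N \<omega> = n \<and> perm \<omega> = p} \<omega> * ?H c (\<lambda>i. X i \<omega>) \<partial>M)"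
      by (intro Bochner_Integration.integral_cong) (auto simp: indicator_def)
    also have "\<dots> = (1 - q) * q ^ n / fact n * (\<integral>\<omega>. ?H c (\<lambda>i. X i \<omega>) \<partial>M)"
      by (rule expectation_N_perm[OF p H[OF c] finH])
    also have "(\<integral>\<omega>. ?H c (\<lambda>i. X i \<omega>) \<partial>M) = EE n (?h c)"
      by (simp add: EE_def Xs_def indicator_def)
    finally show "prob (?Ev c) = (1 - q) * q ^ n / fact n * EE n (?h c)" .
  qed
  also have "\<dots> = (1 - q) * q ^ n / fact n * (\<Sum>c\<in>choices ns. EE n (?h c))"
    by (simp add: sum_distrib_left)
  also have "(\<Sum>c\<in>choices ns. EE n (?h c)) = EE n (\<lambda>xs. \<Sum>c\<in>choices ns. ?h c xs)"
    by (rule EE_sum[symmetric, where c = 1]) (use h in \<open>auto simp: indicator_def pmf_le_1\<close>)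
  also have "\<dots> = EE n (\<lambda>xs. \<Sum>\<sigma>\<in>(\<Pi>\<^sub>E i\<in>{..<length ns}. {..<ns ! i}).
        weight (rotate_blocks \<sigma> (split_blocks ns xs)) * sort_average (indicator E) (rotate_blocks \<sigma> (split_blocks ns xs)))"
  proof (rule EE_cong)
    fix xs :: "real list" assume len: "length xs = n"
    have fin: "finite (admissible ns xs)" using finite_subset[OF admissible_subset_choices finite_choices] .
    have ne: "admissible ns xs \<noteq> {}"
    proof -
      have "\<exists>s. s < ns ! i \<and> good (rotate s (split_blocks ns xs ! i))" if "i < length ns" for i
      proof -
        have l: "length (split_blocks ns xs ! i) = ns ! i"
          using map_length_split_blocks[of ns xs] ns len that by (metis length_split_blocks nth_map order_refl)
        moreover have "ns ! i \<noteq> 0" using ns(1) that by (metis nth_mem)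
        ultimately have "split_blocks ns xs ! i \<noteq> []" by auto
        from good_rotation_exists[OF this] show ?thesis using l by auto
      qed
      then show ?thesis
        unfolding admissible_eq using sorting_nonempty by (auto simp: PiE_eq_empty_iff)
    qed
    have "(\<Sum>c\<in>choices ns. ?h c xs) = (\<Sum>c\<in>admissible ns xs. indicator E (rearrange ns xs c) / real (card (admissible ns xs)))"
      by (rule sum.mono_neutral_cong_right)
         (use fin ne admissible_subset_choices finite_choices in \<open>auto simp: pmf_of_set indicator_def\<close>)
    also have "\<dots> = (\<Sum>c\<in>admissible ns xs. indicator E (rearrange ns xs c)) / real (card (admissible ns xs))"
      by (simp add: sum_divide_distrib)
    finally show "(\<Sum>c\<in>choices ns. ?h c xs) = (\<Sum>\<sigma>\<in>(\<Pi>\<^sub>E i\<in>{..<length ns}. {..<ns ! i}).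
        weight (rotate_blocks \<sigma> (split_blocks ns xs)) * sort_average (indicator E) (rotate_blocks \<sigma> (split_blocks ns xs)))"
      using admissible_average[of ns xs "indicator E"] ns len by simp
  qed
  also have "\<dots> = (\<Sum>\<sigma>\<in>(\<Pi>\<^sub>E i\<in>{..<length ns}. {..<ns ! i}).
        EE n (\<lambda>xs. weight (rotate_blocks \<sigma> (split_blocks ns xs)) * sort_average (indicator E) (rotate_blocks \<sigma> (split_blocks ns xs))))"
  proof (rule EE_sum[where c = 1])
    fix \<sigma>
    have "(\<lambda>B. weight B * sort_average (indicator E) B) \<in> borel_measurable segM" using E by measurable
    from measurable_compose[OF measurable_rotate_split_blocks this]
    show "(\<lambda>xs. weight (rotate_blocks \<sigma> (split_blocks ns xs)) * sort_average (indicator E) (rotate_blocks \<sigma> (split_blocks ns xs))) \<in> borel_measurable listM" .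
    fix b
    show "\<bar>weight (rotate_blocks \<sigma> (split_blocks ns b)) * sort_average (indicator E) (rotate_blocks \<sigma> (split_blocks ns b))\<bar> \<le> 1"
      using weight_bounds[of "rotate_blocks \<sigma> (split_blocks ns b)"] sort_average_bounds[of "indicator E" "rotate_blocks \<sigma> (split_blocks ns b)"]
      by (simp add: abs_mult mult_le_one)
  qed
  also have "\<dots> = (\<Sum>\<sigma>\<in>(\<Pi>\<^sub>E i\<in>{..<length ns}. {..<ns ! i}).
        EE n (\<lambda>xs. weight (split_blocks ns xs) * sort_average (indicator E) (split_blocks ns xs)))"
  proof (rule sum.cong[OF refl])
    fix \<sigma>
    have "(\<lambda>B. weight B * sort_average (indicator E) B) \<in> borel_measurable segM" using E by measurable
    from EE_rotate_blocks[OF ns(2) this]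
    show "EE n (\<lambda>xs. weight (rotate_blocks \<sigma> (split_blocks ns xs)) * sort_average (indicator E) (rotate_blocks \<sigma> (split_blocks ns xs))) =
      EE n (\<lambda>xs. weight (split_blocks ns xs) * sort_average (indicator E) (split_blocks ns xs))" .
  qed
  also have "\<dots> = real (prod_list ns) * EE n (\<lambda>xs. weight (split_blocks ns xs) * sort_average (indicator E) (split_blocks ns xs))"
  proof -
    have "card (\<Pi>\<^sub>E i\<in>{..<length ns}. {..<ns ! i}) = (\<Prod>i<length ns. ns ! i)" by (simp add: card_PiE)
    also have "\<dots> = prod_list (map ((!) ns) [0..<length ns])"
      using prod.distinct_set_conv_list[of "[0..<length ns]" "(!) ns"] by (simp only: set_upt atLeast0LessThan distinct_upt)
    finally show ?thesis by (simp add: map_nth)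
  qed
  finally show ?thesis .
qed

text \<open>
  The expectation in the preceding lemma depends on the order of the cycle lengths only through
  their multiset; Cauchy's formula then turns the sum over permutations into a sum over
  compositions, and the product of the cycle lengths cancels.
\<close>

lemma law_symmetric:
  assumes E: "E \<in> sets segM"
  shows "\<P>(\<omega> in M. N \<omega> = n \<and> R \<omega> \<in> E) = (1 - q) * q ^ n *
    (\<Sum>ns\<in>comps n. EE n (\<lambda>xs. weight (split_blocks ns xs) * sort_average (indicator E) (split_blocks ns xs)) / fact (length ns))"
proof -
  define f where "f = (\<lambda>ns. EE n (\<lambda>xs. weight (split_blocks ns xs) * sort_average (indicator E) (split_blocks ns xs)))"
  have f_mset: "f ns = f ms" if eq: "mset ns = mset ms" and s: "sum_list ns = n" for ns ms
  proof -
    obtain \<tau> where t: "\<tau> permutes {..<length ns}" "permute_list \<tau> ns = ms"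
      using mset_eq_permutation[OF eq[symmetric]] by blast
    have m: "(\<lambda>B. weight B * sort_average (indicator E) B) \<in> borel_measurable segM" using E by measurable
    have "f ms = EE n (\<lambda>xs. weight (permute_list \<tau> (split_blocks ns xs)) * sort_average (indicator E) (permute_list \<tau> (split_blocks ns xs)))"
      unfolding f_def t(2)[symmetric] by (rule EE_permute_blocks[OF s t(1) m, symmetric])
    also have "\<dots> = f ns"
      unfolding f_def using t(1) by (simp add: weight_permute_list sort_average_permute)
    finally show ?thesis by simp
  qed
  \<comment> \<open>Any listing of the multiset gives the same value by the preceding fact; the sorted one is a canonical choice.\<close>
  define h where "h = (\<lambda>m. real (prod_mset m) * f (sorted_list_of_multiset m))"
  have h: "h (mset ns) = real (prod_list ns) * f ns" if "sum_list ns = n" for ns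
    unfolding h_def using f_mset[of ns "sorted_list_of_multiset (mset ns)"] that by (simp add: prod_mset_prod_list)
  let ?Ev = "\<lambda>p. {\<omega>\<in>space M. N \<omega> = n \<and> perm \<omega> = p \<and> R \<omega> \<in> E}"
  have pr: "prob (?Ev p) = (1 - q) * q ^ n / fact n * h (cycle_type n p)" if "p permutes {..<n}" for p
  proof -
    have "sum_list (cycle_lengths n p) = n" using cycle_lengths_props(2)[OF that] by (simp add: comps_def)
    from h[OF this] show ?thesis
      unfolding law_given_permutation[OF that E] f_def cycle_lengths_props(1)[OF that] by simp
  qed
  have meas: "?Ev p \<in> events" if p: "p permutes {..<n}" for p
  proof -
    have "?Ev p = (\<Union>c\<in>choices (cycle_lengths n p). {\<omega>\<in>space M. N \<omega> = n \<and> perm \<omega> = p \<and> choice \<omega> = c \<and>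
        rearrange (cycle_lengths n p) (Xs \<omega> [0..<n]) c \<in> E})"
      using choice_admissible admissible_subset_choices by (fastforce simp: R_eq Xs_def)
    also have "\<dots> \<in> events"
    proof (rule sets.finite_UN[OF finite_choices])
      fix c assume "c \<in> choices (cycle_lengths n p)"
      from measurable_compose[OF measurable_Xs[of "[0..<n]"] measurable_rearrange[OF this]]
      have [measurable]: "(\<lambda>\<omega>. rearrange (cycle_lengths n p) (Xs \<omega> [0..<n]) c) \<in> M \<rightarrow>\<^sub>M segM" .
      show "{\<omega>\<in>space M. N \<omega> = n \<and> perm \<omega> = p \<and> choice \<omega> = c \<and> rearrange (cycle_lengths n p) (Xs \<omega> [0..<n]) c \<in> E} \<in> events"
        using E by measurable
    qed
    finally show ?thesis .
  qed
  have "{\<omega>\<in>space M. N \<omega> = n \<and> R \<omega> \<in> E} = (\<Union>p\<in>{p. p permutes {..<n}}. ?Ev p)"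
    using perm_permutes by auto
  moreover have "prob (\<Union>p\<in>{p. p permutes {..<n}}. ?Ev p) = (\<Sum>p | p permutes {..<n}. prob (?Ev p))"
    using meas finite_permutations by (intro finite_measure_finite_Union) (auto simp: disjoint_family_on_def)
  ultimately have "\<P>(\<omega> in M. N \<omega> = n \<and> R \<omega> \<in> E) = (\<Sum>p | p permutes {..<n}. (1 - q) * q ^ n / fact n * h (cycle_type n p))"
    using pr by simp
  also have "\<dots> = (1 - q) * q ^ n / fact n * (\<Sum>p | p permutes {..<n}. h (cycle_type n p))"
    by (simp add: sum_distrib_left)
  also have "\<dots> = (1 - q) * q ^ n * (\<Sum>ns\<in>comps n. comp_weight ns * h (mset ns))"
    unfolding sum_cycle_type by simp
  also have "(\<Sum>ns\<in>comps n. comp_weight ns * h (mset ns)) = (\<Sum>ns\<in>comps n. f ns / fact (length ns))"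
  proof (rule sum.cong[OF refl])
    fix ns assume ns: "ns \<in> comps n"
    then have "real (prod_list ns) \<noteq> 0" by (auto simp: comps_def prod_list_zero_iff)
    then show "comp_weight ns * h (mset ns) = f ns / fact (length ns)"
      using h[of ns] ns by (simp add: comp_weight_def comps_def)
  qed
  finally show ?thesis by (simp add: f_def)
qed

lemma law_permuted:
  assumes G: "G \<in> borel_measurable segM" and bd: "\<And>B. \<bar>G B\<bar> \<le> 1"
  shows "(\<Sum>ns\<in>comps n. EE n (\<lambda>xs. \<Sum>\<tau> | \<tau> permutes {..<length ns}. G (permute_list \<tau> (split_blocks ns xs))) / fact (length ns)) =
    (\<Sum>ns\<in>comps n. EE n (\<lambda>xs. G (split_blocks ns xs)))"
proof -
  have "EE n (\<lambda>xs. \<Sum>\<tau> | \<tau> permutes {..<length ns}. G (permute_list \<tau> (split_blocks ns xs))) =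
     (\<Sum>\<tau> | \<tau> permutes {..<length ns}. EE n (\<lambda>xs. G (split_blocks (permute_list \<tau> ns) xs)))" if "ns \<in> comps n" for ns
  proof -
    have "EE n (\<lambda>xs. \<Sum>\<tau> | \<tau> permutes {..<length ns}. G (permute_list \<tau> (split_blocks ns xs))) =
      (\<Sum>\<tau> | \<tau> permutes {..<length ns}. EE n (\<lambda>xs. G (permute_list \<tau> (split_blocks ns xs))))"
      using bd by (intro EE_sum[where c = 1] measurable_compose[OF measurable_permute_split_blocks G]) auto
    also have "\<dots> = (\<Sum>\<tau> | \<tau> permutes {..<length ns}. EE n (\<lambda>xs. G (split_blocks (permute_list \<tau> ns) xs)))"
      using that G by (intro sum.cong refl EE_permute_blocks) (auto simp: comps_def)
    finally show ?thesis .
  qed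
  then show ?thesis
    using sum_permute_comps[of "\<lambda>ns. EE n (\<lambda>xs. G (split_blocks ns xs))" n] by simp
qed

lemma card_sorting_permute_list: "\<tau> permutes {..<length B} \<Longrightarrow> card (sorting (permute_list \<tau> B)) = card (sorting B)"
  using bij_betw_same_card[OF bij_betw_sorting_permute] .

text \<open>
  The exact law of the list of segments, as a density with respect to iid increments cut at a
  composition. Summing over all orders of the blocks symmetrises over the composition.
\<close>

theorem law_sorted:
  assumes E: "E \<in> sets segM"
  shows "\<P>(\<omega> in M. N \<omega> = n \<and> R \<omega> \<in> E) = (1 - q) * q ^ n *
    (\<Sum>ns\<in>comps n. EE n (\<lambda>xs. weight (split_blocks ns xs) * of_bool (id \<in> sorting (split_blocks ns xs)) *
       indicator E (split_blocks ns xs) / real (card (sorting (split_blocks ns xs)))))"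
proof -
  let ?G = "\<lambda>B. weight B * of_bool (id \<in> sorting B) * indicator E B / real (card (sorting B))"
  have G: "?G \<in> borel_measurable segM"
    using E measurable_fun_sorting[of "\<lambda>S. of_bool (id \<in> S)"] measurable_fun_sorting[of "\<lambda>S. real (card S)"]
    by (intro borel_measurable_divide borel_measurable_times) auto
  have bd: "\<bar>?G B\<bar> \<le> 1" for B
  proof -
    have "real (card (sorting B)) \<ge> 1" using card_sorting_pos[of B] by linarith
    then show ?thesis using weight_bounds[of B] by (auto simp: indicator_def of_bool_def divide_le_eq)
  qed
  \<comment> \<open>The weight and the number of sorting orders are the same for all orders of the blocks.\<close>
  have "weight B * sort_average (indicator E) B = (\<Sum>\<tau> | \<tau> permutes {..<length B}. ?G (permute_list \<tau> B))" for B
  proof -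
    have "?G (permute_list \<tau> B) = weight B * (of_bool (\<tau> \<in> sorting B) * indicator E (permute_list \<tau> B)) / real (card (sorting B))"
      if "\<tau> permutes {..<length B}" for \<tau>
    proof -
      have "id \<in> sorting (permute_list \<tau> B) \<longleftrightarrow> \<tau> \<in> sorting B"
        using that by (simp add: sorting_def permutes_id)
      then show ?thesis using that by (simp add: weight_permute_list card_sorting_permute_list)
    qed
    then show ?thesis unfolding sort_average_alt
      by (simp add: sum_distrib_left sum_divide_distrib)
  qed
  then have "EE n (\<lambda>xs. weight (split_blocks ns xs) * sort_average (indicator E) (split_blocks ns xs)) =
     EE n (\<lambda>xs. \<Sum>\<tau> | \<tau> permutes {..<length ns}. ?G (permute_list \<tau> (split_blocks ns xs)))" for ns by simp
  then show ?thesis unfolding law_symmetric[OF E] by (simp only: law_permuted[OF G bd])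
qed

text \<open>
  For events that do not depend on how segments of different means are interleaved, the
  condition of being sorted and the number of sorting orders disappear and only $1/k!$ is left.
\<close>

theorem law_insensitive:
  assumes E: "E \<in> sets segM" and ins: "\<And>bs. sort_means bs \<in> E \<longleftrightarrow> bs \<in> E"
  shows "\<P>(\<omega> in M. N \<omega> = n \<and> R \<omega> \<in> E) = (1 - q) * q ^ n *
    (\<Sum>ns\<in>comps n. EE n (\<lambda>xs. weight (split_blocks ns xs) * indicator E (split_blocks ns xs)) / fact (length ns))"
proof -
  let ?G = "\<lambda>B. weight B * indicator E B / fact (length B)"
  have G: "?G \<in> borel_measurable segM" using E by measurable
  have bd: "\<bar>?G B\<bar> \<le> 1" for B
  proof -
    have "(fact (length B) :: real) \<ge> 1" by (rule fact_ge_1)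
    then have "weight B \<le> fact (length B)" using weight_bounds(2)[of B] by linarith
    then show ?thesis using weight_bounds(1)[of B] by (auto simp: indicator_def divide_le_eq)
  qed
  have "weight B * sort_average (indicator E) B = (\<Sum>\<tau> | \<tau> permutes {..<length B}. ?G (permute_list \<tau> B))" for B
  proof -
    have "sort_average (indicator E) B = (\<Sum>\<tau> | \<tau> permutes {..<length B}. indicator E (permute_list \<tau> B)) / fact (length B)"
      by (rule sort_average_insensitive) (simp add: indicator_def ins)
    then show ?thesis
      by (simp add: sum_distrib_left sum_divide_distrib weight_permute_list)
  qed
  then have "EE n (\<lambda>xs. weight (split_blocks ns xs) * sort_average (indicator E) (split_blocks ns xs)) =
     EE n (\<lambda>xs. \<Sum>\<tau> | \<tau> permutes {..<length ns}. ?G (permute_list \<tau> (split_blocks ns xs)))" for ns by simp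
  then have "\<P>(\<omega> in M. N \<omega> = n \<and> R \<omega> \<in> E) = (1 - q) * q ^ n * (\<Sum>ns\<in>comps n. EE n (\<lambda>xs. ?G (split_blocks ns xs)))"
    unfolding law_symmetric[OF E] by (simp only: law_permuted[OF G bd])
  then show ?thesis using EE_mult[of n "1 / fact (length _)"] by (simp add: EE_def)
qed

end

section \<open>Compound Poisson lists\<close>

lemma prob_bind_pmf:
  "measure_pmf.prob (bind_pmf p f) E = measure_pmf.expectation p (\<lambda>x. measure_pmf.prob (f x) E)"
proof -
  have b: "measure_pmf.prob r E = pmf (map_pmf (\<lambda>x. x \<in> E) r) True" for r
    by (simp add: pmf_map vimage_def)
  show ?thesis unfolding b map_bind_pmf by (rule pmf_bind)
qed

lemma pmf_replicate_pmf:
  "pmf (replicate_pmf k p) ks = (if length ks = k then \<Prod>c\<leftarrow>ks. pmf p c else 0)"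
proof (induction k arbitrary: ks)
  case 0
  then show ?case by (auto simp: pmf_return)
next
  case (Suc k)
  have e: "replicate_pmf (Suc k) p = map_pmf (\<lambda>(x, xs). x # xs) (pair_pmf p (replicate_pmf k p))"
    by (simp add: pair_pmf_def map_bind_pmf)
  show ?case
  proof (cases ks)
    case Nil
    then have "(\<lambda>(x, xs). x # xs) -` {ks} = {}" by auto
    then show ?thesis unfolding e pmf_map using Nil by simp
  next
    case (Cons c cs)
    then have "(\<lambda>(x, xs). x # xs) -` {ks} = {(c, cs)}" by auto
    then show ?thesis unfolding e pmf_map using Cons Suc by (simp add: measure_pmf_single pmf_pair)
  qed
qed

lemma pmf_draw_each:
  "pmf (draw_each f xs) ys = (if length ys = length xs then \<Prod>(x, y)\<leftarrow>zip xs ys. pmf (f x) y else 0)"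
proof (induction xs arbitrary: ys)
  case Nil
  then show ?case by (auto simp: pmf_return)
next
  case (Cons x xs)
  have e: "draw_each f (x # xs) = map_pmf (\<lambda>(y, ys). y # ys) (pair_pmf (f x) (draw_each f xs))"
    by (simp add: pair_pmf_def map_bind_pmf)
  show ?case
  proof (cases ys)
    case Nil
    then have "(\<lambda>(y, ys). y # ys) -` {ys} = {}" by auto
    then show ?thesis unfolding e pmf_map using Nil by simp
  next
    case (Cons c cs)
    then have "(\<lambda>(y, ys). y # ys) -` {ys} = {(c, cs)}" by auto
    then show ?thesis unfolding e pmf_map using Cons Cons.IH by (simp add: measure_pmf_single pmf_pair)
  qed
qed

lemma bind_replicate_draw_each:
  "bind_pmf (replicate_pmf k p) (draw_each f) = replicate_pmf k (bind_pmf p f)"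
proof (induction k)
  case (Suc k)
  have "bind_pmf (replicate_pmf (Suc k) p) (draw_each f) =
     bind_pmf p (\<lambda>x. bind_pmf (replicate_pmf k p) (\<lambda>xs. bind_pmf (f x) (\<lambda>y. bind_pmf (draw_each f xs) (\<lambda>ys. return_pmf (y # ys)))))"
    by (simp add: bind_assoc_pmf bind_return_pmf)
  also have "\<dots> = bind_pmf p (\<lambda>x. bind_pmf (f x) (\<lambda>y. bind_pmf (replicate_pmf k p) (\<lambda>xs. bind_pmf (draw_each f xs) (\<lambda>ys. return_pmf (y # ys)))))"
    by (intro bind_pmf_cong refl bind_commute_pmf)
  also have "\<dots> = bind_pmf (bind_pmf p f) (\<lambda>y. bind_pmf (bind_pmf (replicate_pmf k p) (draw_each f)) (\<lambda>ys. return_pmf (y # ys)))"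
    by (simp add: bind_assoc_pmf)
  finally show ?case using Suc by simp
qed (simp add: bind_return_pmf)

text \<open>
  The part in \<open>A\<close> of a Poisson list of marks with rate \<open>\<theta>\<close> and
  mark law \<open>p\<close>. The case distinction is needed because the conditional law is
  meaningless if \<open>A\<close> is null.
\<close>

definition thinned :: "real \<Rightarrow> 'c pmf \<Rightarrow> 'c set \<Rightarrow> 'c list pmf" where
  "thinned \<theta> p A = (if measure_pmf.prob p A = 0 then return_pmf []
     else bind_pmf (poisson_pmf (\<theta> * measure_pmf.prob p A)) (\<lambda>k. replicate_pmf k (cond_pmf p A)))"

lemma pmf_poisson_replicate:
  assumes "\<mu> > 0"
  shows "pmf (bind_pmf (poisson_pmf \<mu>) (\<lambda>k. replicate_pmf k r)) ks =
     exp (- \<mu>) * \<mu> ^ length ks / fact (length ks) * (\<Prod>c\<leftarrow>ks. pmf r c)"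
proof -
  have "pmf (bind_pmf (poisson_pmf \<mu>) (\<lambda>k. replicate_pmf k r)) ks =
     measure_pmf.expectation (poisson_pmf \<mu>) (\<lambda>k. if length ks = k then \<Prod>c\<leftarrow>ks. pmf r c else 0)"
    unfolding pmf_bind pmf_replicate_pmf ..
  also have "\<dots> = (\<Sum>k\<in>{length ks}. (if length ks = k then \<Prod>c\<leftarrow>ks. pmf r c else 0) * pmf (poisson_pmf \<mu>) k)"
    by (rule integral_measure_pmf_real) (auto split: if_splits)
  finally show ?thesis using assms by simp
qed

lemma set_pmf_nonempty_iff: "measure_pmf.prob p A \<noteq> 0 \<longleftrightarrow> set_pmf p \<inter> A \<noteq> {}"
  using measure_pmf_zero_iff[of p A] by auto

text \<open>
  In this form the mass splits as a product over the marks times $1/k!$, and it holds for null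
  sets as well.
\<close>

lemma pmf_thinned:
  assumes "\<theta> > 0"
  shows "pmf (thinned \<theta> p A) ks = (if set ks \<subseteq> A then exp (- \<theta> * measure_pmf.prob p A) *
     (\<Prod>c\<leftarrow>ks. \<theta> * pmf p c) / fact (length ks) else 0)"
proof (cases "measure_pmf.prob p A = 0")
  case True
  show ?thesis
  proof (cases ks)
    case (Cons c cs)
    then have "pmf p c = 0" if "set ks \<subseteq> A"
      using that True measure_pmf_zero_iff[of p A] by (auto simp: set_pmf_iff)
    then show ?thesis using True Cons by (auto simp: thinned_def pmf_return)
  qed (use True in \<open>simp add: thinned_def\<close>)
next
  case False
  define P where "P = measure_pmf.prob p A"
  have P: "P > 0" using False measure_nonneg[of "measure_pmf p" A] by (simp add: P_def order_less_le)
  have c: "pmf (cond_pmf p A) c = (if c \<in> A then pmf p c / P else 0)" for c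
    using False by (simp add: pmf_cond set_pmf_nonempty_iff P_def)
  have eq1: "(\<theta> * P) ^ length ks * (\<Prod>c\<leftarrow>ks. pmf (cond_pmf p A) c) = (if set ks \<subseteq> A then \<Prod>c\<leftarrow>ks. \<theta> * pmf p c else 0)"
  proof -
    have "(\<theta> * P) ^ length ks * (\<Prod>c\<leftarrow>ks. pmf (cond_pmf p A) c) = (\<Prod>c\<leftarrow>ks. (\<theta> * P) * pmf (cond_pmf p A) c)"
      by (induction ks) (simp_all add: mult_ac)
    also have "(\<lambda>c. (\<theta> * P) * pmf (cond_pmf p A) c) = (\<lambda>c. if c \<in> A then \<theta> * pmf p c else 0)"
      using P by (auto simp: c fun_eq_iff)
    also have "(\<Prod>c\<leftarrow>ks. if c \<in> A then \<theta> * pmf p c else 0) = (if set ks \<subseteq> A then \<Prod>c\<leftarrow>ks. \<theta> * pmf p c else 0)"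
      by (induction ks) auto
    finally show ?thesis .
  qed
  have "pmf (thinned \<theta> p A) ks = exp (- (\<theta> * P)) * (\<theta> * P) ^ length ks / fact (length ks) * (\<Prod>c\<leftarrow>ks. pmf (cond_pmf p A) c)"
    using False P assms unfolding thinned_def P_def[symmetric] by (simp add: pmf_poisson_replicate)
  then have "pmf (thinned \<theta> p A) ks = exp (- (\<theta> * P)) * ((\<theta> * P) ^ length ks * (\<Prod>c\<leftarrow>ks. pmf (cond_pmf p A) c)) / fact (length ks)"
    by simp
  from this[unfolded eq1] show ?thesis by (simp add: P_def)
qed

lemma filter_pair_shuffles:
  assumes "set l1 \<subseteq> A" "set l2 \<inter> A = {}"
  shows "{ks. filter (\<lambda>c. c \<in> A) ks = l1 \<and> filter (\<lambda>c. c \<notin> A) ks = l2} = shuffles l1 l2"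
proof (intro equalityI subsetI)
  fix ks assume "ks \<in> {ks. filter (\<lambda>c. c \<in> A) ks = l1 \<and> filter (\<lambda>c. c \<notin> A) ks = l2}"
  then show "ks \<in> shuffles l1 l2" using partition_in_shuffles[of ks "\<lambda>c. c \<in> A"] by auto
next
  fix ks assume ks: "ks \<in> shuffles l1 l2"
  have "filter P ks \<in> shuffles (filter P l1) (filter P l2)" for P
    using ks filter_shuffles[of P l1 l2] by blast
  moreover have "filter (\<lambda>c. c \<in> A) l1 = l1" "filter (\<lambda>c. c \<in> A) l2 = []"
    "filter (\<lambda>c. c \<notin> A) l1 = []" "filter (\<lambda>c. c \<notin> A) l2 = l2"
    using assms by (auto simp: filter_empty_conv intro!: filter_True)
  ultimately show "ks \<in> {ks. filter (\<lambda>c. c \<in> A) ks = l1 \<and> filter (\<lambda>c. c \<notin> A) ks = l2}"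
    by (metis (mono_tags, lifting) mem_Collect_eq shuffles.simps(1) shuffles.simps(2) singletonD)
qed

text \<open>
  The lists with given parts inside and outside \<open>A\<close> are the shuffles of the two
  parts, of which there are $\binom{k+l}{k}$; this turns $1/(k+l)!$ into $1/(k!\,l!)$.
\<close>

lemma thinned_split:
  assumes l: "\<theta> > 0"
  shows "map_pmf (\<lambda>ks. (filter (\<lambda>c. c \<in> A) ks, filter (\<lambda>c. c \<notin> A) ks)) (thinned \<theta> p B) =
    pair_pmf (thinned \<theta> p (B \<inter> A)) (thinned \<theta> p (B - A))"
proof (rule pmf_eqI)
  fix z :: "'a list \<times> 'a list"
  obtain l1 l2 where z: "z = (l1, l2)" by (cases z)
  let ?P = "measure_pmf.prob p"
  let ?S = "{ks. filter (\<lambda>c. c \<in> A) ks = l1 \<and> filter (\<lambda>c. c \<notin> A) ks = l2}"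
  have v: "(\<lambda>ks. (filter (\<lambda>c. c \<in> A) ks, filter (\<lambda>c. c \<notin> A) ks)) -` {z} = ?S" by (auto simp: z)
  have LHS: "pmf (map_pmf (\<lambda>ks. (filter (\<lambda>c. c \<in> A) ks, filter (\<lambda>c. c \<notin> A) ks)) (thinned \<theta> p B)) z = measure_pmf.prob (thinned \<theta> p B) ?S"
    unfolding pmf_map v ..
  have RHS: "pmf (pair_pmf (thinned \<theta> p (B \<inter> A)) (thinned \<theta> p (B - A))) z = pmf (thinned \<theta> p (B \<inter> A)) l1 * pmf (thinned \<theta> p (B - A)) l2"
    by (simp add: z pmf_pair)
  show "pmf (map_pmf (\<lambda>ks. (filter (\<lambda>c. c \<in> A) ks, filter (\<lambda>c. c \<notin> A) ks)) (thinned \<theta> p B)) z =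
      pmf (pair_pmf (thinned \<theta> p (B \<inter> A)) (thinned \<theta> p (B - A))) z"
  proof (cases "set l1 \<subseteq> A \<and> set l2 \<inter> A = {}")
    case False
    then have S0: "?S = {}" by auto
    have "\<not> set l1 \<subseteq> B \<inter> A \<or> \<not> set l2 \<subseteq> B - A" using False by blast
    then have "pmf (thinned \<theta> p (B \<inter> A)) l1 = 0 \<or> pmf (thinned \<theta> p (B - A)) l2 = 0"
      unfolding pmf_thinned[OF l] by presburger
    then show ?thesis unfolding LHS RHS S0 by auto
  next
    case True
    then have S: "?S = shuffles l1 l2" by (intro filter_pair_shuffles) auto
    have fin: "finite (shuffles l1 l2)" by simp
    define c where "c = (if set l1 \<union> set l2 \<subseteq> B then exp (- \<theta> * ?P B) * ((\<Prod>c\<leftarrow>l1. \<theta> * pmf p c) * (\<Prod>c\<leftarrow>l2. \<theta> * pmf p c)) / fact (length l1 + length l2) else 0)"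
    have "pmf (thinned \<theta> p B) ks = c" if "ks \<in> shuffles l1 l2" for ks
    proof -
      have m: "mset ks = mset l1 + mset l2" using mset_shuffles[OF that] .
      have "(\<Prod>c\<leftarrow>ks. \<theta> * pmf p c) = prod_mset (image_mset (\<lambda>c. \<theta> * pmf p c) (mset ks))"
        by (metis mset_map prod_mset_prod_list)
      also have "\<dots> = (\<Prod>c\<leftarrow>l1. \<theta> * pmf p c) * (\<Prod>c\<leftarrow>l2. \<theta> * pmf p c)"
        unfolding m by (metis (no_types, lifting) image_mset_union mset_map prod_mset_Un prod_mset_prod_list)
      finally show ?thesis
        using set_shuffles[OF that] length_shuffles[OF that] by (simp add: pmf_thinned[OF l] c_def)
    qed
    then have "measure_pmf.prob (thinned \<theta> p B) ?S = real (card (shuffles l1 l2)) * c"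
      unfolding S by (simp add: measure_measure_pmf_finite[OF fin])
    also have "card (shuffles l1 l2) = (length l1 + length l2) choose length l1"
      using True by (intro card_disjoint_shuffles) auto
    also have "real \<dots> = fact (length l1 + length l2) / (fact (length l1) * fact (length l2))"
      by (simp add: binomial_fact)
    also have "\<dots> * c = pmf (thinned \<theta> p (B \<inter> A)) l1 * pmf (thinned \<theta> p (B - A)) l2"
    proof (cases "set l1 \<union> set l2 \<subseteq> B")
      case B: True
      have s: "?P (B \<inter> A) + ?P (B - A) = ?P B"
        by (subst measure_pmf.finite_measure_Union[symmetric]) (auto intro!: arg_cong[where f = ?P])
      have e: "exp (- \<theta> * ?P B) = exp (- \<theta> * ?P (B \<inter> A)) * exp (- \<theta> * ?P (B - A))"
        unfolding s[symmetric] by (simp add: algebra_simps flip: exp_add)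
      have "pmf (thinned \<theta> p (B \<inter> A)) l1 = exp (- \<theta> * ?P (B \<inter> A)) * (\<Prod>c\<leftarrow>l1. \<theta> * pmf p c) / fact (length l1)"
        "pmf (thinned \<theta> p (B - A)) l2 = exp (- \<theta> * ?P (B - A)) * (\<Prod>c\<leftarrow>l2. \<theta> * pmf p c) / fact (length l2)"
        using True B by (subst pmf_thinned[OF l]; auto)+
      moreover have "exp (- (\<theta> * ?P B)) = exp (- (\<theta> * ?P (B \<inter> A))) * exp (- (\<theta> * ?P (B - A)))"
        using e by simp
      ultimately show ?thesis using B by (simp add: c_def)
    next
      case False
      then show ?thesis using True by (auto simp: c_def pmf_thinned[OF l])
    qed
    finally show ?thesis unfolding LHS RHS .
  qed
qed

lemma prob_pair_pmf_times:
  "measure_pmf.prob (pair_pmf p r) {z. fst z \<in> A \<and> snd z \<in> B} = measure_pmf.prob p A * measure_pmf.prob r B"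
proof -
  have "measure_pmf.prob (pair_pmf p r) {z. fst z \<in> A \<and> snd z \<in> B} = measure_pmf.expectation p (\<lambda>x. measure_pmf.prob (map_pmf (Pair x) r) {z. fst z \<in> A \<and> snd z \<in> B})"
    unfolding pair_pmf_def map_pmf_def by (rule prob_bind_pmf[where f = "\<lambda>x. bind_pmf r (\<lambda>y. return_pmf (x, y))", unfolded map_pmf_def])
  also have "\<dots> = measure_pmf.expectation p (\<lambda>x. indicator A x * measure_pmf.prob r B)"
    by (intro Bochner_Integration.integral_cong) (auto simp: indicator_def vimage_def)
  finally show ?thesis by simp
qed

lemma thinned_independent:
  assumes l: "\<theta> > 0" and "finite I" and "disjoint_family_on A I"
  shows "measure_pmf.prob (thinned \<theta> p B) {ks. \<forall>i\<in>I. filter (\<lambda>c. c \<in> A i) ks \<in> E i} =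
    (\<Prod>i\<in>I. measure_pmf.prob (thinned \<theta> p (B \<inter> A i)) (E i))"
  using assms(2,3)
proof (induction I arbitrary: B rule: finite_induct)
  case (insert i I)
  let ?f = "\<lambda>ks. (filter (\<lambda>c. c \<in> A i) ks, filter (\<lambda>c. c \<notin> A i) ks)"
  have d: "disjoint_family_on A I" using insert by (auto simp: disjoint_family_on_def)
  have disj: "A i \<inter> A k = {}" if "k \<in> I" for k
  proof -
    have "i \<noteq> k" using that insert.hyps by auto
    then show ?thesis using disjoint_family_onD[OF insert.prems, of i k] that by simp
  qed
  have f: "filter (\<lambda>c. c \<in> A k) (filter (\<lambda>c. c \<notin> A i) ks) = filter (\<lambda>c. c \<in> A k) ks" if "k \<in> I" for k ks
    using disj[OF that] unfolding filter_filter by (intro filter_cong) auto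
  have "{ks. \<forall>k\<in>insert i I. filter (\<lambda>c. c \<in> A k) ks \<in> E k} =
     ?f -` {z. fst z \<in> E i \<and> snd z \<in> {ks. \<forall>k\<in>I. filter (\<lambda>c. c \<in> A k) ks \<in> E k}}"
    using f by auto
  then have "measure_pmf.prob (thinned \<theta> p B) {ks. \<forall>k\<in>insert i I. filter (\<lambda>c. c \<in> A k) ks \<in> E k} =
     measure_pmf.prob (map_pmf ?f (thinned \<theta> p B)) {z. fst z \<in> E i \<and> snd z \<in> {ks. \<forall>k\<in>I. filter (\<lambda>c. c \<in> A k) ks \<in> E k}}"
    by (simp add: measure_map_pmf)
  also have "\<dots> = measure_pmf.prob (thinned \<theta> p (B \<inter> A i)) (E i) *
      measure_pmf.prob (thinned \<theta> p (B - A i)) {ks. \<forall>k\<in>I. filter (\<lambda>c. c \<in> A k) ks \<in> E k}"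
    unfolding thinned_split[OF l] by (rule prob_pair_pmf_times)
  also have "measure_pmf.prob (thinned \<theta> p (B - A i)) {ks. \<forall>k\<in>I. filter (\<lambda>c. c \<in> A k) ks \<in> E k} =
     (\<Prod>k\<in>I. measure_pmf.prob (thinned \<theta> p ((B - A i) \<inter> A k)) (E k))"
    by (rule insert.IH[OF d])
  also have "\<dots> = (\<Prod>k\<in>I. measure_pmf.prob (thinned \<theta> p (B \<inter> A k)) (E k))"
  proof (rule prod.cong[OF refl])
    fix k assume "k \<in> I"
    then have "(B - A i) \<inter> A k = B \<inter> A k" using disj by blast
    then show "measure_pmf.prob (thinned \<theta> p ((B - A i) \<inter> A k)) (E k) = measure_pmf.prob (thinned \<theta> p (B \<inter> A k)) (E k)" by simp
  qed
  finally show ?case using insert by simp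
qed simp

lemma map_length_thinned:
  assumes l: "\<theta> > 0"
  shows "measure_pmf.prob (thinned \<theta> p A) {ks. length ks = k} =
    (\<theta> * measure_pmf.prob p A) ^ k / fact k * exp (- (\<theta> * measure_pmf.prob p A))"
proof (cases "measure_pmf.prob p A = 0")
  case True
  then show ?thesis by (cases k) (auto simp: thinned_def measure_pmf_single)
next
  case False
  let ?W = "\<theta> * measure_pmf.prob p A"
  have W: "?W > 0" using False l measure_nonneg[of "measure_pmf p" A] by (simp add: order_less_le)
  have "map_pmf length (replicate_pmf m r) = return_pmf m" for m and r :: "'a pmf"
  proof -
    have "map_pmf length (replicate_pmf m r) = map_pmf (\<lambda>_. m) (replicate_pmf m r)"
      by (rule map_pmf_cong) (auto simp: set_replicate_pmf)
    then show ?thesis by simp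
  qed
  then have "map_pmf length (thinned \<theta> p A) = poisson_pmf ?W"
    using False by (simp add: thinned_def map_bind_pmf bind_return_pmf')
  then have "measure_pmf.prob (thinned \<theta> p A) (length -` {k}) = pmf (poisson_pmf ?W) k"
    by (metis measure_map_pmf measure_pmf_single)
  then show ?thesis using W by (simp add: vimage_def)
qed

lemma thinned_UNIV: "thinned \<theta> p UNIV = bind_pmf (poisson_pmf \<theta>) (\<lambda>k. replicate_pmf k p)"
proof -
  have "cond_pmf p UNIV = p"
    by (rule pmf_eqI) (simp add: pmf_cond set_pmf_not_empty)
  then show ?thesis by (simp add: thinned_def)
qed

section \<open>The logarithmic series distribution\<close>

lemma log_series_sums:
  assumes "0 < p" "p < 1"
  shows "log_series_mass p sums 1"
proof -
  have "(\<lambda>n. - ((- (- p)) ^ n) / real n) sums ln (1 + (- p))"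
    by (rule ln_series') (use assms in auto)
  then have "(\<lambda>n. (- (p ^ n) / real n) / ln (1 - p)) sums (ln (1 - p) / ln (1 - p))"
    by (intro sums_divide) simp
  moreover have "ln (1 - p) \<noteq> 0" using assms by simp
  moreover have "(- (p ^ n) / real n) / ln (1 - p) = log_series_mass p n" for n
    by (auto simp: log_series_mass_def)
  ultimately show ?thesis by simp
qed

lemma log_series_nonneg: "0 < p \<Longrightarrow> p < 1 \<Longrightarrow> 0 \<le> log_series_mass p n"
proof -
  assume "0 < p" "p < 1"
  then have "0 \<le> real n * (- ln (1 - p))" by (intro mult_nonneg_nonneg) auto
  then have "0 \<le> - real n * ln (1 - p)" by simp
  then have "0 \<le> p ^ n / (- real n * ln (1 - p))" using \<open>0 < p\<close> by (intro divide_nonneg_nonneg) auto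
  then show ?thesis unfolding log_series_mass_def by (simp only: if_split) simp
qed

definition log_series_pmf :: "real \<Rightarrow> nat pmf" where
  "log_series_pmf p = embed_pmf (log_series_mass p)"

lemma pmf_log_series:
  assumes "0 < p" "p < 1"
  shows "pmf (log_series_pmf p) n = log_series_mass p n"
  unfolding log_series_pmf_def
proof (rule pmf_embed_pmf)
  show "0 \<le> log_series_mass p n" for n by (rule log_series_nonneg[OF assms])
  have "(\<integral>\<^sup>+n. ennreal (log_series_mass p n) \<partial>count_space UNIV) = (\<Sum>n. ennreal (log_series_mass p n))"
    by (rule nn_integral_count_space_nat)
  also have "\<dots> = ennreal 1"
    using log_series_sums[OF assms] log_series_nonneg[OF assms] by (intro suminf_ennreal_eq) auto
  finally show "(\<integral>\<^sup>+n. ennreal (log_series_mass p n) \<partial>count_space UNIV) = 1" by simp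
qed

text \<open>
  With rate $-\log(1-p)$ the normalising constants cancel and the mass is $(1-p)\,p^n/(k!\,\prod
  n_i)$, the law of the randomly ordered cycle lengths of a uniform permutation of geometric
  size.
\<close>

lemma pmf_poisson_log_series:
  assumes "0 < p" "p < 1" "0 \<notin> set ns"
  shows "pmf (bind_pmf (poisson_pmf (- ln (1 - p))) (\<lambda>k. replicate_pmf k (log_series_pmf p))) ns =
    (1 - p) * p ^ sum_list ns / (fact (length ns) * real (prod_list ns))"
proof -
  let ?l = "- ln (1 - p)"
  have l: "?l > 0" using assms by simp
  have "?l ^ length ns * (\<Prod>n\<leftarrow>ns. log_series_mass p n) = p ^ sum_list ns / real (prod_list ns)"
  proof -
    have "?l ^ length ns * (\<Prod>n\<leftarrow>ns. log_series_mass p n) = (\<Prod>n\<leftarrow>ns. ?l * log_series_mass p n)"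
      by (induction ns) (simp_all add: mult_ac)
    also have "\<dots> = (\<Prod>n\<leftarrow>ns. p ^ n / real n)"
      using assms(3) l by (intro arg_cong[where f = prod_list] map_cong refl) (auto simp: log_series_mass_def)
    also have "\<dots> = p ^ sum_list ns / real (prod_list ns)"
      by (induction ns) (simp_all add: power_add)
    finally show ?thesis .
  qed
  note eq = this
  have "pmf (bind_pmf (poisson_pmf ?l) (\<lambda>k. replicate_pmf k (log_series_pmf p))) ns =
     exp (- ?l) * (?l ^ length ns * (\<Prod>n\<leftarrow>ns. log_series_mass p n)) / fact (length ns)"
    unfolding pmf_poisson_replicate[OF l] pmf_log_series[OF assms(1,2)] by simp
  from this[unfolded eq] show ?thesis using assms by simp
qed

section \<open>Weighted laws of marks\<close>

lemma pmf_of_countable_measure: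
  fixes Q :: "'c :: countable measure"
  assumes "prob_space Q" "sets Q = UNIV"
  shows "\<exists>p. measure_pmf p = Q"
proof -
  interpret prob_space Q by fact
  have "(\<Union>x\<in>{x. measure Q {x} = 0}. {x}) \<in> null_sets Q"
    using assms(2) by (intro null_sets_UN') (auto simp: null_sets_def emeasure_eq_measure)
  then have "{x. measure Q {x} = 0} \<in> null_sets Q" by simp
  then have "AE x in Q. measure Q {x} \<noteq> 0" by (rule AE_I') auto
  then have "measure_pmf (Abs_pmf Q) = Q" using assms by (intro Abs_pmf_inverse) auto
  then show ?thesis by metis
qed

context iid_sequence
begin

lemma EE_const: "EE n (\<lambda>_. c) = c"
  by (simp add: EE_def prob_space)

lemma EE_nonneg: "(\<And>xs. 0 \<le> G xs) \<Longrightarrow> 0 \<le> EE n G"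
  unfolding EE_def by (rule Bochner_Integration.integral_nonneg) auto

lemma EE_zero_weight: "EE 0 (\<lambda>b. block_weight b * G b) = 0"
proof -
  have "EE 0 (\<lambda>b. block_weight b * G b) = EE 0 (\<lambda>_. 0)"
    by (rule EE_cong) (simp add: block_weight_def nrot_def)
  then show ?thesis by (simp add: EE_const)
qed

text \<open>
  A density with respect to iid increments, pushed forward to a countable set of marks, is given
  by a probability mass function.
\<close>

lemma weighted_law:
  fixes f :: "real list \<Rightarrow> 'c :: countable"
  assumes [measurable]: "g \<in> borel_measurable listM" "f \<in> listM \<rightarrow>\<^sub>M count_space UNIV"
    and g: "\<And>xs. 0 \<le> g xs" and bd: "\<And>xs. length xs = n \<Longrightarrow> g xs \<le> c" and one: "EE n g = 1"
  shows "\<exists>p. \<forall>E. measure_pmf.prob p E = EE n (\<lambda>xs. g xs * indicator E (f xs))"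
proof -
  let ?x = "\<lambda>\<omega>. Xs \<omega> [0..<n]"
  let ?d = "density M (\<lambda>\<omega>. ennreal (g (?x \<omega>)))"
  let ?Q = "distr ?d (count_space UNIV) (\<lambda>\<omega>. f (?x \<omega>))"
  have int: "integrable M (\<lambda>\<omega>. g (?x \<omega>) * indicator E (f (?x \<omega>)))" for E
  proof -
    have "(\<lambda>xs. g xs * indicator E (f xs)) \<in> borel_measurable listM"
      by (intro borel_measurable_times measurable_compose[OF assms(2)]) auto
    moreover have "\<bar>g b * indicator E (f b)\<bar> \<le> max c 0" if "length b = length [0..<n]" for b
      using g[of b] bd[of b] that by (auto simp: indicator_def)
    ultimately show ?thesis using integrable_Xs by blast
  qed
  have em: "emeasure ?Q E = ennreal (EE n (\<lambda>xs. g xs * indicator E (f xs)))" for E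
  proof -
    have [measurable]: "(\<lambda>\<omega>. f (?x \<omega>)) \<in> M \<rightarrow>\<^sub>M count_space UNIV"
      using measurable_compose[OF measurable_Xs assms(2)] .
    have "emeasure ?Q E = emeasure ?d ((\<lambda>\<omega>. f (?x \<omega>)) -` E \<inter> space M)"
      by (subst emeasure_distr) (auto simp: )
    also have "\<dots> = (\<integral>\<^sup>+\<omega>. ennreal (g (?x \<omega>)) * indicator ((\<lambda>\<omega>. f (?x \<omega>)) -` E \<inter> space M) \<omega> \<partial>M)"
      by (rule emeasure_density) auto
    also have "\<dots> = (\<integral>\<^sup>+\<omega>. ennreal (g (?x \<omega>) * indicator E (f (?x \<omega>))) \<partial>M)"
      by (intro nn_integral_cong) (auto simp: indicator_def)
    also have "\<dots> = ennreal (\<integral>\<omega>. g (?x \<omega>) * indicator E (f (?x \<omega>)) \<partial>M)"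
      using g int by (intro nn_integral_eq_integral) auto
    finally show ?thesis by (simp add: EE_def)
  qed
  have "prob_space ?Q"
  proof
    show "emeasure ?Q (space ?Q) = 1" using em[of UNIV] one by simp
  qed
  then obtain p where p: "measure_pmf p = ?Q"
    using pmf_of_countable_measure[of ?Q] by auto
  have "measure ?Q E = EE n (\<lambda>xs. g xs * indicator E (f xs))" for E
    unfolding measure_def em using g by (intro enn2real_ennreal EE_nonneg) auto
  then show ?thesis unfolding p[symmetric] by blast
qed

text \<open>
  The good rotations of a block have total weight one, and each of the \<open>n\<close>
  rotations preserves the law of the increments.
\<close>

lemma EE_rotation_invariant:
  assumes G: "G \<in> borel_measurable listM" and bd: "\<And>b. length b = n \<Longrightarrow> \<bar>G b\<bar> \<le> c"
    and inv: "\<And>s b. G (rotate s b) = G b" and n: "n > 0"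
  shows "EE n (\<lambda>b. block_weight b * G b) = EE n G / real n"
proof -
  have one: "(\<Sum>s<n. block_weight (rotate s b)) = 1" if "length b = n" for b
  proof -
    have "(\<Sum>s<n. block_weight (rotate s b)) = (\<Sum>s\<in>{s. s < length b \<and> good (rotate s b)}. 1 / real (nrot b))"
      by (rule sum.mono_neutral_cong_right) (use that in \<open>auto simp: block_weight_def nrot_rotate\<close>)
    also have "\<dots> = real (nrot b) / real (nrot b)" by (simp add: nrot_def)
    also have "\<dots> = 1"
    proof -
      have "b \<noteq> []" using that n by auto
      then show ?thesis using nrot_pos[of b] by simp
    qed
    finally show ?thesis .
  qed
  have m: "(\<lambda>b. block_weight b * G b) \<in> borel_measurable listM" using G by measurable
  have "EE n G = EE n (\<lambda>b. \<Sum>s<n. block_weight (rotate s b) * G (rotate s b))"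
  proof (rule EE_cong)
    fix b :: "real list" assume "length b = n"
    then show "G b = (\<Sum>s<n. block_weight (rotate s b) * G (rotate s b))"
      using one[of b] by (simp add: inv flip: sum_distrib_right)
  qed
  also have "\<dots> = (\<Sum>s<n. EE n (\<lambda>b. block_weight (rotate s b) * G (rotate s b)))"
  proof (rule EE_sum[where c = c])
    fix s
    show "(\<lambda>b. block_weight (rotate s b) * G (rotate s b)) \<in> borel_measurable listM"
      using measurable_compose[OF measurable_rotate_listM m] .
    fix b :: "real list" assume "length b = n"
    then have "\<bar>G (rotate s b)\<bar> \<le> c" using bd by (simp add: inv)
    then show "\<bar>block_weight (rotate s b) * G (rotate s b)\<bar> \<le> c"
      using block_weight_bounds[of "rotate s b"] mult_left_le_one_le[of "\<bar>G (rotate s b)\<bar>" "block_weight (rotate s b)"] by (simp add: abs_mult)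
  qed
  also have "\<dots> = (\<Sum>s<n. EE n (\<lambda>b. block_weight b * G b))"
  proof (rule sum.cong[OF refl])
    fix s
    show "EE n (\<lambda>b. block_weight (rotate s b) * G (rotate s b)) = EE n (\<lambda>b. block_weight b * G b)"
      by (rule EE_rearrange[where r' = "rotate s", OF _ _ m]) (auto simp: rotate_map mset_rotate_list)
  qed
  finally show ?thesis using n by simp
qed

lemma EE_block_weight: "n > 0 \<Longrightarrow> EE n block_weight = 1 / real n"
  using EE_rotation_invariant[of "\<lambda>_. 1" n 1] EE_const[of n 1] by simp

text \<open>
  The law of the mark of a segment of length \<open>n\<close>, a block of iid increments having
  the density \<open>n * block_weight\<close> after rotation.
\<close>

definition mark_law :: "(real list \<Rightarrow> 'c :: countable) \<Rightarrow> nat \<Rightarrow> 'c pmf" where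
  "mark_law \<kappa> n = (SOME p. \<forall>E. measure_pmf.prob p E = EE n (\<lambda>b. real n * block_weight b * indicator E (\<kappa> b)))"

lemma mark_law:
  assumes [measurable]: "\<kappa> \<in> listM \<rightarrow>\<^sub>M count_space UNIV" and "n > 0"
  shows "measure_pmf.prob (mark_law \<kappa> n) E = EE n (\<lambda>b. real n * block_weight b * indicator E (\<kappa> b))"
proof -
  have "\<exists>p. \<forall>E. measure_pmf.prob p E = EE n (\<lambda>b. real n * block_weight b * indicator E (\<kappa> b))"
  proof (rule weighted_law[where c = "real n"])
    show "(\<lambda>b. real n * block_weight b) \<in> borel_measurable listM" by measurable
    show "EE n (\<lambda>b. real n * block_weight b) = 1" using EE_block_weight[OF assms(2)] assms(2) by (simp add: EE_mult)
    show "real n * block_weight xs \<le> real n" for xs using block_weight_bounds[of xs] by (simp add: mult_left_le)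
  qed (use block_weight_bounds in auto)
  from someI_ex[OF this] show ?thesis unfolding mark_law_def by blast
qed

text \<open>Consecutive blocks of iid increments are independent.\<close>

lemma EE_blocks_product:
  assumes m: "\<And>i. i < length ns \<Longrightarrow> g i \<in> borel_measurable listM" and bd: "\<And>i b. \<bar>g i b\<bar> \<le> c i"
  shows "EE (sum_list ns) (\<lambda>xs. \<Prod>i<length ns. g i (split_blocks ns xs ! i)) = (\<Prod>i<length ns. EE (ns ! i) (g i))"
  using assms
proof (induction ns arbitrary: g c)
  case Nil
  then show ?case by (simp add: EE_const)
next
  case (Cons a ns)
  have "EE (a + sum_list ns) (\<lambda>xs. g 0 (take a xs) * (\<Prod>i<length ns. g (Suc i) (split_blocks ns (drop a xs) ! i))) =
    EE a (g 0) * EE (sum_list ns) (\<lambda>xs. \<Prod>i<length ns. g (Suc i) (split_blocks ns xs ! i))"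
  proof (rule EE_append)
    show "g 0 \<in> borel_measurable listM" using Cons.prems(1)[of 0] by simp
    show "(\<lambda>xs. \<Prod>i<length ns. g (Suc i) (split_blocks ns xs ! i)) \<in> borel_measurable listM"
      using Cons.prems(1) by (intro borel_measurable_prod measurable_compose[OF measurable_nth_split_blocks]) auto
    show "\<bar>g 0 b\<bar> \<le> c 0" for b by (rule Cons.prems(2))
    show "\<bar>\<Prod>i<length ns. g (Suc i) (split_blocks ns b ! i)\<bar> \<le> (\<Prod>i<length ns. c (Suc i))" for b
      unfolding abs_prod using Cons.prems(2) by (intro prod_mono) auto
  qed
  also have "EE (sum_list ns) (\<lambda>xs. \<Prod>i<length ns. g (Suc i) (split_blocks ns xs ! i)) = (\<Prod>i<length ns. EE (ns ! i) (g (Suc i)))"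
    by (rule Cons.IH[of "\<lambda>i. g (Suc i)" "\<lambda>i. c (Suc i)"]) (use Cons.prems in auto)
  finally show ?case by (simp add: prod.lessThan_Suc_shift del: prod.lessThan_Suc)
qed

lemma weight_nth: "weight B = (\<Prod>i<length B. block_weight (B ! i))"
proof -
  have "weight B = prod_list (map (\<lambda>i. block_weight (B ! i)) [0..<length B])"
    unfolding weight_def by (subst (1) map_nth[of B, symmetric]) (simp add: comp_def del: map_nth)
  also have "\<dots> = (\<Prod>i\<in>set [0..<length B]. block_weight (B ! i))"
    by (rule prod.distinct_set_conv_list[symmetric]) simp
  finally show ?thesis by (simp add: atLeast0LessThan)
qed

lemma prod_list_nth: "real (prod_list ns) = (\<Prod>i<length ns. real (ns ! i))"
proof -
  have "prod_list ns = prod_list (map ((!) ns) [0..<length ns])" by (simp add: map_nth)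
  also have "\<dots> = (\<Prod>i\<in>set [0..<length ns]. ns ! i)"
    by (rule prod.distinct_set_conv_list[symmetric]) simp
  finally show ?thesis by (simp add: atLeast0LessThan)
qed

lemma marks_law:
  assumes k: "\<kappa> \<in> listM \<rightarrow>\<^sub>M count_space UNIV" and ns: "ns \<in> comps n"
  shows "EE n (\<lambda>xs. weight (split_blocks ns xs) * indicator E (map \<kappa> (split_blocks ns xs))) =
     measure_pmf.prob (draw_each (mark_law \<kappa>) ns) E / real (prod_list ns)"
proof -
  note [measurable] = k
  have n: "sum_list ns = n" and pos: "0 \<notin> set ns" using ns by (auto simp: comps_def)
  have nz: "real (prod_list ns) > 0" using pos by (metis of_nat_0_less_iff neq0_conv prod_list_zero_iff)
  have posi: "ns ! i > 0" if "i < length ns" for i using pos that by (metis neq0_conv nth_mem)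
  let ?g = "\<lambda>xs. real (prod_list ns) * weight (split_blocks ns xs)"
  have g: "?g xs = (\<Prod>i<length ns. real (ns ! i) * block_weight (split_blocks ns xs ! i))" for xs
    by (simp add: prod_list_nth weight_nth prod.distrib)
  have mb: "(\<lambda>b. real (ns ! i) * block_weight b) \<in> borel_measurable listM" for i by measurable
  have "EE n ?g = (\<Prod>i<length ns. EE (ns ! i) (\<lambda>b. real (ns ! i) * block_weight b))"
    unfolding g n[symmetric]
    by (rule EE_blocks_product[where c = "\<lambda>i. real (ns ! i)"])
       (use mb block_weight_bounds in \<open>auto simp: abs_mult mult_left_le\<close>)
  also have "\<dots> = 1" using EE_block_weight posi by (intro prod.neutral) (auto simp: EE_mult)
  finally have one: "EE n ?g = 1" .
  have "\<exists>p. \<forall>E. measure_pmf.prob p E = EE n (\<lambda>xs. ?g xs * indicator E (map \<kappa> (split_blocks ns xs)))"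
  proof (rule weighted_law[where c = "real (prod_list ns)"])
    show "(\<lambda>xs. map \<kappa> (split_blocks ns xs)) \<in> listM \<rightarrow>\<^sub>M count_space UNIV"
      by (rule measurable_compose[OF measurable_split_blocks measurable_map_segM[OF k]])
    show "0 \<le> ?g xs" for xs using weight_bounds[of "split_blocks ns xs"] by simp
    show "?g xs \<le> real (prod_list ns)" for xs using weight_bounds[of "split_blocks ns xs"] nz by (simp add: mult_left_le)
  qed (use one in measurable)
  then obtain p where p: "\<And>E. measure_pmf.prob p E = EE n (\<lambda>xs. ?g xs * indicator E (map \<kappa> (split_blocks ns xs)))" by blast
  have "p = draw_each (mark_law \<kappa>) ns"
  proof (rule pmf_eqI)
    fix ks
    show "pmf p ks = pmf (draw_each (mark_law \<kappa>) ns) ks"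
    proof (cases "length ks = length ns")
      case False
      then have "map \<kappa> (split_blocks ns xs) \<noteq> ks" for xs by auto
      then have "pmf p ks = EE n (\<lambda>_. 0)" unfolding measure_pmf_single[symmetric] p by (simp add: indicator_def)
      then show ?thesis using False by (simp add: pmf_draw_each EE_const)
    next
      case True
      have "?g xs * indicator {ks} (map \<kappa> (split_blocks ns xs)) =
          (\<Prod>i<length ns. real (ns ! i) * block_weight (split_blocks ns xs ! i) * indicator {ks ! i} (\<kappa> (split_blocks ns xs ! i)))" for xs
      proof -
        have "indicator {ks} (map \<kappa> (split_blocks ns xs)) = (\<Prod>i<length ns. indicator {ks ! i} (\<kappa> (split_blocks ns xs ! i)) :: real)"
        proof (cases "map \<kappa> (split_blocks ns xs) = ks")
          case True
          then show ?thesis by (auto simp: indicator_def intro!: prod.neutral[symmetric])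
        next
          case False
          then obtain i where "i < length ns" "\<kappa> (split_blocks ns xs ! i) \<noteq> ks ! i"
            using True by (auto simp: list_eq_iff_nth_eq)
          then have "(\<Prod>i<length ns. indicator {ks ! i} (\<kappa> (split_blocks ns xs ! i)) :: real) = 0"
            by (intro prod_zero) (auto simp: indicator_def)
          then show ?thesis using False by simp
        qed
        then show ?thesis unfolding g by (simp add: prod.distrib)
      qed
      then have "pmf p ks = EE (sum_list ns) (\<lambda>xs. \<Prod>i<length ns. (\<lambda>i b. real (ns ! i) * block_weight b * indicator {ks ! i} (\<kappa> b)) i (split_blocks ns xs ! i))"
        unfolding measure_pmf_single[symmetric] p n by simp
      also have "\<dots> = (\<Prod>i<length ns. EE (ns ! i) (\<lambda>b. real (ns ! i) * block_weight b * indicator {ks ! i} (\<kappa> b)))"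
      proof (rule EE_blocks_product[where c = "\<lambda>i. real (ns ! i)"])
        show "(\<lambda>b. real (ns ! i) * block_weight b * indicator {ks ! i} (\<kappa> b)) \<in> borel_measurable listM" for i
          by (intro borel_measurable_times measurable_compose[OF k]) auto
        show "\<bar>real (ns ! i) * block_weight b * indicator {ks ! i} (\<kappa> b)\<bar> \<le> real (ns ! i)" for i b
          using block_weight_bounds[of b] by (auto simp: indicator_def abs_mult mult_left_le)
      qed
      also have "\<dots> = (\<Prod>i<length ns. pmf (mark_law \<kappa> (ns ! i)) (ks ! i))"
        using mark_law[OF k posi] by (intro prod.cong refl) (simp flip: measure_pmf_single)
      also have "\<dots> = pmf (draw_each (mark_law \<kappa>) ns) ks"
      proof -
        have "(\<Prod>(x, y)\<leftarrow>zip ns ks. pmf (mark_law \<kappa> x) y) = prod_list (map (\<lambda>i. pmf (mark_law \<kappa> (ns ! i)) (ks ! i)) [0..<length ns])"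
          by (rule arg_cong[where f = prod_list]) (rule nth_equalityI, use True in auto)
        also have "\<dots> = (\<Prod>i\<in>set [0..<length ns]. pmf (mark_law \<kappa> (ns ! i)) (ks ! i))"
          by (rule prod.distinct_set_conv_list[symmetric]) simp
        finally show ?thesis using True by (simp add: pmf_draw_each atLeast0LessThan)
      qed
      finally show ?thesis .
    qed
  qed
  then have "measure_pmf.prob (draw_each (mark_law \<kappa>) ns) E = EE n (\<lambda>xs. ?g xs * indicator E (map \<kappa> (split_blocks ns xs)))"
    using p by simp
  also have "\<dots> = real (prod_list ns) * EE n (\<lambda>xs. weight (split_blocks ns xs) * indicator E (map \<kappa> (split_blocks ns xs)))"
    by (simp add: mult.assoc EE_mult)
  finally show ?thesis using nz by simp
qed

end

context rearranged_walk
begin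

text \<open>The expected number of segments.\<close>

definition total_rate :: real where "total_rate = - ln (1 - q)"

lemma total_rate_pos: "total_rate > 0"
  using q by (simp add: total_rate_def)

text \<open>The law of the mark of a single segment: its length has the log-series distribution.\<close>

definition segment_law :: "(real list \<Rightarrow> 'c :: countable) \<Rightarrow> 'c pmf" where
  "segment_law \<kappa> = bind_pmf (log_series_pmf q) (mark_law \<kappa>)"

text \<open>
  A sum over lists is arranged by the total of their entries, which is the length of the walk.
\<close>

lemma sums_by_total:
  assumes g: "\<And>ns. 0 \<le> g ns" "\<And>ns. g ns \<le> 1"
    and supp: "set_pmf NS \<subseteq> {ns. 0 \<notin> set ns}"
  shows "(\<lambda>n. \<Sum>ns\<in>comps n. pmf NS ns * g ns) sums measure_pmf.expectation NS g"
proof -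
  have "(\<lambda>n. \<Sum>ns\<in>comps n. pmf NS ns * g ns) = (\<lambda>n. measure_pmf.expectation NS (\<lambda>ns. g ns * indicator {ns. sum_list ns = n} ns))"
  proof
    fix n
    have "measure_pmf.expectation NS (\<lambda>ns. g ns * indicator {ns. sum_list ns = n} ns) =
       (\<Sum>ns\<in>comps n. g ns * indicator {ns. sum_list ns = n} ns * pmf NS ns)"
      by (rule integral_measure_pmf_real[OF finite_comps]) (use supp in \<open>auto simp: comps_def indicator_def split: if_splits\<close>)
    also have "\<dots> = (\<Sum>ns\<in>comps n. pmf NS ns * g ns)" by (rule sum.cong) (auto simp: comps_def)
    finally show "(\<Sum>ns\<in>comps n. pmf NS ns * g ns) = measure_pmf.expectation NS (\<lambda>ns. g ns * indicator {ns. sum_list ns = n} ns)" by simp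
  qed
  moreover have "(\<lambda>n. measure_pmf.expectation NS (\<lambda>ns. g ns * indicator {ns. sum_list ns = n} ns)) sums
     measure_pmf.expectation NS (\<lambda>ns. \<Sum>n. g ns * indicator {ns. sum_list ns = n} ns)"
  proof (rule sums_integral)
    show "integrable NS (\<lambda>ns. g ns * indicator {ns. sum_list ns = n} ns)" for n
      by (rule measure_pmf.integrable_const_bound[of _ 1]) (use g in \<open>auto simp: indicator_def\<close>)
    have fin: "(\<lambda>n. norm (g ns * indicator {ns. sum_list ns = n} ns)) sums g ns" for ns
    proof -
      have "(\<lambda>n. norm (g ns * indicator {ns. sum_list ns = n} ns)) = (\<lambda>n. if n = sum_list ns then g ns else 0)"
        by (rule ext) (use g(1)[of ns] in \<open>simp add: indicator_def\<close>)
      then show ?thesis using sums_single[of "sum_list ns" "\<lambda>_. g ns"] by simp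
    qed
    show "AE ns in NS. summable (\<lambda>n. norm (g ns * indicator {ns. sum_list ns = n} ns))"
      using fin by (auto simp: sums_iff)
    have "summable (\<lambda>n. measure_pmf.prob NS {ns. sum_list ns = n})"
    proof -
      have "(\<lambda>n. measure_pmf.prob NS {ns. sum_list ns = n}) sums measure_pmf.prob NS (\<Union>n. {ns. sum_list ns = n})"
        by (rule measure_pmf.finite_measure_UNION) (auto simp: disjoint_family_on_def)
      then show ?thesis by (rule sums_summable)
    qed
    then show "summable (\<lambda>n. measure_pmf.expectation NS (\<lambda>ns. norm (g ns * indicator {ns. sum_list ns = n} ns)))"
    proof (rule summable_comparison_test'[where N = 0])
      fix n :: nat
      have "measure_pmf.expectation NS (\<lambda>ns. norm (g ns * indicator {ns. sum_list ns = n} ns)) \<le> measure_pmf.expectation NS (indicator {ns. sum_list ns = n})"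
        by (intro integral_mono measure_pmf.integrable_const_bound[of _ 1]) (use g in \<open>auto simp: indicator_def\<close>)
      then show "norm (measure_pmf.expectation NS (\<lambda>ns. norm (g ns * indicator {ns. sum_list ns = n} ns))) \<le> measure_pmf.prob NS {ns. sum_list ns = n}"
        by simp
    qed
  qed
  moreover have "(\<Sum>n. g ns * indicator {ns. sum_list ns = n} ns) = g ns" for ns
  proof -
    have "(\<lambda>n. g ns * indicator {ns. sum_list ns = n} ns) = (\<lambda>n. if n = sum_list ns then g ns else 0)"
      by (rule ext) (simp add: indicator_def)
    then show ?thesis using sums_single[of "sum_list ns" "\<lambda>_. g ns"] by (simp add: sums_iff)
  qed
  ultimately show ?thesis by simp
qed

lemma measurable_R [measurable]: "R \<in> M \<rightarrow>\<^sub>M segM"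
proof (rule measurableI)
  fix E assume E: "E \<in> sets segM"
  have "R -` E \<inter> space M = (\<Union>n. \<Union>p\<in>{p. p permutes {..<n}}. \<Union>c\<in>choices (cycle_lengths n p). {\<omega>\<in>space M. N \<omega> = n \<and> perm \<omega> = p \<and> choice \<omega> = c \<and>
        rearrange (cycle_lengths n p) (Xs \<omega> [0..<n]) c \<in> E})"
  proof (intro equalityI subsetI)
    fix \<omega> assume w: "\<omega> \<in> R -` E \<inter> space M"
    then have "perm \<omega> permutes {..<N \<omega>}" "choice \<omega> \<in> choices (cycle_lengths (N \<omega>) (perm \<omega>))"
      using perm_permutes[of \<omega>] subsetD[OF admissible_subset_choices choice_admissible[of \<omega>]] by auto
    then show "\<omega> \<in> (\<Union>n. \<Union>p\<in>{p. p permutes {..<n}}. \<Union>c\<in>choices (cycle_lengths n p). {\<omega>\<in>space M. N \<omega> = n \<and> perm \<omega> = p \<and> choice \<omega> = c \<and>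
        rearrange (cycle_lengths n p) (Xs \<omega> [0..<n]) c \<in> E})"
      using w by (auto simp: R_eq)
  qed (auto simp: R_eq)
  also have "\<dots> \<in> events"
  proof (intro sets.countable_UN sets.finite_UN image_subsetI finite_permutations finite_choices)
    fix n p c assume "c \<in> choices (cycle_lengths n p)"
    from measurable_compose[OF measurable_Xs[of "[0..<n]"] measurable_rearrange[OF this]]
    have [measurable]: "(\<lambda>\<omega>. rearrange (cycle_lengths n p) (Xs \<omega> [0..<n]) c) \<in> M \<rightarrow>\<^sub>M segM" .
    show "{\<omega>\<in>space M. N \<omega> = n \<and> perm \<omega> = p \<and> choice \<omega> = c \<and> rearrange (cycle_lengths n p) (Xs \<omega> [0..<n]) c \<in> E} \<in> events"
      using E by measurable
  qed auto
  finally show "R -` E \<inter> space M \<in> events" .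
qed simp

text \<open>
  The geometric weight and the weights of law_insensitive combine to the mass of a Poisson
  number of log-series lengths, and given the lengths the marks are independent.
\<close>

theorem law_marks:
  fixes \<kappa> :: "real list \<Rightarrow> 'c :: countable"
  assumes k: "\<kappa> \<in> listM \<rightarrow>\<^sub>M count_space UNIV"
    and ins: "\<And>bs. map \<kappa> (sort_means bs) \<in> E \<longleftrightarrow> map \<kappa> bs \<in> E"
  shows "\<P>(\<omega> in M. map \<kappa> (R \<omega>) \<in> E) = measure_pmf.prob (thinned total_rate (segment_law \<kappa>) UNIV) E"
proof -
  define NS where "NS = bind_pmf (poisson_pmf total_rate) (\<lambda>k. replicate_pmf k (log_series_pmf q))"
  let ?E = "{bs. map \<kappa> bs \<in> E}"
  have E: "?E \<in> sets segM"
    using measurable_sets[OF measurable_map_segM[OF k], of E] by (simp add: vimage_def)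
  have pNS: "pmf NS ns = (1 - q) * q ^ sum_list ns / (fact (length ns) * real (prod_list ns))" if "0 \<notin> set ns" for ns
    using pmf_poisson_log_series[OF q that] by (simp add: NS_def total_rate_def)
  have supp: "set_pmf NS \<subseteq> {ns. 0 \<notin> set ns}"
  proof -
    have "0 \<notin> set_pmf (log_series_pmf q)" using pmf_log_series[OF q, of 0] by (simp add: set_pmf_iff log_series_mass_def)
    then show ?thesis unfolding NS_def by (auto simp: set_replicate_pmf)
  qed
  have law: "thinned total_rate (segment_law \<kappa>) UNIV = bind_pmf NS (draw_each (mark_law \<kappa>))"
    by (simp add: thinned_UNIV segment_law_def NS_def bind_assoc_pmf bind_replicate_draw_each)
  have "\<P>(\<omega> in M. N \<omega> = n \<and> R \<omega> \<in> ?E) = (\<Sum>ns\<in>comps n. pmf NS ns * measure_pmf.prob (draw_each (mark_law \<kappa>) ns) E)" for n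
  proof -
    have "\<P>(\<omega> in M. N \<omega> = n \<and> R \<omega> \<in> ?E) = (1 - q) * q ^ n *
       (\<Sum>ns\<in>comps n. EE n (\<lambda>xs. weight (split_blocks ns xs) * indicator ?E (split_blocks ns xs)) / fact (length ns))"
      by (rule law_insensitive[OF E]) (use ins in simp)
    also have "\<dots> = (\<Sum>ns\<in>comps n. (1 - q) * q ^ n * (EE n (\<lambda>xs. weight (split_blocks ns xs) * indicator E (map \<kappa> (split_blocks ns xs))) / fact (length ns)))"
      by (simp add: sum_distrib_left indicator_def)
    also have "\<dots> = (\<Sum>ns\<in>comps n. pmf NS ns * measure_pmf.prob (draw_each (mark_law \<kappa>) ns) E)"
    proof (rule sum.cong[OF refl])
      fix ns assume ns: "ns \<in> comps n"
      then have "0 \<notin> set ns" "sum_list ns = n" by (auto simp: comps_def)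
      then show "(1 - q) * q ^ n * (EE n (\<lambda>xs. weight (split_blocks ns xs) * indicator E (map \<kappa> (split_blocks ns xs))) / fact (length ns))
         = pmf NS ns * measure_pmf.prob (draw_each (mark_law \<kappa>) ns) E"
        unfolding marks_law[OF k ns] pNS[OF \<open>0 \<notin> set ns\<close>] by simp
    qed
    finally show ?thesis .
  qed
  then have "(\<lambda>n. \<P>(\<omega> in M. N \<omega> = n \<and> R \<omega> \<in> ?E)) sums measure_pmf.expectation NS (\<lambda>ns. measure_pmf.prob (draw_each (mark_law \<kappa>) ns) E)"
    using sums_by_total[OF _ _ supp, of "\<lambda>ns. measure_pmf.prob (draw_each (mark_law \<kappa>) ns) E"] by simp
  moreover have "(\<lambda>n. \<P>(\<omega> in M. N \<omega> = n \<and> R \<omega> \<in> ?E)) sums \<P>(\<omega> in M. R \<omega> \<in> ?E)"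
  proof -
    have "(\<lambda>n. prob {\<omega>\<in>space M. N \<omega> = n \<and> R \<omega> \<in> ?E}) sums prob (\<Union>n. {\<omega>\<in>space M. N \<omega> = n \<and> R \<omega> \<in> ?E})"
    proof (rule finite_measure_UNION)
      show "range (\<lambda>n. {\<omega>\<in>space M. N \<omega> = n \<and> R \<omega> \<in> ?E}) \<subseteq> events"
      proof (intro image_subsetI)
        fix n
        have [measurable]: "Measurable.pred M (\<lambda>\<omega>. R \<omega> \<in> ?E)"
          using measurable_sets[OF measurable_R E] by (simp add: pred_def vimage_def Int_def conj_commute)
        show "{\<omega>\<in>space M. N \<omega> = n \<and> R \<omega> \<in> ?E} \<in> events" by measurable
      qed
    qed (auto simp: disjoint_family_on_def)
    also have "(\<Union>n. {\<omega>\<in>space M. N \<omega> = n \<and> R \<omega> \<in> ?E}) = {\<omega>\<in>space M. R \<omega> \<in> ?E}" by auto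
    finally show ?thesis .
  qed
  ultimately have "\<P>(\<omega> in M. R \<omega> \<in> ?E) = measure_pmf.expectation NS (\<lambda>ns. measure_pmf.prob (draw_each (mark_law \<kappa>) ns) E)"
    by (rule sums_unique2[symmetric])
  then show ?thesis unfolding law prob_bind_pmf by simp
qed

text \<open>
  The intensity of the segments whose mark lies in \<open>A\<close>, arranged by their length.
\<close>

lemma rate_sums:
  fixes \<kappa> :: "real list \<Rightarrow> 'c :: countable"
  assumes k: "\<kappa> \<in> listM \<rightarrow>\<^sub>M count_space UNIV"
  shows "(\<lambda>n. q ^ n * EE n (\<lambda>b. block_weight b * indicator A (\<kappa> b))) sums (total_rate * measure_pmf.prob (segment_law \<kappa>) A)"
proof -
  have z: "EE 0 (\<lambda>b. block_weight b * indicator A (\<kappa> b)) = 0" by (rule EE_zero_weight)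
  have t: "total_rate * (pmf (log_series_pmf q) n * measure_pmf.prob (mark_law \<kappa> n) A) = q ^ n * EE n (\<lambda>b. block_weight b * indicator A (\<kappa> b))" for n
  proof (cases "n = 0")
    case True
    then show ?thesis using z by (simp add: pmf_log_series[OF q] log_series_mass_def)
  next
    case False
    then have "measure_pmf.prob (mark_law \<kappa> n) A = real n * EE n (\<lambda>b. block_weight b * indicator A (\<kappa> b))"
      using mark_law[OF k, of n A] by (simp add: mult.assoc EE_mult)
    moreover have "ln (1 - q) \<noteq> 0" using q by simp
    ultimately show ?thesis using False by (simp add: pmf_log_series[OF q] log_series_mass_def total_rate_def field_simps)
  qed
  have "(\<lambda>n. pmf (log_series_pmf q) n * measure_pmf.prob (mark_law \<kappa> n) A) sums measure_pmf.expectation (log_series_pmf q) (\<lambda>n. measure_pmf.prob (mark_law \<kappa> n) A)"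
  proof -
    have i: "integrable (log_series_pmf q) (\<lambda>n. measure_pmf.prob (mark_law \<kappa> n) A)"
      by (rule measure_pmf.integrable_const_bound[of _ 1]) auto
    have "measure_pmf.expectation (log_series_pmf q) (\<lambda>n. measure_pmf.prob (mark_law \<kappa> n) A) =
       (\<integral>n. pmf (log_series_pmf q) n * measure_pmf.prob (mark_law \<kappa> n) A \<partial>count_space UNIV)"
      by (simp add: measure_pmf_eq_density integral_density)
    moreover have "integrable (count_space UNIV) (\<lambda>n. pmf (log_series_pmf q) n * measure_pmf.prob (mark_law \<kappa> n) A)"
      using i by (simp add: measure_pmf_eq_density integrable_density)
    ultimately show ?thesis by (simp only: sums_integral_count_space_nat)
  qed
  then have "(\<lambda>n. pmf (log_series_pmf q) n * measure_pmf.prob (mark_law \<kappa> n) A) sums measure_pmf.prob (segment_law \<kappa>) A"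
    by (simp add: segment_law_def prob_bind_pmf)
  from sums_mult[OF this, of total_rate] show ?thesis unfolding t .
qed

end

section \<open>Excursions of one slope\<close>

lemma expectation_bind_bounded:
  fixes f :: "'b \<Rightarrow> real"
  assumes "\<And>x. \<bar>f x\<bar> \<le> 1"
  shows "measure_pmf.expectation (bind_pmf p r) f = measure_pmf.expectation p (\<lambda>x. measure_pmf.expectation (r x) f)"
proof -
  have b: "0 \<le> f x + 1" "f x + 1 \<le> 2" for x using assms[of x] by (auto simp: abs_le_iff)
  have i: "integrable (measure_pmf s) f" for s
    by (rule measure_pmf.integrable_const_bound[of _ 1]) (use assms in auto)
  have e: "measure_pmf.expectation s f = measure_pmf.expectation s (\<lambda>x. f x + 1) - 1" for s
    using i[of s] by (subst Bochner_Integration.integral_add) auto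
  have n: "ennreal (measure_pmf.expectation s (\<lambda>x. f x + 1)) = (\<integral>\<^sup>+x. ennreal (f x + 1) \<partial>measure_pmf s)" for s
    using i[of s] b by (intro nn_integral_eq_integral[symmetric]) auto
  have bd: "0 \<le> measure_pmf.expectation s (\<lambda>x. f x + 1)" "measure_pmf.expectation s (\<lambda>x. f x + 1) \<le> 2" for s
  proof -
    show "0 \<le> measure_pmf.expectation s (\<lambda>x. f x + 1)" using b by (intro Bochner_Integration.integral_nonneg) auto
    have "measure_pmf.expectation s (\<lambda>x. f x + 1) \<le> measure_pmf.expectation s (\<lambda>x. 2)"
      using b i[of s] by (intro integral_mono) auto
    then show "measure_pmf.expectation s (\<lambda>x. f x + 1) \<le> 2" by simp
  qed
  have i2: "integrable (measure_pmf p) (\<lambda>x. measure_pmf.expectation (r x) (\<lambda>y. f y + 1))"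
    by (rule measure_pmf.integrable_const_bound[of _ 2]) (use bd in auto)
  have "ennreal (measure_pmf.expectation (bind_pmf p r) (\<lambda>x. f x + 1)) = (\<integral>\<^sup>+x. \<integral>\<^sup>+y. ennreal (f y + 1) \<partial>measure_pmf (r x) \<partial>measure_pmf p)"
    unfolding n by (rule nn_integral_bind_pmf)
  also have "\<dots> = (\<integral>\<^sup>+x. ennreal (measure_pmf.expectation (r x) (\<lambda>y. f y + 1)) \<partial>measure_pmf p)" unfolding n ..
  also have "\<dots> = ennreal (measure_pmf.expectation p (\<lambda>x. measure_pmf.expectation (r x) (\<lambda>y. f y + 1)))"
    using bd i2 by (intro nn_integral_eq_integral) auto
  finally have "measure_pmf.expectation (bind_pmf p r) (\<lambda>x. f x + 1) = measure_pmf.expectation p (\<lambda>x. measure_pmf.expectation (r x) (\<lambda>y. f y + 1))"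
    using bd by (subst (asm) ennreal_inj) (auto intro!: Bochner_Integration.integral_nonneg)
  moreover have "measure_pmf.expectation p (\<lambda>x. measure_pmf.expectation (r x) (\<lambda>y. f y + 1)) - 1 = measure_pmf.expectation p (\<lambda>x. measure_pmf.expectation (r x) (\<lambda>y. f y + 1) - 1)"
    using i2 by (subst Bochner_Integration.integral_diff) auto
  ultimately show ?thesis unfolding e by simp
qed

lemma expectation_replicate_power:
  fixes z :: real
  assumes "\<bar>z\<bar> \<le> 1"
  shows "measure_pmf.expectation (replicate_pmf m p) (\<lambda>l. z ^ sum_list l) = (measure_pmf.expectation p (\<lambda>i. z ^ i)) ^ m"
proof (induction m)
  case (Suc m)
  have b: "\<bar>z ^ k\<bar> \<le> 1" for k using assms by (simp add: power_abs power_le_one)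
  have "measure_pmf.expectation (replicate_pmf (Suc m) p) (\<lambda>l. z ^ sum_list l) =
     measure_pmf.expectation p (\<lambda>x. measure_pmf.expectation (replicate_pmf m p) (\<lambda>xs. z ^ x * z ^ sum_list xs))"
    using b by (simp add: expectation_bind_bounded power_add)
  then show ?case using Suc by simp
qed simp

lemma expectation_nat_sums:
  fixes f :: "nat \<Rightarrow> real"
  assumes "\<And>n. \<bar>f n\<bar> \<le> 1"
  shows "(\<lambda>n. pmf p n * f n) sums measure_pmf.expectation p f"
proof -
  have i: "integrable (measure_pmf p) f"
    by (rule measure_pmf.integrable_const_bound[of _ 1]) (use assms in auto)
  have "measure_pmf.expectation p f = (\<integral>n. pmf p n * f n \<partial>count_space UNIV)"
    by (simp add: measure_pmf_eq_density integral_density)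
  moreover have "integrable (count_space UNIV) (\<lambda>n. pmf p n * f n)"
    using i by (simp add: measure_pmf_eq_density integrable_density)
  ultimately show ?thesis by (simp only: sums_integral_count_space_nat)
qed

lemma log_sums:
  assumes "\<bar>x\<bar> < (1::real)"
  shows "(\<lambda>n. x ^ n / real n) sums (- ln (1 - x))"
proof -
  have "(\<lambda>n. - ((- (- x)) ^ n) / real n) sums ln (1 + (- x))"
    by (rule ln_series') (use assms in auto)
  from sums_minus[OF this] show ?thesis by simp
qed

text \<open>
  A law on lists whose mass is a product over the entries divided by the length is a log-series
  number of independent entries. The total mass \<open>F\<close> of one entry is determined by
  $\mu = \sum_m F^m/m = -\log(1-F)$.
\<close>

locale product_list_law =
  fixes L :: "nat list pmf" and a :: "nat \<Rightarrow> real" and \<mu> :: real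
  assumes mu: "\<mu> > 0" and a_nonneg: "\<And>i. a i \<ge> 0"
    and mass: "\<And>l. \<mu> * pmf L l = (\<Prod>i\<leftarrow>l. a i) / real (length l)"
begin

definition F :: real where "F = (\<Sum>i. a i)"

lemma a_sums: "a sums F"
proof -
  have e: "a = (\<lambda>i. \<mu> * measure_pmf.prob L {[i]})" using mass[of "[_]"] by (auto simp: fun_eq_iff measure_pmf_single)
  have "(\<lambda>i. measure_pmf.prob L {[i]}) sums measure_pmf.prob L (\<Union>i. {[i]})"
    by (rule measure_pmf.finite_measure_UNION) (auto simp: disjoint_family_on_def)
  then have "summable a" unfolding e by (intro summable_mult) (rule sums_summable)
  then show ?thesis by (simp add: F_def summable_sums)
qed

lemma F_pos: "F > 0"
proof (rule ccontr)
  assume "\<not> F > 0"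
  moreover have "F \<ge> 0" using a_sums a_nonneg by (metis sums_le sums_zero)
  ultimately have "a sums 0" using a_sums by simp
  then have "a i = 0" for i
    using a_nonneg suminf_eq_zero_iff[of a] by (auto simp: sums_iff)
  then have "pmf L l = 0" for l
    using mass[of l] mu by (cases l) auto
  then have "set_pmf L = {}" by (auto simp: set_pmf_eq)
  then show False using set_pmf_not_empty by blast
qed

definition P :: "nat pmf" where "P = embed_pmf (\<lambda>i. a i / F)"

lemma pmf_P: "pmf P i = a i / F"
  unfolding P_def
proof (rule pmf_embed_pmf)
  show "0 \<le> a i / F" for i using a_nonneg F_pos by simp
  have "(\<lambda>i. a i / F) sums (F / F)" by (rule sums_divide[OF a_sums])
  then have "(\<Sum>i. ennreal (a i / F)) = ennreal 1"
    using a_nonneg F_pos by (intro suminf_ennreal_eq) auto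
  then show "(\<integral>\<^sup>+i. ennreal (a i / F) \<partial>count_space UNIV) = 1"
    by (simp add: nn_integral_count_space_nat)
qed

lemma pmf_L: "pmf L l = F ^ length l / (real (length l) * \<mu>) * pmf (replicate_pmf (length l) P) l"
proof -
  have "(\<Prod>i\<leftarrow>l. a i) = F ^ length l * (\<Prod>i\<leftarrow>l. pmf P i)"
    using F_pos by (induction l) (auto simp: pmf_P)
  then have "\<mu> * pmf L l = F ^ length l / real (length l) * (\<Prod>i\<leftarrow>l. pmf P i)" using mass[of l] by simp
  then have "\<mu> * pmf L l / \<mu> = F ^ length l / real (length l) * (\<Prod>i\<leftarrow>l. pmf P i) / \<mu>" by simp
  then have "pmf L l = F ^ length l / real (length l) * (\<Prod>i\<leftarrow>l. pmf P i) / \<mu>" using mu by simp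
  then show ?thesis by (simp add: pmf_replicate_pmf)
qed

lemma prob_length: "measure_pmf.prob L {l. length l = m} = F ^ m / (real m * \<mu>)"
proof -
  have "measure_pmf.prob L {l. length l = m} = infsetsum (pmf L) {l. length l = m}"
    by (rule measure_pmf_conv_infsetsum)
  also have "\<dots> = infsetsum (\<lambda>l. F ^ m / (real m * \<mu>) * pmf (replicate_pmf m P) l) {l. length l = m}"
    by (rule infsetsum_cong) (auto simp: pmf_L)
  also have "\<dots> = F ^ m / (real m * \<mu>) * measure_pmf.prob (replicate_pmf m P) {l. length l = m}"
    unfolding measure_pmf_conv_infsetsum by (rule infsetsum_cmult_right) (auto intro: pmf_abs_summable)
  also have "measure_pmf.prob (replicate_pmf m P) {l. length l = m} = 1"
    by (rule measure_pmf.prob_eq_1[THEN iffD2]) (auto simp: AE_measure_pmf_iff set_replicate_pmf)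
  finally show ?thesis by simp
qed

lemma F_power_sums: "(\<lambda>m. F ^ m / real m) sums \<mu>"
proof -
  have "(\<lambda>m. measure_pmf.prob L {l. length l = m}) sums measure_pmf.prob L (\<Union>m. {l. length l = m})"
    by (rule measure_pmf.finite_measure_UNION) (auto simp: disjoint_family_on_def)
  moreover have "(\<Union>m. {l :: nat list. length l = m}) = UNIV" by auto
  ultimately have "(\<lambda>m. F ^ m / (real m * \<mu>)) sums 1" by (simp add: prob_length)
  from sums_mult[OF this, of \<mu>] show ?thesis using mu by simp
qed

lemma F_less_1: "F < 1"
proof (rule ccontr)
  assume "\<not> F < 1"
  then have "1 \<le> F ^ m" for m by (simp add: one_le_power)
  then have "1 / real m \<le> F ^ m / real m" for m by (rule divide_right_mono) simp
  then have a: "norm (1 / real m) \<le> F ^ m / real m" for m by simp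
  have "summable (\<lambda>m. F ^ m / real m)" using F_power_sums by (rule sums_summable)
  then have "summable (\<lambda>m. 1 / real m)" by (rule summable_comparison_test'[where N = 0]) (rule a)
  then show False using not_summable_harmonic[where ?'a = real] by (simp add: inverse_eq_divide)
qed

lemma mu_eq: "\<mu> = - ln (1 - F)"
  using F_power_sums log_sums[of F] F_pos F_less_1 by (auto intro: sums_unique2)

lemma F_eq: "F = 1 - exp (- \<mu>)"
  using mu_eq F_less_1 by simp

lemma L_eq: "L = bind_pmf (log_series_pmf F) (\<lambda>m. replicate_pmf m P)"
proof (rule pmf_eqI)
  fix l
  have "pmf (bind_pmf (log_series_pmf F) (\<lambda>m. replicate_pmf m P)) l =
     (\<Sum>m\<in>{length l}. pmf (replicate_pmf m P) l * pmf (log_series_pmf F) m)"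
    unfolding pmf_bind by (rule integral_measure_pmf_real) (auto simp: pmf_replicate_pmf split: if_splits)
  also have "\<dots> = pmf L l"
    using F_pos F_less_1 by (simp add: pmf_L pmf_log_series log_series_mass_def mu_eq)
  finally show "pmf L l = pmf (bind_pmf (log_series_pmf F) (\<lambda>m. replicate_pmf m P)) l" by simp
qed

lemma map_length_L: "map_pmf length L = log_series_pmf F"
proof -
  have "map_pmf length (replicate_pmf m P) = return_pmf m" for m
  proof -
    have "map_pmf length (replicate_pmf m P) = map_pmf (\<lambda>_. m) (replicate_pmf m P)"
      by (rule map_pmf_cong) (auto simp: set_replicate_pmf)
    then show ?thesis by simp
  qed
  then show ?thesis unfolding L_eq map_bind_pmf by (simp add: bind_return_pmf')
qed

text \<open>
  Applying the relation between \<open>F\<close> and \<open>\<mu>\<close> to the entries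
  weighted by powers of \<open>z\<close>.
\<close>

lemma generating_function:
  assumes z: "\<bar>z\<bar> \<le> 1"
  shows "measure_pmf.expectation P (\<lambda>i. z ^ i) = (1 - exp (- (\<mu> * measure_pmf.expectation L (\<lambda>l. z ^ sum_list l)))) / F"
proof -
  let ?G = "measure_pmf.expectation P (\<lambda>i. z ^ i)"
  have b: "\<bar>z ^ k\<bar> \<le> 1" for k using z by (simp add: power_abs power_le_one)
  have G: "\<bar>?G\<bar> \<le> 1"
  proof -
    have "\<bar>?G\<bar> \<le> measure_pmf.expectation P (\<lambda>i. \<bar>z ^ i\<bar>)" by (rule integral_abs_bound)
    also have "\<dots> \<le> measure_pmf.expectation P (\<lambda>i. 1)"
      using b by (intro integral_mono measure_pmf.integrable_const_bound[of _ 1]) auto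
    finally show ?thesis by simp
  qed
  have "measure_pmf.expectation L (\<lambda>l. z ^ sum_list l) = measure_pmf.expectation (log_series_pmf F) (\<lambda>m. ?G ^ m)"
    unfolding L_eq using b by (simp add: expectation_bind_bounded expectation_replicate_power[OF z])
  moreover have "(\<lambda>m. pmf (log_series_pmf F) m * ?G ^ m) sums measure_pmf.expectation (log_series_pmf F) (\<lambda>m. ?G ^ m)"
    by (rule expectation_nat_sums) (use G in \<open>simp add: power_abs power_le_one\<close>)
  ultimately have "(\<lambda>m. \<mu> * (pmf (log_series_pmf F) m * ?G ^ m)) sums (\<mu> * measure_pmf.expectation L (\<lambda>l. z ^ sum_list l))"
    by (simp add: sums_mult)
  moreover have "\<mu> * (pmf (log_series_pmf F) m * ?G ^ m) = (F * ?G) ^ m / real m" for m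
    using F_pos F_less_1 mu by (auto simp: pmf_log_series log_series_mass_def mu_eq[symmetric] power_mult_distrib)
       (simp add: mu_eq)
  moreover have FG: "\<bar>F * ?G\<bar> < 1"
  proof -
    have "\<bar>F * ?G\<bar> = F * \<bar>?G\<bar>" using F_pos by (simp add: abs_mult)
    also have "\<dots> \<le> F * 1" using F_pos G by (intro mult_left_mono) auto
    finally show ?thesis using F_less_1 by simp
  qed
  ultimately have "\<mu> * measure_pmf.expectation L (\<lambda>l. z ^ sum_list l) = - ln (1 - F * ?G)"
    using log_sums[OF FG] by (auto intro: sums_unique2)
  then have "exp (- (\<mu> * measure_pmf.expectation L (\<lambda>l. z ^ sum_list l))) = 1 - F * ?G"
    using FG by (simp add: abs_less_iff)
  then show ?thesis using F_pos by simp
qed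

end

lemma map_replicate_pmf: "map_pmf (map f) (replicate_pmf k p) = replicate_pmf k (map_pmf f p)"
proof (induction k)
  case (Suc k)
  have "map_pmf (map f) (replicate_pmf (Suc k) p) = bind_pmf p (\<lambda>x. bind_pmf (map_pmf (map f) (replicate_pmf k p)) (\<lambda>xs. return_pmf (f x # xs)))"
    by (simp add: map_bind_pmf bind_map_pmf)
  then show ?case unfolding Suc by (simp add: bind_map_pmf)
qed simp

context iid_sequence
begin

lemma EE_indicator_sum:
  assumes "{s. Q s} \<in> sets borel"
  shows "EE n (\<lambda>b. indicator {b. Q (sum_list b)} b) = \<P>(\<omega> in M. Q (partial_sum X n \<omega>))"
proof -
  have s: "sum_list (Xs \<omega> [0..<n]) = partial_sum X n \<omega>" for \<omega>
    by (simp add: Xs_def partial_sum_def interv_sum_list_conv_sum_set_nat atLeast0LessThan)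
  have "EE n (\<lambda>b. indicator {b. Q (sum_list b)} b) = (\<integral>\<omega>. indicator {\<omega>\<in>space M. Q (partial_sum X n \<omega>)} \<omega> \<partial>M)"
    unfolding EE_def by (rule Bochner_Integration.integral_cong) (auto simp: indicator_def s)
  then show ?thesis by (simp add: Int_absorb2)
qed

end

context rearranged_walk
begin

text \<open>
  The mark of a segment records which atom is its slope, if any, the lengths of its excursions,
  and in which of the sets \<open>B i\<close> the pair of its length and increment lies. It
  takes countably many values.
\<close>

definition kappa :: "(nat \<Rightarrow> real) \<Rightarrow> nat set \<Rightarrow> (nat \<Rightarrow> (nat \<times> real) set) \<Rightarrow> nat \<Rightarrow> real list \<Rightarrow> nat option \<times> nat list \<times> bool list" where
  "kappa x J B m b = ((if mean b \<in> x ` J then Some (the_inv_into J x (mean b)) else None), excs b,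
      map (\<lambda>i. (length b, sum_list b) \<in> B i) [0..<m])"

lemma fst_kappa_Some:
  assumes "inj_on x J" "j \<in> J"
  shows "fst (kappa x J B m b) = Some j \<longleftrightarrow> mean b = x j"
proof -
  have "the_inv_into J x (x j) = j" using assms by (rule the_inv_into_f_f)
  moreover have "mean b \<in> x ` J \<Longrightarrow> x (the_inv_into J x (mean b)) = mean b" using assms(1) by (rule f_the_inv_into_f)
  ultimately show ?thesis using assms(2) by (auto simp: kappa_def)
qed

lemma fst_kappa_Some_notin:
  assumes "inj_on x J" "j \<notin> J"
  shows "fst (kappa x J B m b) \<noteq> Some j"
  using assms the_inv_into_into[OF assms(1), of "mean b" J] by (auto simp: kappa_def)

lemma fst_kappa_None: "fst (kappa x J B m b) = None \<longleftrightarrow> mean b \<notin> x ` J"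
  by (simp add: kappa_def)

lemma measurable_kappa:
  assumes inj: "inj_on x J" and B: "\<And>i. i < m \<Longrightarrow> B i \<in> sets (count_space UNIV \<Otimes>\<^sub>M borel)"
  shows "kappa x J B m \<in> listM \<rightarrow>\<^sub>M count_space UNIV"
proof -
  have 1: "(\<lambda>b. fst (kappa x J B m b)) \<in> listM \<rightarrow>\<^sub>M count_space UNIV"
  proof (subst measurable_count_space_eq2_countable, intro conjI ballI)
    fix o' :: "nat option"
    have ms: "{b. mean b = y} \<in> sets listM" for y
      using measurable_sets[OF measurable_mean_listM, of "{y}"] by (simp add: vimage_def)
    show "(\<lambda>b. fst (kappa x J B m b)) -` {o'} \<inter> space listM \<in> sets listM"
    proof (cases o')
      case None
      have "(\<lambda>b. fst (kappa x J B m b)) -` {o'} \<inter> space listM = UNIV - (\<Union>j\<in>J. {b. mean b = x j})"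
        using None by (auto simp: kappa_def)
      also have "\<dots> \<in> sets listM"
        using ms sets.top[of listM] by (intro sets.Diff sets.countable_UN') auto
      finally show ?thesis .
    next
      case (Some j)
      show ?thesis
      proof (cases "j \<in> J")
        case True
        then have "(\<lambda>b. fst (kappa x J B m b)) -` {o'} \<inter> space listM = {b. mean b = x j}"
          using Some fst_kappa_Some[OF inj] by auto
        then show ?thesis using ms by simp
      next
        case False
        then have "(\<lambda>b. fst (kappa x J B m b)) -` {o'} \<inter> space listM = {}"
          using Some fst_kappa_Some_notin[OF inj] by auto
        then show ?thesis by simp
      qed
    qed
  qed auto
  have 2: "(\<lambda>b. map (\<lambda>i. (length b, sum_list b) \<in> B i) [0..<m]) \<in> listM \<rightarrow>\<^sub>M count_space UNIV"
  proof (rule measurable_map_const)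
    fix i assume "i \<in> set [0..<m]"
    then have [measurable]: "B i \<in> sets (count_space UNIV \<Otimes>\<^sub>M borel)" using B by simp
    show "Measurable.pred listM (\<lambda>b. (length b, sum_list b) \<in> B i)" by measurable
  qed
  have "(\<lambda>b. (fst (kappa x J B m b), excs b, map (\<lambda>i. (length b, sum_list b) \<in> B i) [0..<m])) \<in> listM \<rightarrow>\<^sub>M count_space UNIV"
    using measurable_countable2[OF 1 measurable_countable2[OF measurable_excs_listM 2, of Pair], of Pair] .
  then show ?thesis by (simp add: kappa_def[abs_def])
qed

text \<open>
  A Poisson list splits into independent lists according to disjoint classes of marks. The
  insensitivity assumption restricts to events that are not affected by how the classes are
  interleaved.
\<close>

lemma marks_independent:
  fixes \<kappa> :: "real list \<Rightarrow> 'c :: countable"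
  assumes k: "\<kappa> \<in> listM \<rightarrow>\<^sub>M count_space UNIV" and I: "finite I" "disjoint_family_on C I"
    and ins: "\<And>i bs. i \<in> I \<Longrightarrow> filter (\<lambda>c. c \<in> C i) (map \<kappa> (sort_means bs)) \<in> E i \<longleftrightarrow> filter (\<lambda>c. c \<in> C i) (map \<kappa> bs) \<in> E i"
  shows "\<P>(\<omega> in M. \<forall>i\<in>I. filter (\<lambda>c. c \<in> C i) (map \<kappa> (R \<omega>)) \<in> E i) =
    (\<Prod>i\<in>I. measure_pmf.prob (thinned total_rate (segment_law \<kappa>) (C i)) (E i))"
proof -
  have "\<P>(\<omega> in M. map \<kappa> (R \<omega>) \<in> {ks. \<forall>i\<in>I. filter (\<lambda>c. c \<in> C i) ks \<in> E i}) =
     measure_pmf.prob (thinned total_rate (segment_law \<kappa>) UNIV) {ks. \<forall>i\<in>I. filter (\<lambda>c. c \<in> C i) ks \<in> E i}"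
    by (rule law_marks[OF k]) (use ins in auto)
  also have "\<dots> = (\<Prod>i\<in>I. measure_pmf.prob (thinned total_rate (segment_law \<kappa>) (UNIV \<inter> C i)) (E i))"
    by (rule thinned_independent[OF total_rate_pos I])
  finally show ?thesis by simp
qed

lemma marks_class_law:
  fixes \<kappa> :: "real list \<Rightarrow> 'c :: countable"
  assumes k: "\<kappa> \<in> listM \<rightarrow>\<^sub>M count_space UNIV"
    and ins: "\<And>bs. filter (\<lambda>c. c \<in> C) (map \<kappa> (sort_means bs)) \<in> E \<longleftrightarrow> filter (\<lambda>c. c \<in> C) (map \<kappa> bs) \<in> E"
  shows "\<P>(\<omega> in M. filter (\<lambda>c. c \<in> C) (map \<kappa> (R \<omega>)) \<in> E) = measure_pmf.prob (thinned total_rate (segment_law \<kappa>) C) E"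
  using marks_independent[OF k, of "{()}" "\<lambda>_. C" "\<lambda>_. E"] ins by (simp add: disjoint_family_on_def)

lemma filter_sort_means_slope:
  "filter (\<lambda>b. mean b = y) (sort_means bs) = filter (\<lambda>b. mean b = y) bs"
  using sort_key_stable[of "\<lambda>b. - mean b" "- y" bs] by simp

definition slope_class :: "nat \<Rightarrow> (nat option \<times> nat list \<times> bool list) set" where
  "slope_class j = {c. fst c = Some j}"

lemma filter_slope_class:
  assumes "inj_on x J" "j \<in> J"
  shows "filter (\<lambda>c. c \<in> slope_class j) (map (kappa x J B m) bs) = map (kappa x J B m) (filter (\<lambda>b. mean b = x j) bs)"
  using fst_kappa_Some[OF assms] by (simp add: filter_map comp_def slope_class_def)

lemma excursion_lengths_R:
  "\<omega> \<in> space M \<Longrightarrow> excursion_lengths (R \<omega>) y = map excs (filter (\<lambda>b. mean b = y) (R \<omega>))"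
  by (rule excursion_lengths_valid[OF R_valid(1)])

lemma excursion_lengths_marks:
  assumes "inj_on x J" "j \<in> J" "\<omega> \<in> space M"
  shows "excursion_lengths (R \<omega>) (x j) = map (fst \<circ> snd) (filter (\<lambda>c. c \<in> slope_class j) (map (kappa x J B m) (R \<omega>)))"
  unfolding filter_slope_class[OF assms(1,2)] excursion_lengths_R[OF assms(3)] by (simp add: kappa_def)

lemma has_face_R: "\<omega> \<in> space M \<Longrightarrow> has_face (concat (R \<omega>)) y \<longleftrightarrow> excursion_lengths (R \<omega>) y \<noteq> []"
  using has_face_valid[OF R_valid(1)] by (auto simp: excursion_lengths_R filter_empty_conv)

context
  fixes x :: "nat \<Rightarrow> real" and J :: "nat set" and j :: nat
  assumes x: "bij_betw x J (atom_slopes M X)" and j: "j \<in> J"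
begin

lemma inj_x: "inj_on x J" using x by (simp add: bij_betw_def)

abbreviation "kp \<equiv> kappa x J (\<lambda>_. {}) 0"
abbreviation "sl \<equiv> segment_law kp"

lemma kp_measurable: "kp \<in> listM \<rightarrow>\<^sub>M count_space UNIV"
  by (rule measurable_kappa[OF inj_x]) simp

definition mu :: "real \<Rightarrow> real" where "mu r = slope_rate M X (x j) r"

abbreviation "atom n \<equiv> \<P>(\<omega> in M. partial_sum X n \<omega> = real n * x j)"

lemma EE_mean_atom:
  assumes "n > 0"
  shows "EE n (\<lambda>b. block_weight b * indicator {b. mean b = x j} b) = atom n / real n"
proof -
  have m: "(indicator {b. mean b = x j} :: _ \<Rightarrow> real) \<in> borel_measurable listM"
    using measurable_sets[OF measurable_mean_listM, of "{x j}"] by (simp add: vimage_def)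
  have "EE n (\<lambda>b. block_weight b * indicator {b. mean b = x j} b) = EE n (indicator {b. mean b = x j}) / real n"
    by (rule EE_rotation_invariant[OF m, where c = 1]) (use assms in \<open>auto simp: indicator_def\<close>)
  also have "EE n (indicator {b. mean b = x j}) = EE n (\<lambda>b. indicator {b. sum_list b = real n * x j} b)"
    by (rule EE_cong) (use assms in \<open>auto simp: indicator_def mean_def field_simps\<close>)
  also have "\<dots> = atom n" by (rule EE_indicator_sum) simp
  finally show ?thesis .
qed

text \<open>
  The slope of a block is invariant under rotation, so the weights of the good rotations of a
  block add up to one and leave the factor \<open>1 / n\<close>.
\<close>

lemma rate_length:
  "total_rate * measure_pmf.prob sl {c. c \<in> slope_class j \<and> sum_list (fst (snd c)) = n} = q ^ n * (atom n / real n)"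
proof -
  let ?A = "{c. c \<in> slope_class j \<and> sum_list (fst (snd c)) = n}"
  have z: "q ^ k * EE k (\<lambda>b. block_weight b * indicator ?A (kp b)) = (if k = n then q ^ n * (atom n / real n) else 0)" for k
  proof (cases "k = 0")
    case True
    then show ?thesis by (simp only: True EE_zero_weight) auto
  next
    case False
    have eq: "EE k (\<lambda>b. block_weight b * indicator ?A (kp b)) = EE k (\<lambda>b. if k = n then block_weight b * indicator {b. mean b = x j} b else 0)"
    proof (rule EE_cong)
      fix b :: "real list" assume len: "length b = k"
      show "block_weight b * indicator ?A (kp b) = (if k = n then block_weight b * indicator {b. mean b = x j} b else 0)"
      proof (cases "good b")
        case True
        then have "sum_list (excs b) = k" using excs_props(1)[of b] len False by auto
        then show ?thesis using fst_kappa_Some[OF inj_x j] by (auto simp: indicator_def slope_class_def kappa_def)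
      qed (simp add: block_weight_def)
    qed
    show ?thesis unfolding eq using EE_mean_atom[of n] False by (auto simp: EE_const)
  qed
  have "(\<lambda>k. if k = n then q ^ n * (atom n / real n) else 0) sums (total_rate * measure_pmf.prob sl ?A)"
    using rate_sums[OF kp_measurable, of ?A] unfolding z .
  moreover have "(\<lambda>k. if k = n then q ^ n * (atom n / real n) else 0) sums (q ^ n * (atom n / real n))"
    using sums_single[of n "\<lambda>_. q ^ n * (atom n / real n)"] by simp
  ultimately show ?thesis by (rule sums_unique2)
qed

lemma mu_sums:
  assumes "\<bar>z\<bar> \<le> 1"
  shows "(\<lambda>n. (z * q) ^ n * (atom n / real n)) sums mu (z * q)"
proof -
  let ?f = "\<lambda>n. (z * q) ^ n * (atom n / real n)"
  have "summable ?f"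
  proof (rule summable_comparison_test'[where N = 0])
    show "summable (\<lambda>n. q ^ n)" using q by (intro summable_geometric) auto
    fix n
    have "\<bar>z * q\<bar> ^ n \<le> q ^ n" using assms q by (intro power_mono) (auto simp: abs_mult mult_left_le_one_le)
    moreover have "\<bar>atom n / real n\<bar> \<le> 1" by (cases n) (auto simp: divide_le_eq intro: order_trans[OF prob_le_1])
    ultimately have "\<bar>z * q\<bar> ^ n * \<bar>atom n / real n\<bar> \<le> q ^ n * 1" using q by (intro mult_mono) auto
    then show "norm (?f n) \<le> q ^ n" by (simp add: abs_mult power_abs)
  qed
  then have s: "?f sums (\<Sum>n. ?f n)" by (rule summable_sums)
  have "(\<lambda>n. ?f (Suc n)) sums ((\<Sum>n. ?f n) - ?f 0)" using s sums_Suc_iff[of ?f "(\<Sum>n. ?f n) - ?f 0"] by (simp only: diff_add_cancel)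
  moreover have "?f 0 = 0" by simp
  ultimately have "(\<lambda>n. ?f (Suc n)) sums (\<Sum>n. ?f n)" by (simp only: diff_zero)
  moreover have "?f (Suc n) = (z * q) ^ Suc n / real (Suc n) * atom (Suc n)" for n by simp
  ultimately have "(\<lambda>k. (z * q) ^ Suc k / real (Suc k) * atom (Suc k)) sums (\<Sum>n. ?f n)" by (simp only:)
  then have "mu (z * q) = (\<Sum>n. ?f n)" unfolding mu_def slope_rate_def by (rule sums_unique[symmetric])
  then show ?thesis using s by simp
qed

text \<open>
  Summing over the lengths identifies the rate of the segments of slope \<open>x j\<close>.
\<close>

lemma mu_eq_rate: "total_rate * measure_pmf.prob sl (slope_class j) = mu q"
proof -
  have "(\<lambda>n. measure_pmf.prob sl {c. c \<in> slope_class j \<and> sum_list (fst (snd c)) = n}) sums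
     measure_pmf.prob sl (\<Union>n. {c. c \<in> slope_class j \<and> sum_list (fst (snd c)) = n})"
    by (rule measure_pmf.finite_measure_UNION) (auto simp: disjoint_family_on_def)
  moreover have "(\<Union>n. {c. c \<in> slope_class j \<and> sum_list (fst (snd c)) = n}) = slope_class j" by auto
  ultimately have "(\<lambda>n. measure_pmf.prob sl {c. c \<in> slope_class j \<and> sum_list (fst (snd c)) = n}) sums measure_pmf.prob sl (slope_class j)" by simp
  from sums_mult[OF this, of total_rate] have "(\<lambda>n. q ^ n * (atom n / real n)) sums (total_rate * measure_pmf.prob sl (slope_class j))"
    unfolding rate_length .
  then show ?thesis using mu_sums[of 1] by (auto intro: sums_unique2)
qed

lemma mu_pos: "mu q > 0"
proof -
  have "x j \<in> atom_slopes M X" using x j by (auto simp: bij_betw_def)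
  then obtain k where k: "k > 0" "atom k > 0" by (auto simp: atom_slopes_def)
  have s: "(\<lambda>n. q ^ n * (atom n / real n)) sums mu q" using mu_sums[of 1] by simp
  have "0 < q ^ k * (atom k / real k)" using k q by simp
  also have "\<dots> = (\<Sum>n\<in>{k}. q ^ n * (atom n / real n))" by simp
  also have "\<dots> \<le> (\<Sum>n. q ^ n * (atom n / real n))"
    using s q by (intro sum_le_suminf) (auto simp: sums_iff)
  finally show ?thesis using s by (simp add: sums_iff)
qed

text \<open>The intensity of a single excursion.\<close>

definition exc_mass :: "nat \<Rightarrow> real" where
  "exc_mass i = q ^ i * EE i (indicator {e. irr (x j) e})"

definition seg_law :: "nat list pmf" where
  "seg_law = map_pmf (fst \<circ> snd) (cond_pmf sl (slope_class j))"

lemma class_prob_pos: "measure_pmf.prob sl (slope_class j) > 0"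
  using mu_eq_rate mu_pos total_rate_pos by (metis zero_less_mult_pos)

lemma seg_law_prob: "mu q * measure_pmf.prob seg_law S = total_rate * measure_pmf.prob sl {c. c \<in> slope_class j \<and> fst (snd c) \<in> S}"
proof -
  have ne: "set_pmf sl \<inter> slope_class j \<noteq> {}" using class_prob_pos by (metis less_irrefl set_pmf_nonempty_iff)
  have "measure_pmf.prob seg_law S = measure_pmf.prob (cond_pmf sl (slope_class j)) {c. fst (snd c) \<in> S}"
    by (simp add: seg_law_def vimage_def)
  also have "\<dots> = measure_pmf.prob sl (slope_class j \<inter> {c. fst (snd c) \<in> S}) / measure_pmf.prob sl (slope_class j)"
    unfolding cond_pmf.rep_eq[OF ne] using class_prob_pos
    by (subst measure_uniform_measure) (auto simp: measure_pmf.emeasure_eq_measure)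
  finally show ?thesis using class_prob_pos unfolding mu_eq_rate[symmetric] by (simp add: Int_def)
qed

text \<open>
  A segment with the excursion lengths \<open>l\<close> has \<open>length l\<close> good
  rotations, hence the weight \<open>1 / length l\<close>, and it is a concatenation of
  irreducible excursions of these lengths.
\<close>

lemma seg_law_mass: "mu q * pmf seg_law l = (\<Prod>i\<leftarrow>l. exc_mass i) / real (length l)"
proof -
  let ?n = "sum_list l"
  let ?A = "{c. c \<in> slope_class j \<and> fst (snd c) \<in> {l}}"
  let ?f = "\<lambda>i. EE i (indicator {e. irr (x j) e})"
  have irr_m: "(indicator {e. irr (x j) e} :: _ \<Rightarrow> real) \<in> borel_measurable listM"
    using measurable_irr_listM[of "x j"] by (simp add: pred_def)
  have z: "q ^ k * EE k (\<lambda>b. block_weight b * indicator ?A (kp b)) = (if k = ?n then (\<Prod>i\<leftarrow>l. exc_mass i) / real (length l) else 0)" for k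
  proof (cases "k = 0")
    case True
    have "exc_mass 0 = 0"
    proof -
      have "EE 0 (indicator {e. irr (x j) e}) = EE 0 (\<lambda>_. 0)" by (rule EE_cong) (simp add: irr_def)
      then show ?thesis by (simp add: exc_mass_def EE_const)
    qed
    moreover have "l = [] \<or> 0 \<in> set l" if "?n = 0" using that by (cases l) auto
    ultimately have "?n = 0 \<Longrightarrow> (\<Prod>i\<leftarrow>l. exc_mass i) / real (length l) = 0" by (auto simp: prod_list_zero_iff)
    then show ?thesis by (simp only: True EE_zero_weight) auto
  next
    case False
    have p: "block_weight b * indicator ?A (kp b) =
        (if k = ?n then 1 / real (length l) * (\<Prod>i<length l. indicator {e. irr (x j) e} (split_blocks l b ! i)) else 0)"
      if len: "length b = k" for b
    proof -
      have ne: "b \<noteq> []" using len False by auto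
      have A: "kp b \<in> ?A \<longleftrightarrow> mean b = x j \<and> excs b = l"
        using fst_kappa_Some[OF inj_x j] by (auto simp: slope_class_def kappa_def)
      show ?thesis
      proof (cases "k = ?n")
        case True
        have iff: "good b \<and> mean b = x j \<and> excs b = l \<longleftrightarrow> (\<forall>i<length l. irr (x j) (split_blocks l b ! i))"
          using good_excs_iff[OF ne, of l "x j"] len True by (auto simp: all_set_conv_all_nth)
        show ?thesis
        proof (cases "good b \<and> mean b = x j \<and> excs b = l")
          case t: True
          then have "block_weight b = 1 / real (length l)" using nrot_good[of b] ne by (simp add: block_weight_def)
          moreover have "(\<Prod>i<length l. indicator {e. irr (x j) e} (split_blocks l b ! i) :: real) = 1"
            using iff t by (intro prod.neutral) auto
          ultimately show ?thesis using t A True by (simp add: indicator_def)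
        next
          case f: False
          then obtain i where "i < length l" "\<not> irr (x j) (split_blocks l b ! i)" using iff by auto
          then have "(\<Prod>i<length l. indicator {e. irr (x j) e} (split_blocks l b ! i) :: real) = 0"
            by (intro prod_zero bexI[of _ i]) (auto simp: indicator_def)
          then show ?thesis using f A by (auto simp: block_weight_def indicator_def)
        qed
      next
        case n: False
        then have "\<not> (good b \<and> excs b = l)" using excs_props(1)[OF _ ne] len by auto
        then show ?thesis using n A by (auto simp: block_weight_def indicator_def)
      qed
    qed
    have "EE k (\<lambda>b. block_weight b * indicator ?A (kp b)) =
       EE k (\<lambda>b. if k = ?n then 1 / real (length l) * (\<Prod>i<length l. indicator {e. irr (x j) e} (split_blocks l b ! i)) else 0)"
      by (rule EE_cong) (rule p)
    also have "\<dots> = (if k = ?n then 1 / real (length l) * (\<Prod>i<length l. ?f (l ! i)) else 0)"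
    proof (cases "k = ?n")
      case True
      have "EE ?n (\<lambda>b. \<Prod>i<length l. indicator {e. irr (x j) e} (split_blocks l b ! i)) = (\<Prod>i<length l. ?f (l ! i))"
        by (rule EE_blocks_product[of l "\<lambda>_. indicator {e. irr (x j) e}" "\<lambda>_. 1"]) (use irr_m in \<open>auto simp: indicator_def\<close>)
      then show ?thesis
        using EE_mult[of ?n "1 / real (length l)" "\<lambda>b. \<Prod>i<length l. indicator {e. irr (x j) e} (split_blocks l b ! i)"]
        by (simp only: True if_True simp_thms)
    qed (simp add: EE_const)
    also have "q ^ k * \<dots> = (if k = ?n then (\<Prod>i\<leftarrow>l. exc_mass i) / real (length l) else 0)"
    proof -
      have "(\<Prod>i<length l. ?f (l ! i)) = (\<Prod>i\<leftarrow>l. ?f i)"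
      proof -
        have "map ?f l = map (\<lambda>i. ?f (l ! i)) [0..<length l]" by (rule nth_equalityI) auto
        then show ?thesis
          using prod.distinct_set_conv_list[of "[0..<length l]" "\<lambda>i. ?f (l ! i)"] by (simp only: set_upt atLeast0LessThan distinct_upt)
      qed
      moreover have "q ^ ?n * (\<Prod>i\<leftarrow>l. ?f i) = (\<Prod>i\<leftarrow>l. exc_mass i)"
        by (induction l) (auto simp: exc_mass_def power_add)
      ultimately show ?thesis by (auto simp: field_simps)
    qed
    finally show ?thesis .
  qed
  have "(\<lambda>k. if k = ?n then (\<Prod>i\<leftarrow>l. exc_mass i) / real (length l) else 0) sums (total_rate * measure_pmf.prob sl ?A)"
    using rate_sums[OF kp_measurable, of ?A] unfolding z .
  moreover have "(\<lambda>k. if k = ?n then (\<Prod>i\<leftarrow>l. exc_mass i) / real (length l) else 0) sums ((\<Prod>i\<leftarrow>l. exc_mass i) / real (length l))"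
    using sums_single[of ?n "\<lambda>_. (\<Prod>i\<leftarrow>l. exc_mass i) / real (length l)"] by simp
  ultimately have "total_rate * measure_pmf.prob sl ?A = (\<Prod>i\<leftarrow>l. exc_mass i) / real (length l)" by (rule sums_unique2)
  then show ?thesis using seg_law_prob[of "{l}"] by (simp add: measure_pmf_single)
qed

interpretation prod_law: product_list_law seg_law exc_mass "mu q"
proof
  show "exc_mass i \<ge> 0" for i unfolding exc_mass_def using q by (intro mult_nonneg_nonneg EE_nonneg) auto
qed (rule mu_pos, rule seg_law_mass)

definition slope_law :: "nat list list pmf" where
  "slope_law = bind_pmf (poisson_pmf (mu q)) (\<lambda>k. replicate_pmf k seg_law)"

text \<open>
  Segments of one slope appear in the walk in the order of the underlying Poisson list, because
  stable sorting does not reorder them.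
\<close>

lemma prob_excursion_lengths:
  "\<P>(\<omega> in M. excursion_lengths (R \<omega>) (x j) \<in> E) = measure_pmf.prob slope_law E"
proof -
  have "\<P>(\<omega> in M. excursion_lengths (R \<omega>) (x j) \<in> E) =
     \<P>(\<omega> in M. filter (\<lambda>c. c \<in> slope_class j) (map kp (R \<omega>)) \<in> {ks. map (fst \<circ> snd) ks \<in> E})"
    using excursion_lengths_marks[OF inj_x j, of _ "\<lambda>_. {}" 0] by (intro arg_cong[where f = prob]) auto
  also have "\<dots> = measure_pmf.prob (thinned total_rate sl (slope_class j)) {ks. map (fst \<circ> snd) ks \<in> E}"
    by (rule marks_class_law[OF kp_measurable]) (simp add: filter_slope_class[OF inj_x j] filter_sort_means_slope)
  also have "\<dots> = measure_pmf.prob (map_pmf (map (fst \<circ> snd)) (thinned total_rate sl (slope_class j))) E"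
    by (simp add: vimage_def)
  also have "map_pmf (map (fst \<circ> snd)) (thinned total_rate sl (slope_class j)) = slope_law"
    using class_prob_pos unfolding thinned_def mu_eq_rate
    by (simp add: map_bind_pmf map_replicate_pmf slope_law_def seg_law_def)
  finally show ?thesis .
qed

lemma exp_mu: "1 - exp (- mu q) = prod_law.F"
  by (rule prod_law.F_eq[symmetric])

lemma prob_has_face: "\<P>(\<omega> in M. has_face (concat (R \<omega>)) (x j)) = 1 - exp (- mu q)"
proof -
  have "\<P>(\<omega> in M. has_face (concat (R \<omega>)) (x j)) = \<P>(\<omega> in M. excursion_lengths (R \<omega>) (x j) \<in> - {[]})"
    using has_face_R by (intro arg_cong[where f = prob]) auto
  also have "\<dots> = 1 - pmf slope_law []"
    unfolding prob_excursion_lengths using measure_pmf.prob_compl[of "{[]}" slope_law]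
    by (simp add: Compl_eq_Diff_UNIV measure_pmf_single)
  finally show ?thesis using mu_pos by (simp add: slope_law_def pmf_poisson_replicate)
qed

lemma map_length_slope_law: "map_pmf length slope_law = poisson_pmf (mu q)"
proof -
  have "map_pmf length (replicate_pmf m r) = return_pmf m" for m and r :: "nat list pmf"
  proof -
    have "map_pmf length (replicate_pmf m r) = map_pmf (\<lambda>_. m) (replicate_pmf m r)"
      by (rule map_pmf_cong) (auto simp: set_replicate_pmf)
    then show ?thesis by simp
  qed
  then show ?thesis by (simp add: slope_law_def map_bind_pmf bind_return_pmf')
qed

lemma prob_length_eq: "\<P>(\<omega> in M. length (excursion_lengths (R \<omega>) (x j)) = k) = pmf (poisson_pmf (mu q)) k"
proof -
  have "\<P>(\<omega> in M. length (excursion_lengths (R \<omega>) (x j)) = k) = \<P>(\<omega> in M. excursion_lengths (R \<omega>) (x j) \<in> length -` {k})"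
    by simp
  also have "\<dots> = measure_pmf.prob (map_pmf length slope_law) {k}" unfolding prob_excursion_lengths by simp
  finally show ?thesis by (simp add: map_length_slope_law measure_pmf_single)
qed

lemma cond_prob_number:
  "\<P>(\<omega> in M. length (excursion_lengths (R \<omega>) (x j)) = k \<bar> has_face (concat (R \<omega>)) (x j)) =
     pmf (cond_pmf (poisson_pmf (mu q)) {1..}) k"
proof -
  have ne: "set_pmf (poisson_pmf (mu q)) \<inter> {1..} \<noteq> {}" using mu_pos by (auto simp: set_pmf_poisson)
  have "{1..} = UNIV - {0::nat}" by auto
  then have P1: "measure_pmf.prob (poisson_pmf (mu q)) {1..} = 1 - exp (- mu q)"
    using measure_pmf.prob_compl[of "{0}" "poisson_pmf (mu q)"] mu_pos by (simp add: measure_pmf_single)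
  show ?thesis
  proof (cases "k = 0")
    case True
    have "{\<omega>\<in>space M. length (excursion_lengths (R \<omega>) (x j)) = k \<and> has_face (concat (R \<omega>)) (x j)} = {}"
      using True has_face_R by auto
    then show ?thesis unfolding cond_prob_def using True ne by (simp only: measure_empty) (simp add: pmf_cond)
  next
    case False
    have "{\<omega>\<in>space M. length (excursion_lengths (R \<omega>) (x j)) = k \<and> has_face (concat (R \<omega>)) (x j)} =
        {\<omega>\<in>space M. length (excursion_lengths (R \<omega>) (x j)) = k}"
      using False has_face_R by auto
    then show ?thesis unfolding cond_prob_def using False ne P1
      by (simp only: prob_has_face prob_length_eq) (simp add: pmf_cond)
  qed
qed

lemma prob_map_length: "\<P>(\<omega> in M. map length (excursion_lengths (R \<omega>) (x j)) = es) =
   exp (- mu q) * mu q ^ length es / fact (length es) * (\<Prod>e\<leftarrow>es. log_series_mass (1 - exp (- mu q)) e)"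
proof -
  have "\<P>(\<omega> in M. map length (excursion_lengths (R \<omega>) (x j)) = es) = \<P>(\<omega> in M. excursion_lengths (R \<omega>) (x j) \<in> map length -` {es})"
    by simp
  also have "\<dots> = measure_pmf.prob (map_pmf (map length) slope_law) {es}" unfolding prob_excursion_lengths by simp
  also have "\<dots> = pmf (map_pmf (map length) slope_law) es" by (rule measure_pmf_single)
  also have "map_pmf (map length) slope_law = bind_pmf (poisson_pmf (mu q)) (\<lambda>k. replicate_pmf k (log_series_pmf prod_law.F))"
    by (simp add: slope_law_def map_bind_pmf map_replicate_pmf prod_law.map_length_L)
  also have "pmf \<dots> es = exp (- mu q) * mu q ^ length es / fact (length es) * (\<Prod>e\<leftarrow>es. pmf (log_series_pmf prod_law.F) e)"
    by (rule pmf_poisson_replicate[OF mu_pos])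
  also have "pmf (log_series_pmf prod_law.F) = log_series_mass prod_law.F"
    using pmf_log_series[OF prod_law.F_pos prod_law.F_less_1] by auto
  finally show ?thesis by (simp add: exp_mu)
qed

lemma cond_prob_excursion_numbers:
  assumes "length es = k"
  shows "\<P>(\<omega> in M. map length (excursion_lengths (R \<omega>) (x j)) = es \<bar> length (excursion_lengths (R \<omega>) (x j)) = k) =
       (\<Prod>e\<leftarrow>es. log_series_mass (1 - exp (- mu q)) e)"
proof -
  have "{\<omega>\<in>space M. map length (excursion_lengths (R \<omega>) (x j)) = es \<and> length (excursion_lengths (R \<omega>) (x j)) = k} =
      {\<omega>\<in>space M. map length (excursion_lengths (R \<omega>) (x j)) = es}"
    using assms by auto
  then show ?thesis
    using assms mu_pos by (simp add: cond_prob_def prob_map_length prob_length_eq)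
qed

definition exc_law :: "nat pmf" where "exc_law = prod_law.P"

lemma cond_prob_excursions:
  assumes "[] \<notin> set lss"
  shows "\<P>(\<omega> in M. excursion_lengths (R \<omega>) (x j) = lss \<bar> map length (excursion_lengths (R \<omega>) (x j)) = map length lss) =
    (\<Prod>l\<leftarrow>concat lss. pmf exc_law l)"
proof -
  let ?F = prod_law.F
  let ?c = "exp (- mu q) * mu q ^ length lss / fact (length lss)"
  have s: "{\<omega>\<in>space M. excursion_lengths (R \<omega>) (x j) = lss \<and> map length (excursion_lengths (R \<omega>) (x j)) = map length lss} =
      {\<omega>\<in>space M. excursion_lengths (R \<omega>) (x j) \<in> {lss}}" by auto
  have n: "prob {\<omega>\<in>space M. excursion_lengths (R \<omega>) (x j) \<in> {lss}} = ?c * (\<Prod>l\<leftarrow>lss. pmf seg_law l)"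
    unfolding prob_excursion_lengths measure_pmf_single slope_law_def by (rule pmf_poisson_replicate[OF mu_pos])
  have d: "prob {\<omega>\<in>space M. map length (excursion_lengths (R \<omega>) (x j)) = map length lss} =
     ?c * (\<Prod>l\<leftarrow>lss. log_series_mass ?F (length l))"
    unfolding prob_map_length exp_mu by (simp add: comp_def)
  have seg: "pmf seg_law l = log_series_mass ?F (length l) * (\<Prod>i\<leftarrow>l. pmf exc_law i)" if "l \<noteq> []" for l
  proof -
    have "pmf seg_law l = ?F ^ length l / (real (length l) * mu q) * (\<Prod>i\<leftarrow>l. pmf exc_law i)"
      unfolding prod_law.pmf_L exc_law_def by (simp add: pmf_replicate_pmf)
    moreover have "log_series_mass ?F (length l) = ?F ^ length l / (real (length l) * mu q)"
      using that prod_law.mu_eq by (simp add: log_series_mass_def)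
    ultimately show ?thesis by simp
  qed
  have "(\<Prod>l\<leftarrow>lss. pmf seg_law l) = (\<Prod>l\<leftarrow>lss. log_series_mass ?F (length l)) * (\<Prod>l\<leftarrow>concat lss. pmf exc_law l)"
    using assms by (induction lss) (auto simp: seg)
  moreover have "(\<Prod>l\<leftarrow>lss. log_series_mass ?F (length l)) \<noteq> 0"
    using assms prod_law.F_pos prod_law.F_less_1 by (induction lss) (auto simp: log_series_mass_def)
  moreover have "?c \<noteq> 0" using mu_pos by simp
  ultimately show ?thesis by (simp only: cond_prob_def s n d) simp
qed

lemma exc_law_pgf:
  assumes z: "\<bar>z\<bar> \<le> 1"
  shows "measure_pmf.expectation exc_law (\<lambda>l. z ^ l) = (1 - exp (- mu (z * q))) / (1 - exp (- mu q))"
proof -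
  have b: "\<bar>z ^ k\<bar> \<le> 1" for k using z by (simp add: power_abs power_le_one)
  have "measure_pmf.expectation seg_law (\<lambda>l. z ^ sum_list l) = measure_pmf.expectation (map_pmf sum_list seg_law) (\<lambda>n. z ^ n)"
    by simp
  moreover have "(\<lambda>n. pmf (map_pmf sum_list seg_law) n * z ^ n) sums measure_pmf.expectation (map_pmf sum_list seg_law) (\<lambda>n. z ^ n)"
    by (rule expectation_nat_sums) (rule b)
  ultimately have "(\<lambda>n. mu q * (pmf (map_pmf sum_list seg_law) n * z ^ n)) sums (mu q * measure_pmf.expectation seg_law (\<lambda>l. z ^ sum_list l))"
    by (simp add: sums_mult)
  moreover have "mu q * (pmf (map_pmf sum_list seg_law) n * z ^ n) = (z * q) ^ n * (atom n / real n)" for n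
  proof -
    have "mu q * pmf (map_pmf sum_list seg_law) n = mu q * measure_pmf.prob seg_law (sum_list -` {n})"
      by (simp add: pmf_map)
    also have "\<dots> = q ^ n * (atom n / real n)" unfolding seg_law_prob rate_length[symmetric] by (simp add: vimage_def)
    finally have e: "mu q * pmf (map_pmf sum_list seg_law) n = q ^ n * (atom n / real n)" .
    have "mu q * (pmf (map_pmf sum_list seg_law) n * z ^ n) = (mu q * pmf (map_pmf sum_list seg_law) n) * z ^ n" by simp
    also have "\<dots> = (z * q) ^ n * (atom n / real n)" unfolding e power_mult_distrib by simp
    finally show ?thesis .
  qed
  ultimately have "mu q * measure_pmf.expectation seg_law (\<lambda>l. z ^ sum_list l) = mu (z * q)"
    using mu_sums[OF z] by (auto intro: sums_unique2)
  then show ?thesis unfolding exc_law_def prod_law.generating_function[OF z] exp_mu by simp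
qed

end
end

section \<open>Exchanging excursions inside the faces\<close>

text \<open>
  A walk is now given by its faces, each a list of segments, each a list of excursions, each a
  list of increments. The condition depends on a face only through the set of its excursions.
\<close>

definition faces_ok :: "real list list list list \<Rightarrow> real list \<Rightarrow> bool" where
  "faces_ok S ys \<longleftrightarrow> sorted_wrt (>) ys \<and> list_all2 (\<lambda>f y. \<forall>e\<in>set (concat f). irr y e) S ys"

abbreviation flatten_faces :: "'a list list list list \<Rightarrow> 'a list list" where
  "flatten_faces S \<equiv> map concat (concat S)"

abbreviation shape :: "'a list list list list \<Rightarrow> nat list list list" where
  "shape S \<equiv> map (map (map length)) S"

lemma groups_unique:
  assumes "[] \<notin> set gs" "list_all2 (\<lambda>g y. \<forall>b\<in>set g. mean b = y) gs ys" "sorted_wrt (>) ys"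
  shows "groups (concat gs) = gs"
  using assms
proof (induction gs arbitrary: ys)
  case (Cons g gs)
  then obtain y ys' where ys: "ys = y # ys'" by (cases ys) auto
  obtain b bs where g: "g = b # bs" using Cons.prems(1) by (cases g) auto
  have m: "\<forall>c\<in>set (b # bs). mean c = y" using Cons.prems(2) ys g by simp
  have IH: "groups (concat gs) = gs" using Cons.prems ys by (intro Cons.IH[of ys']) auto
  have first: "takeWhile (\<lambda>c. mean c = mean b) (concat gs) = [] \<and> dropWhile (\<lambda>c. mean c = mean b) (concat gs) = concat gs"
  proof (cases gs)
    case (Cons h hs)
    then obtain c cs where h: "h = c # cs" using Cons.prems(1) by (cases h) auto
    obtain y' zs where ys': "ys' = y' # zs" using Cons.prems(2) ys Cons by (cases ys') auto
    have "mean c = y'" "y' < y" using Cons.prems(2,3) ys ys' Cons h by auto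
    then show ?thesis using m Cons h by auto
  qed simp
  have all: "\<forall>c\<in>set bs. mean c = mean b" using m by simp
  have "takeWhile (\<lambda>c. mean c = mean b) (bs @ concat gs) = bs"
    using all first by (simp add: takeWhile_append2)
  moreover have "dropWhile (\<lambda>c. mean c = mean b) (bs @ concat gs) = concat gs"
    using all first by (simp add: dropWhile_append2)
  ultimately show ?case using IH g by simp
qed simp

lemma segment_from_irr:
  assumes "\<forall>e\<in>set s. irr y e" "s \<noteq> []"
  shows "concat s \<noteq> []" "mean (concat s) = y" "good (concat s)" "excs (concat s) = map length s"
proof -
  show "mean (concat s) = y" "good (concat s)" "excs (concat s) = map length s"
    using irr_excursions_contacts[OF assms] .
  show "concat s \<noteq> []" using assms by (cases s) (auto simp: irr_def)
qed

lemma faces_ok_imp: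
  assumes ok: "faces_ok S ys" and wf: "[] \<notin> set S" "[] \<notin> set (concat S)"
  shows "valid (flatten_faces S)" "face_shape (flatten_faces S) = shape S"
    "map mean (flatten_faces S) = concat (map2 (\<lambda>f y. replicate (length f) y) S ys)"
    "weight (flatten_faces S) = (\<Prod>s\<leftarrow>concat S. 1 / real (length s))"
proof -
  have l2: "list_all2 (\<lambda>f y. \<forall>e\<in>set (concat f). irr y e) S ys" and srt: "sorted_wrt (>) ys"
    using ok by (auto simp: faces_ok_def)
  have seg: "\<exists>y. \<forall>e\<in>set s. irr y e" if s: "s \<in> set (concat S)" for s
  proof -
    obtain f where f: "f \<in> set S" "s \<in> set f" using s by auto
    then obtain i where i: "i < length S" "S ! i = f" by (auto simp: in_set_conv_nth)
    have "\<forall>e\<in>set (concat f). irr (ys ! i) e" using list_all2_nthD[OF l2 i(1)] i(2) by simp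
    then show ?thesis using f by auto
  qed
  have sne: "s \<noteq> []" if "s \<in> set (concat S)" for s using that wf(2) by auto
  have bl: "b \<noteq> [] \<and> good b" if b: "b \<in> set (flatten_faces S)" for b
  proof -
    obtain s where s: "s \<in> set (concat S)" "b = concat s" using b by auto
    obtain y where "\<forall>e\<in>set s. irr y e" using seg[OF s(1)] by blast
    from segment_from_irr[OF this sne[OF s(1)]] show ?thesis using s by simp
  qed
  have mean_face: "list_all2 (\<lambda>g y. \<forall>b\<in>set g. mean b = y) (map (map concat) S) ys"
  proof (rule list_all2_all_nthI)
    show "length (map (map concat) S) = length ys" using list_all2_lengthD[OF l2] by simp
    fix i assume i: "i < length (map (map concat) S)"
    show "\<forall>b\<in>set (map (map concat) S ! i). mean b = ys ! i"
    proof
      fix b assume "b \<in> set (map (map concat) S ! i)"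
      then obtain s where s: "s \<in> set (S ! i)" "b = concat s" using i by auto
      have "\<forall>e\<in>set s. irr (ys ! i) e" using list_all2_nthD[OF l2, of i] i s(1) by auto
      moreover have "S ! i \<in> set S" using i by simp
      then have "s \<noteq> []" using s(1) sne by auto
      ultimately show "mean b = ys ! i" using segment_from_irr(2) s(2) by blast
    qed
  qed
  show m: "map mean (flatten_faces S) = concat (map2 (\<lambda>f y. replicate (length f) y) S ys)"
    using mean_face
  proof (induction S arbitrary: ys)
    case (Cons f S)
    then obtain y ys' where ys: "ys = y # ys'" by (cases ys) auto
    have "map mean (map concat f) = replicate (length f) y"
      using Cons.prems ys by (intro replicate_eqI) auto
    then show ?case using Cons.IH[of ys'] Cons.prems ys by (simp add: comp_def)
  qed simp
  have "sorted_wrt (\<ge>) (concat (map2 (\<lambda>f y. replicate (length f) y) S ys))"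
    using srt
  proof (induction S arbitrary: ys)
    case (Cons f S)
    show ?case
    proof (cases ys)
      case (Cons y ys')
      let ?rest = "concat (map2 (\<lambda>f y. replicate (length f) y) S ys')"
      have "z \<le> y" if "z \<in> set ?rest" for z
      proof -
        have "z \<in> set ys'" using that by (auto dest: set_zip_rightD)
        then show ?thesis using Cons.prems Cons by auto
      qed
      moreover have "sorted_wrt (\<ge>) ?rest" using Cons.IH[of ys'] Cons.prems Cons by simp
      moreover have "sorted_wrt (\<ge>) (replicate (length f) y)" by (simp add: sorted_wrt_iff_nth_less)
      ultimately have "sorted_wrt (\<ge>) (replicate (length f) y @ ?rest)" unfolding sorted_wrt_append by simp
      then show ?thesis using Cons by simp
    qed simp
  qed simp
  then show "valid (flatten_faces S)" using bl m unfolding valid_def by metis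
  have "groups (concat (map (map concat) S)) = map (map concat) S"
    by (rule groups_unique[OF _ mean_face srt]) (use wf(1) in auto)
  then have g: "groups (flatten_faces S) = map (map concat) S" by (simp add: map_concat)
  have ex: "excs (concat s) = map length s" if "s \<in> set (concat S)" for s
    using seg[OF that] segment_from_irr(4)[OF _ sne[OF that]] by blast
  show "face_shape (flatten_faces S) = shape S"
    unfolding face_shape_def g by (auto intro!: map_cong ex)
  have bw: "block_weight (concat s) = 1 / real (length s)" if s: "s \<in> set (concat S)" for s
  proof -
    obtain y where y: "\<forall>e\<in>set s. irr y e" using seg[OF s] by blast
    note p = segment_from_irr[OF y sne[OF s]]
    show ?thesis using nrot_good[OF p(3,1)] p by (simp add: block_weight_def)
  qed
  show "weight (flatten_faces S) = (\<Prod>s\<leftarrow>concat S. 1 / real (length s))"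
    unfolding weight_def map_map
    by (rule arg_cong[where f = prod_list], rule map_cong[OF refl]) (simp only: comp_def bw)
qed

lemma faces_ok_if:
  assumes v: "valid (flatten_faces S)" and sh: "face_shape (flatten_faces S) = shape S"
  shows "\<exists>ys. faces_ok S ys"
proof -
  let ?B = "flatten_faces S" and ?gs = "groups (flatten_faces S)"
  have s: "sorted_wrt (\<ge>) (map mean ?B)" using v by (simp add: valid_def)
  have "map length ?gs = map length (shape S)"
    using arg_cong[OF sh, of "map length"] by (simp add: face_shape_def comp_def)
  then have "?gs = map (map concat) S"
    using split_blocks_concat[of ?gs] split_blocks_concat[of "map (map concat) S"]
    by (simp add: map_concat comp_def)
  then have g: "?gs = map (map concat) S" .
  have ex: "excs (concat t) = map length t" if "f \<in> set S" "t \<in> set f" for f t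
  proof -
    have "map (map (excs \<circ> concat)) S = map (map (map length)) S" using sh unfolding face_shape_def g by (simp add: comp_def)
    then have "map (excs \<circ> concat) f = map (map length) f" using that(1) by (metis (no_types, lifting) map_eq_conv)
    then have "(excs \<circ> concat) t = map length t" using that(2) by (metis (no_types, lifting) map_eq_conv)
    then show ?thesis by simp
  qed
  have "list_all2 (\<lambda>f y. \<forall>e\<in>set (concat f). irr y e) S (map (\<lambda>g. mean (hd g)) ?gs)"
    unfolding g map_map list_all2_map2
  proof (rule list_all2_same[THEN iffD2], intro ballI)
    fix f e assume f: "f \<in> set S" "e \<in> set (concat f)"
    then obtain t where t: "t \<in> set f" "e \<in> set t" by auto
    have "map concat f \<in> set ?gs" using f(1) g by auto
    from groups_props(2)[OF s this] t(1) have m: "mean (concat t) = mean (hd (map concat f))" by auto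
    have "concat t \<in> set ?B" using f(1) t(1) by auto
    then have gd: "good (concat t)" "concat t \<noteq> []" using v unfolding valid_def by blast+
    have "\<forall>e\<in>set (split_blocks (map length t) (concat t)). irr (mean (concat t)) e"
      using good_excs_iff[OF gd(2), of "map length t" "mean (concat t)"] gd ex[OF f(1) t(1)] by (simp add: length_concat)
    then show "irr (((\<lambda>g. mean (hd g)) \<circ> map concat) f) e" using t(2) m by (simp add: split_blocks_concat)
  qed
  then show ?thesis using groups_props(3)[OF s] by (auto simp: faces_ok_def)
qed

lemma faces_ok_mset:
  assumes "faces_ok S ys" "list_all2 (\<lambda>f f'. set (concat f) = set (concat f')) S S'"
  shows "faces_ok S' ys"
  using assms by (simp add: faces_ok_def list_all2_conv_all_nth del: set_concat)

text \<open>
  Forgets the order of the segments inside each face and of the excursions inside each segment.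
\<close>

definition forget :: "nat list list list \<Rightarrow> nat multiset multiset list" where
  "forget v = map (\<lambda>f. mset (map mset f)) v"

primrec split_nested :: "nat list list \<Rightarrow> 'a list \<Rightarrow> 'a list list list" where
  "split_nested [] xs = []"
| "split_nested (s # ss) xs = split_blocks s (take (sum_list s) xs) # split_nested ss (drop (sum_list s) xs)"

primrec split_faces :: "nat list list list \<Rightarrow> 'a list \<Rightarrow> 'a list list list list" where
  "split_faces [] xs = []"
| "split_faces (f # fs) xs = split_nested f (take (sum_list (concat f)) xs) # split_faces fs (drop (sum_list (concat f)) xs)"

lemma split_nested_props:
  "sum_list (concat ss) = length xs \<Longrightarrow> concat (concat (split_nested ss xs)) = xs \<and> map (map length) (split_nested ss xs) = ss"
proof (induction ss arbitrary: xs)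
  case (Cons s ss)
  have "sum_list (concat ss) = length (drop (sum_list s) xs)" using Cons.prems by simp
  note IH = Cons.IH[OF this]
  have "sum_list s = length (take (sum_list s) xs)" using Cons.prems by simp
  then show ?case using IH concat_split_blocks[of s "take (sum_list s) xs"] map_length_split_blocks[of s "take (sum_list s) xs"] by simp
qed simp

lemma split_faces_props:
  "sum_list (concat (concat fs)) = length xs \<Longrightarrow> concat (concat (concat (split_faces fs xs))) = xs \<and> shape (split_faces fs xs) = fs"
proof (induction fs arbitrary: xs)
  case (Cons f fs)
  have "sum_list (concat (concat fs)) = length (drop (sum_list (concat f)) xs)" using Cons.prems by simp
  note IH = Cons.IH[OF this]
  have "sum_list (concat f) = length (take (sum_list (concat f)) xs)" using Cons.prems by simp
  note N = split_nested_props[OF this]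
  show ?case using IH N by simp
qed simp

text \<open>
  The pieces are assigned to the places of the new shape by any bijection that preserves
  lengths.
\<close>

lemma regroup:
  assumes "mset (map length es) = mset (concat f')"
  shows "\<exists>F'. map (map length) F' = f' \<and> mset (concat F') = mset es"
proof -
  obtain \<tau> where t: "\<tau> permutes {..<length es}" "permute_list \<tau> (map length es) = concat f'"
    using mset_eq_permutation[OF assms[symmetric]] by auto
  define es' where "es' = permute_list \<tau> es"
  have m: "map length es' = concat f'" using t by (simp add: es'_def map_permute_list)
  define F' where "F' = split_blocks (map length f') es'"
  have len: "sum_list (map length f') = length es'" using arg_cong[OF m, of length] by (simp add: length_concat)
  have c: "concat F' = es'" unfolding F'_def by (rule concat_split_blocks[OF len])
  have "map (map length) F' = split_blocks (map length f') (map length es')"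
    unfolding F'_def split_blocks_map ..
  also have "\<dots> = f'" unfolding m by (rule split_blocks_concat)
  finally show ?thesis using c t by (intro exI[of _ F']) (simp add: es'_def mset_permute_list)
qed

lemma regroup_faces:
  assumes "list_all2 (\<lambda>f f'. mset (concat (map (map length) f)) = mset (concat f')) T v'"
  shows "\<exists>T'. shape T' = v' \<and> list_all2 (\<lambda>f f'. mset (concat f) = mset (concat f')) T T'"
  using assms
proof (induction rule: list_all2_induct)
  case (Cons f T f' v')
  have "mset (map length (concat f)) = mset (concat f')" using Cons by (simp add: map_concat)
  from regroup[OF this] obtain F' where "map (map length) F' = f'" "mset (concat F') = mset (concat f)" by blast
  moreover obtain T' where "shape T' = v'" "list_all2 (\<lambda>f f'. mset (concat f) = mset (concat f')) T T'" using Cons by blast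
  ultimately show ?case by (intro exI[of _ "F' # T'"]) auto
qed simp

lemma mset_concat_msets: "mset (map mset a) = mset (map mset b) \<Longrightarrow> mset (concat a) = mset (concat b)"
proof -
  assume "mset (map mset a) = mset (map mset b)"
  then have "sum_mset (mset (map mset a)) = sum_mset (mset (map mset b))" by simp
  then show ?thesis by (simp only: mset_concat sum_mset_sum_list)
qed

lemma prod_list_mset: "mset a = mset b \<Longrightarrow> prod_list a = (prod_list b :: real)"
  by (metis prod_mset_prod_list)

lemma mset_concat_list_all2:
  "list_all2 (\<lambda>f f'. mset (concat f) = mset (concat f')) T T' \<Longrightarrow> mset (concat (concat T)) = mset (concat (concat T'))"
  by (induction rule: list_all2_induct) auto

lemma mset_concat_concat: "mset a = mset b \<Longrightarrow> mset (concat a) = mset (concat b)"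
  by (metis mset_concat mset_map sum_mset_sum_list)

context rearranged_walk
begin

text \<open>The density of law_sorted restricted to one face shape.\<close>

definition shape_event :: "nat list list list \<Rightarrow> real list list \<Rightarrow> real" where
  "shape_event v B = weight B * of_bool (id \<in> sorting B) * of_bool (face_shape B = v) / real (card (sorting B))"

lemma measurable_shape_event: "shape_event v \<in> borel_measurable segM"
proof -
  have [measurable]: "(\<lambda>B. of_bool (id \<in> sorting B) :: real) \<in> borel_measurable segM" "(\<lambda>B. real (card (sorting B))) \<in> borel_measurable segM"
    using measurable_fun_sorting[of "\<lambda>S. of_bool (id \<in> S)"] measurable_fun_sorting[of "\<lambda>S. real (card S)"] by auto
  have [measurable]: "(\<lambda>B. of_bool (face_shape B = v) :: real) \<in> borel_measurable segM"
    by (rule measurable_compose[OF measurable_face_shape]) simp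
  show ?thesis unfolding shape_event_def[abs_def] by measurable
qed

text \<open>
  A walk of a given face shape is cut at the composition which that shape prescribes, so only
  one summand of law_sorted contributes.
\<close>

lemma shape_event_zero:
  assumes "shape_event v B \<noteq> 0" "[] \<notin> set B"
  shows "valid B" "face_shape B = v" "map length B = map sum_list (concat v)"
proof -
  have w: "weight B \<noteq> 0" "id \<in> sorting B" "face_shape B = v" using assms(1) by (auto simp: shape_event_def)
  have "good b" if "b \<in> set B" for b
    using w(1) that by (auto simp: weight_def prod_list_zero_iff block_weight_def split: if_splits)
  then show v: "valid B" using w(2) assms(2) by (auto simp: valid_def sorting_def)
  show "face_shape B = v" by fact
  show "map length B = map sum_list (concat v)"
    using compositions_face_shape(2)[OF v] w(3) by (simp add: \<Xi>K_def)
qed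

definition wf_shape :: "nat list list list \<Rightarrow> bool" where
  "wf_shape v \<longleftrightarrow> [] \<notin> set v \<and> [] \<notin> set (concat v) \<and> 0 \<notin> set (concat (concat v))"

lemma wf_face_shape: "valid B \<Longrightarrow> wf_shape (face_shape B)"
proof -
  assume v: "valid B"
  have s: "sorted_wrt (\<ge>) (map mean B)" using v by (simp add: valid_def)
  have c: "concat (face_shape B) = map excs B" by (simp add: face_shape_def flip: map_concat)
  have "[] \<notin> set (face_shape B)" using groups_props(1)[OF s] by (auto simp: face_shape_def)
  moreover have "[] \<notin> set (concat (face_shape B))" "0 \<notin> set (concat (concat (face_shape B)))"
    unfolding c using v excs_props(2,3) by (fastforce simp: valid_def)+
  ultimately show ?thesis by (simp add: wf_shape_def)
qed

lemma wf_shape_forget: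
  assumes "forget v = forget v'"
  shows "wf_shape v \<longleftrightarrow> wf_shape v'"
proof -
  have "wf_shape v \<longleftrightarrow> (\<forall>m\<in>set (forget v). m \<noteq> {#} \<and> {#} \<notin># m \<and> (\<forall>s\<in>#m. 0 \<notin># s))" for v
    by (auto simp: wf_shape_def forget_def)
  then show ?thesis using assms by simp
qed

lemma prob_face_shape_N:
  assumes wf: "wf_shape v"
  shows "\<P>(\<omega> in M. N \<omega> = n \<and> face_shape (R \<omega>) = v) = (if sum_list (concat (concat v)) = n
     then (1 - q) * q ^ n * EE n (\<lambda>xs. shape_event v (split_blocks (map sum_list (concat v)) xs)) else 0)"
proof -
  let ?E = "{B. face_shape B = v}" and ?ns = "map sum_list (concat v)"
  have E: "?E \<in> sets segM" using measurable_sets[OF measurable_face_shape, of "{v}"] by (simp add: vimage_def)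
  have nsum: "sum_list ?ns = sum_list (concat (concat v))"
  proof -
    have "sum_list (map sum_list xss) = sum_list (concat xss)" for xss :: "nat list list" by (induction xss) auto
    then show ?thesis .
  qed
  have "\<P>(\<omega> in M. N \<omega> = n \<and> face_shape (R \<omega>) = v) = \<P>(\<omega> in M. N \<omega> = n \<and> R \<omega> \<in> ?E)" by simp
  also have "\<dots> = (1 - q) * q ^ n * (\<Sum>ns\<in>comps n. EE n (\<lambda>xs. shape_event v (split_blocks ns xs)))"
    unfolding law_sorted[OF E] shape_event_def by (simp add: indicator_def)
  also have "(\<Sum>ns\<in>comps n. EE n (\<lambda>xs. shape_event v (split_blocks ns xs))) =
     (\<Sum>ns\<in>comps n. if ns = ?ns then EE n (\<lambda>xs. shape_event v (split_blocks ?ns xs)) else 0)"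
  proof (rule sum.cong[OF refl])
    fix ns assume ns: "ns \<in> comps n"
    show "EE n (\<lambda>xs. shape_event v (split_blocks ns xs)) = (if ns = ?ns then EE n (\<lambda>xs. shape_event v (split_blocks ?ns xs)) else 0)"
    proof (cases "ns = ?ns")
      case False
      have "EE n (\<lambda>xs. shape_event v (split_blocks ns xs)) = EE n (\<lambda>_. 0)"
      proof (rule EE_cong)
        fix xs :: "real list" assume "length xs = n"
        then have l: "map length (split_blocks ns xs) = ns" using ns by (intro map_length_split_blocks) (auto simp: comps_def)
        moreover have "[] \<notin> set (split_blocks ns xs)"
        proof
          assume "[] \<in> set (split_blocks ns xs)"
          then have "0 \<in> set (map length (split_blocks ns xs))" by force
          then show False using l ns by (simp add: comps_def)
        qed
        ultimately show "shape_event v (split_blocks ns xs) = 0" using shape_event_zero(3) False by metis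
      qed
      then show ?thesis using False by (simp add: EE_const)
    qed simp
  qed
  also have "\<dots> = (if ?ns \<in> comps n then EE n (\<lambda>xs. shape_event v (split_blocks ?ns xs)) else 0)"
    by (simp add: sum.delta)
  also have "?ns \<in> comps n \<longleftrightarrow> sum_list (concat (concat v)) = n"
  proof -
    have "0 \<notin> set ?ns"
    proof
      assume "0 \<in> set ?ns"
      then obtain s where s: "s \<in> set (concat v)" "sum_list s = 0" by (metis imageE list.set_map)
      then have "s \<noteq> []" using wf by (auto simp: wf_shape_def)
      then have "hd s \<in> set s" by (rule hd_in_set)
      then have "0 \<in> set s" using s(2) by auto
      then show False using s(1) wf by (auto simp: wf_shape_def)
    qed
    then show ?thesis using nsum by (auto simp: comps_def)
  qed
  finally show ?thesis by simp
qed

text \<open>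
  Regroup the increments: the pieces that are excursions in the shape \<open>v\<close> are
  moved, inside their faces, to places of pieces of equal length in the shape \<open>v'\<close>.
  This permutes iid increments. Slopes of faces, numbers of segments in a face and the multiset
  of the numbers of excursions are the same, hence so are the weight and the number of sorting
  orders.
\<close>

lemma EE_shape_event_forget:
  assumes wf: "wf_shape v" and fg: "forget v = forget v'" and n: "sum_list (concat (concat v)) = n"
  shows "EE n (\<lambda>xs. shape_event v (split_blocks (map sum_list (concat v)) xs)) =
    EE n (\<lambda>xs. shape_event v' (split_blocks (map sum_list (concat v')) xs))"
proof -
  have wf': "wf_shape v'" using wf_shape_forget[OF fg] wf by simp
  have vv: "list_all2 (\<lambda>f f'. mset (map mset f) = mset (map mset f')) v v'"
    using fg unfolding forget_def by (auto simp: list_all2_conv_all_nth list_eq_iff_nth_eq)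
  \<comment> \<open>The regrouping is carried out on indices, so that one permutation of the increments serves all walks.\<close>
  define T where "T = split_faces v [0..<n]"
  have T: "concat (concat (concat T)) = [0..<n]" "shape T = v"
    using split_faces_props[of v "[0..<n]"] n by (auto simp: T_def)
  have "list_all2 (\<lambda>f f'. mset (concat (map (map length) f)) = mset (concat f')) T v'"
  proof -
    have "list_all2 (\<lambda>f f'. mset (concat f) = mset (concat f')) (map (map (map length)) T) v'"
      unfolding T(2) by (rule list_all2_mono[OF vv]) (rule mset_concat_msets)
    then show ?thesis by (simp add: list_all2_map1)
  qed
  from regroup_faces[OF this] obtain T' where T': "shape T' = v'"
    "list_all2 (\<lambda>f f'. mset (concat f) = mset (concat f')) T T'" by blast
  define iss where "iss = concat (concat (concat T'))"
  have iss: "mset iss = mset [0..<n]"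
    unfolding iss_def T(1)[symmetric] by (rule mset_concat_concat[OF mset_concat_list_all2[OF T'(2)], symmetric])
  let ?G = "\<lambda>v xs. shape_event v (split_blocks (map sum_list (concat v)) xs)"
  have blocks: "split_blocks (map sum_list (concat (shape U))) (map f (concat (concat (concat U)))) = flatten_faces (map (map (map (map f))) U)"
    for U :: "nat list list list list" and f :: "nat \<Rightarrow> real"
  proof -
    have 1: "map f (concat (concat (concat U))) = concat (flatten_faces (map (map (map (map f))) U))"
    proof -
      have c: "concat (map concat xss) = concat (concat xss)" for xss :: "real list list list" by (induction xss) auto
      have "map f (concat (concat (concat U))) = concat (concat (concat (map (map (map (map f))) U)))"
        by (simp only: map_concat)
      then show ?thesis by (simp only: c)
    qed
    have 2: "map length (flatten_faces (map (map (map (map f))) U)) = map sum_list (concat (shape U))"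
    proof -
      have "map length (flatten_faces W) = map sum_list (concat (shape W))" for W :: "real list list list list"
        by (simp add: length_concat comp_def flip: map_concat)
      moreover have "shape (map (map (map (map f))) U) = shape U" by (simp add: comp_def)
      ultimately show ?thesis by metis
    qed
    show ?thesis unfolding 1 by (rule split_blocks_concat'[OF 2])
  qed
  \<comment> \<open>The densities of the two shapes agree at a walk and at its regrouped version.\<close>
  have pt: "?G v (map f [0..<n]) = ?G v' (map f iss)" for f :: "nat \<Rightarrow> real"
  proof -
    let ?S = "map (map (map (map f))) T" and ?S' = "map (map (map (map f))) T'"
    have sS: "shape ?S = v" "shape ?S' = v'" using T(2) T'(1) by (simp_all add: comp_def)
    have B: "split_blocks (map sum_list (concat v)) (map f [0..<n]) = flatten_faces ?S"
      using blocks[of T f] T by simp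
    have B': "split_blocks (map sum_list (concat v')) (map f iss) = flatten_faces ?S'"
      using blocks[of T' f] T' by (simp add: iss_def)
    have ne: "[] \<notin> set U" "[] \<notin> set (concat U)" "[] \<notin> set (flatten_faces U)" if "wf_shape (shape U)" for U :: "real list list list list"
    proof -
      show a: "[] \<notin> set U" "[] \<notin> set (concat U)" using that by (force simp: wf_shape_def)+
      have "e \<noteq> []" if "e \<in> set (concat (concat U))" for e
        using that \<open>wf_shape (shape U)\<close> by (force simp: wf_shape_def)
      then show "[] \<notin> set (flatten_faces U)" using a(2) by auto (metis hd_in_set)
    qed
    have sets: "list_all2 (\<lambda>f f'. set (concat f) = set (concat f')) ?S ?S'"
      using T'(2) unfolding list_all2_map1 list_all2_map2
    proof (rule list_all2_mono)
      fix g g' :: "nat list list list" assume "mset (concat g) = mset (concat g')"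
      then have "set (concat g) = set (concat g')" by (metis set_mset_mset)
      then have "map f ` set (concat g) = map f ` set (concat g')" by simp
      then show "set (concat (map (map (map f)) g)) = set (concat (map (map (map f)) g'))"
        by (simp only: set_map[symmetric] map_concat)
    qed
    then have sets': "list_all2 (\<lambda>f f'. set (concat f) = set (concat f')) ?S' ?S"
      by (auto simp: list_all2_conv_all_nth)
    have key: "shape_event v (flatten_faces ?S) = shape_event v' (flatten_faces ?S')" if ok: "faces_ok ?S ys" for ys
    proof -
      have ok': "faces_ok ?S' ys" by (rule faces_ok_mset[OF ok sets])
      have w1: "wf_shape (shape ?S)" "wf_shape (shape ?S')" using sS wf wf' by simp_all
      note p = faces_ok_imp[OF ok ne(1,2)[OF w1(1)]] and p' = faces_ok_imp[OF ok' ne(1,2)[OF w1(2)]]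
      have fl: "list_all2 (\<lambda>f f'. length f = length f') v v'"
        using vv by (rule list_all2_mono) (metis length_map size_mset)
      have lenS: "map length ?S = map length ?S'"
      proof -
        have "map length U = map length (shape U)" for U :: "real list list list list" by (simp add: comp_def)
        moreover have "map length v = map length v'" using fl by (auto simp: list_all2_conv_all_nth list_eq_iff_nth_eq)
        ultimately show ?thesis using sS by metis
      qed
      have mm: "map mean (flatten_faces ?S) = map mean (flatten_faces ?S')"
      proof -
        have "map2 (\<lambda>f y. replicate (length f) y) U ys = map2 replicate (map length U) ys" for U :: "real list list list list"
          by (rule nth_equalityI) auto
        then show ?thesis unfolding p(3) p'(3) using lenS by metis
      qed
      have W: "weight (flatten_faces ?S) = weight (flatten_faces ?S')"
      proof -
        have e: "(\<Prod>s\<leftarrow>concat U. 1 / real (length s)) = (\<Prod>s\<leftarrow>concat (shape U). 1 / real (length s))" for U :: "real list list list list"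
          by (simp add: map_concat comp_def)
        have "mset (map length (concat v)) = mset (map length (concat v'))"
          using vv
        proof (induction rule: list_all2_induct)
          case (Cons f vs f' vs')
          have "image_mset size (mset (map mset f)) = image_mset size (mset (map mset f'))" using Cons by simp
          then have "mset (map length f) = mset (map length f')" by (simp add: image_mset.compositionality comp_def flip: mset_map)
          then show ?case using Cons by simp
        qed simp
        from arg_cong[OF this, of "image_mset (\<lambda>k. 1 / real k)"]
        have "mset (map (\<lambda>s. 1 / real (length s)) (concat v)) = mset (map (\<lambda>s. 1 / real (length s)) (concat v'))"
          by (simp only: mset_map[symmetric] map_map comp_def)
        then show ?thesis unfolding p(4) p'(4) e sS by (rule prod_list_mset)
      qed
      have "valid (flatten_faces ?S)" "valid (flatten_faces ?S')" using p(1) p'(1) .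
      then have "id \<in> sorting (flatten_faces ?S)" "id \<in> sorting (flatten_faces ?S')"
        by (auto simp: sorting_def valid_def permutes_id)
      then show ?thesis
        using W p(2) p'(2) sS sorting_cong[OF mm] by (simp add: shape_event_def)
    qed
    show ?thesis
    proof (cases "\<exists>ys. faces_ok ?S ys")
      case True
      then show ?thesis unfolding B B' using key by blast
    next
      case False
      have "shape_event v (flatten_faces ?S) = 0"
      proof (rule ccontr)
        assume nz: "shape_event v (flatten_faces ?S) \<noteq> 0"
        have "wf_shape (shape ?S)" using sS wf by simp
        note z = shape_event_zero[OF nz ne(3)[OF this]]
        then show False using faces_ok_if[of ?S] sS False by simp
      qed
      moreover have "shape_event v' (flatten_faces ?S') = 0"
      proof (rule ccontr)
        assume nz: "shape_event v' (flatten_faces ?S') \<noteq> 0"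
        have "wf_shape (shape ?S')" using sS wf' by simp
        note z = shape_event_zero[OF nz ne(3)[OF this]]
        then obtain ys where "faces_ok ?S' ys" using faces_ok_if[of ?S'] sS by auto
        from faces_ok_mset[OF this sets'] show False using False by blast
      qed
      ultimately show ?thesis unfolding B B' by simp
    qed
  qed
  have m: "?G v' \<in> borel_measurable listM"
    by (rule measurable_compose[OF measurable_split_blocks measurable_shape_event])
  have "EE n (?G v) = (\<integral>\<omega>. ?G v' (Xs \<omega> iss) \<partial>M)"
    unfolding EE_def Xs_def pt ..
  also have "\<dots> = EE n (?G v')"
  proof (rule exchangeable[OF _ _ m])
    show "distinct iss" using iss by (metis distinct_upt mset_eq_imp_distinct_iff)
    show "length iss = n" using iss by (metis length_upt minus_nat.diff_0 size_mset)
  qed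
  finally show ?thesis .
qed

text \<open>
  Given the unordered data, all orders of the segments inside the faces and of the excursions
  inside the segments are equally likely.
\<close>

theorem prob_face_shape_forget:
  assumes "forget v = forget v'"
  shows "\<P>(\<omega> in M. face_shape (R \<omega>) = v) = \<P>(\<omega> in M. face_shape (R \<omega>) = v')"
proof (cases "wf_shape v")
  case False
  then have "\<not> wf_shape v'" using wf_shape_forget[OF assms] by simp
  then have "{\<omega>\<in>space M. face_shape (R \<omega>) = v} = {}" "{\<omega>\<in>space M. face_shape (R \<omega>) = v'} = {}"
    using False wf_face_shape[OF R_valid(1)] by auto
  then show ?thesis by (simp only:)
next
  case True
  then have wf': "wf_shape v'" using wf_shape_forget[OF assms] by simp
  let ?n = "sum_list (concat (concat v))"
  have N: "N \<omega> = sum_list (concat (concat (face_shape (R \<omega>))))" if "\<omega> \<in> space M" for \<omega>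
  proof -
    have "is_composition (N \<omega>) (\<Xi>H (R \<omega>))" using compositions_valid(1)[OF R_valid[OF that]] .
    then show ?thesis using compositions_face_shape(1)[OF R_valid(1)[OF that]] by (simp add: is_composition_def)
  qed
  have n': "sum_list (concat (concat v')) = ?n"
  proof -
    have "list_all2 (\<lambda>f f'. mset (map mset f) = mset (map mset f')) v v'"
      using assms unfolding forget_def by (auto simp: list_all2_conv_all_nth list_eq_iff_nth_eq)
    then have "mset (concat (concat v)) = mset (concat (concat v'))"
    proof (induction rule: list_all2_induct)
      case (Cons f vs f' vs')
      then show ?case using mset_concat_msets[of f f'] by simp
    qed simp
    then show ?thesis by (metis sum_mset_sum_list)
  qed
  have e: "\<P>(\<omega> in M. face_shape (R \<omega>) = u) = \<P>(\<omega> in M. N \<omega> = ?n \<and> face_shape (R \<omega>) = u)"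
    if "sum_list (concat (concat u)) = ?n" for u
    using N that by (intro arg_cong[where f = prob]) auto
  show ?thesis
    unfolding e[OF refl] e[OF n'] prob_face_shape_N[OF True] prob_face_shape_N[OF wf'] n'
    using EE_shape_event_forget[OF True assms refl] by simp
qed

end

section \<open>Random ordering within the faces\<close>

lemma pmf_order_randomly:
  "pmf (order_randomly A) xs = (if mset xs = A then 1 / real (card (permutations_of_multiset A)) else 0)"
proof -
  have "permutations_of_multiset A \<noteq> {}" using ex_mset[of A] by (auto simp: permutations_of_multiset_def)
  from pmf_of_set[OF this finite_permutations_of_multiset] show ?thesis
    by (simp add: order_randomly_def indicator_def permutations_of_multiset_def)
qed

text \<open>The common probability of all orders of an unordered face.\<close>

definition face_const :: "nat multiset multiset \<Rightarrow> real" where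
  "face_const A = 1 / real (card (permutations_of_multiset A)) * (\<Prod>m\<in>#A. 1 / real (card (permutations_of_multiset m)))"

lemma prod_list_zip_order_randomly:
  "length f = length ms \<Longrightarrow> (\<Prod>(m, s)\<leftarrow>zip ms f. pmf (order_randomly m) s) =
    (if map mset f = ms then \<Prod>m\<leftarrow>ms. 1 / real (card (permutations_of_multiset m)) else 0)"
proof (induction ms arbitrary: f)
  case (Cons m ms)
  then show ?case by (cases f) (auto simp: pmf_order_randomly)
qed simp

lemma pmf_order_face: "pmf (order_face A) f = (if mset (map mset f) = A then face_const A else 0)"
proof -
  have "pmf (order_face A) f = measure_pmf.expectation (order_randomly A) (\<lambda>ms. pmf (draw_each order_randomly ms) f)"
    unfolding order_face_def by (rule pmf_bind)
  also have "\<dots> = (\<Sum>ms\<in>{map mset f}. pmf (draw_each order_randomly ms) f * pmf (order_randomly A) ms)"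
    by (rule integral_measure_pmf_real) (auto simp: pmf_draw_each prod_list_zip_order_randomly split: if_splits)
  also have "\<dots> = (if mset (map mset f) = A then face_const A else 0)"
  proof -
    have "(\<Prod>m\<leftarrow>map mset f. 1 / real (card (permutations_of_multiset m))) = (\<Prod>m\<in>#mset (map mset f). 1 / real (card (permutations_of_multiset m)))"
      by (metis mset_map prod_mset_prod_list)
    then show ?thesis
      by (auto simp: pmf_draw_each prod_list_zip_order_randomly pmf_order_randomly face_const_def simp del: mset_map)
  qed
  finally show ?thesis .
qed

lemma pmf_draw_faces: "pmf (draw_each order_face As) v = (if forget v = As then \<Prod>A\<leftarrow>As. face_const A else 0)"
proof (cases "length v = length As")
  case True
  have "(\<Prod>(A, f)\<leftarrow>zip As v. pmf (order_face A) f) = (if forget v = As then \<Prod>A\<leftarrow>As. face_const A else 0)"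
    using True
  proof (induction As arbitrary: v)
    case (Cons A As)
    then show ?case by (cases v) (auto simp: pmf_order_face forget_def)
  qed (simp add: forget_def)
  then show ?thesis using True by (simp add: pmf_draw_each)
next
  case False
  then have "forget v \<noteq> As" by (auto simp: forget_def)
  then show ?thesis using False by (simp add: pmf_draw_each)
qed

text \<open>
  If all points of a fibre of \<open>g\<close> are equally likely, drawing a uniform point of
  the fibre of a sample does not change the law. The fibres are finite because the redrawing law
  is uniform on them.
\<close>

lemma redraw_fibre:
  fixes Q :: "'a pmf" and g :: "'a \<Rightarrow> 'b"
  assumes inv: "\<And>u v. g u = g v \<Longrightarrow> pmf Q u = pmf Q v"
    and D: "\<And>A v. pmf (D A) v = (if g v = A then c A else 0)"
  shows "bind_pmf Q (\<lambda>u. D (g u)) = Q"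
proof (rule pmf_eqI)
  fix v
  let ?F = "{u. g u = g v}" and ?c = "c (g v)"
  have pc: "pmf (D (g v)) u = ?c" if "u \<in> ?F" for u using that by (simp add: D)
  have c: "?c > 0"
  proof (rule ccontr)
    assume "\<not> ?c > 0"
    moreover have "?c \<ge> 0" using pc[of v] pmf_nonneg[of "D (g v)" v] by simp
    ultimately have "pmf (D (g v)) u = 0" for u by (simp add: D)
    then have "set_pmf (D (g v)) = {}" by (auto simp: set_pmf_eq)
    then show False using set_pmf_not_empty by blast
  qed
  \<comment> \<open>All points of the fibre have the same positive mass, so there are at most \<open>1 / c\<close> of them.\<close>
  have fin: "finite ?F"
  proof (rule ccontr)
    assume inf: "infinite ?F"
    obtain n :: nat where n: "1 / ?c < real n" using reals_Archimedean2 by blast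
    obtain S where S: "S \<subseteq> ?F" "finite S" "card S = n" using infinite_arbitrarily_large[OF inf] by blast
    have "real n * ?c = (\<Sum>u\<in>S. pmf (D (g v)) u)" using S pc by (simp add: subset_iff)
    also have "\<dots> = measure_pmf.prob (D (g v)) S" using S by (simp add: measure_measure_pmf_finite)
    also have "\<dots> \<le> 1" by simp
    finally show False using n c by (simp add: field_simps)
  qed
  have one: "real (card ?F) * ?c = 1"
  proof -
    have "set_pmf (D (g v)) \<subseteq> ?F" by (auto simp: set_pmf_iff D split: if_splits)
    then have "1 = measure_pmf.prob (D (g v)) ?F" by (metis measure_pmf.prob_eq_1 AE_measure_pmf_iff UNIV_I sets_measure_pmf subsetD)
    also have "\<dots> = (\<Sum>u\<in>?F. pmf (D (g v)) u)" using fin by (rule measure_measure_pmf_finite)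
    also have "\<dots> = real (card ?F) * ?c" using pc by simp
    finally show ?thesis by simp
  qed
  have "pmf (bind_pmf Q (\<lambda>u. D (g u))) v = (\<Sum>u\<in>?F. pmf (D (g u)) v * pmf Q u)"
    unfolding pmf_bind
  proof (rule integral_measure_pmf_real[OF fin])
    fix u assume "pmf (D (g u)) v \<noteq> 0"
    then have "g v = g u" using D[of "g u" v] by (cases "g v = g u") simp_all
    then show "u \<in> ?F" by simp
  qed
  also have "\<dots> = (\<Sum>u\<in>?F. ?c * pmf Q v)"
    
  proof (rule sum.cong[OF refl])
    fix u assume "u \<in> ?F"
    then have g: "g u = g v" by simp
    have "pmf (D (g v)) v = ?c" using D[of "g v" v] by (simp only: if_P)
    then show "pmf (D (g u)) v * pmf Q u = ?c * pmf Q v" using inv[OF g] g by (simp only:)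
  qed
  also have "\<dots> = pmf Q v" using one by simp
  finally show "pmf (bind_pmf Q (\<lambda>u. D (g u))) v = pmf Q v" .
qed

text \<open>
  Distinct faces have distinct slopes, so ordering by slope recovers their order in the walk.
\<close>

lemma by_decreasing_slope_unordered_faces:
  assumes v: "valid bs"
  shows "by_decreasing_slope (unordered_faces bs) = forget (face_shape bs)"
proof -
  define zs where "zs = map (\<lambda>g. (mean (hd g), mset (map mset (map excs g)))) (groups bs)"
  have s: "sorted_wrt (\<ge>) (map mean bs)" using v by (simp add: valid_def)
  let ?F = "\<lambda>I. (slope (concat bs) I, image_mset (\<lambda>I'. image_mset block_length (mset (blocks_within (\<Xi>H bs) I'))) (mset (blocks_within (\<Xi>K bs) I)))"
  have "map ?F (filter (\<lambda>_. True) (blocks (\<Xi>F bs))) = map (\<lambda>g. (mean (hd g), mset (map mset (map excs g)))) (filter (\<lambda>_. True) (groups bs))"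
  proof (rule map_filter_list_all2, rule list_all2_mono[OF face_blocks[OF v]], elim conjE)
    fix I g
    assume a: "slope (concat bs) I = mean (hd g)"
      "map (\<lambda>I'. map block_length (blocks_within (\<Xi>H bs) I')) (blocks_within (\<Xi>K bs) I) = map excs g"
    have "image_mset (\<lambda>I'. image_mset block_length (mset (blocks_within (\<Xi>H bs) I'))) (mset (blocks_within (\<Xi>K bs) I)) =
       mset (map mset (map (\<lambda>I'. map block_length (blocks_within (\<Xi>H bs) I')) (blocks_within (\<Xi>K bs) I)))"
      by (simp add: comp_def)
    then show "(True \<longleftrightarrow> True) \<and> ?F I = (mean (hd g), mset (map mset (map excs g)))" using a by simp
  qed
  then have "map ?F (blocks (\<Xi>F bs)) = zs" by (simp add: zs_def)
  then have D: "unordered_faces bs = set zs" unfolding unordered_faces_def by (simp only: list.set_map[symmetric])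
  have srt: "sorted_wrt (>) (map fst zs)" using groups_props(3)[OF s] by (simp add: zs_def comp_def)
  then have srt': "sorted_wrt (<) (map fst (rev zs))" by (simp add: sorted_wrt_rev rev_map[symmetric])
  then have "distinct (map fst (rev zs))" by (simp only: strict_sorted_iff)
  then have dist: "distinct (map fst zs)" by (simp add: rev_map[symmetric])
  have "set zs \<subseteq> Map.graph (map_of zs)" using dist by (auto simp: Map.graph_def)
  moreover have "length (rev zs) = card (set zs)" using dist by (metis distinct_card distinct_map length_rev)
  ultimately have "sorted_key_list_of_set fst (set zs) = rev zs"
    using folding_Map_graph.sorted_key_list_of_set_unique[of "set zs" "map_of zs" "rev zs"] srt' by simp
  then have "by_decreasing_slope (unordered_faces bs) = map snd zs" unfolding by_decreasing_slope_def D by simp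
  then show ?thesis by (simp add: zs_def forget_def face_shape_def comp_def multiset.map_comp)
qed

definition comps_of_shape :: "nat list list list \<Rightarrow> nat list \<times> nat list \<times> nat list" where
  "comps_of_shape fs = (concat (concat fs), map sum_list (concat fs), map (sum_list \<circ> concat) fs)"

lemma Xi_comps_of_shape: "valid bs \<Longrightarrow> (\<Xi>H bs, \<Xi>K bs, \<Xi>F bs) = comps_of_shape (face_shape bs)"
  using compositions_face_shape[of bs] by (simp add: comps_of_shape_def)

lemma face_points_split:
  assumes v: "valid bs"
  shows "face_points A bs = mset (map (\<lambda>f. (length f, sum_list f)) (filter (\<lambda>f. mean f \<notin> A) (split_blocks (\<Xi>F bs) (concat bs))))"
proof -
  have F: "\<Xi>F bs = map length (map concat (groups bs))"
    by (simp add: \<Xi>F_def face_comp_valid[OF v] comp_def)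
  have sp: "split_blocks (\<Xi>F bs) (concat bs) = map concat (groups bs)"
    unfolding F using split_blocks_concat[of "map concat (groups bs)"] by (simp only: concat_map_concat_groups)
  have "filter (\<lambda>g. mean (hd g) \<notin> A) (groups bs) = filter (\<lambda>g. mean (concat g) \<notin> A) (groups bs)"
    using valid_groups(2)[OF v] by (intro filter_cong) auto
  then show ?thesis unfolding face_points_valid[OF v] sp by (simp add: filter_map comp_def)
qed

lemma face_points_single:
  assumes v: "valid bs" and single: "\<And>g. g \<in> set (groups bs) \<Longrightarrow> mean (hd g) \<notin> A \<Longrightarrow> length g = 1"
  shows "face_points A bs = mset (map (\<lambda>b. (length b, sum_list b)) (filter (\<lambda>b. mean b \<notin> A) bs))"
proof -
  have s: "sorted_wrt (\<ge>) (map mean bs)" using v by (simp add: valid_def)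
  have "map (\<lambda>g. (length (concat g), sum_list (concat g))) (filter (\<lambda>g. mean (hd g) \<notin> A) gs) =
     map (\<lambda>b. (length b, sum_list b)) (filter (\<lambda>b. mean b \<notin> A) (concat gs))"
    if "\<And>g. g \<in> set gs \<Longrightarrow> \<forall>b\<in>set g. mean b = mean (hd g)" "\<And>g. g \<in> set gs \<Longrightarrow> mean (hd g) \<notin> A \<Longrightarrow> length g = 1" for gs
    using that
  proof (induction gs)
    case (Cons g gs)
    have IH: "map (\<lambda>g. (length (concat g), sum_list (concat g))) (filter (\<lambda>g. mean (hd g) \<notin> A) gs) =
      map (\<lambda>b. (length b, sum_list b)) (filter (\<lambda>b. mean b \<notin> A) (concat gs))" by (rule Cons.IH) (use Cons.prems in auto)
    show ?case
    proof (cases "mean (hd g) \<in> A")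
      case True
      then have "filter (\<lambda>b. mean b \<notin> A) g = []" using Cons.prems(1)[of g] by (auto simp: filter_empty_conv)
      then show ?thesis using IH True by simp
    next
      case False
      then obtain b where "g = [b]" using Cons.prems(2)[of g] by (auto simp: length_Suc_conv)
      then show ?thesis using IH False by simp
    qed
  qed simp
  from this[of "groups bs"] show ?thesis
    using groups_props(2)[OF s] single unfolding face_points_valid[OF v] by simp
qed

context iid_sequence
begin

text \<open>
  The two means are independent, and the second one charges no point outside the countable set
  of atoms.
\<close>

lemma AE_mean_coincidence:
  assumes d: "distinct is" "distinct js" "set is \<inter> set js = {}" "js \<noteq> []"
    and cnt: "countable (atom_slopes M X)"
  shows "AE \<omega> in M. mean (Xs \<omega> is) = mean (Xs \<omega> js) \<longrightarrow> mean (Xs \<omega> js) \<in> atom_slopes M X"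
proof -
  let ?A = "atom_slopes M X"
  let ?k = "length js"
  let ?U = "\<lambda>\<omega>. mean (Xs \<omega> is)" and ?V = "\<lambda>\<omega>. mean (Xs \<omega> js)"
  have A[measurable]: "?A \<in> sets borel" by (rule sets.countable[OF _ cnt]) simp
  have ind: "indep_var (Pi\<^sub>M (set is) (\<lambda>_. borel)) (\<lambda>\<omega>. \<lambda>i\<in>set is. X i \<omega>) (Pi\<^sub>M (set js) (\<lambda>_. borel)) (\<lambda>\<omega>. \<lambda>i\<in>set js. X i \<omega>)"
    by (rule indep_var_restrict[OF X_indep]) (use d in auto)
  have m: "(\<lambda>x. mean (map (\<lambda>i. x i) ks)) \<in> borel_measurable (Pi\<^sub>M (set ks) (\<lambda>_. borel))" for ks :: "nat list"
  proof -
    have "(\<lambda>x. map (\<lambda>i. x i) ks) \<in> Pi\<^sub>M (set ks) (\<lambda>_. borel) \<rightarrow>\<^sub>M listM"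
      by (intro measurable_to_listM measurable_component_singleton)
    from measurable_compose[OF this measurable_mean_listM] show ?thesis .
  qed
  have e: "mean (Xs \<omega> ks) = mean (map (\<lambda>i. (\<lambda>i\<in>set ks. X i \<omega>) i) ks)" for \<omega> ks
    by (simp add: Xs_def cong: map_cong)
  have "indep_var borel ((\<lambda>x. mean (map (\<lambda>i. x i) is)) \<circ> (\<lambda>\<omega>. \<lambda>i\<in>set is. X i \<omega>)) borel ((\<lambda>x. mean (map (\<lambda>i. x i) js)) \<circ> (\<lambda>\<omega>. \<lambda>i\<in>set js. X i \<omega>))"
    by (rule indep_var_compose[OF ind m m])
  then have iv: "indep_var borel ?U borel ?V" unfolding e by (simp add: comp_def)
  have U[measurable]: "?U \<in> borel_measurable M" and V[measurable]: "?V \<in> borel_measurable M" by measurable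
  have pd: "distr M borel ?U \<Otimes>\<^sub>M distr M borel ?V = distr M (borel \<Otimes>\<^sub>M borel) (\<lambda>\<omega>. (?U \<omega>, ?V \<omega>))"
    using iv by (simp add: indep_var_distribution_eq)
  have null: "prob {\<omega>\<in>space M. ?V \<omega> = y} = 0" if y: "y \<notin> ?A" for y
  proof -
    have "prob {\<omega>\<in>space M. ?V \<omega> = y} = (\<integral>\<omega>. indicator {b. mean b = y} (Xs \<omega> js) \<partial>M)"
    proof -
      have "(\<integral>\<omega>. indicator {b. mean b = y} (Xs \<omega> js) \<partial>M) = (\<integral>\<omega>. indicator {\<omega>\<in>space M. ?V \<omega> = y} \<omega> \<partial>M :: real)"
        by (rule Bochner_Integration.integral_cong) (auto simp: indicator_def)
      also have "\<dots> = prob ({\<omega>\<in>space M. ?V \<omega> = y} \<inter> space M)" by (rule Bochner_Integration.integral_indicator)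
      also have "{\<omega>\<in>space M. ?V \<omega> = y} \<inter> space M = {\<omega>\<in>space M. ?V \<omega> = y}" by auto
      finally show ?thesis by (rule sym)
    qed
    also have "\<dots> = EE ?k (indicator {b. mean b = y})"
    proof (rule exchangeable[OF d(2) refl])
      show "(indicator {b. mean b = y} :: _ \<Rightarrow> real) \<in> borel_measurable listM"
        using measurable_sets[OF measurable_mean_listM, of "{y}"] by (simp add: vimage_def)
    qed
    also have "\<dots> = EE ?k (\<lambda>b. indicator {b. sum_list b = real ?k * y} b)"
      by (rule EE_cong) (use d(4) in \<open>auto simp: indicator_def mean_def field_simps\<close>)
    also have "\<dots> = \<P>(\<omega> in M. partial_sum X ?k \<omega> = real ?k * y)" by (rule EE_indicator_sum) simp
    also have "\<dots> = 0"
    proof (rule ccontr)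
      assume "\<P>(\<omega> in M. partial_sum X ?k \<omega> = real ?k * y) \<noteq> 0"
      then have "\<P>(\<omega> in M. partial_sum X ?k \<omega> = real ?k * y) > 0" by (simp add: zero_less_measure_iff)
      then show False using y d(4) unfolding atom_slopes_def by blast
    qed
    finally show ?thesis .
  qed
  interpret U: prob_space "distr M borel ?U" by (rule prob_space_distr) simp
  interpret V: prob_space "distr M borel ?V" by (rule prob_space_distr) simp
  interpret UV: pair_prob_space "distr M borel ?U" "distr M borel ?V" ..
  have "AE z in distr M borel ?U \<Otimes>\<^sub>M distr M borel ?V. fst z = snd z \<longrightarrow> snd z \<in> ?A"
  proof (rule UV.AE_pair_measure)
    show "{z \<in> space (distr M borel ?U \<Otimes>\<^sub>M distr M borel ?V). fst z = snd z \<longrightarrow> snd z \<in> ?A} \<in> sets (distr M borel ?U \<Otimes>\<^sub>M distr M borel ?V)"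
      by measurable
    show "AE u in distr M borel ?U. AE v in distr M borel ?V. fst (u, v) = snd (u, v) \<longrightarrow> snd (u, v) \<in> ?A"
    proof (rule AE_I2)
      fix u
      show "AE v in distr M borel ?V. fst (u, v) = snd (u, v) \<longrightarrow> snd (u, v) \<in> ?A"
      proof (cases "u \<in> ?A")
        case False
        have "AE \<omega> in M. \<omega> \<notin> {\<omega>\<in>space M. ?V \<omega> = u}"
          using null[OF False] by (subst prob_eq_0[symmetric]) auto
        with AE_space have "AE \<omega> in M. \<not> ?V \<omega> = u" by eventually_elim auto
        then have "AE v in distr M borel ?V. \<not> v = u" by (subst AE_distr_iff) auto
        then show ?thesis by eventually_elim auto
      qed auto
    qed
  qed
  then have "AE z in distr M (borel \<Otimes>\<^sub>M borel) (\<lambda>\<omega>. (?U \<omega>, ?V \<omega>)). fst z = snd z \<longrightarrow> snd z \<in> ?A" unfolding pd .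
  then show ?thesis by (subst (asm) AE_distr_iff) auto
qed

end

section \<open>Slopes that are not atoms\<close>

lemma split_blocks_nth_map: "i < length ns \<Longrightarrow> split_blocks ns (map f xs) ! i = map f (split_blocks ns xs ! i)"
  by (simp add: split_blocks_map)

lemma rearrange_map:
  assumes "c \<in> choices ns"
  shows "rearrange ns (map f xs) c = map (map f) (rearrange ns xs c)"
proof -
  obtain \<tau> \<sigma> where c: "c = (\<tau>, \<sigma>)" by (cases c) auto
  have t: "\<tau> permutes {..<length ns}" using assms c by (auto simp: choices_def)
  have "\<tau> i < length ns" if "i < length ns" for i using permutes_in_image[OF t, of i] that by simp
  then show ?thesis by (auto simp: rearrange_def c rotate_map split_blocks_nth_map)
qed

lemma mset_concat_rearrange:
  assumes "c \<in> choices ns" "sum_list ns = length xs"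
  shows "mset (concat (rearrange ns xs c)) = mset xs"
proof -
  obtain \<tau> \<sigma> where c: "c = (\<tau>, \<sigma>)" by (cases c) auto
  have t: "\<tau> permutes {..<length ns}" using assms c by (auto simp: choices_def)
  then have t': "\<tau> permutes {..<length (rotate_blocks \<sigma> (split_blocks ns xs))}" by simp
  show ?thesis unfolding c rearrange_conv[OF t] mset_concat_permute_list[OF t'] mset_concat_rotate_blocks
    using concat_split_blocks[OF assms(2)] by simp
qed

lemma size_filter_mset_list: "size (filter_mset P (mset xs)) = length (filter P xs)"
  by (simp only: mset_filter[symmetric] size_mset)

lemma length_filter_sort: "length (filter P (map f (sort_key k bs))) = length (filter P (map f bs))"
proof -
  have "size (filter_mset P (mset (map f (sort_key k bs)))) = size (filter_mset P (mset (map f bs)))" by simp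
  then show ?thesis by (simp only: mset_filter[symmetric] size_mset)
qed

text \<open>The first two excursions of a block have the slope of the block.\<close>

lemma excs_at_least_two:
  assumes "good b" "b \<noteq> []" "length (excs b) \<noteq> 1"
  shows "\<exists>k l. 0 < l \<and> k + l \<le> length b \<and> mean (take k b) = mean b \<and> mean (take l (drop k b)) = mean b"
proof -
  obtain es where es: "concat es = b" "\<forall>e\<in>set es. irr (mean b) e" "es \<noteq> []" "excs b = map length es"
    using good_decompose[OF assms(1,2)] .
  have "length es \<noteq> 1" "length es \<noteq> 0" using es(3,4) assms(3) by auto
  then obtain e1 e2 es' where e: "es = e1 # e2 # es'" by (cases es; cases "tl es") auto
  have m: "e \<noteq> [] \<and> mean e = mean b" if "e \<in> set es" for e
    using es(2) that by (auto simp: irr_def mean_def)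
  have b: "b = e1 @ e2 @ concat es'" using es(1) e by simp
  have "take (length e1) b = e1" "take (length e2) (drop (length e1) b) = e2" using b by simp_all
  then show ?thesis using m[of e1] m[of e2] e b
    by (intro exI[of _ "length e1"] exI[of _ "length e2"]) auto
qed

context rearranged_walk
begin

text \<open>
  The rearrangement acts on the indices of the increments, so the segments are built from
  disjoint sets of indices.
\<close>

definition R_indices :: "'w \<Rightarrow> nat list list" where
  "R_indices \<omega> = rearrange (cycle_lengths (N \<omega>) (perm \<omega>)) [0..<N \<omega>] (choice \<omega>)"

lemma R_indices:
  assumes w: "\<omega> \<in> space M"
  shows "R \<omega> = map (Xs \<omega>) (R_indices \<omega>)" "distinct (concat (R_indices \<omega>))"
proof -
  have c: "choice \<omega> \<in> choices (cycle_lengths (N \<omega>) (perm \<omega>))"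
    using choice_admissible[OF w] admissible_subset_choices by blast
  have s: "sum_list (cycle_lengths (N \<omega>) (perm \<omega>)) = length [0..<N \<omega>]"
    using cycle_lengths_props(2)[OF perm_permutes[OF w]] by (simp add: comps_def)
  show "R \<omega> = map (Xs \<omega>) (R_indices \<omega>)"
    unfolding R_eq Xs_def R_indices_def by (rule rearrange_map[OF c])
  have "mset (concat (R_indices \<omega>)) = mset [0..<N \<omega>]"
    unfolding R_indices_def by (rule mset_concat_rearrange[OF c s])
  then show "distinct (concat (R_indices \<omega>))" by (metis distinct_upt mset_eq_imp_distinct_iff)
qed

text \<open>
  The almost sure event on which means of disjoint groups of increments coincide only at atoms.
\<close>

definition generic :: "'w \<Rightarrow> bool" where
  "generic \<omega> \<longleftrightarrow> (\<forall>is js. distinct (is @ js) \<and> js \<noteq> [] \<longrightarrow>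
     mean (Xs \<omega> is) = mean (Xs \<omega> js) \<longrightarrow> mean (Xs \<omega> js) \<in> atom_slopes M X)"

lemma AE_generic:
  assumes "countable (atom_slopes M X)"
  shows "AE \<omega> in M. generic \<omega>"
proof -
  have pair: "AE \<omega> in M. distinct (is @ js) \<and> js \<noteq> [] \<longrightarrow>
     mean (Xs \<omega> is) = mean (Xs \<omega> js) \<longrightarrow> mean (Xs \<omega> js) \<in> atom_slopes M X" for "is" js
  proof (cases "distinct (is @ js) \<and> js \<noteq> []")
    case True
    then have d: "distinct is" "distinct js" "set is \<inter> set js = {}" "js \<noteq> []" by auto
    show ?thesis using AE_mean_coincidence[OF d assms] by eventually_elim simp
  next
    case False
    then show ?thesis by (intro AE_I2) blast
  qed
  show ?thesis unfolding generic_def by (intro AE_all_countable[THEN iffD2] allI pair)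
qed

text \<open>
  A second segment in a face, or a second excursion in a segment, would be a coincidence of the
  means of two disjoint groups of increments.
\<close>

lemma generic_segments:
  assumes w: "\<omega> \<in> space M" and gen: "generic \<omega>"
  shows "g \<in> set (groups (R \<omega>)) \<Longrightarrow> mean (hd g) \<notin> atom_slopes M X \<Longrightarrow> length g = 1"
    and "b \<in> set (R \<omega>) \<Longrightarrow> mean b \<notin> atom_slopes M X \<Longrightarrow> length (excs b) = 1"
proof -
  note v = R_valid(1)[OF w]
  have s: "sorted_wrt (\<ge>) (map mean (R \<omega>))" using v by (simp add: valid_def)
  note idx = R_indices[OF w]
  {
    assume g: "g \<in> set (groups (R \<omega>))" and A: "mean (hd g) \<notin> atom_slopes M X"
    show "length g = 1"
    proof (rule ccontr)
      assume "length g \<noteq> 1"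
      moreover have "g \<noteq> []" using groups_props(1)[OF s] g by auto
      ultimately obtain b c g' where gg: "g = b # c # g'" by (cases g; cases "tl g") auto
      obtain gs1 gs2 where gs: "groups (R \<omega>) = gs1 @ g # gs2" using split_list[OF g] by auto
      have "R \<omega> = concat (groups (R \<omega>))" by simp
      also have "\<dots> = concat gs1 @ b # c # (g' @ concat gs2)" unfolding gs gg by simp
      finally have "map (Xs \<omega>) (R_indices \<omega>) = concat gs1 @ b # c # (g' @ concat gs2)" unfolding idx(1) .
      then obtain i1 p r i2 where i: "R_indices \<omega> = i1 @ p # r # i2" "b = Xs \<omega> p" "c = Xs \<omega> r"
        by (auto simp: map_eq_append_conv map_eq_Cons_conv)
      have "c \<in> set (R \<omega>)" using i idx(1) by simp
      then have "c \<noteq> []" using v by (auto simp: valid_def)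
      then have "r \<noteq> []" using i(3) by (auto simp: Xs_def)
      moreover have "distinct (p @ r)" using idx(2) i(1) by auto
      moreover have m: "mean b = mean (hd g)" "mean c = mean (hd g)" using groups_props(2)[OF s g] gg by auto
      ultimately have "mean c \<in> atom_slopes M X" using gen i(2,3) unfolding generic_def by metis
      then show False using A m by simp
    qed
  next
    assume b: "b \<in> set (R \<omega>)" and A: "mean b \<notin> atom_slopes M X"
    show "length (excs b) = 1"
    proof (rule ccontr)
      assume 1: "length (excs b) \<noteq> 1"
      have gd: "good b" "b \<noteq> []" using v b by (auto simp: valid_def)
      obtain k l where kl: "0 < l" "k + l \<le> length b" "mean (take k b) = mean b" "mean (take l (drop k b)) = mean b"
        using excs_at_least_two[OF gd 1] by blast
      obtain p where p: "p \<in> set (R_indices \<omega>)" "b = Xs \<omega> p" using b idx(1) by auto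
      have "distinct p" using idx(2) p(1) by (auto simp: distinct_concat_iff)
      then have "distinct (take (k + l) p)" by simp
      then have d: "distinct (take k p @ take l (drop k p))" by (simp only: take_add)
      have len: "length p = length b" using p(2) by simp
      have ne: "take l (drop k p) \<noteq> []" using kl(1,2) len by auto
      have "Xs \<omega> (take k p) = take k b" "Xs \<omega> (take l (drop k p)) = take l (drop k b)"
        using p(2) by (simp_all add: Xs_def take_map drop_map)
      then have "mean b \<in> atom_slopes M X" using gen d ne kl(3,4) unfolding generic_def by metis
      then show False using A by simp
    qed
  }
qed

lemma generic_faces:
  assumes w: "\<omega> \<in> space M" and gen: "generic \<omega>"
    and I: "I \<in> set (blocks (\<Xi>F (R \<omega>)))" and A: "slope (concat (R \<omega>)) I \<notin> atom_slopes M X"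
  shows "\<exists>I'. blocks_within (\<Xi>K (R \<omega>)) I = [I'] \<and> (\<exists>I''. blocks_within (\<Xi>H (R \<omega>)) I' = [I''])"
proof -
  note v = R_valid(1)[OF w]
  obtain i where i: "i < length (blocks (\<Xi>F (R \<omega>)))" "I = blocks (\<Xi>F (R \<omega>)) ! i"
    using I by (auto simp: in_set_conv_nth)
  let ?g = "groups (R \<omega>) ! i"
  have g: "?g \<in> set (groups (R \<omega>))" using list_all2_lengthD[OF face_blocks[OF v]] i(1) by simp
  have F: "slope (concat (R \<omega>)) I = mean (hd ?g)"
    "map (\<lambda>I'. map block_length (blocks_within (\<Xi>H (R \<omega>)) I')) (blocks_within (\<Xi>K (R \<omega>)) I) = map excs ?g"
    using list_all2_nthD[OF face_blocks[OF v] i(1)] i(2) by auto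
  have "length ?g = 1" using generic_segments(1)[OF w gen g] F(1) A by simp
  then obtain b where b: "?g = [b]" by (auto simp: length_Suc_conv)
  have "b \<in> set (concat (groups (R \<omega>)))" using g b by (simp del: concat_groups) (metis list.set_intros(1))
  then have "b \<in> set (R \<omega>)" by simp
  then have "length (excs b) = 1" using generic_segments(2)[OF w gen] F(1) b A by simp
  then obtain l where l: "excs b = [l]" by (auto simp: length_Suc_conv)
  from F(2) b l obtain I' where I': "blocks_within (\<Xi>K (R \<omega>)) I = [I']" "map block_length (blocks_within (\<Xi>H (R \<omega>)) I') = [l]"
    by (auto simp: map_eq_Cons_conv)
  then show ?thesis by (auto simp: map_eq_Cons_conv)
qed

section \<open>The point process of the remaining faces\<close>

abbreviation pointM :: "(nat \<times> real) measure" where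
  "pointM \<equiv> count_space UNIV \<Otimes>\<^sub>M borel"

text \<open>
  The counting variables of the point process of faces whose slope avoids \<open>A\<close>.
\<close>

abbreviation points_in :: "real set \<Rightarrow> (nat \<times> real) set \<Rightarrow> 'w \<Rightarrow> nat" where
  "points_in A B \<omega> \<equiv> size (filter_mset (\<lambda>z. z \<in> B) (face_points A (R \<omega>)))"

text \<open>
  The face composition takes countably many values, and for each of them the count is a
  measurable function of the concatenated walk.
\<close>

lemma measurable_points_in:
  assumes A: "countable A" and B[measurable]: "B \<in> sets pointM"
  shows "points_in A B \<in> M \<rightarrow>\<^sub>M count_space UNIV"
proof -
  have A'[measurable]: "A \<in> sets borel" by (rule sets.countable[OF _ A]) simp
  let ?P = "\<lambda>f. mean f \<notin> A \<and> (length f, sum_list f) \<in> B"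
  have P: "Measurable.pred listM ?P" by measurable
  let ?G = "\<lambda>c bs. length (filter id (map ?P (split_blocks c (concat bs))))"
  have G: "(\<lambda>bs. ?G c bs) \<in> segM \<rightarrow>\<^sub>M count_space UNIV" for c
  proof -
    have 1: "(\<lambda>bs. split_blocks c (concat bs)) \<in> segM \<rightarrow>\<^sub>M segM"
      by (rule measurable_compose[OF measurable_concat_segM measurable_split_blocks])
    have 2: "(\<lambda>bs. map ?P (split_blocks c (concat bs))) \<in> segM \<rightarrow>\<^sub>M count_space UNIV"
      by (rule measurable_compose[OF 1 measurable_map_segM[OF P]])
    show ?thesis by (rule measurable_compose[OF 2]) simp
  qed
  have c: "(\<lambda>\<omega>. map (sum_list \<circ> concat) (face_shape (R \<omega>))) \<in> M \<rightarrow>\<^sub>M count_space UNIV"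
    by (rule measurable_compose[OF measurable_compose[OF measurable_R measurable_face_shape]]) simp
  have "(\<lambda>\<omega>. ?G (map (sum_list \<circ> concat) (face_shape (R \<omega>))) (R \<omega>)) \<in> M \<rightarrow>\<^sub>M count_space UNIV"
    by (rule measurable_compose_countable[OF measurable_compose[OF measurable_R G] c])
  moreover have "?G (map (sum_list \<circ> concat) (face_shape (R \<omega>))) (R \<omega>) = points_in A B \<omega>" if w: "\<omega> \<in> space M" for \<omega>
  proof -
    note v = R_valid(1)[OF w]
    have "points_in A B \<omega> = length (filter (\<lambda>z. z \<in> B) (map (\<lambda>f. (length f, sum_list f)) (filter (\<lambda>f. mean f \<notin> A) (split_blocks (\<Xi>F (R \<omega>)) (concat (R \<omega>))))))"
      unfolding face_points_split[OF v] by (rule size_filter_mset_list)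
    also have "\<dots> = ?G (\<Xi>F (R \<omega>)) (R \<omega>)"
      by (simp add: filter_map comp_def conj_commute)
    finally show ?thesis using compositions_face_shape(3)[OF v] by simp
  qed
  ultimately show ?thesis by (simp cong: measurable_cong)
qed

text \<open>
  Off the atoms faces are single segments, so the points can be counted along the segments.
\<close>

lemma generic_points_in:
  assumes w: "\<omega> \<in> space M" and gen: "generic \<omega>"
  shows "points_in (atom_slopes M X) B \<omega> =
    length (filter (\<lambda>b. mean b \<notin> atom_slopes M X \<and> (length b, sum_list b) \<in> B) (R \<omega>))"
proof -
  have "points_in (atom_slopes M X) B \<omega> = length (filter (\<lambda>z. z \<in> B) (map (\<lambda>b. (length b, sum_list b)) (filter (\<lambda>b. mean b \<notin> atom_slopes M X) (R \<omega>))))"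
  proof -
    have "face_points (atom_slopes M X) (R \<omega>) = mset (map (\<lambda>b. (length b, sum_list b)) (filter (\<lambda>b. mean b \<notin> atom_slopes M X) (R \<omega>)))"
      by (rule face_points_single[OF R_valid(1)[OF w]]) (rule generic_segments(1)[OF w gen])
    then show ?thesis by (simp only: size_filter_mset_list)
  qed
  then show ?thesis by (simp add: filter_map comp_def conj_commute)
qed

text \<open>
  Product formula for events that agree almost surely with events about disjoint classes of
  marks.
\<close>

lemma prob_marks_independent:
  fixes \<kappa> :: "real list \<Rightarrow> 'c :: countable"
  assumes k: "\<kappa> \<in> listM \<rightarrow>\<^sub>M count_space UNIV" and I: "finite I" "disjoint_family_on C I"
    and ins: "\<And>i bs. i \<in> I \<Longrightarrow> filter (\<lambda>c. c \<in> C i) (map \<kappa> (sort_means bs)) \<in> E i \<longleftrightarrow> filter (\<lambda>c. c \<in> C i) (map \<kappa> bs) \<in> E i"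
    and A: "\<And>i. i \<in> I \<Longrightarrow> A i \<in> events"
      "\<And>i. i \<in> I \<Longrightarrow> AE \<omega> in M. \<omega> \<in> A i \<longleftrightarrow> filter (\<lambda>c. c \<in> C i) (map \<kappa> (R \<omega>)) \<in> E i"
    and ne: "I \<noteq> {}"
  shows "prob (\<Inter>i\<in>I. A i) = (\<Prod>i\<in>I. prob (A i))"
proof -
  have m: "(\<lambda>\<omega>. map \<kappa> (R \<omega>)) \<in> M \<rightarrow>\<^sub>M count_space UNIV"
    by (rule measurable_compose[OF measurable_R measurable_map_segM[OF k]])
  have T: "{\<omega>\<in>space M. filter (\<lambda>c. c \<in> C i) (map \<kappa> (R \<omega>)) \<in> E i} \<in> events" for i
    using measurable_sets[OF m, of "{ks. filter (\<lambda>c. c \<in> C i) ks \<in> E i}"] by (simp add: vimage_def Int_def conj_commute)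
  have one: "prob (A i) = measure_pmf.prob (thinned total_rate (segment_law \<kappa>) (C i)) (E i)" if i: "i \<in> I" for i
  proof -
    have "prob (A i) = \<P>(\<omega> in M. filter (\<lambda>c. c \<in> C i) (map \<kappa> (R \<omega>)) \<in> E i)"
      by (rule finite_measure_eq_AE[OF _ A(1)[OF i] T]) (use A(2)[OF i] AE_space in eventually_elim, simp)
    then show ?thesis using marks_class_law[OF k ins[OF i]] by simp
  qed
  have "prob (\<Inter>i\<in>I. A i) = \<P>(\<omega> in M. \<forall>i\<in>I. filter (\<lambda>c. c \<in> C i) (map \<kappa> (R \<omega>)) \<in> E i)"
  proof (rule finite_measure_eq_AE)
    have "AE \<omega> in M. \<forall>i\<in>I. \<omega> \<in> A i \<longleftrightarrow> filter (\<lambda>c. c \<in> C i) (map \<kappa> (R \<omega>)) \<in> E i"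
      using I(1) A(2) by (intro AE_finite_allI)
    with AE_space show "AE \<omega> in M. (\<omega> \<in> (\<Inter>i\<in>I. A i)) = (\<omega> \<in> {\<omega>\<in>space M. \<forall>i\<in>I. filter (\<lambda>c. c \<in> C i) (map \<kappa> (R \<omega>)) \<in> E i})"
      by eventually_elim simp
    show "(\<Inter>i\<in>I. A i) \<in> events" using I(1) ne A(1) by (intro sets.finite_INT)
    have "{\<omega>\<in>space M. \<forall>i\<in>I. filter (\<lambda>c. c \<in> C i) (map \<kappa> (R \<omega>)) \<in> E i} = (\<Inter>i\<in>I. {\<omega>\<in>space M. filter (\<lambda>c. c \<in> C i) (map \<kappa> (R \<omega>)) \<in> E i})"
      using ne by auto
    also have "\<dots> \<in> events" using I(1) ne T by (intro sets.finite_INT)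
    finally show "{\<omega>\<in>space M. \<forall>i\<in>I. filter (\<lambda>c. c \<in> C i) (map \<kappa> (R \<omega>)) \<in> E i} \<in> events" .
  qed
  then show ?thesis using marks_independent[OF k I ins] one by simp
qed

lemma filter_kappa_None:
  "length (filter (\<lambda>c. fst c = None \<and> Q (snd (snd c))) (map (kappa x J B m) bs)) =
   length (filter (\<lambda>b. mean b \<notin> x ` J \<and> Q (map (\<lambda>i. (length b, sum_list b) \<in> B i) [0..<m])) bs)"
  by (simp add: filter_map comp_def fst_kappa_None) (simp add: kappa_def)

context
  fixes x :: "nat \<Rightarrow> real" and J :: "nat set"
  assumes x: "bij_betw x J (atom_slopes M X)"
begin

lemma atoms: "x ` J = atom_slopes M X" "inj_on x J" "countable (atom_slopes M X)"
proof -
  show e: "x ` J = atom_slopes M X" "inj_on x J" using x by (auto simp: bij_betw_def)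
  show "countable (atom_slopes M X)" unfolding e(1)[symmetric] by simp
qed

text \<open>
  Length, increment and slope are invariant under rotations, so averaging over the
  \<open>i\<close> rotations leaves the law of \<open>S_i\<close> with the factor \<open>1 /
  i\<close>.
\<close>

lemma rate_face_intensity:
  assumes B: "B \<in> sets pointM"
  defines "\<kappa> \<equiv> kappa x J (\<lambda>_. B) 1"
  shows "emeasure (face_intensity M X q (x ` J)) B =
    ennreal (total_rate * measure_pmf.prob (segment_law \<kappa>) {c. fst c = None \<and> snd (snd c) = [True]})"
proof -
  let ?A = "x ` J"
  let ?C = "{c. fst c = None \<and> snd (snd c) = [True]}"
  have A[measurable]: "?A \<in> sets borel" by (rule sets.countable) auto
  have k: "\<kappa> \<in> listM \<rightarrow>\<^sub>M count_space UNIV" unfolding \<kappa>_def by (rule measurable_kappa[OF atoms(2) B])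
  let ?S = "\<lambda>k. {s. (k, s) \<in> B \<and> (\<forall>y\<in>?A. s \<noteq> real k * y)}"
  let ?p = "\<lambda>k. \<P>(\<omega> in M. partial_sum X k \<omega> \<in> ?S k)"
  have S: "?S k \<in> sets borel" for k
  proof -
    have "?S k = (Pair k -` B) - (\<Union>y\<in>?A. {real k * y})" by auto
    also have "\<dots> \<in> sets borel" using sets_Pair1[OF B] by (intro sets.Diff sets.countable_UN') auto
    finally show ?thesis .
  qed
  have e: "q ^ Suc k * EE (Suc k) (\<lambda>b. block_weight b * indicator ?C (\<kappa> b)) = q ^ Suc k / real (Suc k) * ?p (Suc k)" for k
  proof -
    let ?I = "\<lambda>b. indicator {b. mean b \<notin> ?A \<and> (length b, sum_list b) \<in> B} b :: real"
    have i: "indicator ?C (\<kappa> b) = ?I b" for b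
      by (auto simp: indicator_def \<kappa>_def fst_kappa_None) (auto simp: kappa_def)
    have "EE (Suc k) (\<lambda>b. block_weight b * indicator ?C (\<kappa> b)) = EE (Suc k) ?I / real (Suc k)"
      unfolding i
    proof (rule EE_rotation_invariant[where c = 1])
      have "Measurable.pred listM (\<lambda>b. mean b \<notin> ?A \<and> (length b, sum_list b) \<in> B)" using B by measurable
      then show "?I \<in> borel_measurable listM" by (intro borel_measurable_indicator) (simp add: pred_def)
    qed (auto simp: indicator_def)
    also have "EE (Suc k) ?I = EE (Suc k) (\<lambda>b. indicator {b. sum_list b \<in> ?S (Suc k)} b)"
      by (rule EE_cong) (auto simp: indicator_def mean_def field_simps)
    also have "\<dots> = ?p (Suc k)" by (rule EE_indicator_sum) (use S[of "Suc k"] in \<open>simp only: mem_Collect_eq Collect_mem_eq\<close>)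
    finally show ?thesis by simp
  qed
  have z: "EE 0 (\<lambda>b. block_weight b * indicator ?C (\<kappa> b)) = 0" by (rule EE_zero_weight)
  have "(\<lambda>k. q ^ Suc k * EE (Suc k) (\<lambda>b. block_weight b * indicator ?C (\<kappa> b))) sums (total_rate * measure_pmf.prob (segment_law \<kappa>) ?C)"
    using rate_sums[OF k, of ?C] z by (subst sums_Suc_iff) simp
  then have sm: "(\<lambda>k. q ^ Suc k / real (Suc k) * ?p (Suc k)) sums (total_rate * measure_pmf.prob (segment_law \<kappa>) ?C)"
    unfolding e .
  have Sm[measurable]: "partial_sum X k \<in> borel_measurable M" for k unfolding partial_sum_def by measurable
  have "emeasure (face_intensity M X q ?A) B = (\<Sum>k. ennreal (q ^ Suc k / real (Suc k)) * emeasure (distr M borel (partial_sum X (Suc k))) (?S (Suc k)))"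
    by (rule emeasure_face_intensity[OF prob_space_axioms X_measurable _ B]) simp
  also have "\<dots> = (\<Sum>k. ennreal (q ^ Suc k / real (Suc k) * ?p (Suc k)))"
  proof (rule suminf_cong)
    fix k
    have "emeasure (distr M borel (partial_sum X (Suc k))) (?S (Suc k)) = ennreal (?p (Suc k))"
      unfolding emeasure_distr[OF Sm S] emeasure_eq_measure by (simp add: vimage_def Int_def conj_commute)
    then show "ennreal (q ^ Suc k / real (Suc k)) * emeasure (distr M borel (partial_sum X (Suc k))) (?S (Suc k)) = ennreal (q ^ Suc k / real (Suc k) * ?p (Suc k))"
      using q by (simp only:) (rule ennreal_mult[symmetric]; simp)
  qed
  also have "\<dots> = ennreal (\<Sum>k. q ^ Suc k / real (Suc k) * ?p (Suc k))"
    by (rule suminf_ennreal2) (use q sums_summable[OF sm] in auto)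
  finally show ?thesis using sums_unique[OF sm] by simp
qed

lemma AE_points_in:
  "AE \<omega> in M. points_in (x ` J) B \<omega> = length (filter (\<lambda>b. mean b \<notin> x ` J \<and> (length b, sum_list b) \<in> B) (R \<omega>))"
  using AE_generic[OF atoms(3)] AE_space
proof eventually_elim
  case (elim \<omega>)
  show ?case unfolding atoms(1) by (rule generic_points_in) (use elim in auto)
qed

lemma prob_points_in:
  assumes B: "B \<in> sets pointM"
  shows "\<P>(\<omega> in M. points_in (x ` J) B \<omega> = k) =
    measure (face_intensity M X q (x ` J)) B ^ k / fact k * exp (- measure (face_intensity M X q (x ` J)) B)"
proof -
  let ?\<kappa> = "kappa x J (\<lambda>_. B) 1" and ?C = "{c. fst c = None \<and> snd (snd c) = [True]}"
  have km: "?\<kappa> \<in> listM \<rightarrow>\<^sub>M count_space UNIV" by (rule measurable_kappa[OF atoms(2) B])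
  have T: "{\<omega>\<in>space M. filter (\<lambda>c. c \<in> ?C) (map ?\<kappa> (R \<omega>)) \<in> {ks. length ks = k}} \<in> events"
    using measurable_sets[OF measurable_compose[OF measurable_R measurable_map_segM[OF km]], of "{ks. length (filter (\<lambda>c. c \<in> ?C) ks) = k}"]
    by (simp add: vimage_def Int_def conj_commute)
  have "\<P>(\<omega> in M. points_in (x ` J) B \<omega> = k) = \<P>(\<omega> in M. filter (\<lambda>c. c \<in> ?C) (map ?\<kappa> (R \<omega>)) \<in> {ks. length ks = k})"
  proof (rule finite_measure_eq_AE[OF _ _ T])
    show "{\<omega>\<in>space M. points_in (x ` J) B \<omega> = k} \<in> events"
      using measurable_sets[OF measurable_points_in[OF _ B, of "x ` J"], of "{k}"] by (simp add: vimage_def Int_def conj_commute)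
    show "AE \<omega> in M. (\<omega> \<in> {\<omega>\<in>space M. points_in (x ` J) B \<omega> = k}) =
       (\<omega> \<in> {\<omega>\<in>space M. filter (\<lambda>c. c \<in> ?C) (map ?\<kappa> (R \<omega>)) \<in> {ks. length ks = k}})"
      using AE_points_in[of B]
    proof eventually_elim
      case (elim \<omega>)
      have "length (filter (\<lambda>c. c \<in> ?C) (map ?\<kappa> (R \<omega>))) = points_in (x ` J) B \<omega>"
        using filter_kappa_None[of "\<lambda>v. v = [True]" x J "\<lambda>_. B" 1 "R \<omega>"] elim by simp
      then show ?case by simp
    qed
  qed
  also have "\<dots> = measure_pmf.prob (thinned total_rate (segment_law ?\<kappa>) ?C) {ks. length ks = k}"
    by (rule marks_class_law[OF km]) (simp only: mem_Collect_eq length_filter_sort)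
  also have "\<dots> = (total_rate * measure_pmf.prob (segment_law ?\<kappa>) ?C) ^ k / fact k * exp (- (total_rate * measure_pmf.prob (segment_law ?\<kappa>) ?C))"
    by (rule map_length_thinned[OF total_rate_pos])
  also have "total_rate * measure_pmf.prob (segment_law ?\<kappa>) ?C = measure (face_intensity M X q (x ` J)) B"
    unfolding measure_def[of "face_intensity M X q (x ` J)"] rate_face_intensity[OF B]
    using total_rate_pos by (intro enn2real_ennreal[symmetric] mult_nonneg_nonneg) auto
  finally show ?thesis .
qed

lemma sets_face_intensity: "sets (face_intensity M X q A) = sets pointM"
  by (simp add: face_intensity_def)

text \<open>
  Counts over disjoint sets are lengths of disjoint classes of marks; the class of \<open>B
  i\<close> consists of the marks whose membership vector is the \<open>i\<close>-th unit
  vector.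
\<close>

theorem face_points_poisson:
  "poisson_point_process M (face_intensity M X q (x ` J)) (\<lambda>\<omega>. face_points (x ` J) (R \<omega>))"
  unfolding poisson_point_process_def sets_face_intensity
proof (intro conjI ballI allI impI)
  show "finite_measure (face_intensity M X q (x ` J))"
  proof (rule finite_measureI)
    have "space (face_intensity M X q (x ` J)) = UNIV" by (simp add: face_intensity_def space_pair_measure)
    then show "emeasure (face_intensity M X q (x ` J)) (space (face_intensity M X q (x ` J))) \<noteq> \<infinity>"
      using rate_face_intensity[of UNIV] sets.top[of pointM] by (simp add: space_pair_measure)
  qed
next
  fix B assume "B \<in> sets pointM"
  then show "points_in (x ` J) B \<in> M \<rightarrow>\<^sub>M count_space UNIV" by (intro measurable_points_in) auto
next
  fix B k assume "B \<in> sets pointM"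
  then show "\<P>(\<omega> in M. points_in (x ` J) B \<omega> = k) =
    measure (face_intensity M X q (x ` J)) B ^ k / fact k * exp (- measure (face_intensity M X q (x ` J)) B)"
    by (rule prob_points_in)
next
  fix B :: "nat \<Rightarrow> (nat \<times> real) set" and m
  assume "B ` {..<m} \<subseteq> sets pointM \<and> disjoint_family_on B {..<m}"
  then have B: "\<And>i. i < m \<Longrightarrow> B i \<in> sets pointM" and disj: "disjoint_family_on B {..<m}" by auto
  let ?\<kappa> = "kappa x J B m" and ?u = "\<lambda>i. map (\<lambda>k. k = i) [0..<m]"
  let ?C = "\<lambda>i. {c. fst c = None \<and> snd (snd c) = ?u i}"
  have km: "?\<kappa> \<in> listM \<rightarrow>\<^sub>M count_space UNIV" by (rule measurable_kappa[OF atoms(2) B])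
  have pm: "points_in (x ` J) (B i) \<in> M \<rightarrow>\<^sub>M count_space UNIV" if "i < m" for i
    using B[OF that] by (intro measurable_points_in) auto
  show "indep_vars (\<lambda>_. count_space UNIV) (\<lambda>i \<omega>. points_in (x ` J) (B i) \<omega>) {..<m}"
    unfolding indep_vars_def2
  proof (intro conjI ballI)
    fix i assume "i \<in> {..<m}"
    then show "points_in (x ` J) (B i) \<in> M \<rightarrow>\<^sub>M count_space UNIV" using pm by simp
  next
    show "indep_sets (\<lambda>i. {points_in (x ` J) (B i) -` A \<inter> space M |A. A \<in> sets (count_space UNIV)}) {..<m}"
    proof (rule indep_setsI)
      fix i assume "i \<in> {..<m}"
      then show "{points_in (x ` J) (B i) -` A \<inter> space M |A. A \<in> sets (count_space UNIV)} \<subseteq> events"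
        using measurable_sets[OF pm] by auto
    next
      fix A I assume I: "I \<noteq> {}" "I \<subseteq> {..<m}" "finite I"
        and A: "\<forall>i\<in>I. A i \<in> {points_in (x ` J) (B i) -` A \<inter> space M |A. A \<in> sets (count_space UNIV)}"
      then obtain S where S: "\<And>i. i \<in> I \<Longrightarrow> A i = points_in (x ` J) (B i) -` S i \<inter> space M"
        by simp metis
      show "prob (\<Inter>i\<in>I. A i) = (\<Prod>i\<in>I. prob (A i))"
      proof (rule prob_marks_independent[OF km I(3), where C = ?C and E = "\<lambda>i. {ks. length ks \<in> S i}"])
        show "disjoint_family_on ?C I"
          unfolding disjoint_family_on_def
        proof (intro ballI impI)
          fix i l assume il: "i \<in> I" "l \<in> I" "i \<noteq> l"
          have "i < m" using il(1) I(2) by auto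
          then have "?u i ! i \<noteq> ?u l ! i" using il(3) by simp
          then have "?u i \<noteq> ?u l" by (intro notI) (simp only: simp_thms)
          then show "?C i \<inter> ?C l = {}" by (auto simp del: map_eq_conv)
        qed
        show "A i \<in> events" if "i \<in> I" for i
        proof -
          have "i < m" using that I(2) by auto
          then show ?thesis unfolding S[OF that] using measurable_sets[OF pm, of i "S i"] by simp
        qed
        show "AE \<omega> in M. (\<omega> \<in> A i) = (filter (\<lambda>c. c \<in> ?C i) (map ?\<kappa> (R \<omega>)) \<in> {ks. length ks \<in> S i})" if i: "i \<in> I" for i
          using AE_points_in[of "B i"] AE_space
        proof eventually_elim
          case (elim \<omega>)
          have im: "i < m" using i I(2) by auto
          have u: "map (\<lambda>k. (length b, sum_list b) \<in> B k) [0..<m] = ?u i \<longleftrightarrow> (length b, sum_list b) \<in> B i" for b :: "real list"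
          proof
            assume "map (\<lambda>k. (length b, sum_list b) \<in> B k) [0..<m] = ?u i"
            then have "map (\<lambda>k. (length b, sum_list b) \<in> B k) [0..<m] ! i = ?u i ! i" by (rule arg_cong)
            then show "(length b, sum_list b) \<in> B i" using im by simp
          next
            assume b: "(length b, sum_list b) \<in> B i"
            have "(length b, sum_list b) \<notin> B k" if "k < m" "k \<noteq> i" for k
              using disjoint_family_onD[OF disj, of k i] that im b by auto
            then show "map (\<lambda>k. (length b, sum_list b) \<in> B k) [0..<m] = ?u i" using b by (intro map_cong refl) (metis atLeastLessThan_iff set_upt)
          qed
          have "length (filter (\<lambda>c. c \<in> ?C i) (map ?\<kappa> (R \<omega>))) = points_in (x ` J) (B i) \<omega>"
            using filter_kappa_None[of "\<lambda>v. v = ?u i" x J B m "R \<omega>"] elim(1) unfolding u by (simp only: mem_Collect_eq)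
          then show ?case using elim(2) by (simp only: S[OF i] vimage_def Int_iff mem_Collect_eq simp_thms)
        qed
      qed (use I in \<open>simp_all only: mem_Collect_eq simp_thms length_filter_sort\<close>)
    qed
  qed
qed

end
end

section \<open>Independence over the slopes\<close>

context rearranged_walk
begin

context
  fixes x :: "nat \<Rightarrow> real" and J :: "nat set"
  assumes x: "bij_betw x J (atom_slopes M X)"
begin

abbreviation slope_data :: "nat \<Rightarrow> 'w \<Rightarrow> bool \<times> nat list list" where
  "slope_data j \<omega> \<equiv> (has_face (concat (R \<omega>)) (x j), excursion_lengths (R \<omega>) (x j))"

abbreviation data_of_marks :: "(nat option \<times> nat list \<times> bool list) list \<Rightarrow> bool \<times> nat list list" where
  "data_of_marks ks \<equiv> (ks \<noteq> [], map (fst \<circ> snd) ks)"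

lemma slope_data_marks:
  assumes w: "\<omega> \<in> space M" and j: "j \<in> J"
  shows "slope_data j \<omega> = data_of_marks (filter (\<lambda>c. c \<in> {c. fst c = Some j}) (map (kappa x J B m) (R \<omega>)))"
  unfolding has_face_R[OF w] excursion_lengths_marks[OF atoms(2)[OF x] j w, of B m] slope_class_def by simp

text \<open>
  The events of the point process are generated by finitely many counts. Such a cylinder event
  and the data of finitely many atoms are events about disjoint classes of one and the same
  family of marks.
\<close>

theorem slopes_independent:
  "indep_sets (\<lambda>i. case i of
      Some j \<Rightarrow> {slope_data j -` E \<inter> space M | E. True}
    | None \<Rightarrow> process_events M pointM (\<lambda>\<omega>. face_points (x ` J) (R \<omega>)))
    (insert None (Some ` J))"
proof -
  define cyl where "cyl l = {\<omega>\<in>space M. \<forall>p\<in>set l. points_in (x ` J) (fst p) \<omega> = snd p}" for l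
  define G where "G = {cyl l | l. \<forall>p\<in>set l. fst p \<in> sets pointM}"
  define F where "F = case_option G (\<lambda>j. {slope_data j -` E \<inter> space M | E. True})"
  have G_events: "cyl l \<in> events" if l: "\<forall>p\<in>set l. fst p \<in> sets pointM" for l
    unfolding cyl_def
  proof (rule sets.sets_Collect_finite_All)
    fix p assume "p \<in> set l"
    then have "points_in (x ` J) (fst p) \<in> M \<rightarrow>\<^sub>M count_space UNIV" using l by (intro measurable_points_in) auto
    from measurable_sets[OF this, of "{snd p}"] show "{\<omega>\<in>space M. points_in (x ` J) (fst p) \<omega> = snd p} \<in> events"
      by (simp add: vimage_def Int_def conj_commute)
  qed simp
  have Y_events: "slope_data j -` E \<inter> space M \<in> events" if j: "j \<in> J" for j E
  proof -
    have km: "kappa x J (\<lambda>_. {}) 0 \<in> listM \<rightarrow>\<^sub>M count_space UNIV" by (rule measurable_kappa[OF atoms(2)[OF x]]) simp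
    let ?S = "{ks. data_of_marks (filter (\<lambda>c. c \<in> {c. fst c = Some j}) ks) \<in> E}"
    have "slope_data j -` E \<inter> space M = (\<lambda>\<omega>. map (kappa x J (\<lambda>_. {}) 0) (R \<omega>)) -` ?S \<inter> space M"
    proof (rule set_eqI)
      fix \<omega>
      show "\<omega> \<in> slope_data j -` E \<inter> space M \<longleftrightarrow> \<omega> \<in> (\<lambda>\<omega>. map (kappa x J (\<lambda>_. {}) 0) (R \<omega>)) -` ?S \<inter> space M"
      proof (cases "\<omega> \<in> space M")
        case True
        show ?thesis unfolding vimage_eq Int_iff mem_Collect_eq slope_data_marks[OF True j, of "\<lambda>_. {}" 0] ..
      qed simp
    qed
    then show ?thesis
      using measurable_sets[OF measurable_compose[OF measurable_R measurable_map_segM[OF km]], of ?S] by simp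
  qed
  have "indep_sets F (insert None (Some ` J))"
  proof (rule indep_setsI)
    fix i assume "i \<in> insert None (Some ` J)"
    then show "F i \<subseteq> events" using G_events Y_events by (auto simp: F_def G_def)
  next
    fix A I assume I: "I \<noteq> {}" "I \<subseteq> insert None (Some ` J)" "finite I" and A: "\<forall>i\<in>I. A i \<in> F i"
    have "\<exists>l. (\<forall>p\<in>set l. fst p \<in> sets pointM) \<and> (None \<in> I \<longrightarrow> A None = cyl l)"
    proof (cases "None \<in> I")
      case True
      then show ?thesis using bspec[OF A, of None] by (auto simp: F_def G_def)
    next
      case False
      then show ?thesis by (intro exI[of _ "[]"]) simp
    qed
    \<comment> \<open>If the point process is not among the factors, the empty list serves as a dummy cylinder.\<close>
    then obtain l where l: "\<forall>p\<in>set l. fst p \<in> sets pointM" and A_None: "None \<in> I \<Longrightarrow> A None = cyl l" by blast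
    have "\<forall>j. \<exists>E. Some j \<in> I \<longrightarrow> A (Some j) = slope_data j -` E \<inter> space M"
    proof
      fix j
      show "\<exists>E. Some j \<in> I \<longrightarrow> A (Some j) = slope_data j -` E \<inter> space M"
      proof (cases "Some j \<in> I")
        case True
        then show ?thesis using bspec[OF A, of "Some j"] by (auto simp: F_def)
      qed simp
    qed
    from choice[OF this] obtain E' where E': "\<forall>j. Some j \<in> I \<longrightarrow> A (Some j) = slope_data j -` E' j \<inter> space M" ..
    have A_Some: "A (Some j) = slope_data j -` E' j \<inter> space M" if "Some j \<in> I" for j using E' that by simp
    let ?m = "length l"
    let ?\<kappa> = "kappa x J (\<lambda>k. fst (l ! k)) ?m"
    let ?C = "\<lambda>i. {c :: nat option \<times> nat list \<times> bool list. fst c = i}"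
    let ?E = "case_option {ks. \<forall>k<?m. length (filter (\<lambda>c. snd (snd c) ! k) ks) = snd (l ! k)} (\<lambda>j. {ks. data_of_marks ks \<in> E' j})"
    have km: "?\<kappa> \<in> listM \<rightarrow>\<^sub>M count_space UNIV"
      by (rule measurable_kappa[OF atoms(2)[OF x]]) (use l in auto)
    have J: "j \<in> J" if "Some j \<in> I" for j using that I(2) by auto
    have count: "length (filter (\<lambda>c. snd (snd c) ! k) (filter (\<lambda>c. c \<in> ?C None) ks)) = length (filter (\<lambda>c. fst c = None \<and> snd (snd c) ! k) ks)" for k and ks :: "(nat option \<times> nat list \<times> bool list) list"
      by (simp add: conj_commute)
    show "prob (\<Inter>i\<in>I. A i) = (\<Prod>i\<in>I. prob (A i))"
    proof (rule prob_marks_independent[OF km I(3), where C = ?C and E = ?E])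
      show "disjoint_family_on ?C I" by (auto simp: disjoint_family_on_def)
      show "A i \<in> events" if i: "i \<in> I" for i
      proof (cases i)
        case None
        then show ?thesis using A_None G_events[OF l] i by simp
      next
        case (Some j)
        then show ?thesis using A_Some[of j] Y_events[OF J] i by simp
      qed
      show "(filter (\<lambda>c. c \<in> ?C i) (map ?\<kappa> (sort_means bs)) \<in> ?E i) = (filter (\<lambda>c. c \<in> ?C i) (map ?\<kappa> bs) \<in> ?E i)" if i: "i \<in> I" for i bs
      proof (cases i)
        case None
        then show ?thesis by (simp only: option.case mem_Collect_eq count[unfolded mem_Collect_eq] length_filter_sort)
      next
        case (Some j)
        then have "j \<in> J" using J i by simp
        from filter_slope_class[OF atoms(2)[OF x] this] have "filter (\<lambda>c. c \<in> ?C i) (map ?\<kappa> (sort_means bs)) = filter (\<lambda>c. c \<in> ?C i) (map ?\<kappa> bs)"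
          unfolding slope_class_def Some by (simp only: filter_sort_means_slope)
        then show ?thesis by (simp only:)
      qed
      show "AE \<omega> in M. (\<omega> \<in> A i) = (filter (\<lambda>c. c \<in> ?C i) (map ?\<kappa> (R \<omega>)) \<in> ?E i)" if i: "i \<in> I" for i
      proof (cases i)
        case None
        have "AE \<omega> in M. \<forall>k\<in>{..<?m}. points_in (x ` J) (fst (l ! k)) \<omega> =
            length (filter (\<lambda>b. mean b \<notin> x ` J \<and> (length b, sum_list b) \<in> fst (l ! k)) (R \<omega>))"
          by (intro AE_finite_allI AE_points_in[OF x]) simp
        then show ?thesis using AE_space
        proof eventually_elim
          case (elim \<omega>)
          have "length (filter (\<lambda>c. snd (snd c) ! k) (filter (\<lambda>c. c \<in> ?C None) (map ?\<kappa> (R \<omega>)))) = points_in (x ` J) (fst (l ! k)) \<omega>" if k: "k < ?m" for k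
            unfolding count filter_kappa_None[of "\<lambda>v. v ! k"] using elim(1) k by simp
          moreover have "\<omega> \<in> A i \<longleftrightarrow> (\<forall>k<?m. points_in (x ` J) (fst (l ! k)) \<omega> = snd (l ! k))"
            using A_None None i elim(2) by (auto simp: cyl_def all_set_conv_all_nth)
          ultimately show ?case unfolding None by (simp only: option.case mem_Collect_eq cong: imp_cong)
        qed
      next
        case (Some j)
        show ?thesis using AE_space
        proof eventually_elim
          case (elim \<omega>)
          show ?case using A_Some[of j] slope_data_marks[OF elim J, of j "\<lambda>k. fst (l ! k)" ?m] i elim unfolding Some
            by (simp only: option.case mem_Collect_eq vimage_def Int_iff simp_thms)
        qed
      qed
    qed (use I in auto)
  qed
  moreover have "Int_stable (F i)" for i
  proof (cases i)
    case None
    show ?thesis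
    proof (rule Int_stableI)
      fix a b assume "a \<in> F i" "b \<in> F i"
      then obtain l l' where l: "a = cyl l" "b = cyl l'" "\<forall>p\<in>set (l @ l'). fst p \<in> sets pointM"
        using None by (auto simp: F_def G_def)
      then have "a \<inter> b = cyl (l @ l')" by (auto simp: cyl_def)
      then show "a \<inter> b \<in> F i" using None l(3) unfolding F_def G_def by (simp only: option.case mem_Collect_eq) blast
    qed
  next
    case (Some j)
    show ?thesis
    proof (rule Int_stableI)
      fix a b assume "a \<in> F i" "b \<in> F i"
      then obtain E E' where "a = slope_data j -` E \<inter> space M" "b = slope_data j -` E' \<inter> space M"
        using Some by (auto simp: F_def)
      then have "a \<inter> b = slope_data j -` (E \<inter> E') \<inter> space M" by auto
      then show "a \<inter> b \<in> F i" using Some by (simp only: F_def option.case mem_Collect_eq) blast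
    qed
  qed
  ultimately have "indep_sets (\<lambda>i. sigma_sets (space M) (F i)) (insert None (Some ` J))"
    by (rule indep_sets_sigma)
  then show ?thesis
  proof (rule indep_sets_mono_sets)
    fix i assume "i \<in> insert None (Some ` J)"
    show "(case i of Some j \<Rightarrow> {slope_data j -` E \<inter> space M | E. True}
       | None \<Rightarrow> process_events M pointM (\<lambda>\<omega>. face_points (x ` J) (R \<omega>))) \<subseteq> sigma_sets (space M) (F i)"
    proof (cases i)
      case None
      have "{\<omega>\<in>space M. points_in (x ` J) B \<omega> = m} \<in> G" if "B \<in> sets pointM" for B m
        unfolding G_def using that by (intro CollectI exI[of _ "[(B, m)]"]) (simp add: cyl_def)
      then have "{{\<omega>\<in>space M. points_in (x ` J) B \<omega> = m} | B m. B \<in> sets pointM} \<subseteq> G" by blast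
      then show ?thesis unfolding None process_events_def F_def option.case by (rule sigma_sets_mono')
    next
      case (Some j)
      then show ?thesis by (auto simp: F_def)
    qed
  qed
qed

end

section \<open>The joint law of the three compositions\<close>

lemma measurable_compositions:
  "(\<lambda>\<omega>. (\<Xi>H (R \<omega>), \<Xi>K (R \<omega>), \<Xi>F (R \<omega>))) \<in> M \<rightarrow>\<^sub>M count_space UNIV"
proof -
  have "(\<lambda>\<omega>. comps_of_shape (face_shape (R \<omega>))) \<in> M \<rightarrow>\<^sub>M count_space UNIV"
    by (rule measurable_compose[OF measurable_compose[OF measurable_R measurable_face_shape]]) simp
  then show ?thesis by (rule measurable_cong[THEN iffD1, rotated]) (rule Xi_comps_of_shape[OF R_valid(1), symmetric])
qed

text \<open>
  The shape of the faces determines the compositions, and its law is unchanged when all orders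
  inside the faces are redrawn.
\<close>

theorem law_compositions:
  "\<P>(\<omega> in M. (\<Xi>H (R \<omega>), \<Xi>K (R \<omega>), \<Xi>F (R \<omega>)) = \<xi>) =
   (\<integral>\<omega>. pmf (created_compositions (unordered_faces (R \<omega>))) \<xi> \<partial>M)"
proof -
  let ?f = "\<lambda>\<omega>. face_shape (R \<omega>)"
  let ?D = "\<lambda>u. draw_each order_face (forget u)"
  have f: "?f \<in> M \<rightarrow>\<^sub>M count_space UNIV" by (rule measurable_compose[OF measurable_R measurable_face_shape])
  obtain P where P: "measure_pmf P = distr M (count_space UNIV) ?f"
    using pmf_of_countable_measure[OF prob_space_distr[OF f]] by auto
  have pr: "measure_pmf.prob P S = \<P>(\<omega> in M. ?f \<omega> \<in> S)" for S
    unfolding P using f by (subst measure_distr) (auto simp: vimage_def Int_def conj_commute)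
  have inv: "pmf P u = pmf P v" if "forget u = forget v" for u v
    using prob_face_shape_forget[OF that] pr[of "{u}"] pr[of "{v}"] by (simp add: measure_pmf_single)
  have redraw: "bind_pmf P ?D = P" by (rule redraw_fibre) (rule inv, assumption, rule pmf_draw_faces)
  have created: "created_compositions (unordered_faces (R \<omega>)) = map_pmf comps_of_shape (?D (?f \<omega>))" if w: "\<omega> \<in> space M" for \<omega>
    unfolding created_compositions_def by_decreasing_slope_unordered_faces[OF R_valid(1)[OF w]]
    by (rule arg_cong2[where f = map_pmf]) (auto simp: comps_of_shape_def)
  have "(\<integral>\<omega>. pmf (created_compositions (unordered_faces (R \<omega>))) \<xi> \<partial>M) = (\<integral>\<omega>. pmf (map_pmf comps_of_shape (?D (?f \<omega>))) \<xi> \<partial>M)"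
    by (rule Bochner_Integration.integral_cong[OF refl]) (simp only: created)
  also have "\<dots> = measure_pmf.expectation P (\<lambda>u. pmf (map_pmf comps_of_shape (?D u)) \<xi>)"
    unfolding P by (rule integral_distr[OF f, symmetric]) simp
  also have "\<dots> = pmf (map_pmf comps_of_shape (bind_pmf P ?D)) \<xi>"
    unfolding map_bind_pmf by (rule pmf_bind[symmetric])
  also have "\<dots> = measure_pmf.prob P {u. comps_of_shape u = \<xi>}"
    unfolding redraw pmf_map by (rule arg_cong[where f = "measure_pmf.prob P"]) auto
  also have "\<dots> = \<P>(\<omega> in M. (\<Xi>H (R \<omega>), \<Xi>K (R \<omega>), \<Xi>F (R \<omega>)) = \<xi>)"
    unfolding pr using Xi_comps_of_shape[OF R_valid(1)] by (intro arg_cong[where f = prob]) auto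
  finally show ?thesis by (rule sym)
qed

end

theorem theorem22:
  fixes M :: "'w measure" and q :: real and N :: "'w \<Rightarrow> nat" and X :: "nat \<Rightarrow> 'w \<Rightarrow> real"
    and perm :: "'w \<Rightarrow> nat \<Rightarrow> nat" and choice :: "'w \<Rightarrow> (nat \<Rightarrow> nat) \<times> (nat \<Rightarrow> nat)"
    and x :: "nat \<Rightarrow> real" and J :: "nat set"
  assumes "rearranged_walk M q N X perm choice"
    and "bij_betw x J (atom_slopes M X)"
  defines "\<mu> \<equiv> \<lambda>j r. slope_rate M X (x j) r"
    and "R \<equiv> segments N X perm choice"
  defines "L \<equiv> \<lambda>j \<omega>. excursion_lengths (R \<omega>) (x j)"
    and "Z \<equiv> \<lambda>\<omega>. face_points (x ` J) (R \<omega>)"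
  shows
    "(\<forall>\<omega>\<in>space M.
       is_composition (N \<omega>) (\<Xi>H (R \<omega>)) \<and> is_composition (N \<omega>) (\<Xi>K (R \<omega>)) \<and>
       is_composition (N \<omega>) (\<Xi>F (R \<omega>)) \<and>
       comp_refines (\<Xi>H (R \<omega>)) (\<Xi>K (R \<omega>)) \<and> comp_refines (\<Xi>K (R \<omega>)) (\<Xi>F (R \<omega>))) \<and>
     (prob_space.indep_sets M
       (\<lambda>i. case i of
          Some j \<Rightarrow> {(\<lambda>\<omega>. (has_face (concat (R \<omega>)) (x j), L j \<omega>)) -` E \<inter> space M | E. True}
        | None \<Rightarrow> process_events M (count_space UNIV \<Otimes>\<^sub>M borel) Z)
       (insert None (Some ` J))) \<and>
     (\<forall>j\<in>J. \<P>(\<omega> in M. has_face (concat (R \<omega>)) (x j)) = 1 - exp (- \<mu> j q)) \<and>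
     (\<forall>j\<in>J. \<forall>k.
       \<P>(\<omega> in M. length (L j \<omega>) = k \<bar> has_face (concat (R \<omega>)) (x j)) =
       pmf (cond_pmf (poisson_pmf (\<mu> j q)) {1..}) k) \<and>
     (\<forall>j\<in>J. \<forall>k\<ge>1. \<forall>es. length es = k \<longrightarrow>
       \<P>(\<omega> in M. map length (L j \<omega>) = es \<bar> length (L j \<omega>) = k) =
       (\<Prod>e\<leftarrow>es. log_series_mass (1 - exp (- \<mu> j q)) e)) \<and>
     (\<forall>j\<in>J. \<exists>p :: nat pmf.
       (\<forall>z. \<bar>z\<bar> \<le> 1 \<longrightarrow>
          measure_pmf.expectation p (\<lambda>l. z ^ l) =
          (1 - exp (- \<mu> j (z * q))) / (1 - exp (- \<mu> j q))) \<and>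
       (\<forall>lss. [] \<notin> set lss \<longrightarrow>
          \<P>(\<omega> in M. L j \<omega> = lss \<bar> map length (L j \<omega>) = map length lss) =
          (\<Prod>l\<leftarrow>concat lss. pmf p l))) \<and>
     (AE \<omega> in M. \<forall>I\<in>set (blocks (\<Xi>F (R \<omega>))). slope (concat (R \<omega>)) I \<notin> x ` J \<longrightarrow>
       (\<exists>I'. blocks_within (\<Xi>K (R \<omega>)) I = [I'] \<and>
         (\<exists>I''. blocks_within (\<Xi>H (R \<omega>)) I' = [I'']))) \<and>
     (poisson_point_process M (face_intensity M X q (x ` J)) Z) \<and>
     ((\<lambda>\<omega>. (\<Xi>H (R \<omega>), \<Xi>K (R \<omega>), \<Xi>F (R \<omega>))) \<in> M \<rightarrow>\<^sub>M count_space UNIV) \<and>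
     (\<forall>\<xi>. \<P>(\<omega> in M. (\<Xi>H (R \<omega>), \<Xi>K (R \<omega>), \<Xi>F (R \<omega>)) = \<xi>) =
       (\<integral>\<omega>. pmf (created_compositions (unordered_faces (R \<omega>))) \<xi> \<partial>M))"
proof -
  interpret W: rearranged_walk M q N X perm choice by fact
  note x = assms(2)
  have R: "R = W.R" unfolding R_def W.R_def ..
  note d = L_def Z_def R
  have \<mu>: "\<mu> j = W.mu x j" if "j \<in> J" for j
    unfolding \<mu>_def using W.mu_def[OF x that] by (intro ext) simp
  show ?thesis
  proof (intro conjI)
    show "\<forall>\<omega>\<in>space M.
       is_composition (N \<omega>) (\<Xi>H (R \<omega>)) \<and> is_composition (N \<omega>) (\<Xi>K (R \<omega>)) \<and>
       is_composition (N \<omega>) (\<Xi>F (R \<omega>)) \<and>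
       comp_refines (\<Xi>H (R \<omega>)) (\<Xi>K (R \<omega>)) \<and> comp_refines (\<Xi>K (R \<omega>)) (\<Xi>F (R \<omega>))"
      unfolding R using compositions_valid[OF W.R_valid] by blast
  next
    show "prob_space.indep_sets M
       (\<lambda>i. case i of
          Some j \<Rightarrow> {(\<lambda>\<omega>. (has_face (concat (R \<omega>)) (x j), L j \<omega>)) -` E \<inter> space M | E. True}
        | None \<Rightarrow> process_events M (count_space UNIV \<Otimes>\<^sub>M borel) Z)
       (insert None (Some ` J))"
      unfolding d by (rule W.slopes_independent[OF x])
  next
    show "\<forall>j\<in>J. \<P>(\<omega> in M. has_face (concat (R \<omega>)) (x j)) = 1 - exp (- \<mu> j q)"
      unfolding d using W.prob_has_face[OF x] by (simp add: \<mu>)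
  next
    show "\<forall>j\<in>J. \<forall>k. \<P>(\<omega> in M. length (L j \<omega>) = k \<bar> has_face (concat (R \<omega>)) (x j)) =
       pmf (cond_pmf (poisson_pmf (\<mu> j q)) {1..}) k"
      unfolding d using W.cond_prob_number[OF x] by (simp add: \<mu>)
  next
    show "\<forall>j\<in>J. \<forall>k\<ge>1. \<forall>es. length es = k \<longrightarrow>
       \<P>(\<omega> in M. map length (L j \<omega>) = es \<bar> length (L j \<omega>) = k) =
       (\<Prod>e\<leftarrow>es. log_series_mass (1 - exp (- \<mu> j q)) e)"
      unfolding d using W.cond_prob_excursion_numbers[OF x] by (simp add: \<mu>)
  next
    show "\<forall>j\<in>J. \<exists>p :: nat pmf.
       (\<forall>z. \<bar>z\<bar> \<le> 1 \<longrightarrow> measure_pmf.expectation p (\<lambda>l. z ^ l) =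
          (1 - exp (- \<mu> j (z * q))) / (1 - exp (- \<mu> j q))) \<and>
       (\<forall>lss. [] \<notin> set lss \<longrightarrow>
          \<P>(\<omega> in M. L j \<omega> = lss \<bar> map length (L j \<omega>) = map length lss) = (\<Prod>l\<leftarrow>concat lss. pmf p l))"
    proof (intro ballI exI conjI allI impI)
      fix j z assume "j \<in> J" "\<bar>z\<bar> \<le> (1 :: real)"
      then show "measure_pmf.expectation (W.exc_law x j) (\<lambda>l. z ^ l) = (1 - exp (- \<mu> j (z * q))) / (1 - exp (- \<mu> j q))"
        unfolding \<mu>[OF \<open>j \<in> J\<close>] by (rule W.exc_law_pgf[OF x])
    next
      fix j and lss :: "nat list list" assume "j \<in> J" "[] \<notin> set lss"
      then show "\<P>(\<omega> in M. L j \<omega> = lss \<bar> map length (L j \<omega>) = map length lss) = (\<Prod>l\<leftarrow>concat lss. pmf (W.exc_law x j) l)"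
        unfolding d by (rule W.cond_prob_excursions[OF x])
    qed
  next
    show "AE \<omega> in M. \<forall>I\<in>set (blocks (\<Xi>F (R \<omega>))). slope (concat (R \<omega>)) I \<notin> x ` J \<longrightarrow>
       (\<exists>I'. blocks_within (\<Xi>K (R \<omega>)) I = [I'] \<and> (\<exists>I''. blocks_within (\<Xi>H (R \<omega>)) I' = [I'']))"
      unfolding R W.atoms(1)[OF x] using W.AE_generic[OF W.atoms(3)[OF x]] AE_space
    proof eventually_elim
      case (elim \<omega>)
      then show ?case using W.generic_faces[OF elim(2,1)] by blast
    qed
  next
    show "poisson_point_process M (face_intensity M X q (x ` J)) Z"
      unfolding d by (rule W.face_points_poisson[OF x])
  next
    show "(\<lambda>\<omega>. (\<Xi>H (R \<omega>), \<Xi>K (R \<omega>), \<Xi>F (R \<omega>))) \<in> M \<rightarrow>\<^sub>M count_space UNIV"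
      unfolding R by (rule W.measurable_compositions)
  next
    show "\<forall>\<xi>. \<P>(\<omega> in M. (\<Xi>H (R \<omega>), \<Xi>K (R \<omega>), \<Xi>F (R \<omega>)) = \<xi>) =
       (\<integral>\<omega>. pmf (created_compositions (unordered_faces (R \<omega>))) \<xi> \<partial>M)"
      unfolding R using W.law_compositions by blast
  qed
qed

end
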